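(* Let $Q(x,y,z)$ be an irreducible complex quadratic form, and let $\mathcal S_Q=\{Q=1\}\subset\mathbb C^3$. Let $A$ be a complex linear change of coordinates reducing $Q$ to the sum of squares, and let $\Upsilon_Q\subset\mathcal S_Q$ be the corresponding totally real ellipsoid equipped with the measure $dm_Q$. Let $f$ be an analytic function on $\mathcal S_Q$. Then there exists a sequence of multipoles $\{w_k^f\in\overline{\mathcal M}(k)\}_{0\le k<+\infty}$ such that: (1) the sequence gives rise, via the maps $\overline\Phi_Q$, to complex $Q$-harmonic polynomials $P_d^f(x,y,z)=\sum_{k=0}^d\overline\Phi_Q(w_k^f)$, where the mutually orthogonal polynomials $\overline\Phi_Q(w_k^f)\in Har_Q(k)$ are uniquely determined by $f$; (2) as $d\to\infty$, the polynomials $P_d^f$ converge in the space $L_2(\Upsilon_Q)$ to the function $f|_{\Upsilon_Q}$, and therefore uniquely determine $f\in\mathcal O(\mathcal S_Q)$; (3) for a given $f$, there are at most $(2k-1)!!$ choices for each multipole $w_k^f$; (4) the multipoles satisfy $\sum_{k=0}^\infty\sin^2(\theta_k)\cdot\rho(w_k^f,\mathbf 0)^2<\infty$; (5) for any tame deformation $\{f_t\in\mathcal O(\mathcal S_Q)\}_{0\le t\le1}$ of the function $f=f_0$, there exists a continuous deformation $\{w_k^{f_t}\in\overline{\mathcal M}(k)\}$ of the $f_t$-representing multipoles such that $w_k^{f_0}=w_k^f$. For functions $f$ and their continuous deformations $f_t$ outside a subset $\mathcal D\subset\mathcal O(\mathcal S_Q)$ of complex codimension one and for each choice of the appropriate multipoles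 $\{w_k^{f_0}\}$, the lifting of the deformation $f_t$ to the multipole spaces is unique.
   Context: Write $Q(v)=vBv^T$, $B=AA^T$, for row vectors $v=(x,y,z)$. $\Upsilon_Q=\{v\in\mathbb C^3:vA\in\mathbb R^3,\ |vA|=1\}$ and $dm_Q$ is the pull-back under $v\mapsto vA$ of the standard measure on the unit sphere; inner product $\langle f,g\rangle=\int_{\Upsilon_Q}f\bar g\,dm_Q$, norm $\|\cdot\|$. $V(k)$ is the space of complex homogeneous polynomials of degree $k$, a Hermitian space with this inner product, $V_Q(k)\subset V(k)$ the subspace of those divisible by $Q$. $\Delta_Q=\sum b^{ij}\partial_i\partial_j$ with $(b^{ij})=B^{-1}$; $Q$-harmonic means lying in $Ker\,\Delta_Q$; $Har_Q(k)=Ker(\Delta_Q)\cap V(k)$ equals the orthogonal complement $V_Q^\perp(k)$ of $V_Q(k)$. $\mathcal O(\mathcal S_Q)$ is the space of holomorphic functions on $\mathcal S_Q$. $\mathcal M(k)=[V(1)\setminus0]^k/\Sigma_k$, with $\Sigma_k$ generated by permutations of factors and by rescalings $(\lambda_\nu)\in(\mathbb C^\ast)^k$, $\prod\lambda_\nu=1$; $\overline{\mathcal M}(k)$ adds the zero multipole $\mathbf 0$ (for $k=0$, multipoles are just constants). It embeds in $V(k)$ by $\Theta$: class of $(L_1,\dots,L_k)\mapsto\prod L_\nu$, $\mathbf 0\mapsto0$; $\Theta(\mathcal M(k))=\mathcal{F}act(k)$ is the set of products of $k$ non-zero linear forms. $\rho$ is the distance on $\overline{\mathcal M}(k)$ induced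 by $\|\cdot\|$ via $\Theta$, so $\rho(w,\mathbf 0)=\|\Theta(w)\|$. $\overline\Phi_Q:\overline{\mathcal M}(k)\to V_Q^\perp(k)=Har_Q(k)$ is $\Theta$ followed by the orthogonal projection. $\theta_k\in(0,\pi/2]$ is the minimal angle between vectors of $\mathcal{F}act(k)$ and non-zero vectors of $V_Q(k)$ ($\theta_k=\pi/2$ if $V_Q(k)=0$). For $f\in L_2(\Upsilon_Q)$, $f_k\in Har_Q(k)$ denotes its Fourier component (the orthogonal projection of $f$ to $Har_Q(k)$); the multipoles $w_k$ are $f$-representing if $\overline\Phi_Q(w_k)=f_k$. To each non-zero $P\in V_Q^\perp(k)$ attach the partition $\pi$ of $2k$ given by the multiplicities of the points of $\{P=0\}\cap\{Q=0\}\subset\mathbb{CP}^2$; the pure strata $\mathcal D_{k,\pi}^\circ\subset V_Q^\perp(k)$ consist of all $P$ with the given partition (the origin is regarded as a separate stratum). $\mathcal D(\Phi_Q)$ is the set of $P$ whose partition is not $1+1+\dots+1$; $\mathcal D\subset\mathcal O(\mathcal S_Q)$ is the set of $f$ with $f_k\in\mathcal D(\Phi_Q)$ for some $k$. A path $[0,1]\to V_Q^\perp(k)$ is tame if it consists of finitely many arcs, the interior of each being contained in some pure stratum; a continuous family $\{f_t\}_{0\le t\le1}$ is tame if for each $k$ the path $\{(f_t)_k\in Har_Q(k)\}$ is tame. *)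

theory Defs
  imports
    "HOL-Complex_Analysis.Complex_Analysis"
    "HOL-Combinatorics.Permutations"
    "HOL-Library.Multiset"
begin

type_synonym cfun3 = "complex ^ 3 \<Rightarrow> complex"

text \<open>
  Since \<open>\<complex>\<close> is infinite, polynomials in three variables are identified with the functions
  they induce on \<open>\<complex>\<^sup>3\<close>. A monomial is given by its exponents \<open>\<alpha> :: 3 \<Rightarrow> nat\<close>.
\<close>

definition polys :: "cfun3 set" where
  "polys = {p. \<exists>(c :: (3 \<Rightarrow> nat) \<Rightarrow> complex) d.
      p = (\<lambda>v. \<Sum>\<alpha> \<in> {\<alpha>. (\<Sum>i\<in>UNIV. \<alpha> i) \<le> d}. c \<alpha> * (\<Prod>i\<in>UNIV. v $ i ^ \<alpha> i))}"

definition hom_polys :: "nat \<Rightarrow> cfun3 set" where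
  "hom_polys k = {p. \<exists>c :: (3 \<Rightarrow> nat) \<Rightarrow> complex.
      p = (\<lambda>v. \<Sum>\<alpha> \<in> {\<alpha>. (\<Sum>i\<in>UNIV. \<alpha> i) = k}. c \<alpha> * (\<Prod>i\<in>UNIV. v $ i ^ \<alpha> i))}"

definition poly_unit :: "cfun3 \<Rightarrow> bool" where
  "poly_unit p \<longleftrightarrow> p \<in> polys \<and> (\<exists>q\<in>polys. \<forall>v. p v * q v = 1)"

definition irreducible_poly_fun :: "cfun3 \<Rightarrow> bool" where
  "irreducible_poly_fun p \<longleftrightarrow> p \<in> polys \<and> p \<noteq> (\<lambda>v. 0) \<and> \<not> poly_unit p \<and>
     (\<forall>q\<in>polys. \<forall>r\<in>polys. p = (\<lambda>v. q v * r v) \<longrightarrow> poly_unit q \<or> poly_unit r)"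

definition quadric :: "cfun3 \<Rightarrow> (complex ^ 3) set" where
  "quadric Q = {v. Q v = 1}"

definition ellipsoid :: "complex ^ 3 ^ 3 \<Rightarrow> (complex ^ 3) set" where
  "ellipsoid A = {v. (\<forall>i. (v v* A) $ i \<in> \<real>) \<and> norm (v v* A) = 1}"

text \<open>
  Surface measure of the unit sphere by the cone construction: the area of \<open>E\<close> is three times
  the volume of the cone \<open>{r x | 0 < r < 1, x \<in> E}\<close>. The total mass is \<open>4 \<pi>\<close>.
\<close>

definition sphere_measure :: "(real ^ 3) measure" where
  "sphere_measure = scale_measure 3
     (distr (restrict_space lborel (ball 0 1 - {0})) (restrict_space borel (sphere 0 1))
       (\<lambda>x. x /\<^sub>R norm x))"

text \<open>
  The pull-back along the bijection \<open>v \<mapsto> v A\<close> from the ellipsoid to the sphere is the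
  push-forward along its inverse. The underlying space is the ellipsoid itself, so that values of
  functions off the ellipsoid do not matter.
\<close>

definition ellipsoid_measure :: "complex ^ 3 ^ 3 \<Rightarrow> (complex ^ 3) measure" where
  "ellipsoid_measure A = distr sphere_measure (restrict_space borel (ellipsoid A))
     (\<lambda>u. (\<chi> i. complex_of_real (u $ i)) v* matrix_inv A)"

definition herm :: "complex ^ 3 ^ 3 \<Rightarrow> cfun3 \<Rightarrow> cfun3 \<Rightarrow> complex" where
  "herm A f g = (LINT v|ellipsoid_measure A. f v * cnj (g v))"

definition L2norm :: "complex ^ 3 ^ 3 \<Rightarrow> cfun3 \<Rightarrow> real" where
  "L2norm A f = sqrt (Re (herm A f f))"

definition orth_proj :: "complex ^ 3 ^ 3 \<Rightarrow> cfun3 set \<Rightarrow> cfun3 \<Rightarrow> cfun3" where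
  "orth_proj A E f = (THE p. p \<in> E \<and> (\<forall>h\<in>E. herm A (\<lambda>v. f v - p v) h = 0))"

definition holomorphic3_on :: "cfun3 \<Rightarrow> (complex ^ 3) set \<Rightarrow> bool" where
  "holomorphic3_on g U \<longleftrightarrow>
     (\<forall>x\<in>U. \<exists>D. (g has_derivative D) (at x) \<and> (\<forall>c v. D (c *s v) = c * D v))"

text \<open>
  A function on a closed complex submanifold is holomorphic iff it extends holomorphically to the
  ambient space near every point. The values off \<open>S\<close> are irrelevant.
\<close>

definition holo_on_variety :: "(complex ^ 3) set \<Rightarrow> cfun3 set" where
  "holo_on_variety S = {f. \<forall>p\<in>S. \<exists>U g. open U \<and> p \<in> U \<and> holomorphic3_on g U \<and>
      (\<forall>v\<in>S \<inter> U. f v = g v)}"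

definition cpartial :: "3 \<Rightarrow> cfun3 \<Rightarrow> cfun3" where
  "cpartial i p = (\<lambda>v. deriv (\<lambda>t. p (v + t *s axis i 1)) 0)"

definition Q_laplacian :: "complex ^ 3 ^ 3 \<Rightarrow> cfun3 \<Rightarrow> cfun3" where
  "Q_laplacian A p = (\<lambda>v. \<Sum>i\<in>UNIV. \<Sum>j\<in>UNIV.
     matrix_inv (A ** transpose A) $ i $ j * cpartial i (cpartial j p) v)"

definition Q_harmonic :: "complex ^ 3 ^ 3 \<Rightarrow> cfun3 set" where
  "Q_harmonic A = {p \<in> polys. Q_laplacian A p = (\<lambda>v. 0)}"

definition Har :: "complex ^ 3 ^ 3 \<Rightarrow> nat \<Rightarrow> cfun3 set" where
  "Har A k = Q_harmonic A \<inter> hom_polys k"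

definition VQ :: "cfun3 \<Rightarrow> nat \<Rightarrow> cfun3 set" where
  "VQ Q k = {p \<in> hom_polys k. \<exists>r\<in>polys. p = (\<lambda>v. Q v * r v)}"

definition VQ_perp :: "complex ^ 3 ^ 3 \<Rightarrow> cfun3 \<Rightarrow> nat \<Rightarrow> cfun3 set" where
  "VQ_perp A Q k = {p \<in> hom_polys k. \<forall>h\<in>VQ Q k. herm A p h = 0}"

definition fourier :: "complex ^ 3 ^ 3 \<Rightarrow> nat \<Rightarrow> cfun3 \<Rightarrow> cfun3" where
  "fourier A k f = orth_proj A (Har A k) f"

definition form_tuples :: "nat \<Rightarrow> cfun3 list set" where
  "form_tuples k = {Ls. length Ls = k \<and> set Ls \<subseteq> hom_polys 1 - {\<lambda>v. 0}}"

definition multipole_rel :: "nat \<Rightarrow> (cfun3 list \<times> cfun3 list) set" where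
  "multipole_rel k = {(Ls, Ms). Ls \<in> form_tuples k \<and> Ms \<in> form_tuples k \<and>
     (\<exists>\<sigma> (c :: nat \<Rightarrow> complex). \<sigma> permutes {..<k} \<and> (\<Prod>i<k. c i) = 1 \<and>
        (\<forall>i<k. Ms ! i = (\<lambda>v. c i * (Ls ! \<sigma> i) v)))}"

text \<open>
  For \<open>k = 0\<close> multipoles are constants by convention, which the quotient of the empty product does
  not provide; hence the separate constructor. The constant \<open>0\<close> is the zero multipole.
\<close>

datatype multipole = Zero_mp | Const_mp complex | Class_mp "cfun3 list set"

definition multipoles :: "nat \<Rightarrow> multipole set" where
  "multipoles k = (if k = 0 then Const_mp ` (UNIV - {0})
                   else Class_mp ` (form_tuples k // multipole_rel k))"

definition multipoles_bar :: "nat \<Rightarrow> multipole set" where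
  "multipoles_bar k = insert Zero_mp (multipoles k)"

primrec Theta :: "multipole \<Rightarrow> cfun3" where
  "Theta Zero_mp = (\<lambda>v. 0)"
| "Theta (Const_mp c) = (\<lambda>v. c)"
| "Theta (Class_mp X) = (\<lambda>v. \<Prod>L\<leftarrow>(SOME Ls. Ls \<in> X). L v)"

definition Fact :: "nat \<Rightarrow> cfun3 set" where
  "Fact k = Theta ` multipoles k"

definition rho :: "complex ^ 3 ^ 3 \<Rightarrow> multipole \<Rightarrow> multipole \<Rightarrow> real" where
  "rho A w w' = L2norm A (\<lambda>v. Theta w v - Theta w' v)"

definition Phi :: "complex ^ 3 ^ 3 \<Rightarrow> cfun3 \<Rightarrow> nat \<Rightarrow> multipole \<Rightarrow> cfun3" where
  "Phi A Q k w = orth_proj A (VQ_perp A Q k) (Theta w)"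

definition angle :: "complex ^ 3 ^ 3 \<Rightarrow> cfun3 \<Rightarrow> cfun3 \<Rightarrow> real" where
  "angle A p r = arccos (Re (herm A p r) / (L2norm A p * L2norm A r))"

text \<open>
  \<open>Fact k\<close> is stable under multiplication by non-zero complex scalars, so the Euclidean angle and
  the Hermitian angle (modulus instead of real part) have the same infimum.
\<close>

definition theta :: "complex ^ 3 ^ 3 \<Rightarrow> cfun3 \<Rightarrow> nat \<Rightarrow> real" where
  "theta A Q k = (if VQ Q k = {\<lambda>v. 0} then pi / 2
     else Inf {angle A p r | p r. p \<in> Fact k \<and> r \<in> VQ Q k - {\<lambda>v. 0}})"

definition representing :: "complex ^ 3 ^ 3 \<Rightarrow> cfun3 \<Rightarrow> cfun3 \<Rightarrow> (nat \<Rightarrow> multipole) \<Rightarrow> bool" where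
  "representing A Q f w \<longleftrightarrow>
     (\<forall>k. w k \<in> multipoles_bar k \<and> Phi A Q k (w k) = fourier A k f)"

definition partial_sum :: "complex ^ 3 ^ 3 \<Rightarrow> cfun3 \<Rightarrow> (nat \<Rightarrow> multipole) \<Rightarrow> nat \<Rightarrow> cfun3" where
  "partial_sum A Q w d = (\<lambda>v. \<Sum>k\<le>d. Phi A Q k (w k) v)"

definition L2_converges :: "complex ^ 3 ^ 3 \<Rightarrow> (nat \<Rightarrow> cfun3) \<Rightarrow> cfun3 \<Rightarrow> bool" where
  "L2_converges A P f \<longleftrightarrow> (\<lambda>d. L2norm A (\<lambda>v. P d v - f v)) \<longlonglongrightarrow> 0"

definition cpoint :: "complex ^ 3 \<Rightarrow> (complex ^ 3) set" where
  "cpoint v = {c *s v | c. c \<noteq> 0}"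

definition intersection_points :: "cfun3 \<Rightarrow> cfun3 \<Rightarrow> (complex ^ 3) set set" where
  "intersection_points Q P = cpoint ` {v. v \<noteq> 0 \<and> P v = 0 \<and> Q v = 0}"

text \<open>
  Intersection multiplicity of \<open>{P = 0}\<close> with the smooth conic \<open>{Q = 0}\<close> at a point \<open>X\<close> of the
  projective plane: the order of vanishing of \<open>P\<close> along a local holomorphic parametrization \<open>\<gamma>\<close> of
  the conic at \<open>X\<close>, lifted to the affine cone. The derivative condition says that \<open>\<gamma>\<close> induces an
  immersion into the projective plane at \<open>0\<close>.
\<close>

definition intersection_mult :: "cfun3 \<Rightarrow> cfun3 \<Rightarrow> (complex ^ 3) set \<Rightarrow> nat" where
  "intersection_mult Q P X = (THE m. \<exists>(\<gamma> :: complex \<Rightarrow> complex ^ 3) r. 0 < r \<and>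
     (\<forall>i. (\<lambda>z. \<gamma> z $ i) holomorphic_on ball 0 r) \<and>
     \<gamma> 0 \<in> X \<and>
     (\<forall>z\<in>ball 0 r. Q (\<gamma> z) = 0) \<and>
     (\<forall>c. (\<chi> i. deriv (\<lambda>z. \<gamma> z $ i) 0) \<noteq> c *s \<gamma> 0) \<and>
     int m = zorder (\<lambda>z. P (\<gamma> z)) 0)"

definition mult_partition :: "cfun3 \<Rightarrow> cfun3 \<Rightarrow> nat multiset" where
  "mult_partition Q P =
     image_mset (intersection_mult Q P) (mset_set (intersection_points Q P))"

definition pure_stratum :: "complex ^ 3 ^ 3 \<Rightarrow> cfun3 \<Rightarrow> nat \<Rightarrow> nat multiset \<Rightarrow> cfun3 set" where
  "pure_stratum A Q k \<pi> = {P \<in> VQ_perp A Q k. P \<noteq> (\<lambda>v. 0) \<and> mult_partition Q P = \<pi>}"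

definition strata :: "complex ^ 3 ^ 3 \<Rightarrow> cfun3 \<Rightarrow> nat \<Rightarrow> cfun3 set set" where
  "strata A Q k = insert {\<lambda>v. 0} (range (pure_stratum A Q k))"

text \<open>
  The complement of the generic stratum \<open>1 + 1 + \<dots> + 1\<close>; in particular it contains the origin,
  which is a stratum of its own.
\<close>

definition discriminant :: "complex ^ 3 ^ 3 \<Rightarrow> cfun3 \<Rightarrow> nat \<Rightarrow> cfun3 set" where
  "discriminant A Q k = VQ_perp A Q k - pure_stratum A Q k (replicate_mset (2 * k) 1)"

definition discriminant_fun :: "complex ^ 3 ^ 3 \<Rightarrow> cfun3 \<Rightarrow> cfun3 set" where
  "discriminant_fun A Q =
     {f \<in> holo_on_variety (quadric Q). \<exists>k. fourier A k f \<in> discriminant A Q k}"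

text \<open>Continuity of families is with respect to the compact-open topology.\<close>

definition continuous_family :: "(complex ^ 3) set \<Rightarrow> (real \<Rightarrow> cfun3) \<Rightarrow> bool" where
  "continuous_family S F \<longleftrightarrow> (\<forall>t\<in>{0..1}. F t \<in> holo_on_variety S \<and>
     (\<forall>K. compact K \<and> K \<subseteq> S \<longrightarrow> uniform_limit K F (F t) (at t within {0..1})))"

text \<open>
  The arcs are cut out by the nodes \<open>s 0 < \<dots> < s n\<close>. Continuity of the path is not repeated here:
  Fourier components of a continuous family depend continuously on the parameter.
\<close>

definition tame_path :: "complex ^ 3 ^ 3 \<Rightarrow> cfun3 \<Rightarrow> nat \<Rightarrow> (real \<Rightarrow> cfun3) \<Rightarrow> bool" where
  "tame_path A Q k p \<longleftrightarrow> (\<exists>(n :: nat) (s :: nat \<Rightarrow> real). s 0 = 0 \<and> s n = 1 \<and>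
     (\<forall>i<n. s i < s (Suc i) \<and> (\<exists>D\<in>strata A Q k. \<forall>t\<in>{s i<..<s (Suc i)}. p t \<in> D)))"

definition tame_family :: "complex ^ 3 ^ 3 \<Rightarrow> cfun3 \<Rightarrow> (real \<Rightarrow> cfun3) \<Rightarrow> bool" where
  "tame_family A Q F \<longleftrightarrow> continuous_family (quadric Q) F \<and>
     (\<forall>k. tame_path A Q k (\<lambda>t. fourier A k (F t)))"

text \<open>
  \<open>W t k\<close> is the \<open>k\<close>-th multipole at time \<open>t\<close>; continuity in \<open>t\<close> is with respect to the distance
  \<open>rho\<close> on \<open>multipoles_bar k\<close>.
\<close>

definition multipole_lift ::
  "complex ^ 3 ^ 3 \<Rightarrow> cfun3 \<Rightarrow> (real \<Rightarrow> cfun3) \<Rightarrow> (real \<Rightarrow> nat \<Rightarrow> multipole) \<Rightarrow> bool" where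
  "multipole_lift A Q F W \<longleftrightarrow> (\<forall>t\<in>{0..1}. representing A Q (F t) (W t)) \<and>
     (\<forall>k. \<forall>t\<in>{0..1}. ((\<lambda>s. rho A (W s k) (W t k)) \<longlongrightarrow> 0) (at t within {0..1}))"

text \<open>
  Entire functionals on the Frechet space of holomorphic functions on \<open>S\<close> (compact-open topology):
  continuous, and holomorphic on every complex line. As the topology is metrizable, sequential
  continuity suffices.
\<close>

definition entire_functional :: "(complex ^ 3) set \<Rightarrow> (cfun3 \<Rightarrow> complex) \<Rightarrow> bool" where
  "entire_functional S G \<longleftrightarrow>
     (\<forall>f\<in>holo_on_variety S. \<forall>h. (\<forall>n. h n \<in> holo_on_variety S) \<and>
        (\<forall>K. compact K \<and> K \<subseteq> S \<longrightarrow> uniform_limit K h f sequentially)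
        \<longrightarrow> (\<lambda>n. G (h n)) \<longlonglongrightarrow> G f) \<and>
     (\<forall>f\<in>holo_on_variety S. \<forall>g\<in>holo_on_variety S.
        (\<lambda>z. G (\<lambda>v. f v + z * g v)) holomorphic_on UNIV)"

definition analytic_hypersurface :: "(complex ^ 3) set \<Rightarrow> cfun3 set \<Rightarrow> bool" where
  "analytic_hypersurface S H \<longleftrightarrow> H \<noteq> {} \<and> H \<noteq> holo_on_variety S \<and>
     (\<exists>G. entire_functional S G \<and> H = {f \<in> holo_on_variety S. G f = 0})"

text \<open>
  A condition on one of infinitely many Fourier components yields a countable union of
  hypersurfaces, so this is what codimension one means here.
\<close>

definition complex_codim_one :: "(complex ^ 3) set \<Rightarrow> cfun3 set \<Rightarrow> bool" where
  "complex_codim_one S D \<longleftrightarrow>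
     (\<exists>H :: nat \<Rightarrow> cfun3 set. (\<forall>n. analytic_hypersurface S (H n)) \<and> D = (\<Union>n. H n))"

end

theory Submission
  imports Defs "Jordan_Normal_Form.Determinant" "HOL-Computational_Algebra.Fundamental_Theorem_Algebra"
    "HOL-Computational_Algebra.Field_as_Ring"
begin

text \<open>
  The cone over the conic \<open>Q = 0\<close> is parametrized by pairs of complex numbers: \<open>psi\<close> is a
  quadratic map from \<open>\<complex>\<^sup>2\<close> onto it. Pulling back along \<open>psi\<close> turns a form of degree \<open>k\<close> in three
  variables into a binary form of degree \<open>2 * k\<close>, and the kernel of this pull-back is exactly
  \<open>VQ Q k\<close> (\<open>VQ_iff_psi\<close>). So the pull-back is injective on \<open>VQ_perp A Q k\<close>, and a multipole \<open>u\<close>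
  represents \<open>P\<close> if and only if \<open>Theta u\<close> and \<open>P\<close> have the same pull-back (\<open>Phi_eq_iff\<close>). A
  non-zero linear form in three variables pulls back to a product of two non-zero linear forms in
  two variables, and every such product arises in this way (\<open>chord_form_psi\<close>, \<open>chord_form_surj\<close>).
  Since a binary form splits into linear factors, the multipoles over \<open>P\<close> are the groupings of the
  \<open>2 * k\<close> linear factors of its pull-back into \<open>k\<close> pairs. They exist, there are at most
  \<open>(2 k - 1)!!\<close> of them (\<open>card_fibre_le\<close>), and exactly as many if the factors are pairwise
  non-proportional (\<open>card_fibre_roots_distinct\<close>); unique factorization of products of linear forms
  is what makes different groupings give different multipoles.

  The analytic part rests on the rotation fields \<open>x\<^sub>i \<partial>\<^sub>j - x\<^sub>j \<partial>\<^sub>i\<close>, along which all derivatives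
  integrate to zero over the sphere. On forms of degree \<open>k\<close> the sum of their squares is
  \<open>\<bar>x\<bar>\<^sup>2 \<Delta> - k (k + 1)\<close>, so \<open>\<Delta> - k (k + 1)\<close> is symmetric across degrees (\<open>herm_Q_laplacian\<close>).
  Orthogonality of harmonic forms of different degrees and \<open>Har A k = VQ_perp A Q k\<close> follow by
  induction on the degree, without any eigenspace theory. Every polynomial restricts to a sum of
  harmonic forms on the ellipsoid, so the theorem of Stone and Weierstrass gives convergence of
  the Fourier series. A holomorphic function on the quadric is determined by its values on the
  ellipsoid because every point of the quadric lies on a complexified great circle
  (\<open>holo_determined_by_ellipsoid\<close>).

  The weights \<open>sin (theta A Q k)\<close> enter as follows. The norm of \<open>Phi A Q k u\<close> is the norm of
  \<open>Theta u\<close> times the sine of its angle with its projection to \<open>VQ Q k\<close>, and that angle is at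
  least \<open>theta A Q k\<close> (\<open>sin_theta_rho_le\<close>). Hence the series in question is dominated by the one
  in Bessel's inequality.

  For deformations, the fibres over a continuous path form a finite-valued map that is continuous
  for the Hausdorff distance: the linear factors can be normalized to unit vectors, so
  factorizations of convergent forms subconverge, and any grouping of the factors of the limit is
  copied to the nearby forms. On an interval, such a map has a continuous selection through each
  prescribed initial value (\<open>continuous_selection\<close>), and only one if the number of values is
  constant (\<open>selection_unique\<close>). That number is constant off the discriminant, which in degree
  \<open>k > 0\<close> is the zero set of the resultant of the two partial derivatives of the pulled-back
  binary form of the \<open>k\<close>-th Fourier component, an entire functional (\<open>discriminant_codim_one\<close>).
\<close>

text \<open>
  The notation \<open>v $ i\<close> and the names \<open>vec\<close>, \<open>mat\<close>, \<open>row\<close>, \<open>det\<close> refer to vectors and matrices of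
  fixed dimension; determinants of variable size occur in the definition of the discriminant only.
\<close>

no_notation vec_index (infixl "$" 100)
no_notation fps_nth (infixl "$" 75)
hide_const (open) Matrix.vec Matrix.mat Matrix.row Determinant.det
hide_fact (open) Matrix.vec_eq_iff

section \<open>Polynomials as functions\<close>

definition monomial3 :: "(3 \<Rightarrow> nat) \<Rightarrow> cfun3" where
  "monomial3 \<alpha> v = (\<Prod>i\<in>UNIV. v $ i ^ \<alpha> i)"

lemma finite_exponents: "finite {\<alpha> :: 3 \<Rightarrow> nat. (\<Sum>i\<in>UNIV. \<alpha> i) \<le> d}"
proof (rule finite_subset)
  show "{\<alpha> :: 3 \<Rightarrow> nat. (\<Sum>i\<in>UNIV. \<alpha> i) \<le> d} \<subseteq> (UNIV \<rightarrow>\<^sub>E {..d})"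
  proof
    fix \<alpha> :: "3 \<Rightarrow> nat" assume "\<alpha> \<in> {\<alpha>. (\<Sum>i\<in>UNIV. \<alpha> i) \<le> d}"
    then have "\<alpha> i \<le> d" for i
      using member_le_sum[of i UNIV \<alpha>] by simp
    then show "\<alpha> \<in> (UNIV \<rightarrow>\<^sub>E {..d})" by (auto simp: PiE_def)
  qed
  show "finite (UNIV \<rightarrow>\<^sub>E {..d} :: (3 \<Rightarrow> nat) set)"
    by (intro finite_PiE) auto
qed

lemma finite_exponents_eq: "finite {\<alpha> :: 3 \<Rightarrow> nat. (\<Sum>i\<in>UNIV. \<alpha> i) = d}"
  by (rule finite_subset[OF _ finite_exponents[of d]]) auto

lemma polys_alt:
  "p \<in> polys \<longleftrightarrow> (\<exists>c d. p = (\<lambda>v. \<Sum>\<alpha> | (\<Sum>i\<in>UNIV. \<alpha> i) \<le> d. c \<alpha> * monomial3 \<alpha> v))"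
  by (simp add: polys_def monomial3_def)

lemma polys_add:
  assumes "p \<in> polys" "q \<in> polys"
  shows "(\<lambda>v. p v + q v) \<in> polys"
proof -
  define X where "X d = {\<alpha> :: 3 \<Rightarrow> nat. (\<Sum>i\<in>UNIV. \<alpha> i) \<le> d}" for d
  obtain c d where p: "p = (\<lambda>v. \<Sum>\<alpha>\<in>X d. c \<alpha> * monomial3 \<alpha> v)"
    using assms(1) unfolding polys_alt X_def by blast
  obtain c' d' where q: "q = (\<lambda>v. \<Sum>\<alpha>\<in>X d'. c' \<alpha> * monomial3 \<alpha> v)"
    using assms(2) unfolding polys_alt X_def by blast
  define D where "D = max d d'"
  define e where "e \<alpha> = (if \<alpha> \<in> X d then c \<alpha> else 0) + (if \<alpha> \<in> X d' then c' \<alpha> else 0)" for \<alpha>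
  have fin: "finite (X n)" for n by (simp add: X_def finite_exponents)
  have sub: "X d \<subseteq> X D" "X d' \<subseteq> X D" by (auto simp: X_def D_def)
  have "(\<lambda>v. p v + q v) = (\<lambda>v. \<Sum>\<alpha>\<in>X D. e \<alpha> * monomial3 \<alpha> v)"
  proof
    fix v
    have "p v = (\<Sum>\<alpha>\<in>X D. (if \<alpha> \<in> X d then c \<alpha> else 0) * monomial3 \<alpha> v)"
      unfolding p using sub fin by (intro sum.mono_neutral_cong_left) auto
    moreover have "q v = (\<Sum>\<alpha>\<in>X D. (if \<alpha> \<in> X d' then c' \<alpha> else 0) * monomial3 \<alpha> v)"
      unfolding q using sub fin by (intro sum.mono_neutral_cong_left) auto
    ultimately show "p v + q v = (\<Sum>\<alpha>\<in>X D. e \<alpha> * monomial3 \<alpha> v)"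
      by (simp add: e_def distrib_right sum.distrib)
  qed
  then show ?thesis unfolding polys_alt X_def by blast
qed

lemma monomial3_polys: "monomial3 \<alpha> \<in> polys"
proof -
  let ?d = "\<Sum>i\<in>UNIV. \<alpha> i"
  have "(\<Sum>\<beta> | (\<Sum>i\<in>UNIV. \<beta> i) \<le> ?d. (if \<beta> = \<alpha> then 1 else 0) * monomial3 \<beta> v) = monomial3 \<alpha> v" for v
    using finite_exponents[of ?d] by (simp add: if_distrib[of "\<lambda>x. x * _"] cong: if_cong)
  then have "monomial3 \<alpha> = (\<lambda>v. \<Sum>\<beta> | (\<Sum>i\<in>UNIV. \<beta> i) \<le> ?d. (if \<beta> = \<alpha> then 1 else 0) * monomial3 \<beta> v)"
    by simp
  then show ?thesis unfolding polys_alt by (intro exI[of _ "\<lambda>\<beta>. if \<beta> = \<alpha> then 1 else 0"] exI[of _ ?d])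
qed

lemma polys_cmult:
  assumes "p \<in> polys" shows "(\<lambda>v. a * p v) \<in> polys"
proof -
  obtain c d where p: "p = (\<lambda>v. \<Sum>\<alpha> | (\<Sum>i\<in>UNIV. \<alpha> i) \<le> d. c \<alpha> * monomial3 \<alpha> v)"
    using assms unfolding polys_alt by blast
  show ?thesis unfolding polys_alt p
    by (intro exI[of _ "\<lambda>\<alpha>. a * c \<alpha>"] exI[of _ d]) (simp add: sum_distrib_left mult.assoc)
qed

lemma polys_const: "(\<lambda>v. a) \<in> polys"
proof -
  have "monomial3 (\<lambda>i. 0) = (\<lambda>v. 1)" by (simp add: monomial3_def fun_eq_iff)
  then show ?thesis using polys_cmult[OF monomial3_polys[of "\<lambda>i. 0"], of a] by simp
qed

lemma polys_sum:
  assumes "finite I" "\<And>i. i \<in> I \<Longrightarrow> p i \<in> polys"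
  shows "(\<lambda>v. \<Sum>i\<in>I. p i v) \<in> polys"
  using assms by (induction I) (auto intro: polys_const polys_add)

lemma monomial3_mult: "monomial3 \<alpha> v * monomial3 \<beta> v = monomial3 (\<lambda>i. \<alpha> i + \<beta> i) v"
  by (simp add: monomial3_def power_add prod.distrib)

lemma polys_mult:
  assumes "p \<in> polys" "q \<in> polys"
  shows "(\<lambda>v. p v * q v) \<in> polys"
proof -
  define X where "X d = {\<alpha> :: 3 \<Rightarrow> nat. (\<Sum>i\<in>UNIV. \<alpha> i) \<le> d}" for d
  obtain c d where p: "p = (\<lambda>v. \<Sum>\<alpha>\<in>X d. c \<alpha> * monomial3 \<alpha> v)"
    using assms(1) unfolding polys_alt X_def by blast
  obtain c' d' where q: "q = (\<lambda>v. \<Sum>\<alpha>\<in>X d'. c' \<alpha> * monomial3 \<alpha> v)"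
    using assms(2) unfolding polys_alt X_def by blast
  have fin: "finite (X n)" for n by (simp add: X_def finite_exponents)
  have "p v * q v = (\<Sum>\<alpha>\<in>X d. \<Sum>\<beta>\<in>X d'. c \<alpha> * c' \<beta> * monomial3 (\<lambda>i. \<alpha> i + \<beta> i) v)" for v
    unfolding p q sum_product by (simp add: monomial3_mult[symmetric] mult_ac)
  then show ?thesis
    by (simp, intro polys_sum fin polys_cmult monomial3_polys)
qed

lemma monomial3_single: "monomial3 (\<lambda>j. if j = i then 1 else 0) v = v $ i"
proof -
  have "monomial3 (\<lambda>j. if j = i then 1 else 0) v = (\<Prod>j\<in>UNIV. if j = i then v $ j else 1)"
    unfolding monomial3_def by (intro prod.cong) auto
  then show ?thesis by simp
qed

lemma polys_coord: "(\<lambda>v. v $ i) \<in> polys"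
  using monomial3_polys[of "\<lambda>j. if j = i then 1 else 0"] by (simp add: monomial3_single[abs_def])

text \<open>
  Polynomials are generated by constants and coordinates, so structural induction replaces
  calculations with coefficients nearly everywhere below.
\<close>

lemma polys_induct [consumes 1, case_names const coord add mult]:
  assumes "p \<in> polys"
    and "\<And>c. P (\<lambda>v. c)" and "\<And>i. P (\<lambda>v. v $ i)"
    and "\<And>p q. p \<in> polys \<Longrightarrow> q \<in> polys \<Longrightarrow> P p \<Longrightarrow> P q \<Longrightarrow> P (\<lambda>v. p v + q v)"
    and "\<And>p q. p \<in> polys \<Longrightarrow> q \<in> polys \<Longrightarrow> P p \<Longrightarrow> P q \<Longrightarrow> P (\<lambda>v. p v * q v)"
  shows "P p"
proof -
  have pw: "(\<lambda>v. v $ i ^ n) \<in> polys \<and> P (\<lambda>v. v $ i ^ n)" for i n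
    by (induction n) (auto simp: assms(2) polys_const intro: polys_mult polys_coord assms(3,5))
  have pr: "(\<lambda>v. \<Prod>i\<in>I. v $ i ^ \<alpha> i) \<in> polys \<and> P (\<lambda>v. \<Prod>i\<in>I. v $ i ^ \<alpha> i)" if "finite I" for I and \<alpha> :: "3 \<Rightarrow> nat"
    using that by (induction I) (auto simp: assms(2) polys_const pw intro!: polys_mult assms(5))
  have mo: "P (monomial3 \<alpha>)" for \<alpha> using pr[of UNIV \<alpha>] by (simp add: monomial3_def[abs_def])
  have cm: "P (\<lambda>v. c * monomial3 \<alpha> v)" for c \<alpha> by (intro assms polys_const monomial3_polys mo)
  have sm: "(\<lambda>v. \<Sum>\<alpha>\<in>I. c \<alpha> * monomial3 \<alpha> v) \<in> polys \<and> P (\<lambda>v. \<Sum>\<alpha>\<in>I. c \<alpha> * monomial3 \<alpha> v)"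
    if "finite I" for I c
    using that
    by (induction I) (auto simp: assms(2) polys_const cm intro!: polys_add polys_cmult monomial3_polys assms(4))
  show ?thesis using assms(1) sm[OF finite_exponents] unfolding polys_alt by blast
qed

lemma polys_power: "p \<in> polys \<Longrightarrow> (\<lambda>v. p v ^ n) \<in> polys"
  by (induction n) (auto intro: polys_const polys_mult)

lemma polys_diff: "p \<in> polys \<Longrightarrow> q \<in> polys \<Longrightarrow> (\<lambda>v. p v - q v) \<in> polys"
  using polys_add[of p "\<lambda>v. (-1) * q v"] polys_cmult[of q "-1"] by simp

lemma polys_linear_form: "(\<lambda>v. \<Sum>i\<in>UNIV. c i * v $ i) \<in> polys"
  by (intro polys_sum polys_cmult polys_coord) auto

lemma vector_matrix_mult_nth:
  "(v v* M) $ j = (\<Sum>i\<in>UNIV. M $ i $ j * v $ i)" for v :: "complex^'n"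
  by (simp add: vector_matrix_mult_def mult.commute)

lemma polys_subst:
  assumes "p \<in> polys" shows "(\<lambda>v. p (v v* M)) \<in> polys"
  using assms
proof (induction rule: polys_induct)
  case (coord i) then show ?case by (simp add: vector_matrix_mult_nth polys_linear_form)
qed (auto intro: polys_const polys_add polys_mult)

lemma polys_continuous: "p \<in> polys \<Longrightarrow> continuous_on S p"
  by (induction rule: polys_induct) (auto intro!: continuous_intros)

section \<open>Partial derivatives\<close>

text \<open>
  The chain rule is proved first with unnamed partial derivatives \<open>g\<close>, because their being
  polynomials is part of what the induction needs; applied to coordinate lines it then identifies
  \<open>g i\<close> with \<open>cpartial i p\<close>.
\<close>

lemma polys_chain_ex:
  assumes "p \<in> polys"
  shows "\<exists>g :: 3 \<Rightarrow> cfun3. (\<forall>i. g i \<in> polys) \<and>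
     (\<forall>\<gamma> \<gamma>' z. (\<forall>i. ((\<lambda>t. \<gamma> t $ i) has_field_derivative \<gamma>' $ i) (at z)) \<longrightarrow>
        ((\<lambda>t. p (\<gamma> t)) has_field_derivative (\<Sum>i\<in>UNIV. g i (\<gamma> z) * \<gamma>' $ i)) (at z))"
  using assms
proof (induction rule: polys_induct)
  case (const c)
  show ?case by (rule exI[of _ "\<lambda>i v. 0"]) (auto intro: polys_const)
next
  case (coord j)
  have [simp]: "(\<Sum>i\<in>UNIV. (if i = j then 1 else 0) * \<gamma> $ i) = \<gamma> $ j" for \<gamma> :: "complex^3"
    by (simp add: if_distrib[of "\<lambda>x. x * _"] cong: if_cong)
  show ?case by (rule exI[of _ "\<lambda>i v. if i = j then 1 else 0"]) (auto intro: polys_const)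
next
  case (add p q)
  then obtain g h where g: "\<And>i. g i \<in> polys" "\<And>i. h i \<in> polys"
    and d: "\<And>\<gamma> \<gamma>' z. (\<forall>i. ((\<lambda>t. \<gamma> t $ i) has_field_derivative \<gamma>' $ i) (at z)) \<Longrightarrow>
        ((\<lambda>t. p (\<gamma> t)) has_field_derivative (\<Sum>i\<in>UNIV. g i (\<gamma> z) * \<gamma>' $ i)) (at z)"
      "\<And>\<gamma> \<gamma>' z. (\<forall>i. ((\<lambda>t. \<gamma> t $ i) has_field_derivative \<gamma>' $ i) (at z)) \<Longrightarrow>
        ((\<lambda>t. q (\<gamma> t)) has_field_derivative (\<Sum>i\<in>UNIV. h i (\<gamma> z) * \<gamma>' $ i)) (at z)"
    by blast
  show ?case
  proof (intro exI[of _ "\<lambda>i v. g i v + h i v"] conjI allI impI polys_add g)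
    fix \<gamma> :: "complex \<Rightarrow> complex ^ 3" and \<gamma>' z
    assume *: "\<forall>i. ((\<lambda>t. \<gamma> t $ i) has_field_derivative \<gamma>' $ i) (at z)"
    show "((\<lambda>t. p (\<gamma> t) + q (\<gamma> t)) has_field_derivative (\<Sum>i\<in>UNIV. (g i (\<gamma> z) + h i (\<gamma> z)) * \<gamma>' $ i)) (at z)"
      using DERIV_add[OF d(1)[OF *] d(2)[OF *]] by (simp add: distrib_right sum.distrib)
  qed
next
  case (mult p q)
  then obtain g h where g: "\<And>i. g i \<in> polys" "\<And>i. h i \<in> polys"
    and d: "\<And>\<gamma> \<gamma>' z. (\<forall>i. ((\<lambda>t. \<gamma> t $ i) has_field_derivative \<gamma>' $ i) (at z)) \<Longrightarrow>
        ((\<lambda>t. p (\<gamma> t)) has_field_derivative (\<Sum>i\<in>UNIV. g i (\<gamma> z) * \<gamma>' $ i)) (at z)"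
      "\<And>\<gamma> \<gamma>' z. (\<forall>i. ((\<lambda>t. \<gamma> t $ i) has_field_derivative \<gamma>' $ i) (at z)) \<Longrightarrow>
        ((\<lambda>t. q (\<gamma> t)) has_field_derivative (\<Sum>i\<in>UNIV. h i (\<gamma> z) * \<gamma>' $ i)) (at z)"
    by blast
  show ?case
  proof (intro exI[of _ "\<lambda>i v. g i v * q v + p v * h i v"] conjI allI impI polys_add polys_mult g mult)
    fix \<gamma> :: "complex \<Rightarrow> complex ^ 3" and \<gamma>' z
    assume *: "\<forall>i. ((\<lambda>t. \<gamma> t $ i) has_field_derivative \<gamma>' $ i) (at z)"
    show "((\<lambda>t. p (\<gamma> t) * q (\<gamma> t)) has_field_derivative
      (\<Sum>i\<in>UNIV. (g i (\<gamma> z) * q (\<gamma> z) + p (\<gamma> z) * h i (\<gamma> z)) * \<gamma>' $ i)) (at z)"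
      using DERIV_mult[OF d(1)[OF *] d(2)[OF *]]
      by (simp add: distrib_right distrib_left sum.distrib sum_distrib_left sum_distrib_right mult_ac)
  qed
qed

lemma polys_chain_aux:
  assumes "p \<in> polys"
  shows "(\<forall>i. cpartial i p \<in> polys) \<and>
     (\<forall>\<gamma> \<gamma>' z. (\<forall>i. ((\<lambda>t. \<gamma> t $ i) has_field_derivative \<gamma>' $ i) (at z)) \<longrightarrow>
        ((\<lambda>t. p (\<gamma> t)) has_field_derivative (\<Sum>i\<in>UNIV. cpartial i p (\<gamma> z) * \<gamma>' $ i)) (at z))"
proof -
  obtain g :: "3 \<Rightarrow> cfun3" where g: "\<And>i. g i \<in> polys" and
    d: "\<And>\<gamma> \<gamma>' z. (\<forall>i. ((\<lambda>t. \<gamma> t $ i) has_field_derivative \<gamma>' $ i) (at z)) \<Longrightarrow>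
        ((\<lambda>t. p (\<gamma> t)) has_field_derivative (\<Sum>i\<in>UNIV. g i (\<gamma> z) * \<gamma>' $ i)) (at z)"
    using polys_chain_ex[OF assms] by blast
  have "cpartial j p = g j" for j
  proof
    fix v
    have "((\<lambda>t. p (v + t *s axis j 1)) has_field_derivative
        (\<Sum>i\<in>UNIV. g i (v + 0 *s axis j 1) * axis j 1 $ i)) (at 0)"
      by (rule d) (auto intro!: derivative_eq_intros)
    then have "deriv (\<lambda>t. p (v + t *s axis j 1)) 0 = (\<Sum>i\<in>UNIV. g i (v + 0 *s axis j 1) * axis j 1 $ i)"
      by (rule DERIV_imp_deriv)
    also have "\<dots> = (\<Sum>i\<in>UNIV. if i = j then g i v else 0)"
      by (intro sum.cong) (auto simp: axis_def)
    finally show "cpartial j p v = g j v" by (simp add: cpartial_def)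
  qed
  then show ?thesis using g d by auto
qed

lemma cpartial_polys: "p \<in> polys \<Longrightarrow> cpartial i p \<in> polys"
  using polys_chain_aux by blast

lemma polys_chain:
  assumes "p \<in> polys" "\<And>i. ((\<lambda>t. \<gamma> t $ i) has_field_derivative \<gamma>' $ i) (at z)"
  shows "((\<lambda>t. p (\<gamma> t)) has_field_derivative (\<Sum>i\<in>UNIV. cpartial i p (\<gamma> z) * \<gamma>' $ i)) (at z)"
  using polys_chain_aux[OF assms(1)] assms(2) by blast

lemma cpartial_eqI:
  assumes "\<And>v. ((\<lambda>t. p (v + t *s axis i 1)) has_field_derivative d v) (at 0)"
  shows "cpartial i p = d"
  using assms by (auto simp: cpartial_def fun_eq_iff intro!: DERIV_imp_deriv)

lemma polys_line:
  assumes "p \<in> polys"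
  shows "((\<lambda>t. p (v + t *s axis i 1)) has_field_derivative cpartial i p v) (at 0)"
proof -
  have "((\<lambda>t. p (v + t *s axis i 1)) has_field_derivative
        (\<Sum>j\<in>UNIV. cpartial j p (v + 0 *s axis i 1) * axis i 1 $ j)) (at 0)"
    by (rule polys_chain[OF assms]) (auto intro!: derivative_eq_intros)
  also have "(\<Sum>j\<in>UNIV. cpartial j p (v + 0 *s axis i 1) * axis i 1 $ j) = (\<Sum>j\<in>UNIV. if j = i then cpartial j p v else 0)"
    by (intro sum.cong) (auto simp: axis_def)
  finally show ?thesis by simp
qed

lemma cpartial_const: "cpartial i (\<lambda>v. c) = (\<lambda>v. 0)"
  by (rule cpartial_eqI) auto

lemma cpartial_coord: "cpartial i (\<lambda>v. v $ j) = (\<lambda>v. if i = j then 1 else 0)"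
  by (rule cpartial_eqI) (auto intro!: derivative_eq_intros simp: axis_def)

lemma cpartial_add:
  assumes "p \<in> polys" "q \<in> polys"
  shows "cpartial i (\<lambda>v. p v + q v) = (\<lambda>v. cpartial i p v + cpartial i q v)"
  by (rule cpartial_eqI) (intro DERIV_add polys_line assms)

lemma cpartial_diff:
  assumes "p \<in> polys" "q \<in> polys"
  shows "cpartial i (\<lambda>v. p v - q v) = (\<lambda>v. cpartial i p v - cpartial i q v)"
  by (rule cpartial_eqI) (intro DERIV_diff polys_line assms)

lemma cpartial_mult:
  assumes "p \<in> polys" "q \<in> polys"
  shows "cpartial i (\<lambda>v. p v * q v) = (\<lambda>v. cpartial i p v * q v + p v * cpartial i q v)"
proof (rule cpartial_eqI)
  fix v
  show "((\<lambda>t. p (v + t *s axis i 1) * q (v + t *s axis i 1)) has_field_derivative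
     cpartial i p v * q v + p v * cpartial i q v) (at 0)"
    using DERIV_mult[OF polys_line[OF assms(1), of v i] polys_line[OF assms(2), of v i]]
    by (simp add: mult_ac)
qed

lemma cpartial_cmult:
  assumes "p \<in> polys"
  shows "cpartial i (\<lambda>v. c * p v) = (\<lambda>v. c * cpartial i p v)"
  using cpartial_mult[OF polys_const assms, of i c] by (simp add: cpartial_const)

lemma cpartial_sum:
  assumes "finite I" "\<And>j. j \<in> I \<Longrightarrow> p j \<in> polys"
  shows "cpartial i (\<lambda>v. \<Sum>j\<in>I. p j v) = (\<lambda>v. \<Sum>j\<in>I. cpartial i (p j) v)"
  using assms
proof (induction I)
  case (insert x F)
  then show ?case using cpartial_add[of "p x" "\<lambda>v. \<Sum>j\<in>F. p j v" i] polys_sum[of F p] by auto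
qed (simp add: cpartial_const)

lemma cpartial_commute:
  assumes "p \<in> polys"
  shows "cpartial i (cpartial j p) = cpartial j (cpartial i p)"
  using assms
proof (induction rule: polys_induct)
  case (add p q)
  then show ?case by (simp add: cpartial_add cpartial_polys)
next
  case (mult p q)
  then show ?case
    by (simp add: cpartial_mult cpartial_add cpartial_polys polys_mult algebra_simps)
qed (simp_all add: cpartial_const cpartial_coord)

lemma cpartial_subst:
  assumes "p \<in> polys"
  shows "cpartial i (\<lambda>u. p (u v* M)) = (\<lambda>u. \<Sum>j\<in>UNIV. M $ i $ j * cpartial j p (u v* M))"
proof (rule cpartial_eqI)
  fix v
  have e: "(\<Sum>k\<in>UNIV. M $ k $ j * axis i 1 $ k) = M $ i $ j" for j
  proof -
    have "(\<Sum>k\<in>UNIV. M $ k $ j * axis i 1 $ k) = (\<Sum>k\<in>UNIV. if k = i then M $ k $ j else 0)"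
      by (intro sum.cong) (auto simp: axis_def)
    then show ?thesis by simp
  qed
  have "((\<lambda>t. p ((v + t *s axis i 1) v* M)) has_field_derivative
     (\<Sum>j\<in>UNIV. cpartial j p ((v + 0 *s axis i 1) v* M) * (\<chi> j. M $ i $ j) $ j)) (at 0)"
  proof (rule polys_chain[OF assms])
    fix j
    show "((\<lambda>t. ((v + t *s axis i 1) v* M) $ j) has_field_derivative (\<chi> j. M $ i $ j) $ j) (at 0)"
      unfolding vector_matrix_mult_nth
      by (auto intro!: derivative_eq_intros simp: e[unfolded mult.commute[of "_ $ _ $ _"]])
  qed
  then show "((\<lambda>t. p ((v + t *s axis i 1) v* M)) has_field_derivative
     (\<Sum>j\<in>UNIV. M $ i $ j * cpartial j p (v v* M))) (at 0)"
    by (simp add: mult.commute)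
qed

section \<open>Homogeneous components\<close>

lemma polys_homogeneous_split:
  assumes "p \<in> polys"
  obtains d ps where "\<And>k. ps k \<in> hom_polys k" "p = (\<lambda>v. \<Sum>k\<le>d. ps k v)"
proof -
  obtain c d where p: "p = (\<lambda>v. \<Sum>\<alpha> | (\<Sum>i\<in>UNIV. \<alpha> i) \<le> d. c \<alpha> * monomial3 \<alpha> v)"
    using assms unfolding polys_alt by blast
  define ps where "ps k v = (\<Sum>\<alpha> | (\<Sum>i\<in>UNIV. \<alpha> i) = k. c \<alpha> * monomial3 \<alpha> v)" for k v
  have "p v = (\<Sum>k\<le>d. ps k v)" for v
  proof -
    have "(\<Sum>k\<le>d. ps k v) = (\<Sum>k\<le>d. \<Sum>\<alpha> | \<alpha> \<in> {\<alpha>. (\<Sum>i\<in>UNIV. \<alpha> i) \<le> d} \<and> (\<Sum>i\<in>UNIV. \<alpha> i) = k. c \<alpha> * monomial3 \<alpha> v)"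
      unfolding ps_def by (intro sum.cong refl) (auto intro!: sum.cong)
    also have "\<dots> = p v" unfolding p
      by (rule sum.group) (auto intro: finite_exponents)
    finally show ?thesis by simp
  qed
  moreover have "ps k \<in> hom_polys k" for k
    unfolding hom_polys_def ps_def monomial3_def by blast
  ultimately show ?thesis using that by blast
qed

lemma hom_polys_alt:
  "p \<in> hom_polys k \<longleftrightarrow> (\<exists>c. p = (\<lambda>v. \<Sum>\<alpha> | (\<Sum>i\<in>UNIV. \<alpha> i) = k. c \<alpha> * monomial3 \<alpha> v))"
  by (simp add: hom_polys_def monomial3_def)

lemma hom_polys_polys: "p \<in> hom_polys k \<Longrightarrow> p \<in> polys"
  unfolding hom_polys_alt by (auto intro!: polys_sum polys_cmult monomial3_polys finite_exponents_eq)

lemma monomial3_scale: "monomial3 \<alpha> (t *s v) = t ^ (\<Sum>i\<in>UNIV. \<alpha> i) * monomial3 \<alpha> v"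
  by (simp add: monomial3_def power_mult_distrib prod.distrib power_sum)

lemma hom_polys_scale:
  assumes "p \<in> hom_polys k" shows "p (t *s v) = t ^ k * p v"
proof -
  obtain c where p: "p = (\<lambda>v. \<Sum>\<alpha> | (\<Sum>i\<in>UNIV. \<alpha> i) = k. c \<alpha> * monomial3 \<alpha> v)"
    using assms unfolding hom_polys_alt by blast
  show ?thesis unfolding p sum_distrib_left
    by (intro sum.cong refl) (auto simp: monomial3_scale)
qed

lemma hom_polys_zero: "(\<lambda>v. 0) \<in> hom_polys k"
  unfolding hom_polys_alt by (rule exI[of _ "\<lambda>_. 0"]) simp

text \<open>
  Both sides are polynomials in \<open>t\<close>; comparing coefficients isolates the component of degree \<open>k\<close>.
\<close>

lemma homogeneous_components_unique:
  fixes a :: "nat \<Rightarrow> complex"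
  assumes "\<And>t. (\<Sum>j\<le>d. t ^ j * a j) = t ^ k * b"
  shows "b = (if k \<le> d then a k else 0)"
proof -
  define n where "n = max d k"
  have "(\<Sum>i\<le>n. (if i \<le> d then a i else 0) * t ^ i) = (\<Sum>i\<le>n. (if i = k then b else 0) * t ^ i)" for t
  proof -
    have "(\<Sum>i\<le>n. (if i \<le> d then a i else 0) * t ^ i) = (\<Sum>j\<le>d. t ^ j * a j)"
      by (rule sum.mono_neutral_cong_right) (auto simp: n_def)
    also have "\<dots> = (\<Sum>i\<le>n. (if i = k then b else 0) * t ^ i)"
      using assms[of t] by (simp add: if_distribR if_distrib[of "\<lambda>x. x * _"] n_def mult.commute[of b] cong: if_cong)
    finally show ?thesis .
  qed
  then have "\<forall>i\<le>n. (if i \<le> d then a i else 0) = (if i = k then b else 0)"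
    using polyfun_eq_coeffs[of "\<lambda>i. if i \<le> d then a i else 0" n "\<lambda>i. if i = k then b else 0"] by blast
  then show ?thesis by (auto simp: n_def)
qed

text \<open>
  Homogeneity as a function forces the form of the polynomial: all homogeneous components of other
  degrees vanish. This spares all later arguments the monomial expansion.
\<close>

lemma hom_polysI:
  assumes "p \<in> polys" "\<And>t v. p (t *s v) = t ^ k * p v"
  shows "p \<in> hom_polys k"
proof -
  obtain d ps where ps: "\<And>j. ps j \<in> hom_polys j" and p: "p = (\<lambda>v. \<Sum>j\<le>d. ps j v)"
    using polys_homogeneous_split[OF assms(1)] by blast
  have "p v = (if k \<le> d then ps k v else 0)" for v
  proof (rule homogeneous_components_unique)
    fix t
    have "(\<Sum>j\<le>d. t ^ j * ps j v) = p (t *s v)"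
      unfolding p using hom_polys_scale[OF ps] by simp
    then show "(\<Sum>j\<le>d. t ^ j * ps j v) = t ^ k * p v" using assms(2) by simp
  qed
  then have "p = (if k \<le> d then ps k else (\<lambda>v. 0))" by (auto simp: fun_eq_iff)
  then show ?thesis using ps hom_polys_zero by simp
qed

lemma hom_polys_iff: "p \<in> hom_polys k \<longleftrightarrow> p \<in> polys \<and> (\<forall>t v. p (t *s v) = t ^ k * p v)"
  using hom_polysI hom_polys_polys hom_polys_scale by metis

lemma hom_polys_add: "p \<in> hom_polys k \<Longrightarrow> q \<in> hom_polys k \<Longrightarrow> (\<lambda>v. p v + q v) \<in> hom_polys k"
  by (auto simp: hom_polys_iff algebra_simps intro: polys_add)

lemma hom_polys_diff: "p \<in> hom_polys k \<Longrightarrow> q \<in> hom_polys k \<Longrightarrow> (\<lambda>v. p v - q v) \<in> hom_polys k"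
  by (auto simp: hom_polys_iff algebra_simps intro: polys_diff)

lemma hom_polys_cmult: "p \<in> hom_polys k \<Longrightarrow> (\<lambda>v. c * p v) \<in> hom_polys k"
  by (auto simp: hom_polys_iff algebra_simps intro: polys_cmult)

lemma hom_polys_mult: "p \<in> hom_polys j \<Longrightarrow> q \<in> hom_polys k \<Longrightarrow> (\<lambda>v. p v * q v) \<in> hom_polys (j + k)"
  by (auto simp: hom_polys_iff algebra_simps power_add intro: polys_mult)

lemma hom_polys_sum:
  "finite I \<Longrightarrow> (\<And>i. i \<in> I \<Longrightarrow> p i \<in> hom_polys k) \<Longrightarrow> (\<lambda>v. \<Sum>i\<in>I. p i v) \<in> hom_polys k"
  by (induction I rule: finite_induct) (auto intro: hom_polys_zero hom_polys_add)

lemma vector_matrix_scale: "(t *s v) v* M = t *s (v v* M)" for M :: "complex^3^3"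
  by (simp add: vec_eq_iff vector_matrix_mult_nth sum_distrib_left mult_ac)

lemma hom_polys_subst: "p \<in> hom_polys k \<Longrightarrow> (\<lambda>v. p (v v* M)) \<in> hom_polys k"
  by (auto simp: hom_polys_iff vector_matrix_scale intro: polys_subst)

lemma hom_polys_0: "p \<in> hom_polys 0 \<Longrightarrow> p = (\<lambda>v. p 0)"
proof
  fix v assume "p \<in> hom_polys 0"
  then have "p (0 *s v) = p v" using hom_polys_scale[of p 0 0 v] by simp
  moreover have "0 *s v = 0" by simp
  ultimately show "p v = p 0" by metis
qed

text \<open>Both sides are the derivative of \<open>t \<mapsto> p (t *s v)\<close> at \<open>1\<close>.\<close>

lemma euler:
  assumes "p \<in> hom_polys k"
  shows "(\<Sum>i\<in>UNIV. v $ i * cpartial i p v) = of_nat k * p v"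
proof -
  have 1: "((\<lambda>t. p (t *s v)) has_field_derivative (\<Sum>i\<in>UNIV. cpartial i p (1 *s v) * v $ i)) (at 1)"
    by (rule polys_chain[OF hom_polys_polys[OF assms]]) (auto intro!: derivative_eq_intros)
  have 2: "((\<lambda>t. p (t *s v)) has_field_derivative of_nat k * p v) (at 1)"
    unfolding hom_polys_scale[OF assms] by (auto intro!: derivative_eq_intros)
  show ?thesis using DERIV_unique[OF 1 2] by (simp add: mult.commute)
qed

lemma cpartial_hom:
  assumes "p \<in> hom_polys k"
  shows "cpartial i p \<in> hom_polys (k - 1)"
proof (cases k)
  case 0
  then have "p = (\<lambda>v. p 0)" using hom_polys_0 assms by blast
  then have "cpartial i p = (\<lambda>v. 0)" using cpartial_const by metis
  then show ?thesis using hom_polys_zero by simp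
next
  case (Suc n)
  have pp: "p \<in> polys" using assms hom_polys_polys by blast
  have nz: "cpartial i p (t *s v) = t ^ n * cpartial i p v" if "t \<noteq> 0" for t v
  proof -
    have "((\<lambda>s. p (t *s (v + s *s axis i 1))) has_field_derivative t ^ k * cpartial i p v) (at 0)"
      unfolding hom_polys_scale[OF assms] by (intro DERIV_cmult polys_line pp)
    moreover have "((\<lambda>s. p (t *s (v + s *s axis i 1))) has_field_derivative
        (\<Sum>j\<in>UNIV. cpartial j p (t *s (v + 0 *s axis i 1)) * (t *s axis i 1) $ j)) (at 0)"
      by (rule polys_chain[OF pp]) (auto intro!: derivative_eq_intros)
    moreover have "(\<Sum>j\<in>UNIV. cpartial j p (t *s (v + 0 *s axis i 1)) * (t *s axis i 1) $ j)
       = (\<Sum>j\<in>UNIV. if j = i then cpartial j p (t *s v) * t else 0)"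
      by (intro sum.cong) (auto simp: axis_def)
    ultimately have "t ^ k * cpartial i p v = cpartial i p (t *s v) * t"
      using DERIV_unique by fastforce
    then show ?thesis using that Suc by auto
  qed
  have "cpartial i p (t *s v) = t ^ n * cpartial i p v" for t v
  proof (cases "t = 0")
    case False then show ?thesis using nz by blast
  next
    case True
    \<comment> \<open>the value at \<open>t = 0\<close> follows by continuity in \<open>t\<close>\<close>
    have c: "continuous_on UNIV (\<lambda>t. cpartial i p (t *s v) - t ^ n * cpartial i p v)"
      by (intro continuous_intros continuous_on_compose2[OF polys_continuous[OF cpartial_polys[OF pp], of UNIV]])
         (auto simp: vector_scalar_mult_def intro!: continuous_on_vec_lambda continuous_intros)
    have l1: "((\<lambda>t. cpartial i p (t *s v) - t ^ n * cpartial i p v) \<longlongrightarrow>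
       cpartial i p (0 *s v) - 0 ^ n * cpartial i p v) (at 0)"
      using c[unfolded continuous_on_def, rule_format, of 0] by simp
    have l2: "((\<lambda>t. cpartial i p (t *s v) - t ^ n * cpartial i p v) \<longlongrightarrow> 0) (at 0)"
      by (rule tendsto_eventually) (auto simp: eventually_at_filter nz)
    have "cpartial i p (0 *s v) - 0 ^ n * cpartial i p v = 0"
      by (rule tendsto_unique[OF at_neq_bot l1 l2])
    then show ?thesis using True by simp
  qed
  then show ?thesis using Suc cpartial_polys[OF pp] by (intro hom_polysI) auto
qed

definition laplacian :: "cfun3 \<Rightarrow> cfun3" where
  "laplacian p = (\<lambda>v. \<Sum>i\<in>UNIV. cpartial i (cpartial i p) v)"

lemma Q_laplacian_hom:
  assumes "p \<in> hom_polys k" shows "Q_laplacian A p \<in> hom_polys (k - 2)"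
proof -
  have "cpartial i (cpartial j p) \<in> hom_polys (k - 2)" for i j
    using cpartial_hom[OF cpartial_hom[OF assms]] by (simp add: numeral_2_eq_2)
  then show ?thesis unfolding Q_laplacian_def
    by (intro hom_polys_sum hom_polys_cmult) auto
qed

lemma Q_laplacian_polys:
  assumes "p \<in> polys" shows "Q_laplacian A p \<in> polys"
  unfolding Q_laplacian_def
  by (intro polys_sum polys_cmult cpartial_polys assms) auto

lemma Q_laplacian_add:
  assumes "p \<in> polys" "q \<in> polys"
  shows "Q_laplacian A (\<lambda>v. p v + q v) = (\<lambda>v. Q_laplacian A p v + Q_laplacian A q v)"
  by (simp add: Q_laplacian_def cpartial_add cpartial_polys assms distrib_left sum.distrib)

lemma Q_laplacian_cmult:
  assumes "p \<in> polys"
  shows "Q_laplacian A (\<lambda>v. c * p v) = (\<lambda>v. c * Q_laplacian A p v)"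
  by (simp add: Q_laplacian_def cpartial_cmult cpartial_polys assms sum_distrib_left mult_ac)

lemma Q_laplacian_zero: "Q_laplacian A (\<lambda>v. 0) = (\<lambda>v. 0)"
  by (simp add: Q_laplacian_def cpartial_const)

lemma Q_laplacian_sum:
  assumes "finite I" "\<And>j. j \<in> I \<Longrightarrow> p j \<in> polys"
  shows "Q_laplacian A (\<lambda>v. \<Sum>j\<in>I. p j v) = (\<lambda>v. \<Sum>j\<in>I. Q_laplacian A (p j) v)"
  using assms
proof (induction I)
  case (insert x F)
  then show ?case using Q_laplacian_add[of "p x" "\<lambda>v. \<Sum>j\<in>F. p j v" A] polys_sum[of F p] by auto
qed (simp add: Q_laplacian_zero)

section \<open>The surface measure of the sphere\<close>

definition emb :: "real ^ 3 \<Rightarrow> complex ^ 3" where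
  "emb u = (\<chi> i. complex_of_real (u $ i))"

lemma emb_nth [simp]: "emb u $ i = complex_of_real (u $ i)"
  by (simp add: emb_def)

lemma emb_continuous: "continuous_on S emb"
  unfolding emb_def by (intro continuous_intros)

text \<open>Orthogonal maps preserve the volume of boxes, which determines Lebesgue measure.\<close>

lemma lborel_distr_orthogonal:
  fixes f :: "real^3 \<Rightarrow> real^3"
  assumes f: "orthogonal_transformation f"
  shows "distr lborel borel f = lborel"
proof (rule sym, rule lborel_eqI)
  fix l u :: "real^3"
  assume le: "\<And>b. b \<in> Basis \<Longrightarrow> l \<bullet> b \<le> u \<bullet> b"
  have lin: "linear f" using f by (simp add: orthogonal_transformation_linear)
  have meas: "f \<in> borel_measurable lborel"
    using lin by (simp add: borel_measurable_continuous_onI linear_continuous_on linear_conv_bounded_linear)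
  have bij: "bij f" by (rule orthogonal_transformation_bij[OF f])
  have eq: "f -` box l u = inv_into UNIV f ` box l u"
    by (rule bij_vimage_eq_inv_image[OF bij])
  have lm: "box l u \<in> lmeasurable" by simp
  have o: "orthogonal_transformation (inv_into UNIV f)" using orthogonal_transformation_inv[OF f] .
  have "emeasure (distr lborel borel f) (box l u) = emeasure lborel (f -` box l u)"
    using meas by (subst emeasure_distr) auto
  also have "\<dots> = emeasure lebesgue (inv_into UNIV f ` box l u)"
  proof -
    have "f -` box l u \<in> sets borel"
      using measurable_sets[OF meas, of "box l u"] by simp
    then show ?thesis by (simp add: eq)
  qed
  also have "\<dots> = ennreal (measure lebesgue (inv_into UNIV f ` box l u))"
    using measurable_orthogonal_image[OF o lm] by (simp add: emeasure_eq_measure2)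
  also have "\<dots> = ennreal (measure lebesgue (box l u))"
    by (simp add: measure_orthogonal_image[OF o lm])
  also have "\<dots> = emeasure lborel (box l u)"
    using lm by (simp add: emeasure_eq_measure2)
  also have "\<dots> = (\<Prod>b\<in>Basis. (u - l) \<bullet> b)"
    using le by simp
  finally show "emeasure (distr lborel borel f) (box l u) = (\<Prod>b\<in>Basis. (u - l) \<bullet> b)" .
qed simp

lemma sets_sphere_measure: "sets sphere_measure = sets (restrict_space borel (sphere 0 1))"
  by (simp add: sphere_measure_def)

lemma space_sphere_measure: "space sphere_measure = sphere 0 1"
  by (simp add: sphere_measure_def space_scale_measure space_restrict_space)

lemma radial_measurable:
  "(\<lambda>x :: real^3. x /\<^sub>R norm x) \<in> restrict_space lborel (ball 0 1 - {0}) \<rightarrow>\<^sub>M restrict_space borel (sphere 0 1)"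
proof (rule measurable_restrict_space2)
  show "(\<lambda>x :: real^3. x /\<^sub>R norm x) \<in> space (restrict_space lborel (ball 0 1 - {0})) \<rightarrow> sphere 0 1"
    by (auto simp: space_restrict_space)
  have "(\<lambda>x :: real^3. x /\<^sub>R norm x) \<in> borel_measurable (restrict_space borel (ball 0 1 - {0}))"
    by (rule borel_measurable_continuous_on_restrict) (auto intro!: continuous_intros)
  then show "(\<lambda>x :: real^3. x /\<^sub>R norm x) \<in> restrict_space lborel (ball 0 1 - {0}) \<rightarrow>\<^sub>M borel"
    by (subst measurable_cong_sets[where M' = "restrict_space borel (ball 0 1 - {0})" and N' = borel])
       (simp_all add: sets_restrict_space)
qed

lemma emeasure_sphere_measure:
  assumes "E \<in> sets (restrict_space borel (sphere 0 1))"
  shows "emeasure sphere_measure E = 3 * emeasure lborel {x. x \<noteq> 0 \<and> norm x < 1 \<and> x /\<^sub>R norm x \<in> E}"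
proof -
  have "emeasure sphere_measure E = 3 * emeasure (restrict_space lborel (ball 0 1 - {0}))
      ((\<lambda>x :: real^3. x /\<^sub>R norm x) -` E \<inter> space (restrict_space lborel (ball 0 1 - {0})))"
    unfolding sphere_measure_def
    by (simp add: emeasure_distr[OF radial_measurable assms])
  also have "\<dots> = 3 * emeasure lborel ((\<lambda>x :: real^3. x /\<^sub>R norm x) -` E \<inter> (ball 0 1 - {0}))"
    by (subst emeasure_restrict_space) (auto simp: space_restrict_space)
  also have "(\<lambda>x :: real^3. x /\<^sub>R norm x) -` E \<inter> (ball 0 1 - {0}) = {x. x \<noteq> 0 \<and> norm x < 1 \<and> x /\<^sub>R norm x \<in> E}"
    by (auto simp: dist_norm)
  finally show ?thesis .
qed

lemma cone_measurable:
  assumes "E \<in> sets (restrict_space borel (sphere 0 1))"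
  shows "{x :: real^3. x \<noteq> 0 \<and> norm x < 1 \<and> x /\<^sub>R norm x \<in> E} \<in> sets borel"
proof -
  have "(\<lambda>x :: real^3. x /\<^sub>R norm x) -` E \<inter> space (restrict_space lborel (ball 0 1 - {0}))
      \<in> sets (restrict_space lborel (ball 0 1 - {0}))"
    by (rule measurable_sets[OF radial_measurable assms])
  moreover have "(\<lambda>x :: real^3. x /\<^sub>R norm x) -` E \<inter> space (restrict_space lborel (ball 0 1 - {0}))
     = {x :: real^3. x \<noteq> 0 \<and> norm x < 1 \<and> x /\<^sub>R norm x \<in> E}"
    by (auto simp: space_restrict_space)
  ultimately show ?thesis
    by (subst (asm) sets_restrict_space_iff) auto
qed

lemma finite_sphere_measure: "finite_measure sphere_measure"
proof
  have "sphere 0 1 \<in> sets (restrict_space borel (sphere (0 :: real^3) 1))"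
    using sets.top[of "restrict_space borel (sphere (0 :: real^3) 1)"] by (simp add: space_restrict_space)
  then have "emeasure sphere_measure (sphere 0 1)
     = 3 * emeasure lborel {x :: real^3. x \<noteq> 0 \<and> norm x < 1 \<and> x /\<^sub>R norm x \<in> sphere 0 1}"
    by (rule emeasure_sphere_measure)
  also have "\<dots> \<le> 3 * emeasure lborel (ball (0 :: real^3) 1)"
    by (intro mult_left_mono emeasure_mono) (auto simp: dist_norm)
  also have "\<dots> < \<infinity>"
    using emeasure_lborel_ball_finite[of "0 :: real^3" 1] by (simp add: ennreal_mult_less_top less_top)
  finally show "emeasure sphere_measure (space sphere_measure) \<noteq> \<infinity>"
    by (simp add: space_sphere_measure)
qed

text \<open>
  The cone over a relatively open part of the sphere is open and non-empty, hence not a null set.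
  This makes the Hermitian product definite on continuous functions.
\<close>

lemma sphere_measure_open_pos:
  assumes "open U" "u \<in> U" "norm u = 1"
  shows "emeasure sphere_measure (U \<inter> sphere 0 1) > 0"
proof -
  have E: "U \<inter> sphere 0 1 \<in> sets (restrict_space borel (sphere 0 1))"
    using borel_open[OF assms(1)] by (simp add: sets_restrict_space Int_commute)
  let ?C = "{x. x \<noteq> 0 \<and> norm x < 1 \<and> x /\<^sub>R norm x \<in> U \<inter> sphere 0 1}"
  have "?C = (ball 0 1 - {0}) \<inter> (\<lambda>x. x /\<^sub>R norm x) -` U" by auto
  moreover have "open ((ball 0 1 - {0}) \<inter> (\<lambda>x :: real^3. x /\<^sub>R norm x) -` U)"
    by (rule continuous_open_preimage[OF _ _ assms(1)]) (auto intro!: continuous_intros)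
  ultimately have o: "open ?C" by simp
  have "(1/2) *\<^sub>R u \<in> ?C" using assms by auto
  then have "\<not> negligible ?C" by (intro open_not_negligible o) blast
  then have "?C \<notin> null_sets lebesgue" by (simp add: negligible_iff_null_sets)
  then have "emeasure lborel ?C \<noteq> 0"
    using borel_open[OF o] by (auto simp: null_sets_def)
  then show ?thesis
    unfolding emeasure_sphere_measure[OF E] by (simp add: zero_less_iff_neq_zero)
qed

lemma sphere_measurable:
  assumes "continuous_on (sphere 0 1) \<phi>" shows "\<phi> \<in> borel_measurable sphere_measure"
  using borel_measurable_continuous_on_restrict[OF assms]
  by (simp add: measurable_cong_sets[OF sets_sphere_measure refl])

lemma sphere_integrable:
  fixes \<phi> :: "real^3 \<Rightarrow> 'b :: {banach, second_countable_topology}"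
  assumes "continuous_on (sphere 0 1) \<phi>" shows "integrable sphere_measure \<phi>"
proof -
  have "compact (\<phi> ` sphere 0 1)" using assms by (intro compact_continuous_image) auto
  then obtain B where "\<And>u. u \<in> sphere 0 1 \<Longrightarrow> norm (\<phi> u) \<le> B"
    using compact_imp_bounded bounded_iff by (metis imageI)
  then show ?thesis
    by (intro finite_measure.integrable_const_bound[OF finite_sphere_measure, of _ B] sphere_measurable assms)
       (auto simp: space_sphere_measure)
qed

lemma sphere_integral_zero:
  fixes \<phi> :: "real^3 \<Rightarrow> real"
  assumes c: "continuous_on (sphere 0 1) \<phi>" and nn: "\<And>u. norm u = 1 \<Longrightarrow> 0 \<le> \<phi> u"
    and z: "integral\<^sup>L sphere_measure \<phi> = 0" and u: "norm u = 1"
  shows "\<phi> u = 0"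
proof (rule ccontr)
  assume "\<phi> u \<noteq> 0"
  then have pos: "\<phi> u > 0" using nn[OF u] by simp
  have "AE x in sphere_measure. 0 \<le> \<phi> x"
    using nn by (intro AE_I2) (auto simp: space_sphere_measure)
  then have ae: "AE x in sphere_measure. \<phi> x = 0"
    using integral_nonneg_eq_0_iff_AE[OF sphere_integrable[OF c]] z by blast
  have "\<exists>U. open U \<and> U \<inter> sphere 0 1 = \<phi> -` {0<..} \<inter> sphere 0 1"
    by (rule c[unfolded continuous_on_open_invariant, rule_format]) (rule open_greaterThan)
  then obtain U where U: "open U" "U \<inter> sphere 0 1 = \<phi> -` {0<..} \<inter> sphere 0 1"
    by (elim exE conjE)
  have "u \<in> \<phi> -` {0<..} \<inter> sphere 0 1" using pos u by simp
  then have "u \<in> U" unfolding U(2)[symmetric] by simp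
  then have "emeasure sphere_measure (U \<inter> sphere 0 1) > 0"
    using sphere_measure_open_pos[OF U(1) _ u] by blast
  moreover have "U \<inter> sphere 0 1 \<in> null_sets sphere_measure"
  proof -
    have s: "U \<inter> sphere 0 1 \<in> sets sphere_measure"
      using borel_open[OF U(1)] by (simp add: sets_sphere_measure sets_restrict_space Int_commute)
    have "AE x in sphere_measure. x \<notin> U \<inter> sphere 0 1"
      using ae by eventually_elim (use U(2) in auto)
    then show ?thesis using AE_iff_null_sets[OF s] by blast
  qed
  ultimately show False by (auto simp: null_sets_def)
qed

text \<open>
  The cone over a rotated set is the rotated cone, so rotation invariance is inherited from
  Lebesgue measure.
\<close>

lemma sphere_measure_rotation:
  assumes f: "orthogonal_transformation f" and c: "continuous_on (sphere 0 1) \<phi>"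
  shows "(LINT u|sphere_measure. \<phi> (f u)) = (LINT u|sphere_measure. (\<phi> u :: complex))"
proof -
  have lin: "linear f" and nrm: "\<And>x. norm (f x) = norm x"
    using f by (auto simp: orthogonal_transformation)
  have cf: "continuous_on S f" for S using lin by (simp add: linear_continuous_on linear_conv_bounded_linear)
  have mf: "f \<in> restrict_space borel (sphere 0 1) \<rightarrow>\<^sub>M restrict_space borel (sphere 0 1)"
    by (intro measurable_restrict_space2 borel_measurable_continuous_on_restrict cf)
       (auto simp: nrm space_restrict_space)
  have mf': "f \<in> sphere_measure \<rightarrow>\<^sub>M sphere_measure"
    using mf by (simp add: measurable_cong_sets[OF sets_sphere_measure sets_sphere_measure])
  have "distr sphere_measure sphere_measure f = sphere_measure"
  proof (rule measure_eqI)
    fix E assume "E \<in> sets (distr sphere_measure sphere_measure f)"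
    then have E: "E \<in> sets (restrict_space borel (sphere 0 1))" by (simp add: sets_sphere_measure)
    have E': "f -` E \<inter> sphere 0 1 \<in> sets (restrict_space borel (sphere 0 1))"
      using measurable_sets[OF mf E] by (simp add: space_restrict_space)
    have EE: "E \<subseteq> sphere 0 1" using sets.sets_into_space[OF E] by (simp add: space_restrict_space)
    have "emeasure (distr sphere_measure sphere_measure f) E = emeasure sphere_measure (f -` E \<inter> sphere 0 1)"
      using mf' E by (simp add: emeasure_distr sets_sphere_measure space_sphere_measure)
    also have "\<dots> = 3 * emeasure lborel {x. x \<noteq> 0 \<and> norm x < 1 \<and> x /\<^sub>R norm x \<in> f -` E \<inter> sphere 0 1}"
      by (rule emeasure_sphere_measure[OF E'])
    also have "{x. x \<noteq> 0 \<and> norm x < 1 \<and> x /\<^sub>R norm x \<in> f -` E \<inter> sphere 0 1}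
       = f -` {x. x \<noteq> 0 \<and> norm x < 1 \<and> x /\<^sub>R norm x \<in> E}"
      using EE by (auto simp: nrm linear_scale[OF lin] linear_0[OF lin])
    also have "emeasure lborel \<dots> = emeasure (distr lborel borel f) {x. x \<noteq> 0 \<and> norm x < 1 \<and> x /\<^sub>R norm x \<in> E}"
      using cone_measurable[OF E] borel_measurable_continuous_onI[OF cf]
      by (subst emeasure_distr) auto
    also have "\<dots> = emeasure lborel {x. x \<noteq> 0 \<and> norm x < 1 \<and> x /\<^sub>R norm x \<in> E}"
      by (simp add: lborel_distr_orthogonal[OF f])
    also have "3 * \<dots> = emeasure sphere_measure E"
      by (rule emeasure_sphere_measure[OF E, symmetric])
    finally show "emeasure (distr sphere_measure sphere_measure f) E = emeasure sphere_measure E" .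
  qed simp
  then have "(LINT u|sphere_measure. \<phi> u) = integral\<^sup>L (distr sphere_measure sphere_measure f) \<phi>" by simp
  also have "\<dots> = (LINT u|sphere_measure. \<phi> (f u))"
    by (rule integral_distr[OF mf' sphere_measurable[OF c]])
  finally show ?thesis by simp
qed

section \<open>Rotation fields and the Casimir operator\<close>

text \<open>The infinitesimal rotation in the plane of the coordinates \<open>i\<close> and \<open>j\<close>.\<close>

definition rotfield :: "3 \<Rightarrow> 3 \<Rightarrow> cfun3 \<Rightarrow> cfun3" where
  "rotfield i j p = (\<lambda>v. v $ i * cpartial j p v - v $ j * cpartial i p v)"

lemma rotfield_polys: "p \<in> polys \<Longrightarrow> rotfield i j p \<in> polys"
  unfolding rotfield_def by (intro polys_diff polys_mult polys_coord cpartial_polys)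

lemma rotfield_mult:
  "p \<in> polys \<Longrightarrow> q \<in> polys \<Longrightarrow>
     rotfield i j (\<lambda>v. p v * q v) = (\<lambda>v. rotfield i j p v * q v + p v * rotfield i j q v)"
  by (simp add: rotfield_def cpartial_mult algebra_simps)

text \<open>
  The angle is complex so that the derivative in the angle is a complex derivative; only real
  angles act on the sphere.
\<close>

definition plane_rotation :: "3 \<Rightarrow> 3 \<Rightarrow> complex \<Rightarrow> complex ^ 3 \<Rightarrow> complex ^ 3" where
  "plane_rotation i j z v = (\<chi> l. if l = i then cos z * v $ i - sin z * v $ j
     else if l = j then sin z * v $ i + cos z * v $ j else v $ l)"

definition real_rotation :: "3 \<Rightarrow> 3 \<Rightarrow> real \<Rightarrow> real ^ 3 \<Rightarrow> real ^ 3" where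
  "real_rotation i j \<theta> u = (\<chi> l. if l = i then cos \<theta> * u $ i - sin \<theta> * u $ j
     else if l = j then sin \<theta> * u $ i + cos \<theta> * u $ j else u $ l)"

lemma emb_real_rotation: "emb (real_rotation i j \<theta> u) = plane_rotation i j (of_real \<theta>) (emb u)"
  by (simp add: Finite_Cartesian_Product.vec_eq_iff real_rotation_def plane_rotation_def
      cos_of_real sin_of_real)

lemma real_rotation_orthogonal:
  assumes "i \<noteq> j" shows "orthogonal_transformation (real_rotation i j \<theta>)"
  unfolding orthogonal_transformation
proof
  show "linear (real_rotation i j \<theta>)"
    by (rule linearI) (auto simp: Finite_Cartesian_Product.vec_eq_iff real_rotation_def algebra_simps)
  show "\<forall>v. norm (real_rotation i j \<theta> v) = norm v"
  proof
    fix v :: "real^3"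
    have UN: "(\<Sum>l\<in>UNIV. f l) = f i + f j + (\<Sum>l\<in>UNIV - {i,j}. f l)" for f :: "3 \<Rightarrow> real"
      using assms by (subst sum.subset_diff[of "{i,j}"]) auto
    have "(cos \<theta> * a - sin \<theta> * b)\<^sup>2 + (sin \<theta> * a + cos \<theta> * b)\<^sup>2 = a\<^sup>2 + b\<^sup>2" for a b
    proof -
      have "(c * a - s * b)\<^sup>2 + (s * a + c * b)\<^sup>2 = (s\<^sup>2 + c\<^sup>2) * (a\<^sup>2 + b\<^sup>2)" for c s :: real
        by (simp add: power2_eq_square algebra_simps)
      from this[of "cos \<theta>" "sin \<theta>"] show ?thesis by simp
    qed
    then have "(\<Sum>l\<in>UNIV. (real_rotation i j \<theta> v $ l)\<^sup>2) = (\<Sum>l\<in>UNIV. (v $ l)\<^sup>2)"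
      using assms unfolding UN by (auto simp: real_rotation_def intro!: sum.cong)
    then show "norm (real_rotation i j \<theta> v) = norm v"
      by (simp add: norm_vec_def L2_set_def)
  qed
qed

lemma plane_rotation_deriv:
  assumes "i \<noteq> j"
  shows "((\<lambda>z. plane_rotation i j z v $ l) has_field_derivative
     (if l = i then - plane_rotation i j z v $ j else if l = j then plane_rotation i j z v $ i else 0)) (at z)"
  using assms by (auto simp: plane_rotation_def intro!: derivative_eq_intros)

lemma polys_rotation_deriv:
  assumes "p \<in> polys" "i \<noteq> j"
  shows "((\<lambda>z. p (plane_rotation i j z v)) has_field_derivative rotfield i j p (plane_rotation i j z v)) (at z)"
proof -
  let ?w = "plane_rotation i j z v"
  let ?g = "\<chi> l. if l = i then - ?w $ j else if l = j then ?w $ i else 0"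
  have "((\<lambda>z. p (plane_rotation i j z v)) has_field_derivative (\<Sum>l\<in>UNIV. cpartial l p ?w * ?g $ l)) (at z)"
    by (rule polys_chain[OF assms(1)]) (use plane_rotation_deriv[OF assms(2)] in simp)
  moreover have "(\<Sum>l\<in>UNIV. cpartial l p ?w * ?g $ l) = rotfield i j p ?w"
  proof -
    have "(\<Sum>l\<in>UNIV. cpartial l p ?w * ?g $ l) = (\<Sum>l\<in>{i,j}. cpartial l p ?w * ?g $ l)"
      by (rule sum.mono_neutral_right) auto
    also have "\<dots> = rotfield i j p ?w" using assms(2) by (simp add: rotfield_def)
    finally show ?thesis .
  qed
  ultimately show ?thesis by simp
qed

lemma polys_emb_continuous: "p \<in> polys \<Longrightarrow> continuous_on S (\<lambda>u. p (emb u))"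
  by (rule continuous_on_compose2[OF polys_continuous[of p UNIV] emb_continuous]) auto

lemma plane_rotation_continuous:
  "continuous_on S (\<lambda>x. plane_rotation i j (fst x) (emb (snd x)))"
  unfolding plane_rotation_def
proof (rule continuous_on_vec_lambda)
  fix l
  show "continuous_on S (\<lambda>x. if l = i then cos (fst x) * emb (snd x) $ i - sin (fst x) * emb (snd x) $ j
     else if l = j then sin (fst x) * emb (snd x) $ i + cos (fst x) * emb (snd x) $ j else emb (snd x) $ l)"
    by (cases "l = i"; cases "l = j") (auto simp: emb_def intro!: continuous_intros)
qed

text \<open>
  Rotations preserve the integral of \<open>p\<close> over the sphere, and the integral of the rotation field
  is the derivative of this constant with respect to the angle.
\<close>

lemma integral_rotfield:
  assumes p: "p \<in> polys" and ij: "i \<noteq> j"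
  shows "(LINT u|sphere_measure. rotfield i j p (emb u)) = 0"
proof -
  define S where "S = sphere (0 :: real^3) 1"
  let ?R = "\<lambda>z u. plane_rotation i j z (emb u)"
  define \<theta> where "\<theta> n = 1 / real (Suc n)" for n
  \<comment> \<open>difference quotients in the angle: each has integral zero, and they converge boundedly to
    the rotation field\<close>
  define s where "s n u = (p (?R (of_real (\<theta> n)) u) - p (emb u)) / of_real (\<theta> n)" for n u
  have \<theta>: "\<theta> n > 0" "\<theta> n \<le> 1" for n by (auto simp: \<theta>_def)
  have R0: "?R 0 u = emb u" for u
    by (simp add: plane_rotation_def Finite_Cartesian_Product.vec_eq_iff)
  have cR: "continuous_on (cball 0 1 \<times> S) (\<lambda>x. rotfield i j p (?R (fst x) (snd x)))"
    by (rule continuous_on_compose2[OF polys_continuous[OF rotfield_polys[OF p], of UNIV] plane_rotation_continuous]) auto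
  have "compact ((\<lambda>x. rotfield i j p (?R (fst x) (snd x))) ` (cball 0 1 \<times> S))"
    by (intro compact_continuous_image cR compact_Times) (auto simp: S_def)
  then obtain B where B: "\<And>z u. z \<in> cball 0 1 \<Longrightarrow> u \<in> S \<Longrightarrow> norm (rotfield i j p (?R z u)) \<le> B"
    by (auto dest!: compact_imp_bounded simp: bounded_iff) (metis mem_cball_0)
  have bd: "norm (s n u) \<le> B" if u: "u \<in> S" for n u
  proof -
    have "norm (p (?R (of_real (\<theta> n)) u) - p (?R 0 u)) \<le> B * norm (of_real (\<theta> n) - (0 :: complex))"
    proof (rule field_differentiable_bound[of "cball 0 1"])
      show "((\<lambda>z. p (?R z u)) has_field_derivative rotfield i j p (?R z u)) (at z within cball 0 1)" for z
        by (rule DERIV_subset[OF polys_rotation_deriv[OF p ij]]) auto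
      show "norm (rotfield i j p (?R z u)) \<le> B" if "z \<in> cball 0 1" for z using B that u by blast
    qed (use \<theta>[of n] in auto)
    then show ?thesis using \<theta>[of n] by (simp add: s_def R0 norm_divide divide_le_eq)
  qed
  have lim: "(\<lambda>n. s n u) \<longlonglongrightarrow> rotfield i j p (emb u)" for u
  proof -
    have d: "((\<lambda>h. (p (?R h u) - p (?R 0 u)) / h) \<longlongrightarrow> rotfield i j p (?R 0 u)) (at 0)"
      using polys_rotation_deriv[OF p ij, of "emb u" 0] unfolding DERIV_def by simp
    have "filterlim (\<lambda>n. complex_of_real (\<theta> n)) (at 0) sequentially"
      unfolding filterlim_at
    proof
      have "(\<lambda>n. \<theta> n) \<longlonglongrightarrow> 0" unfolding \<theta>_def using LIMSEQ_Suc[OF lim_1_over_n] by simp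
      then show "(\<lambda>n. complex_of_real (\<theta> n)) \<longlonglongrightarrow> 0" using tendsto_of_real by fastforce
      show "\<forall>\<^sub>F n in sequentially. complex_of_real (\<theta> n) \<in> UNIV \<and> complex_of_real (\<theta> n) \<noteq> 0"
        using \<theta>(1) by (auto simp: less_imp_neq[symmetric])
    qed
    from filterlim_compose[OF d this] show ?thesis by (simp add: s_def R0)
  qed
  have cs: "continuous_on S (s n)" for n
  proof -
    have "continuous_on S (\<lambda>u. p (emb (real_rotation i j (\<theta> n) u)))"
      by (rule continuous_on_compose2[OF polys_emb_continuous[OF p, of UNIV] linear_continuous_on])
        (use real_rotation_orthogonal[OF ij] orthogonal_transformation_linear linear_conv_bounded_linear in auto)
    then have c: "continuous_on S (\<lambda>u. p (?R (of_real (\<theta> n)) u))" unfolding emb_real_rotation .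
    show ?thesis unfolding s_def
      using \<theta>(1)[of n] by (intro continuous_on_divide continuous_on_diff c continuous_on_const polys_emb_continuous p) auto
  qed
  have zero: "integral\<^sup>L sphere_measure (s n) = 0" for n
  proof -
    have c1: "continuous_on S (\<lambda>u. p (emb u))" by (intro polys_emb_continuous p)
    have c2: "continuous_on S (\<lambda>u. p (emb (real_rotation i j (\<theta> n) u)))"
      by (rule continuous_on_compose2[OF polys_emb_continuous[OF p, of UNIV] linear_continuous_on])
        (use real_rotation_orthogonal[OF ij] orthogonal_transformation_linear linear_conv_bounded_linear in auto)
    have "integral\<^sup>L sphere_measure (s n)
      = ((LINT u|sphere_measure. p (emb (real_rotation i j (\<theta> n) u))) - (LINT u|sphere_measure. p (emb u))) / of_real (\<theta> n)"
      unfolding s_def emb_real_rotation[symmetric]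
      using sphere_integrable[OF c1[unfolded S_def]] sphere_integrable[OF c2[unfolded S_def]]
      by (simp add: Bochner_Integration.integral_diff)
    also have "\<dots> = 0"
      using sphere_measure_rotation[OF real_rotation_orthogonal[OF ij] c1[unfolded S_def]] by simp
    finally show ?thesis .
  qed
  have "(\<lambda>n. integral\<^sup>L sphere_measure (s n)) \<longlonglongrightarrow> (LINT u|sphere_measure. rotfield i j p (emb u))"
  proof (rule integral_dominated_convergence[where w = "\<lambda>_. B"])
    show "(\<lambda>u. rotfield i j p (emb u)) \<in> borel_measurable sphere_measure"
      by (intro sphere_measurable polys_emb_continuous rotfield_polys p)
    show "s n \<in> borel_measurable sphere_measure" for n
      using sphere_measurable[OF cs[unfolded S_def]] .
    show "integrable sphere_measure (\<lambda>_. B)"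
      by (rule sphere_integrable) auto
    show "AE u in sphere_measure. (\<lambda>n. s n u) \<longlonglongrightarrow> rotfield i j p (emb u)"
      using lim by simp
    show "AE u in sphere_measure. norm (s n u) \<le> B" for n
      using bd by (intro AE_I2) (auto simp: space_sphere_measure S_def)
  qed
  then show ?thesis using zero by (simp add: LIMSEQ_const_iff)
qed

lemma polys_emb_integrable: "p \<in> polys \<Longrightarrow> integrable sphere_measure (\<lambda>u. p (emb u))"
  by (intro sphere_integrable polys_emb_continuous)

text \<open>The Casimir operator of the rotation group.\<close>

definition casimir :: "cfun3 \<Rightarrow> cfun3" where
  "casimir p = (\<lambda>v. rotfield 1 2 (rotfield 1 2 p) v + rotfield 1 3 (rotfield 1 3 p) v
     + rotfield 2 3 (rotfield 2 3 p) v)"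

text \<open>
  Integration by parts twice: the product rule turns \<open>integral_rotfield\<close> into skew-symmetry of the
  rotation field.
\<close>

lemma integral_rotfield_parts:
  assumes "p \<in> polys" "q \<in> polys" "i \<noteq> j"
  shows "(LINT u|sphere_measure. rotfield i j (rotfield i j p) (emb u) * q (emb u))
       = (LINT u|sphere_measure. p (emb u) * rotfield i j (rotfield i j q) (emb u))"
proof -
  let ?I = "\<lambda>p. LINT u|sphere_measure. p (emb u)"
  have parts: "?I (\<lambda>v. rotfield i j p v * q v) = - ?I (\<lambda>v. p v * rotfield i j q v)"
    if "p \<in> polys" "q \<in> polys" for p q
  proof -
    have "?I (\<lambda>v. rotfield i j p v * q v) + ?I (\<lambda>v. p v * rotfield i j q v) = ?I (rotfield i j (\<lambda>v. p v * q v))"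
      unfolding rotfield_mult[OF that]
      by (rule Bochner_Integration.integral_add[symmetric]; rule polys_emb_integrable;
          intro polys_mult rotfield_polys that)
    also have "\<dots> = 0" by (intro integral_rotfield polys_mult that assms)
    finally show ?thesis by (simp add: eq_neg_iff_add_eq_0)
  qed
  show ?thesis
    using parts[OF rotfield_polys[OF assms(1), of i j] assms(2)] parts[OF assms(1) rotfield_polys[OF assms(2), of i j]]
    by simp
qed

lemma casimir_self_adjoint:
  assumes "p \<in> polys" "q \<in> polys"
  shows "(LINT u|sphere_measure. casimir p (emb u) * q (emb u))
       = (LINT u|sphere_measure. p (emb u) * casimir q (emb u))"
proof -
  have [simp]: "(1::3) \<noteq> 2" "(1::3) \<noteq> 3" "(2::3) \<noteq> 3" by auto
  have i: "integrable sphere_measure (\<lambda>u. rotfield i j (rotfield i j p) (emb u) * q (emb u))"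
     "integrable sphere_measure (\<lambda>u. p (emb u) * rotfield i j (rotfield i j q) (emb u))" for i j
    using assms by (auto intro!: polys_emb_integrable[where p = "\<lambda>v. _ v * _ v"] polys_mult rotfield_polys)
  show ?thesis unfolding casimir_def distrib_left distrib_right
    using i by (simp add: integral_rotfield_parts[OF assms])
qed

lemma rotfield_twice:
  assumes "p \<in> polys" "i \<noteq> j"
  shows "rotfield i j (rotfield i j p) v =
     (v $ i)\<^sup>2 * cpartial j (cpartial j p) v + (v $ j)\<^sup>2 * cpartial i (cpartial i p) v
     - v $ i * cpartial i p v - v $ j * cpartial j p v
     - 2 * (v $ i * v $ j * cpartial i (cpartial j p) v)"
proof -
  have c: "cpartial l (rotfield i j p) v = (if l = i then cpartial j p v else 0) + v $ i * cpartial l (cpartial j p) v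
      - ((if l = j then cpartial i p v else 0) + v $ j * cpartial l (cpartial i p) v)" for l
    unfolding rotfield_def
    by (simp add: cpartial_diff cpartial_mult polys_mult polys_coord cpartial_polys assms cpartial_coord)
  have "rotfield i j (rotfield i j p) v = v $ i * cpartial j (rotfield i j p) v - v $ j * cpartial i (rotfield i j p) v"
    by (simp add: rotfield_def)
  then show ?thesis unfolding c
    using assms(2) by (simp add: cpartial_commute[OF assms(1), of j i] algebra_simps power2_eq_square)
qed

text \<open>
  The hypotheses are Euler's relations for a form of degree \<open>k\<close> and for its three first partial
  derivatives; \<open>p\<^sub>i\<close> and \<open>p\<^sub>i\<^sub>j\<close> stand for the values of the derivatives at a point.
\<close>

lemma casimir_algebra:
  fixes x y z :: complex
  assumes "x * p1 + y * p2 + z * p3 = k * p"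
    and "x * p11 + y * p12 + z * p13 = (k - 1) * p1"
    and "x * p12 + y * p22 + z * p23 = (k - 1) * p2"
    and "x * p13 + y * p23 + z * p33 = (k - 1) * p3"
  shows "(x\<^sup>2 * p22 + y\<^sup>2 * p11 - x * p1 - y * p2 - 2 * (x * y * p12))
     + (x\<^sup>2 * p33 + z\<^sup>2 * p11 - x * p1 - z * p3 - 2 * (x * z * p13))
     + (y\<^sup>2 * p33 + z\<^sup>2 * p22 - y * p2 - z * p3 - 2 * (y * z * p23))
    = (x\<^sup>2 + y\<^sup>2 + z\<^sup>2) * (p11 + p22 + p33) - k * (k + 1) * p"
    (is "?l = ?r")
proof -
  let ?s = "x * (x * p11 + y * p12 + z * p13) + y * (x * p12 + y * p22 + z * p23)
      + z * (x * p13 + y * p23 + z * p33)"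
  have s: "?s = (k - 1) * (k * p)"
    unfolding assms(2-4) assms(1)[symmetric] by (simp add: algebra_simps)
  have "?l = (x\<^sup>2 + y\<^sup>2 + z\<^sup>2) * (p11 + p22 + p33) - ?s - 2 * (x * p1 + y * p2 + z * p3)"
    by (simp add: algebra_simps power2_eq_square)
  also have "\<dots> = ?r" unfolding s assms(1) by (simp add: algebra_simps)
  finally show ?thesis .
qed

lemma casimir_hom:
  assumes p: "p \<in> hom_polys k"
  shows "casimir p v = (\<Sum>i\<in>UNIV. (v $ i)\<^sup>2) * laplacian p v - of_nat k * (of_nat k + 1) * p v"
proof -
  have pp: "p \<in> polys" using p hom_polys_polys by blast
  have [simp]: "(1::3) \<noteq> 2" "(1::3) \<noteq> 3" "(2::3) \<noteq> 3" by auto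
  let ?x = "v $ 1" and ?y = "v $ 2" and ?z = "v $ 3"
  let ?d = "\<lambda>i j. cpartial i (cpartial j p) v"
  have e0: "?x * cpartial 1 p v + ?y * cpartial 2 p v + ?z * cpartial 3 p v = of_nat k * p v"
    using euler[OF p, of v] by (simp add: sum_3)
  have e1: "?x * ?d 1 l + ?y * ?d 2 l + ?z * ?d 3 l = (of_nat k - 1) * cpartial l p v" for l
  proof (cases k)
    case 0
    then have "p = (\<lambda>v. p 0)" using hom_polys_0 p by blast
    then have "cpartial l p = (\<lambda>v. 0)" using cpartial_const by metis
    then show ?thesis by (simp add: cpartial_const)
  next
    case (Suc n)
    then show ?thesis using euler[OF cpartial_hom[OF p, of l], of v] by (simp add: sum_3)
  qed
  have cm: "?d 2 1 = ?d 1 2" "?d 3 1 = ?d 1 3" "?d 3 2 = ?d 2 3"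
    by (simp_all add: cpartial_commute[OF pp, of _ 1] cpartial_commute[OF pp, of 3 2])
  note e = e0 e1[of 1] e1[of 2] e1[of 3]
  show ?thesis
    unfolding casimir_def laplacian_def sum_3
    by (simp only: rotfield_twice[OF pp] \<open>(1::3) \<noteq> 2\<close> \<open>(1::3) \<noteq> 3\<close> \<open>(2::3) \<noteq> 3\<close> simp_thms)
      (rule casimir_algebra[OF e[unfolded cm]])
qed

lemma emb_sphere: "norm u = 1 \<Longrightarrow> (\<Sum>i\<in>UNIV. (complex_of_real (u $ i))\<^sup>2) = 1"
  by (simp add: norm_vec_def L2_set_def flip: of_real_power of_real_sum)

lemma sphere_integral_cong:
  "(\<And>u. norm u = 1 \<Longrightarrow> f u = g u) \<Longrightarrow> integral\<^sup>L sphere_measure f = integral\<^sup>L sphere_measure g"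
  by (rule Bochner_Integration.integral_cong) (auto simp: space_sphere_measure)

lemma laplacian_polys: "p \<in> polys \<Longrightarrow> laplacian p \<in> polys"
  unfolding laplacian_def by (intro polys_sum cpartial_polys) auto

text \<open>On the sphere the Casimir operator, which is symmetric, is the Laplacian minus \<open>k (k + 1)\<close>.\<close>

lemma laplacian_almost_self_adjoint:
  assumes p: "p \<in> hom_polys k" and q: "q \<in> hom_polys j"
  shows "(LINT u|sphere_measure. laplacian p (emb u) * q (emb u))
       - of_nat k * (of_nat k + 1) * (LINT u|sphere_measure. p (emb u) * q (emb u))
     = (LINT u|sphere_measure. p (emb u) * laplacian q (emb u))
       - of_nat j * (of_nat j + 1) * (LINT u|sphere_measure. p (emb u) * q (emb u))"
proof -
  have pp: "p \<in> polys" and qp: "q \<in> polys" using p q hom_polys_polys by auto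
  note [simp] = polys_emb_integrable[where p = "\<lambda>v. _ v * _ v"] polys_mult laplacian_polys pp qp
  have "(LINT u|sphere_measure. casimir p (emb u) * q (emb u))
    = (LINT u|sphere_measure. laplacian p (emb u) * q (emb u) - of_nat k * (of_nat k + 1) * (p (emb u) * q (emb u)))"
    by (rule sphere_integral_cong) (simp add: casimir_hom[OF p] emb_sphere algebra_simps)
  moreover have "(LINT u|sphere_measure. p (emb u) * casimir q (emb u))
    = (LINT u|sphere_measure. p (emb u) * laplacian q (emb u) - of_nat j * (of_nat j + 1) * (p (emb u) * q (emb u)))"
    by (rule sphere_integral_cong) (simp add: casimir_hom[OF q] emb_sphere algebra_simps)
  ultimately show ?thesis
    using casimir_self_adjoint[OF pp qp] by simp
qed

section \<open>Conjugation and linear substitutions\<close>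

text \<open>
  On real points this is complex conjugation, yet it is again a polynomial; it turns Hermitian
  products of polynomials into integrals of polynomials.
\<close>

definition conj_poly :: "cfun3 \<Rightarrow> cfun3" where
  "conj_poly q = (\<lambda>v. cnj (q (\<chi> i. cnj (v $ i))))"

lemma conj_poly_polys: "q \<in> polys \<Longrightarrow> conj_poly q \<in> polys"
proof (induction rule: polys_induct)
  case (coord i) then show ?case using polys_coord by (simp add: conj_poly_def)
next
  case (add p q) then show ?case using polys_add[of "conj_poly p" "conj_poly q"] by (simp add: conj_poly_def)
next
  case (mult p q) then show ?case using polys_mult[of "conj_poly p" "conj_poly q"] by (simp add: conj_poly_def)
qed (simp add: conj_poly_def polys_const)

lemma conj_poly_cpartial: "q \<in> polys \<Longrightarrow> cpartial i (conj_poly q) = conj_poly (cpartial i q)"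
proof (induction rule: polys_induct)
  case (const c) then show ?case by (simp add: conj_poly_def cpartial_const)
next
  case (coord i) then show ?case by (simp add: conj_poly_def cpartial_coord)
next
  case (add p q)
  have "conj_poly (\<lambda>v. p v + q v) = (\<lambda>v. conj_poly p v + conj_poly q v)" by (simp add: conj_poly_def)
  then show ?case using add by (simp add: cpartial_add conj_poly_polys) (simp add: conj_poly_def)
next
  case (mult p q)
  have "conj_poly (\<lambda>v. p v * q v) = (\<lambda>v. conj_poly p v * conj_poly q v)" by (simp add: conj_poly_def)
  then show ?case using mult by (simp add: cpartial_mult conj_poly_polys) (simp add: conj_poly_def)
qed

lemma conj_poly_laplacian: "q \<in> polys \<Longrightarrow> laplacian (conj_poly q) = conj_poly (laplacian q)"
  by (simp add: laplacian_def conj_poly_cpartial cpartial_polys) (simp add: conj_poly_def)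

lemma conj_poly_hom:
  assumes "q \<in> hom_polys k" shows "conj_poly q \<in> hom_polys k"
proof (rule hom_polysI)
  show "conj_poly q \<in> polys" using assms by (simp add: conj_poly_polys hom_polys_polys)
  fix t and v :: "complex^3"
  have "(\<chi> i. cnj ((t *s v) $ i)) = cnj t *s (\<chi> i. cnj (v $ i))"
    by (simp add: Finite_Cartesian_Product.vec_eq_iff)
  then show "conj_poly q (t *s v) = t ^ k * conj_poly q v"
    by (simp add: conj_poly_def hom_polys_scale[OF assms])
qed

lemma conj_poly_emb: "conj_poly q (emb u) = cnj (q (emb u))"
  by (simp add: conj_poly_def emb_def)

lemma matrix_inv_both:
  assumes "invertible A"
  shows "A ** matrix_inv A = mat 1" "matrix_inv A ** A = mat 1"
  using someI_ex[OF assms[unfolded invertible_def]] unfolding matrix_inv_def by auto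

lemma matrix_inv_eqI:
  fixes A :: "complex^'n^'n"
  assumes "A ** B = mat 1" "B ** A = mat 1" shows "matrix_inv A = B"
proof -
  have "invertible A" using assms invertible_def by blast
  then have "A ** matrix_inv A = mat 1" by (rule matrix_inv_both)
  then have "B ** (A ** matrix_inv A) = B" by simp
  then show ?thesis by (simp add: matrix_mul_assoc assms(2))
qed

text \<open>
  In the coordinates \<open>v v* A\<close> the operator \<open>Q_laplacian A\<close> is the standard Laplacian, as its
  coefficient matrix is the inverse of \<open>A ** transpose A\<close>.
\<close>

lemma laplacian_subst:
  assumes "invertible A" "p \<in> polys"
  shows "laplacian (\<lambda>u. p (u v* matrix_inv A)) = (\<lambda>u. Q_laplacian A p (u v* matrix_inv A))"
proof
  fix u
  define M where "M = matrix_inv A"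
  have AM: "A ** M = mat 1" "M ** A = mat 1" using matrix_inv_both[OF assms(1)] by (auto simp: M_def)
  have "(A ** transpose A) ** (transpose M ** M) = A ** (transpose A ** transpose M) ** M"
    by (simp add: matrix_mul_assoc)
  also have "transpose A ** transpose M = mat 1"
    by (metis AM(2) matrix_transpose_mul transpose_mat)
  finally have 1: "(A ** transpose A) ** (transpose M ** M) = mat 1" by (simp add: AM)
  have "(transpose M ** M) ** (A ** transpose A) = transpose M ** (M ** A) ** transpose A"
    by (simp add: matrix_mul_assoc)
  also have "\<dots> = mat 1" using AM by (simp, metis AM(1) matrix_transpose_mul transpose_mat)
  finally have inv: "matrix_inv (A ** transpose A) = transpose M ** M"
    by (rule matrix_inv_eqI[OF 1])
  have "laplacian (\<lambda>u. p (u v* M)) u = (\<Sum>i\<in>UNIV. \<Sum>j\<in>UNIV. M $ i $ j *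
      (\<Sum>l\<in>UNIV. M $ i $ l * cpartial l (cpartial j p) (u v* M)))"
    unfolding laplacian_def using assms(2)
    by (simp add: cpartial_subst cpartial_sum cpartial_cmult polys_cmult polys_subst[where p = "cpartial _ _"] cpartial_polys)
  also have "\<dots> = (\<Sum>i\<in>UNIV. \<Sum>j\<in>UNIV. \<Sum>l\<in>UNIV. M $ i $ j * M $ i $ l * cpartial j (cpartial l p) (u v* M))"
    by (simp add: sum_distrib_left mult_ac cpartial_commute[OF assms(2)])
  also have "\<dots> = (\<Sum>j\<in>UNIV. \<Sum>i\<in>UNIV. \<Sum>l\<in>UNIV. M $ i $ j * M $ i $ l * cpartial j (cpartial l p) (u v* M))"
    by (rule sum.swap)
  also have "\<dots> = (\<Sum>j\<in>UNIV. \<Sum>l\<in>UNIV. \<Sum>i\<in>UNIV. M $ i $ j * M $ i $ l * cpartial j (cpartial l p) (u v* M))"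
    by (intro sum.cong refl sum.swap)
  also have "\<dots> = Q_laplacian A p (u v* M)"
    unfolding Q_laplacian_def inv
    by (simp add: matrix_matrix_mult_def transpose_def sum_distrib_right)
  finally show "laplacian (\<lambda>u. p (u v* matrix_inv A)) u = Q_laplacian A p (u v* matrix_inv A)"
    by (simp add: M_def)
qed

lemma entire_zero_on_reals:
  assumes "h holomorphic_on UNIV" "\<And>x :: real. h (of_real x) = 0"
  shows "h z = 0"
proof (rule analytic_continuation[of h UNIV "range of_real" 0 z])
  show "(0 :: complex) islimpt range of_real"
    unfolding islimpt_approachable
  proof (intro allI impI)
    fix e :: real assume e: "0 < e"
    have "complex_of_real (e/2) \<in> range of_real" by (rule rangeI)
    moreover have "complex_of_real (e/2) \<noteq> 0" "dist (complex_of_real (e/2)) 0 < e"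
      using e by (auto simp: norm_divide)
    ultimately
    show "\<exists>x'\<in>range of_real. x' \<noteq> 0 \<and> dist x' (0 :: complex) < e" by blast
  qed
qed (use assms in auto)

lemma polys_line_holomorphic:
  assumes "p \<in> polys" shows "(\<lambda>z. p (a + z *s b)) holomorphic_on UNIV"
proof -
  have "((\<lambda>z. p (a + z *s b)) has_field_derivative (\<Sum>i\<in>UNIV. cpartial i p (a + z *s b) * b $ i)) (at z)" for z
    by (rule polys_chain[OF assms]) (auto intro!: derivative_eq_intros)
  then show ?thesis unfolding holomorphic_on_def field_differentiable_def
    using has_field_derivative_at_within by blast
qed

text \<open>Each complex point lies on the complexification of a real line.\<close>

lemma polys_zero_on_reals:
  assumes p: "p \<in> polys" and z: "\<And>u. p (emb u) = 0"
  shows "p v = 0"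
proof -
  define a b where "a = (\<chi> i. Re (v $ i))" and "b = (\<chi> i. Im (v $ i))"
  have v: "v = emb a + \<i> *s emb b"
    by (simp add: Finite_Cartesian_Product.vec_eq_iff a_def b_def complex_eq)
  have "(\<lambda>z. p (emb a + z *s emb b)) \<i> = 0"
  proof (rule entire_zero_on_reals[OF polys_line_holomorphic[OF p]])
    fix x :: real
    have "emb a + complex_of_real x *s emb b = emb (a + x *s b)"
      by (simp add: Finite_Cartesian_Product.vec_eq_iff)
    then show "p (emb a + complex_of_real x *s emb b) = 0" using z by simp
  qed
  then show ?thesis using v by simp
qed

section \<open>The Hermitian product on the ellipsoid\<close>

locale ellipsoid_form =
  fixes A :: "complex ^ 3 ^ 3" and Q :: cfun3
  assumes A_inv: "invertible A"
    and Q_eq: "\<And>v. Q v = (\<Sum>i\<in>UNIV. ((v v* A) $ i)\<^sup>2)"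
begin

definition ellipsoid_point :: "real ^ 3 \<Rightarrow> complex ^ 3" where
  "ellipsoid_point u = emb u v* matrix_inv A"

text \<open>
  Continuous functions on the ellipsoid carry the whole Hermitian theory: all integrals exist, and
  functions of norm zero vanish there.
\<close>

definition ellcont :: "cfun3 set" where
  "ellcont = {f. continuous_on (ellipsoid A) f}"

lemma v_A_inv [simp]: "(v v* A) v* matrix_inv A = v" "(v v* matrix_inv A) v* A = v"
  by (simp_all add: vector_matrix_mul_assoc matrix_inv_both[OF A_inv])

lemma ellipsoid_point_A [simp]: "ellipsoid_point u v* A = emb u"
  by (simp add: ellipsoid_point_def)

lemma norm_emb: "norm (emb u) = norm u"
  by (simp add: norm_vec_def)

lemma ellipsoid_eq: "ellipsoid A = ellipsoid_point ` sphere 0 1"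
proof (intro equalityI subsetI)
  fix v assume v: "v \<in> ellipsoid A"
  define u where "u = (\<chi> i. Re ((v v* A) $ i))"
  have e: "emb u = v v* A" using v
    by (simp add: Finite_Cartesian_Product.vec_eq_iff u_def ellipsoid_def)
  then have "norm u = 1" using v norm_emb[of u] by (simp add: ellipsoid_def)
  moreover have "v = ellipsoid_point u" by (simp add: ellipsoid_point_def e)
  ultimately show "v \<in> ellipsoid_point ` sphere 0 1" by auto
qed (auto simp: ellipsoid_def norm_emb)

lemma vm_continuous: "continuous_on S (\<lambda>v :: complex^3. v v* M)"
  unfolding vector_matrix_mult_def by (intro continuous_intros)

lemma ellipsoid_point_continuous: "continuous_on S ellipsoid_point"
  unfolding ellipsoid_point_def
  by (rule continuous_on_compose2[OF vm_continuous[of UNIV] emb_continuous]) auto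

lemma compact_ellipsoid: "compact (ellipsoid A)"
  unfolding ellipsoid_eq by (intro compact_continuous_image ellipsoid_point_continuous) auto

lemma Q_ellipsoid_point: "norm u = 1 \<Longrightarrow> Q (ellipsoid_point u) = 1"
  by (simp add: Q_eq emb_sphere)

lemma Q_ellipsoid: "v \<in> ellipsoid A \<Longrightarrow> Q v = 1"
  by (auto simp: ellipsoid_eq Q_ellipsoid_point)

lemma ellipsoid_subset_quadric: "ellipsoid A \<subseteq> quadric Q"
  by (auto simp: quadric_def Q_ellipsoid)

lemma ellipsoid_point_measurable: "ellipsoid_point \<in> sphere_measure \<rightarrow>\<^sub>M restrict_space borel (ellipsoid A)"
  by (intro measurable_restrict_space2 sphere_measurable ellipsoid_point_continuous)
     (auto simp: space_sphere_measure ellipsoid_eq)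

lemma ellipsoid_measure_eq: "ellipsoid_measure A = distr sphere_measure (restrict_space borel (ellipsoid A)) ellipsoid_point"
  by (simp add: ellipsoid_measure_def ellipsoid_point_def[abs_def] emb_def)

lemma space_ellipsoid_measure: "space (ellipsoid_measure A) = ellipsoid A"
  by (simp add: ellipsoid_measure_eq space_restrict_space)

lemma herm_cong:
  assumes "\<And>v. v \<in> ellipsoid A \<Longrightarrow> f v = f' v" "\<And>v. v \<in> ellipsoid A \<Longrightarrow> g v = g' v"
  shows "herm A f g = herm A f' g'"
  unfolding herm_def by (rule Bochner_Integration.integral_cong) (auto simp: space_ellipsoid_measure assms)

lemma L2norm_cong:
  assumes "\<And>v. v \<in> ellipsoid A \<Longrightarrow> f v = f' v"
  shows "L2norm A f = L2norm A f'"
  unfolding L2norm_def using herm_cong[OF assms assms] by simp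

lemma ellipsoid_integral:
  assumes "f \<in> ellcont"
  shows "integral\<^sup>L (ellipsoid_measure A) f = (LINT u|sphere_measure. (f (ellipsoid_point u) :: complex))"
  unfolding ellipsoid_measure_eq using assms
  by (intro integral_distr[OF ellipsoid_point_measurable] borel_measurable_continuous_on_restrict) (simp add: ellcont_def)

lemma ellcont_add: "f \<in> ellcont \<Longrightarrow> g \<in> ellcont \<Longrightarrow> (\<lambda>v. f v + g v) \<in> ellcont"
  and ellcont_diff: "f \<in> ellcont \<Longrightarrow> g \<in> ellcont \<Longrightarrow> (\<lambda>v. f v - g v) \<in> ellcont"
  and ellcont_mult: "f \<in> ellcont \<Longrightarrow> g \<in> ellcont \<Longrightarrow> (\<lambda>v. f v * g v) \<in> ellcont"
  and ellcont_const: "(\<lambda>v. c) \<in> ellcont"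
  and ellcont_cmult: "f \<in> ellcont \<Longrightarrow> (\<lambda>v. c * f v) \<in> ellcont"
  and ellcont_cnj: "f \<in> ellcont \<Longrightarrow> (\<lambda>v. cnj (f v)) \<in> ellcont"
  by (auto simp: ellcont_def intro!: continuous_intros)

lemma ellcont_sum: "(\<And>i. i \<in> I \<Longrightarrow> f i \<in> ellcont) \<Longrightarrow> (\<lambda>v. \<Sum>i\<in>I. f i v) \<in> ellcont"
  by (auto simp: ellcont_def intro!: continuous_intros)

lemma ellcont_polys: "p \<in> polys \<Longrightarrow> p \<in> ellcont"
  by (simp add: ellcont_def polys_continuous)

lemma ellcont_hom: "p \<in> hom_polys k \<Longrightarrow> p \<in> ellcont"
  by (simp add: ellcont_polys hom_polys_polys)

lemma ellcont_ellipsoid_point: "f \<in> ellcont \<Longrightarrow> continuous_on (sphere 0 1) (\<lambda>u. f (ellipsoid_point u))"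
  unfolding ellcont_def by (rule continuous_on_compose2[OF _ ellipsoid_point_continuous]) (auto simp: ellipsoid_eq)

lemma ellcont_integrable: "f \<in> ellcont \<Longrightarrow> integrable sphere_measure (\<lambda>u. f (ellipsoid_point u))"
  by (intro sphere_integrable ellcont_ellipsoid_point)

lemma herm_eq:
  "f \<in> ellcont \<Longrightarrow> g \<in> ellcont \<Longrightarrow> herm A f g = (LINT u|sphere_measure. f (ellipsoid_point u) * cnj (g (ellipsoid_point u)))"
  unfolding herm_def by (rule ellipsoid_integral[OF ellcont_mult[OF _ ellcont_cnj]])

lemma herm_add_left:
  assumes "f \<in> ellcont" "g \<in> ellcont" "h \<in> ellcont"
  shows "herm A (\<lambda>v. f v + g v) h = herm A f h + herm A g h"
  using assms ellcont_integrable[OF ellcont_mult[OF assms(1) ellcont_cnj[OF assms(3)]]]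
    ellcont_integrable[OF ellcont_mult[OF assms(2) ellcont_cnj[OF assms(3)]]]
  by (simp add: herm_eq ellcont_add distrib_right)

lemma herm_cmult_left:
  assumes "f \<in> ellcont" "h \<in> ellcont"
  shows "herm A (\<lambda>v. c * f v) h = c * herm A f h"
  using assms by (simp add: herm_eq ellcont_cmult mult.assoc)

lemma herm_cnj: "herm A g f = cnj (herm A f g)"
  unfolding herm_def Bochner_Integration.integral_cnj[symmetric] by (simp add: mult.commute)

lemma herm_zero_left [simp]: "herm A (\<lambda>v. 0) h = 0" by (simp add: herm_def)
lemma herm_zero_right [simp]: "herm A h (\<lambda>v. 0) = 0" by (simp add: herm_def)

lemma herm_add_right:
  assumes "f \<in> ellcont" "g \<in> ellcont" "h \<in> ellcont"
  shows "herm A h (\<lambda>v. f v + g v) = herm A h f + herm A h g"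
  using herm_add_left[OF assms] by (simp add: herm_cnj[of h])

lemma herm_cmult_right:
  assumes "f \<in> ellcont" "h \<in> ellcont"
  shows "herm A h (\<lambda>v. c * f v) = cnj c * herm A h f"
  using herm_cmult_left[OF assms] by (simp add: herm_cnj[of h])

lemma herm_diff_left:
  assumes "f \<in> ellcont" "g \<in> ellcont" "h \<in> ellcont"
  shows "herm A (\<lambda>v. f v - g v) h = herm A f h - herm A g h"
  using herm_add_left[OF assms(1) ellcont_cmult[OF assms(2)] assms(3), of "-1"] herm_cmult_left[OF assms(2,3), of "-1"]
  by simp

lemma herm_diff_right:
  assumes "f \<in> ellcont" "g \<in> ellcont" "h \<in> ellcont"
  shows "herm A h (\<lambda>v. f v - g v) = herm A h f - herm A h g"
  using herm_diff_left[OF assms] by (simp add: herm_cnj[of h])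

lemma herm_sum_left:
  assumes "finite I" "\<And>i. i \<in> I \<Longrightarrow> f i \<in> ellcont" "h \<in> ellcont"
  shows "herm A (\<lambda>v. \<Sum>i\<in>I. f i v) h = (\<Sum>i\<in>I. herm A (f i) h)"
  using assms
proof (induction I)
  case (insert x F)
  then show ?case using herm_add_left[of "f x" "\<lambda>v. \<Sum>i\<in>F. f i v" h] ellcont_sum[of F f] by auto
qed simp

lemma herm_self:
  assumes "f \<in> ellcont"
  shows "herm A f f = of_real (LINT u|sphere_measure. (cmod (f (ellipsoid_point u)))\<^sup>2)"
proof -
  have "herm A f f = (LINT u|sphere_measure. of_real ((cmod (f (ellipsoid_point u)))\<^sup>2))"
    unfolding herm_eq[OF assms assms] by (simp only: complex_norm_square)
  then show ?thesis by (simp only: integral_complex_of_real)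
qed

lemma herm_self_nonneg: "f \<in> ellcont \<Longrightarrow> 0 \<le> Re (herm A f f)"
  by (simp add: herm_self)

lemma L2norm_nonneg: "0 \<le> L2norm A f"
proof -
  have "Re (herm A f f) = (LINT v|ellipsoid_measure A. (cmod (f v))\<^sup>2)"
  proof -
    have "herm A f f = (LINT v|ellipsoid_measure A. of_real ((cmod (f v))\<^sup>2))"
      unfolding herm_def by (simp only: complex_norm_square)
    then show ?thesis by (simp only: integral_complex_of_real Re_complex_of_real)
  qed
  then show ?thesis by (simp add: L2norm_def)
qed

lemma L2norm_sq: "f \<in> ellcont \<Longrightarrow> (L2norm A f)\<^sup>2 = Re (herm A f f)"
  by (simp add: L2norm_def herm_self_nonneg)

lemma herm_self_L2norm: "f \<in> ellcont \<Longrightarrow> herm A f f = of_real ((L2norm A f)\<^sup>2)"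
  by (simp add: L2norm_sq herm_self)

text \<open>Definiteness on continuous functions, from the positivity of the measure on open sets.\<close>

lemma herm_zero_iff:
  assumes f: "f \<in> ellcont" and z: "herm A f f = 0" and v: "v \<in> ellipsoid A"
  shows "f v = 0"
proof -
  obtain u where u: "norm u = 1" "v = ellipsoid_point u" using v by (auto simp: ellipsoid_eq)
  have "(cmod (f (ellipsoid_point u)))\<^sup>2 = 0"
  proof (rule sphere_integral_zero[OF _ _ _ u(1), of "\<lambda>u. (cmod (f (ellipsoid_point u)))\<^sup>2"])
    show "continuous_on (sphere 0 1) (\<lambda>u. (cmod (f (ellipsoid_point u)))\<^sup>2)"
      by (intro continuous_intros ellcont_ellipsoid_point f)
    show "(LINT u|sphere_measure. (cmod (f (ellipsoid_point u)))\<^sup>2) = 0"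
      using z herm_self[OF f] by simp
  qed auto
  then show ?thesis using u by simp
qed

lemma L2norm_zero_iff: "f \<in> ellcont \<Longrightarrow> L2norm A f = 0 \<longleftrightarrow> (\<forall>v\<in>ellipsoid A. f v = 0)"
proof
  assume "f \<in> ellcont" "L2norm A f = 0"
  then have "herm A f f = 0" using herm_self_L2norm[of f] by simp
  then show "\<forall>v\<in>ellipsoid A. f v = 0" using herm_zero_iff \<open>f \<in> ellcont\<close> by blast
next
  assume "\<forall>v\<in>ellipsoid A. f v = 0"
  then have "L2norm A f = L2norm A (\<lambda>v. 0)" by (intro L2norm_cong) blast
  then show "L2norm A f = 0" by (simp add: L2norm_def)
qed

lemma L2norm_cmult: "f \<in> ellcont \<Longrightarrow> L2norm A (\<lambda>v. c * f v) = cmod c * L2norm A f"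
proof -
  assume f: "f \<in> ellcont"
  have "herm A (\<lambda>v. c * f v) (\<lambda>v. c * f v) = of_real ((cmod c)\<^sup>2) * herm A f f"
    using f by (simp add: herm_cmult_left herm_cmult_right ellcont_cmult mult.assoc[symmetric] complex_norm_square del: of_real_power)
  then show ?thesis using f
    by (simp add: L2norm_def real_sqrt_mult herm_self)
qed

lemma pythagoras:
  assumes "f \<in> ellcont" "g \<in> ellcont" "herm A f g = 0"
  shows "(L2norm A (\<lambda>v. f v + g v))\<^sup>2 = (L2norm A f)\<^sup>2 + (L2norm A g)\<^sup>2"
proof -
  have "herm A g f = 0" using assms(3) by (simp add: herm_cnj[of g])
  then show ?thesis using assms
    by (simp add: L2norm_sq ellcont_add herm_add_left herm_add_right)
qed

lemma cauchy_schwarz: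
  assumes f: "f \<in> ellcont" and g: "g \<in> ellcont"
  shows "cmod (herm A f g) \<le> L2norm A f * L2norm A g"
proof (cases "L2norm A g = 0")
  case True
  then have "herm A f g = herm A f (\<lambda>v. 0)" using L2norm_zero_iff[OF g] by (intro herm_cong) auto
  then show ?thesis using True by simp
next
  case False
  define n where "n = L2norm A g"
  have n: "n > 0" using False L2norm_nonneg[of g] by (simp add: n_def)
  define a where "a = herm A f g / of_real (n\<^sup>2)"
  have gg: "herm A g g = of_real (n\<^sup>2)" by (simp add: herm_self_L2norm[OF g] n_def)
  have o: "herm A (\<lambda>v. f v - a * g v) (\<lambda>v. a * g v) = 0"
  proof -
    have "herm A (\<lambda>v. f v - a * g v) g = herm A f g - a * of_real (n\<^sup>2)"
      by (simp only: herm_diff_left[OF f ellcont_cmult[OF g] g] herm_cmult_left[OF g g] gg)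
    also have "\<dots> = 0" using n by (simp add: a_def)
    finally show ?thesis
      by (simp only: herm_cmult_right[OF g ellcont_diff[OF f ellcont_cmult[OF g]]] mult_zero_right)
  qed
  have "(L2norm A f)\<^sup>2 = (L2norm A (\<lambda>v. (f v - a * g v) + a * g v))\<^sup>2" by simp
  also have "\<dots> = (L2norm A (\<lambda>v. f v - a * g v))\<^sup>2 + (L2norm A (\<lambda>v. a * g v))\<^sup>2"
    by (rule pythagoras[OF _ _ o]) (intro ellcont_diff ellcont_cmult f g)+
  also have "\<dots> \<ge> (cmod a * n)\<^sup>2" by (simp add: L2norm_cmult[OF g] n_def)
  finally have "cmod a * n \<le> L2norm A f"
    by (rule power2_le_imp_le) (rule L2norm_nonneg)
  moreover have "cmod a * n = cmod (herm A f g) / n"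
    using n by (simp add: a_def norm_divide norm_power norm_mult power2_eq_square)
  ultimately show ?thesis using n by (simp add: n_def[symmetric] divide_le_eq)
qed

lemma L2norm_triangle:
  assumes f: "f \<in> ellcont" and g: "g \<in> ellcont"
  shows "L2norm A (\<lambda>v. f v + g v) \<le> L2norm A f + L2norm A g"
proof (rule power2_le_imp_le)
  have "(L2norm A (\<lambda>v. f v + g v))\<^sup>2 = (L2norm A f)\<^sup>2 + (L2norm A g)\<^sup>2 + 2 * Re (herm A f g)"
    using f g herm_cnj[of g f] by (simp add: L2norm_sq ellcont_add herm_add_left herm_add_right)
  also have "\<dots> \<le> (L2norm A f)\<^sup>2 + (L2norm A g)\<^sup>2 + 2 * (L2norm A f * L2norm A g)"
    using cauchy_schwarz[OF f g] complex_Re_le_cmod[of "herm A f g"] by simp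
  finally show "(L2norm A (\<lambda>v. f v + g v))\<^sup>2 \<le> (L2norm A f + L2norm A g)\<^sup>2"
    by (simp add: power2_sum)
qed (simp add: L2norm_nonneg add_nonneg_nonneg)

lemma L2norm_minus_commute: "L2norm A (\<lambda>v. f v - g v) = L2norm A (\<lambda>v. g v - f v)"
  unfolding L2norm_def herm_def
  by (intro arg_cong[where f = "\<lambda>x. sqrt (Re x)"] Bochner_Integration.integral_cong) (auto simp: algebra_simps)

lemma L2norm_bound:
  assumes f: "f \<in> ellcont" and b: "\<And>v. v \<in> ellipsoid A \<Longrightarrow> cmod (f v) \<le> B"
  shows "L2norm A f \<le> B * sqrt (measure sphere_measure (sphere 0 1))"
proof -
  have B: "0 \<le> B"
  proof -
    have "ellipsoid_point (axis 1 1) \<in> ellipsoid A" by (auto simp: ellipsoid_eq)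
    then show ?thesis using b norm_ge_zero order_trans by blast
  qed
  have "(LINT u|sphere_measure. (cmod (f (ellipsoid_point u)))\<^sup>2) \<le> (LINT u|sphere_measure. B\<^sup>2)"
  proof (rule Bochner_Integration.integral_mono)
    show "integrable sphere_measure (\<lambda>u. (cmod (f (ellipsoid_point u)))\<^sup>2)"
      by (intro sphere_integrable continuous_intros ellcont_ellipsoid_point f)
    show "integrable sphere_measure (\<lambda>u. B\<^sup>2)" by (rule sphere_integrable) auto
    show "(cmod (f (ellipsoid_point u)))\<^sup>2 \<le> B\<^sup>2" if "u \<in> space sphere_measure" for u
      using that b by (intro power_mono) (auto simp: space_sphere_measure ellipsoid_eq)
  qed
  also have "\<dots> = B\<^sup>2 * measure sphere_measure (sphere 0 1)"
    by (simp add: space_sphere_measure mult.commute)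
  finally have "sqrt (LINT u|sphere_measure. (cmod (f (ellipsoid_point u)))\<^sup>2) \<le> sqrt (B\<^sup>2 * measure sphere_measure (sphere 0 1))"
    by (rule real_sqrt_le_mono)
  then show ?thesis using B by (simp add: L2norm_def herm_self[OF f] real_sqrt_mult)
qed

text \<open>
  By homogeneity \<open>p\<close> vanishes on all real multiples of points of the ellipsoid, and these form a
  real form of \<open>\<complex>\<^sup>3\<close>. So the Hermitian product is definite on forms of a fixed degree.
\<close>

lemma hom_zero_on_ellipsoid:
  assumes p: "p \<in> hom_polys k" and z: "\<And>v. v \<in> ellipsoid A \<Longrightarrow> p v = 0"
  shows "p = (\<lambda>v. 0)"
proof
  fix v
  let ?q = "\<lambda>u. p (u v* matrix_inv A)"
  have qh: "?q \<in> hom_polys k" by (rule hom_polys_subst[OF p])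
  have "?q (emb u) = 0" for u
  proof (cases "u = 0")
    case False
    have e: "emb u = of_real (norm u) *s emb (u /\<^sub>R norm u)"
      using False by (simp add: Finite_Cartesian_Product.vec_eq_iff)
    have "?q (emb (u /\<^sub>R norm u)) = 0"
      using z[of "ellipsoid_point (u /\<^sub>R norm u)"] False by (auto simp: ellipsoid_eq ellipsoid_point_def)
    then show ?thesis unfolding e hom_polys_scale[OF qh] by simp
  next
    case True
    show ?thesis
    proof (cases "k = 0")
      case False
      have "emb u = 0 *s emb u" using True by (simp add: Finite_Cartesian_Product.vec_eq_iff)
      then have "?q (emb u) = 0 ^ k * ?q (emb u)" using hom_polys_scale[OF qh, of 0 "emb u"] by metis
      also have "(0 :: complex) ^ k = 0" using False by simp
      finally show ?thesis by simp
    next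
      case k: True
      then have c: "p = (\<lambda>x. p 0)" using hom_polys_0 p by blast
      have "p (ellipsoid_point (axis 1 1)) = 0" by (intro z) (auto simp: ellipsoid_eq)
      then have "p 0 = 0" by (subst (asm) c)
      then show ?thesis by (subst c)
    qed
  qed
  then have "?q (v v* A) = 0" by (rule polys_zero_on_reals[OF hom_polys_polys[OF qh]])
  then show "p v = 0" by (simp only: v_A_inv)
qed

lemma hom_herm_zero: "p \<in> hom_polys k \<Longrightarrow> herm A p p = 0 \<Longrightarrow> p = (\<lambda>v. 0)"
  using hom_zero_on_ellipsoid herm_zero_iff ellcont_hom by blast

section \<open>Orthogonal projections\<close>

text \<open>Linear subspaces, for functions whose type carries no complex vector space structure.\<close>

definition fun_subspace :: "cfun3 set \<Rightarrow> bool" where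
  "fun_subspace E \<longleftrightarrow> (\<lambda>v. 0) \<in> E \<and> (\<forall>p\<in>E. \<forall>q\<in>E. (\<lambda>v. p v + q v) \<in> E) \<and> (\<forall>p\<in>E. \<forall>c. (\<lambda>v. c * p v) \<in> E)"

lemma fun_subspaceD:
  assumes "fun_subspace E"
  shows "(\<lambda>v. 0) \<in> E" "p \<in> E \<Longrightarrow> q \<in> E \<Longrightarrow> (\<lambda>v. p v + q v) \<in> E" "p \<in> E \<Longrightarrow> (\<lambda>v. c * p v) \<in> E"
  using assms by (auto simp: fun_subspace_def)

lemma fun_subspace_diff: "fun_subspace E \<Longrightarrow> p \<in> E \<Longrightarrow> q \<in> E \<Longrightarrow> (\<lambda>v. p v - q v) \<in> E"
  using fun_subspaceD(2)[of E p "\<lambda>v. (-1) * q v"] fun_subspaceD(3)[of E q "-1"] by simp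

lemma fun_subspace_sum:
  assumes "finite I" "fun_subspace E" "\<And>i. i \<in> I \<Longrightarrow> p i \<in> E"
  shows "(\<lambda>v. \<Sum>i\<in>I. p i v) \<in> E"
  using assms
proof (induction I rule: finite_induct)
  case empty then show ?case by (simp add: fun_subspaceD(1))
next
  case (insert x F)
  then show ?case using fun_subspaceD(2)[of E "p x" "\<lambda>v. \<Sum>i\<in>F. p i v"] by auto
qed

text \<open>
  The expansion in the third clause is an equation of functions on all of \<open>\<complex>\<^sup>3\<close>, not only on the
  ellipsoid.
\<close>

definition orthonormal_basis :: "cfun3 set \<Rightarrow> nat \<Rightarrow> (nat \<Rightarrow> cfun3) \<Rightarrow> bool" where
  "orthonormal_basis E n e \<longleftrightarrow> (\<forall>i<n. e i \<in> E) \<and> (\<forall>i<n. \<forall>j<n. herm A (e i) (e j) = (if i = j then 1 else 0)) \<and>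
     (\<forall>p\<in>E. p = (\<lambda>v. \<Sum>i<n. herm A p (e i) * e i v))"

text \<open>
  Gram-Schmidt by induction on a finite spanning set \<open>M\<close>. The induction runs over \<open>M\<close> and not over
  \<open>E\<close>: the subspaces \<open>E \<inter> span M\<close> grow by at most one dimension at a time.
\<close>

lemma orthonormal_basis_exists_span:
  assumes "finite M" "fun_subspace E" "E \<subseteq> hom_polys k"
    and "\<And>p. p \<in> E \<Longrightarrow> \<exists>c :: cfun3 \<Rightarrow> complex. p = (\<lambda>v. \<Sum>b\<in>M. c b * b v)"
  shows "\<exists>n e. orthonormal_basis E n e"
  using assms
proof (induction M arbitrary: E)
  case empty
  then have "\<And>p. p \<in> E \<Longrightarrow> p = (\<lambda>v. 0)" by force
  then have "orthonormal_basis E 0 (\<lambda>_ _. 0)" by (auto simp: orthonormal_basis_def)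
  then show ?case by blast
next
  case (insert m M)
  define L where "L = {p. \<exists>c :: cfun3 \<Rightarrow> complex. p = (\<lambda>v. \<Sum>b\<in>M. c b * b v)}"
  have L_lin: "(\<lambda>v. p v - a * q v) \<in> L" if "p \<in> L" "q \<in> L" for p q a
  proof -
    obtain c d where "p = (\<lambda>v. \<Sum>b\<in>M. c b * b v)" "q = (\<lambda>v. \<Sum>b\<in>M. d b * b v)"
      using \<open>p \<in> L\<close> \<open>q \<in> L\<close> unfolding L_def by blast
    then have "(\<lambda>v. p v - a * q v) = (\<lambda>v. \<Sum>b\<in>M. (c b - a * d b) * b v)"
      by (simp add: sum_subtractf sum_distrib_left algebra_simps)
    then show ?thesis unfolding L_def by (intro CollectI exI[of _ "\<lambda>b. c b - a * d b"])
  qed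
  have L0: "(\<lambda>v. 0) \<in> L" unfolding L_def by (rule CollectI, rule exI[of _ "\<lambda>_. 0"]) simp
  have L_add: "(\<lambda>v. p v + q v) \<in> L" if "p \<in> L" "q \<in> L" for p q
    using L_lin[OF that, of "-1"] by simp
  have L_cm: "(\<lambda>v. a * p v) \<in> L" if "p \<in> L" for p a
    using L_lin[OF L0 that, of "-a"] by simp
  \<comment> \<open>the subspace to which the induction hypothesis applies\<close>
  define E' where "E' = E \<inter> L"
  have sub': "fun_subspace E'" unfolding fun_subspace_def E'_def
    using insert.prems(1) L0 L_add L_cm by (auto simp: fun_subspace_def)
  have "E' \<subseteq> hom_polys k" using insert.prems(2) unfolding E'_def by blast
  moreover have "\<exists>c :: cfun3 \<Rightarrow> complex. p = (\<lambda>v. \<Sum>b\<in>M. c b * b v)" if "p \<in> E'" for p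
    using that unfolding E'_def L_def by blast
  ultimately obtain n e where ob: "orthonormal_basis E' n e" using insert.IH[OF sub'] by blast
  show ?case
  proof (cases "E \<subseteq> L")
    case True
    then show ?thesis using ob by (auto simp: E'_def Int_absorb2)
  next
    case False
    then obtain p0 where p0: "p0 \<in> E" "p0 \<notin> L" by blast
    have split: "\<exists>c r. p = (\<lambda>v. c * m v + r v) \<and> r \<in> L" if pE: "p \<in> E" for p
    proof -
      obtain d where "p = (\<lambda>v. \<Sum>b\<in>insert m M. d b * b v)"
        using insert.prems(3)[OF pE] by (elim exE)
      then have "p = (\<lambda>v. d m * m v + (\<Sum>b\<in>M. d b * b v))" using insert.hyps by simp
      then show ?thesis unfolding L_def
        by (intro exI[of _ "d m"] exI[of _ "\<lambda>v. \<Sum>b\<in>M. d b * b v"]) auto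
    qed
    obtain c0 r0 where c0: "p0 = (\<lambda>v. c0 * m v + r0 v)" "r0 \<in> L" using split p0 by blast
    have c0nz: "c0 \<noteq> 0" using c0 p0(2) by auto
    have EE: "p \<in> ellcont" if "p \<in> E" for p using that insert.prems(2) ellcont_hom by blast
    have eE: "e i \<in> E" "e i \<in> E'" if "i < n" for i using ob that by (auto simp: orthonormal_basis_def E'_def)
    have eC: "e i \<in> ellcont" if "i < n" for i using EE eE that by blast
    have eo: "herm A (e i) (e j) = (if i = j then 1 else 0)" if "i < n" "j < n" for i j
      using ob that by (auto simp: orthonormal_basis_def)
    \<comment> \<open>the Gram-Schmidt step: \<open>p0\<close> does not lie in the span of \<open>M\<close>, so its part orthogonal to the
      smaller basis is not zero\<close>
    define q0 where "q0 = (\<lambda>v. p0 v - (\<Sum>i<n. herm A p0 (e i) * e i v))"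
    have sE': "(\<lambda>v. \<Sum>i<n. c i * e i v) \<in> E'" for c
      by (rule fun_subspace_sum[OF _ sub']) (auto intro: fun_subspaceD(3)[OF sub' eE(2)])
    have q0E: "q0 \<in> E" unfolding q0_def
      using fun_subspace_diff[OF insert.prems(1) p0(1)] sE' by (auto simp: E'_def)
    have q0nz: "q0 \<noteq> (\<lambda>v. 0)"
    proof
      assume "q0 = (\<lambda>v. 0)"
      then have "p0 = (\<lambda>v. \<Sum>i<n. herm A p0 (e i) * e i v)" by (auto simp: q0_def fun_eq_iff)
      then show False using sE' p0(2) by (metis E'_def IntD2)
    qed
    have hs: "herm A (\<lambda>v. \<Sum>i<n. c i * e i v) (e j) = c j" if "j < n" for c j
    proof -
      have "herm A (\<lambda>v. \<Sum>i<n. c i * e i v) (e j) = (\<Sum>i<n. c i * herm A (e i) (e j))"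
        by (subst herm_sum_left) (auto intro!: ellcont_cmult eC that sum.cong herm_cmult_left)
      also have "\<dots> = (\<Sum>i<n. if i = j then c i else 0)"
        using that eo by (intro sum.cong) auto
      finally show ?thesis using that by simp
    qed
    have q0e: "herm A q0 (e j) = 0" if "j < n" for j
      unfolding q0_def using hs[OF that] that
      by (subst herm_diff_left) (auto intro!: EE p0 eE ellcont_sum ellcont_cmult)
    have eq0: "herm A (e j) q0 = 0" if "j < n" for j
      using q0e[OF that] herm_cnj[of "e j" q0] by simp
    define N where "N = L2norm A q0"
    have qq: "herm A q0 q0 = of_real (N\<^sup>2)" by (simp add: N_def herm_self_L2norm EE q0E)
    have N: "N > 0"
    proof -
      have "N \<noteq> 0" using qq q0nz hom_herm_zero[of q0 k] q0E insert.prems(2) by auto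
      then show ?thesis using L2norm_nonneg[of q0] by (simp add: N_def)
    qed
    define en where "en = (\<lambda>v. (1 / of_real N) * q0 v)"
    have enE: "en \<in> E" unfolding en_def by (rule fun_subspaceD(3)[OF insert.prems(1) q0E])
    have hen: "herm A p en = herm A p q0 / of_real N" if "p \<in> E" for p
      unfolding en_def by (subst herm_cmult_right) (auto intro: EE that q0E)
    have hen': "herm A en p = herm A q0 p / of_real N" if "p \<in> E" for p
      unfolding en_def by (subst herm_cmult_left) (auto intro: EE that q0E)
    define e' where "e' = e(n := en)"
    have "orthonormal_basis E (Suc n) e'"
      unfolding orthonormal_basis_def
    proof (intro conjI allI impI ballI)
      fix i assume "i < Suc n" then show "e' i \<in> E" using eE enE by (auto simp: e'_def less_Suc_eq)
    next
      fix i j assume ij: "i < Suc n" "j < Suc n"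
      have "herm A en en = 1" using N by (simp add: hen enE hen' q0E qq power2_eq_square)
      moreover have "herm A en (e l) = 0" "herm A (e l) en = 0" if "l < n" for l
        using that by (simp_all add: hen hen' eE q0e eq0)
      ultimately show "herm A (e' i) (e' j) = (if i = j then 1 else 0)"
        using ij eo by (auto simp: e'_def less_Suc_eq)
    next
      fix p assume p: "p \<in> E"
      obtain c r where c: "p = (\<lambda>v. c * m v + r v)" "r \<in> L" using split p by blast
      \<comment> \<open>subtracting this multiple of \<open>q0\<close> removes \<open>m\<close> from \<open>p\<close>\<close>
      define a where "a = c / c0"
      define r' where "r' = (\<lambda>v. p v - a * q0 v)"
      have r'1: "r' = (\<lambda>v. (r v - a * r0 v) - (- a) * (\<Sum>i<n. herm A p0 (e i) * e i v))"
        using c0nz by (auto simp: r'_def q0_def c c0 a_def algebra_simps)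
      have "r' \<in> L" unfolding r'1 by (intro L_lin c c0) (use sE' in \<open>auto simp: E'_def\<close>)
      moreover have r'E: "r' \<in> E" unfolding r'_def by (intro fun_subspace_diff insert.prems p fun_subspaceD(3) q0E)
      ultimately have "r' \<in> E'" by (simp add: E'_def)
      then have r'e: "r' = (\<lambda>v. \<Sum>i<n. herm A r' (e i) * e i v)" using ob by (auto simp: orthonormal_basis_def)
      have pr: "p = (\<lambda>v. r' v + a * q0 v)" by (simp add: r'_def)
      have pe: "herm A p (e i) = herm A r' (e i)" if "i < n" for i
        unfolding pr using that
        by (subst herm_add_left) (auto intro!: EE r'E ellcont_cmult q0E eE simp: herm_cmult_left EE q0E eE q0e)
      have r'q: "herm A r' q0 = 0"
        by (subst r'e, subst herm_sum_left)
           (auto intro!: ellcont_cmult eC EE[OF q0E] sum.neutral simp: herm_cmult_left eC EE[OF q0E] eq0)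
      have pn: "herm A p en = a * of_real N"
      proof -
        have "herm A p q0 = a * of_real (N\<^sup>2)" unfolding pr
          by (subst herm_add_left) (auto intro!: EE r'E ellcont_cmult q0E simp: herm_cmult_left EE q0E r'q qq)
        then show ?thesis using N by (simp add: hen[OF p] power2_eq_square)
      qed
      show "p = (\<lambda>v. \<Sum>i<Suc n. herm A p (e' i) * e' i v)"
      proof
        fix v
        have "(\<Sum>i<Suc n. herm A p (e' i) * e' i v) = (\<Sum>i<n. herm A p (e i) * e i v) + herm A p en * en v"
          by (simp add: e'_def)
        also have "\<dots> = (\<Sum>i<n. herm A r' (e i) * e i v) + a * q0 v"
          using N by (simp add: pe pn) (simp add: en_def)
        also have "(\<Sum>i<n. herm A r' (e i) * e i v) = r' v" using r'e by metis
        finally show "p v = (\<Sum>i<Suc n. herm A p (e' i) * e' i v)" by (simp add: r'_def)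
      qed
    qed
    then show ?thesis by blast
  qed
qed

lemma orthonormal_basis_exists:
  assumes "fun_subspace E" "E \<subseteq> hom_polys k" shows "\<exists>n e. orthonormal_basis E n e"
proof (rule orthonormal_basis_exists_span[OF _ assms])
  let ?X = "{\<alpha> :: 3 \<Rightarrow> nat. (\<Sum>i\<in>UNIV. \<alpha> i) = k}"
  show "finite (monomial3 ` ?X)" by (intro finite_imageI finite_exponents_eq)
  fix p assume "p \<in> E"
  then obtain c where p: "p = (\<lambda>v. \<Sum>\<alpha>\<in>?X. c \<alpha> * monomial3 \<alpha> v)"
    using assms(2) unfolding hom_polys_alt subset_iff by blast
  have "p v = (\<Sum>b\<in>monomial3 ` ?X. (\<Sum>\<alpha> | \<alpha> \<in> ?X \<and> monomial3 \<alpha> = b. c \<alpha>) * b v)" for v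
  proof -
    have "p v = (\<Sum>b\<in>monomial3 ` ?X. \<Sum>\<alpha> | \<alpha> \<in> ?X \<and> monomial3 \<alpha> = b. c \<alpha> * monomial3 \<alpha> v)"
      unfolding p by (rule sum.image_gen[OF finite_exponents_eq])
    also have "\<dots> = (\<Sum>b\<in>monomial3 ` ?X. (\<Sum>\<alpha> | \<alpha> \<in> ?X \<and> monomial3 \<alpha> = b. c \<alpha>) * b v)"
      unfolding sum_distrib_right by (intro sum.cong) auto
    finally show ?thesis .
  qed
  then show "\<exists>c :: cfun3 \<Rightarrow> complex. p = (\<lambda>v. \<Sum>b\<in>monomial3 ` ?X. c b * b v)"
    by (intro exI[of _ "\<lambda>b. \<Sum>\<alpha> | \<alpha> \<in> ?X \<and> monomial3 \<alpha> = b. c \<alpha>"]) auto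
qed

text \<open>
  Two candidates differ by a form orthogonal to itself, so the description in \<open>orth_proj\<close> is
  unique.
\<close>

lemma orth_proj_eqI:
  assumes E: "fun_subspace E" "E \<subseteq> hom_polys k" and f: "f \<in> ellcont"
    and p: "p \<in> E" "\<And>h. h \<in> E \<Longrightarrow> herm A (\<lambda>v. f v - p v) h = 0"
  shows "orth_proj A E f = p"
  unfolding orth_proj_def
proof (rule the_equality)
  show "p \<in> E \<and> (\<forall>h\<in>E. herm A (\<lambda>v. f v - p v) h = 0)" using p by blast
  fix q assume q: "q \<in> E \<and> (\<forall>h\<in>E. herm A (\<lambda>v. f v - q v) h = 0)"
  have EE: "h \<in> ellcont" if "h \<in> E" for h using that E ellcont_hom by blast
  let ?h = "\<lambda>v. q v - p v"
  have h: "?h \<in> E" using fun_subspace_diff[OF E(1)] p q by blast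
  have fp: "(\<lambda>v. f v - p v) \<in> ellcont" "(\<lambda>v. f v - q v) \<in> ellcont"
    using ellcont_diff[OF f EE] q p(1) by blast+
  have "herm A ?h ?h = herm A (\<lambda>v. (f v - p v) - (f v - q v)) ?h" by simp
  also have "\<dots> = 0"
    using p(2)[OF h] q h by (simp only: herm_diff_left[OF fp EE[OF h]]) simp
  finally have "?h = (\<lambda>v. 0)" using hom_herm_zero h E(2) by blast
  then show "q = p" by (simp add: fun_eq_iff)
qed

lemma orthonormal_basis_projection:
  fixes e n f
  defines "p \<equiv> \<lambda>v. \<Sum>i<n. herm A f (e i) * e i v"
  assumes E: "fun_subspace E" "E \<subseteq> hom_polys k" and f: "f \<in> ellcont" and e: "orthonormal_basis E n e"
  shows "p \<in> E" "h \<in> E \<Longrightarrow> herm A (\<lambda>v. f v - p v) h = 0"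
proof -
  have EE: "h \<in> ellcont" if "h \<in> E" for h using that E ellcont_hom by blast
  have eE: "e i \<in> E" if "i < n" for i using e that by (auto simp: orthonormal_basis_def)
  have eC: "e i \<in> ellcont" if "i < n" for i using EE eE that by blast
  show p: "p \<in> E" unfolding p_def
    by (rule fun_subspace_sum[OF _ E(1)]) (auto intro: fun_subspaceD(3)[OF E(1) eE])
  have pj: "herm A (\<lambda>v. f v - p v) (e j) = 0" if "j < n" for j
  proof -
    have "herm A p (e j) = (\<Sum>i<n. herm A f (e i) * herm A (e i) (e j))" unfolding p_def
      by (subst herm_sum_left) (auto intro!: ellcont_cmult eC that sum.cong herm_cmult_left)
    also have "\<dots> = (\<Sum>i<n. if i = j then herm A f (e i) else 0)"
      using that e by (intro sum.cong) (auto simp: orthonormal_basis_def)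
    finally have "herm A p (e j) = herm A f (e j)" using that by simp
    then show ?thesis by (simp add: herm_diff_left f EE[OF p] EE[OF eE[OF that]])
  qed
  assume h: "h \<in> E"
  then have he: "h = (\<lambda>v. \<Sum>i<n. herm A h (e i) * e i v)" using e by (auto simp: orthonormal_basis_def)
  have fp: "(\<lambda>v. f v - p v) \<in> ellcont" by (intro ellcont_diff f EE p)
  have "herm A (\<lambda>v. \<Sum>i<n. c i * e i v) (\<lambda>v. f v - p v) = 0" for c
    by (subst herm_sum_left)
       (auto intro!: ellcont_cmult eC fp sum.neutral simp: herm_cmult_left eC fp herm_cnj[of "e _"] pj)
  then have "herm A h (\<lambda>v. f v - p v) = 0" using he by metis
  then show "herm A (\<lambda>v. f v - p v) h = 0" by (simp add: herm_cnj[of _ h])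
qed

lemma orth_proj_orthonormal_basis:
  assumes "fun_subspace E" "E \<subseteq> hom_polys k" "f \<in> ellcont" "orthonormal_basis E n e"
  shows "orth_proj A E f = (\<lambda>v. \<Sum>i<n. herm A f (e i) * e i v)"
  using orthonormal_basis_projection[OF assms] by (intro orth_proj_eqI[OF assms(1-3)]) auto

lemma orth_proj_props:
  assumes "fun_subspace E" "E \<subseteq> hom_polys k" "f \<in> ellcont"
  shows "orth_proj A E f \<in> E" "h \<in> E \<Longrightarrow> herm A (\<lambda>v. f v - orth_proj A E f v) h = 0"
proof -
  obtain n e where e: "orthonormal_basis E n e" using orthonormal_basis_exists[OF assms(1,2)] by blast
  show "orth_proj A E f \<in> E" "h \<in> E \<Longrightarrow> herm A (\<lambda>v. f v - orth_proj A E f v) h = 0"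
    using orthonormal_basis_projection[OF assms e] unfolding orth_proj_orthonormal_basis[OF assms e] by blast+
qed

section \<open>Harmonic polynomials\<close>

lemma herm_polys:
  assumes "p \<in> polys" "q \<in> polys"
  shows "herm A p q = (LINT u|sphere_measure. (\<lambda>u. p (u v* matrix_inv A)) (emb u) *
     conj_poly (\<lambda>u. q (u v* matrix_inv A)) (emb u))"
  using assms by (simp add: herm_eq ellcont_polys conj_poly_emb ellipsoid_point_def)

text \<open>
  The identity \<open>laplacian_almost_self_adjoint\<close> in the coordinates \<open>v v* A\<close>. It replaces the
  spectral theory of the Laplacian on the sphere.
\<close>

lemma herm_Q_laplacian:
  assumes p: "p \<in> hom_polys k" and q: "q \<in> hom_polys j"
  shows "herm A (Q_laplacian A p) q - of_nat k * (of_nat k + 1) * herm A p q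
       = herm A p (Q_laplacian A q) - of_nat j * (of_nat j + 1) * herm A p q"
proof -
  define P where "P u = p (u v* matrix_inv A)" for u
  define R where "R u = q (u v* matrix_inv A)" for u
  have pp: "p \<in> polys" "q \<in> polys" using p q hom_polys_polys by auto
  have P: "P \<in> hom_polys k" using hom_polys_subst[OF p] by (simp add: P_def[abs_def])
  have R: "R \<in> hom_polys j" using hom_polys_subst[OF q] by (simp add: R_def[abs_def])
  have LP: "(\<lambda>u. Q_laplacian A p (u v* matrix_inv A)) = laplacian P"
    using laplacian_subst[OF A_inv pp(1)] by (simp add: P_def[abs_def])
  have LR: "(\<lambda>u. Q_laplacian A q (u v* matrix_inv A)) = laplacian R"
    using laplacian_subst[OF A_inv pp(2)] by (simp add: R_def[abs_def])
  have "herm A p q = (LINT u|sphere_measure. P (emb u) * conj_poly R (emb u))"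
    unfolding herm_polys[OF pp] P_def R_def ..
  moreover have "herm A (Q_laplacian A p) q = (LINT u|sphere_measure. laplacian P (emb u) * conj_poly R (emb u))"
    unfolding herm_polys[OF Q_laplacian_polys[OF pp(1)] pp(2)] by (simp add: R_def[abs_def] fun_cong[OF LP])
  moreover have "herm A p (Q_laplacian A q) = (LINT u|sphere_measure. P (emb u) * laplacian (conj_poly R) (emb u))"
    unfolding herm_polys[OF pp(1) Q_laplacian_polys[OF pp(2)]] LR conj_poly_laplacian[OF hom_polys_polys[OF R]]
    by (simp add: P_def)
  ultimately show ?thesis
    using laplacian_almost_self_adjoint[OF P conj_poly_hom[OF R]] by simp
qed

lemma Q_laplacian_low_degree:
  assumes "p \<in> hom_polys k" "k < 2" shows "Q_laplacian A p = (\<lambda>v. 0)"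
proof -
  have "cpartial i (cpartial j p) = (\<lambda>v. 0)" for i j
  proof -
    have "cpartial j p \<in> hom_polys 0" using cpartial_hom[OF assms(1), of j] assms(2) by simp
    then have "cpartial j p = (\<lambda>v. cpartial j p 0)" by (rule hom_polys_0)
    then show ?thesis using cpartial_const by metis
  qed
  then show ?thesis by (simp add: Q_laplacian_def)
qed

lemma Har_ellcont: "p \<in> Har A k \<Longrightarrow> p \<in> ellcont"
  by (auto simp: Har_def ellcont_hom)

lemma HarD: "p \<in> Har A k \<Longrightarrow> p \<in> hom_polys k" "p \<in> Har A k \<Longrightarrow> Q_laplacian A p = (\<lambda>v. 0)"
  by (auto simp: Har_def Q_harmonic_def)

lemma HarI: "p \<in> hom_polys k \<Longrightarrow> Q_laplacian A p = (\<lambda>v. 0) \<Longrightarrow> p \<in> Har A k"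
  by (auto simp: Har_def Q_harmonic_def hom_polys_polys)

text \<open>
  Harmonic forms are orthogonal to all forms of lower degree, by induction on that degree: in
  \<open>herm_Q_laplacian\<close> the Laplacian lowers the degree of \<open>q\<close> by two, and \<open>k (k + 1) \<noteq> j (j + 1)\<close>.
\<close>

lemma Har_orth_lower:
  assumes p: "p \<in> Har A k"
  shows "q \<in> hom_polys j \<Longrightarrow> j < k \<Longrightarrow> herm A p q = 0"
proof (induction j arbitrary: q rule: less_induct)
  case (less j)
  have z: "herm A p (Q_laplacian A q) = 0"
  proof (cases "j < 2")
    case True then show ?thesis using Q_laplacian_low_degree[OF less.prems(1)] by simp
  next
    case False
    then show ?thesis using less.IH[of "j - 2"] Q_laplacian_hom[OF less.prems(1)] less.prems(2) by auto
  qed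
  have "(of_nat k * (of_nat k + 1) - of_nat j * (of_nat j + 1)) * herm A p q = 0"
    using herm_Q_laplacian[OF HarD(1)[OF p] less.prems(1)] z HarD(2)[OF p] by (simp add: algebra_simps)
  moreover have "(of_nat k * (of_nat k + 1) :: complex) \<noteq> of_nat j * (of_nat j + 1)"
  proof -
    have "j * (j + 1) < k * (k + 1)" using less.prems(2) by (intro mult_strict_mono) auto
    then have "of_nat (k * (k + 1)) \<noteq> (of_nat (j * (j + 1)) :: complex)" by (simp only: of_nat_eq_iff)
    then show ?thesis by (simp only: of_nat_mult of_nat_add of_nat_1 not_False_eq_True)
  qed
  ultimately show ?case by auto
qed

lemma Har_orth: "p \<in> Har A j \<Longrightarrow> q \<in> Har A k \<Longrightarrow> j \<noteq> k \<Longrightarrow> herm A p q = 0"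
  using Har_orth_lower[of p j q k] Har_orth_lower[of q k p j] HarD(1) herm_cnj[of q p]
  by (metis complex_cnj_zero_iff nat_neq_iff)

lemma Q_hom: "Q \<in> hom_polys 2"
proof (rule hom_polysI)
  have "(\<lambda>v. \<Sum>i\<in>UNIV. ((v v* A) $ i)\<^sup>2) \<in> polys"
    by (intro polys_sum polys_power polys_subst[OF polys_coord]) auto
  then show "Q \<in> polys" by (simp add: Q_eq[abs_def])
  show "Q (t *s v) = t\<^sup>2 * Q v" for t v
    by (simp add: Q_eq vector_matrix_scale power_mult_distrib sum_distrib_left)
qed

lemma Q_polys: "Q \<in> polys" using Q_hom hom_polys_polys by blast

text \<open>
  A polynomial quotient of a form by \<open>Q\<close> may be replaced by its homogeneous component of degree
  \<open>k - 2\<close>.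
\<close>

lemma VQ_quotient:
  assumes "h \<in> VQ Q k"
  shows "h = (\<lambda>v. 0) \<or> (2 \<le> k \<and> (\<exists>r\<in>hom_polys (k - 2). h = (\<lambda>v. Q v * r v)))"
proof -
  obtain r where r: "r \<in> polys" "h = (\<lambda>v. Q v * r v)" and hk: "h \<in> hom_polys k"
    using assms by (auto simp: VQ_def)
  obtain d rs where rs: "\<And>j. rs j \<in> hom_polys j" and rd: "r = (\<lambda>v. \<Sum>j\<le>d. rs j v)"
    using polys_homogeneous_split[OF r(1)] by blast
  define a where "a v j = (if 2 \<le> j then Q v * rs (j - 2) v else 0)" for v j
  have "h v = (if k \<le> d + 2 then a v k else 0)" for v
  proof (rule homogeneous_components_unique)
    fix t
    have "(\<Sum>j\<le>d + 2. t ^ j * a v j) = (\<Sum>j\<in>{2..d+2}. t ^ j * a v j)"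
      by (rule sum.mono_neutral_right) (auto simp: a_def)
    also have "\<dots> = (\<Sum>j\<in>{0..d}. t ^ (j + 2) * a v (j + 2))"
      using sum.shift_bounds_cl_nat_ivl[of "\<lambda>j. t ^ j * a v j" 0 2 d] by (simp only: add_0)
    also have "\<dots> = Q (t *s v) * r (t *s v)"
      unfolding rd hom_polys_scale[OF Q_hom] hom_polys_scale[OF rs] atLeast0AtMost
      by (simp add: a_def sum_distrib_left power_add power2_eq_square mult_ac)
    also have "\<dots> = t ^ k * h v" using hom_polys_scale[OF hk] r(2) by metis
    finally show "(\<Sum>j\<le>d + 2. t ^ j * a v j) = t ^ k * h v" .
  qed
  then have "h = (if k \<le> d + 2 \<and> 2 \<le> k then (\<lambda>v. Q v * rs (k - 2) v) else (\<lambda>v. 0))"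
    by (auto simp: a_def fun_eq_iff)
  then show ?thesis using rs by metis
qed

lemma VQ_mult: "r \<in> hom_polys j \<Longrightarrow> (\<lambda>v. Q v * r v) \<in> VQ Q (j + 2)"
  using hom_polys_mult[OF Q_hom, of r j] hom_polys_polys[of r j] by (auto simp: VQ_def add.commute)

lemma VQ_sub: "VQ Q k \<subseteq> hom_polys k" by (auto simp: VQ_def)

lemma fun_subspace_VQ: "fun_subspace (VQ Q k)"
  unfolding fun_subspace_def
proof (intro conjI ballI allI)
  show "(\<lambda>v. 0) \<in> VQ Q k" using hom_polys_zero polys_const[of 0] by (auto simp: VQ_def intro!: bexI[of _ "\<lambda>v. 0"])
  show "(\<lambda>v. p v + q v) \<in> VQ Q k" if pq: "p \<in> VQ Q k" "q \<in> VQ Q k" for p q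
  proof -
    obtain r s where "r \<in> polys" "s \<in> polys" "p = (\<lambda>v. Q v * r v)" "q = (\<lambda>v. Q v * s v)"
      using pq by (auto simp: VQ_def)
    then show ?thesis using pq
      by (auto simp: VQ_def distrib_left intro!: hom_polys_add bexI[of _ "\<lambda>v. r v + s v"] polys_add)
  qed
  show "(\<lambda>v. c * p v) \<in> VQ Q k" if p: "p \<in> VQ Q k" for p c
  proof -
    obtain r where "r \<in> polys" "p = (\<lambda>v. Q v * r v)" using p by (auto simp: VQ_def)
    then have "(\<lambda>v. c * r v) \<in> polys" "(\<lambda>v. c * p v) = (\<lambda>v. Q v * (c * r v))" by (auto intro: polys_cmult)
    moreover have "(\<lambda>v. c * p v) \<in> hom_polys k" using p by (auto simp: VQ_def intro: hom_polys_cmult)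
    ultimately show ?thesis unfolding VQ_def mem_Collect_eq by (intro conjI bexI)
  qed
qed

lemma fun_subspace_Har: "fun_subspace (Har A k)"
  unfolding fun_subspace_def
  by (auto intro!: HarI hom_polys_zero hom_polys_add hom_polys_cmult
      simp: Q_laplacian_zero Q_laplacian_add Q_laplacian_cmult HarD hom_polys_polys[OF HarD(1)])

lemma Har_sub: "Har A k \<subseteq> hom_polys k" by (auto simp: Har_def)

text \<open>
  On the ellipsoid \<open>Q = 1\<close>, so orthogonality to multiples of \<open>Q\<close> is orthogonality to forms of
  degree \<open>k - 2\<close>. Harmonic forms have it by \<open>Har_orth_lower\<close>. Conversely, for \<open>P\<close> with this
  property the form \<open>\<Delta> P\<close> is orthogonal to itself by \<open>herm_Q_laplacian\<close>.
\<close>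

lemma Har_eq_VQ_perp: "Har A k = VQ_perp A Q k"
proof (intro equalityI subsetI)
  fix p assume p: "p \<in> Har A k"
  have "herm A p h = 0" if "h \<in> VQ Q k" for h
    using VQ_quotient[OF that]
  proof (elim disjE conjE bexE)
    fix r assume r: "2 \<le> k" "r \<in> hom_polys (k - 2)" "h = (\<lambda>v. Q v * r v)"
    have "herm A p h = herm A p r" by (rule herm_cong) (auto simp: r Q_ellipsoid)
    also have "\<dots> = 0" using Har_orth_lower[OF p r(2)] r(1) by simp
    finally show ?thesis .
  qed simp
  then show "p \<in> VQ_perp A Q k" using HarD(1)[OF p] by (auto simp: VQ_perp_def)
next
  fix P assume P: "P \<in> VQ_perp A Q k"
  then have Ph: "P \<in> hom_polys k" and orth: "\<And>h. h \<in> VQ Q k \<Longrightarrow> herm A P h = 0"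
    by (auto simp: VQ_perp_def)
  have low: "herm A P r = 0" if "r \<in> hom_polys j" "j + 2 = k" for r j
  proof -
    have "herm A P r = herm A P (\<lambda>v. Q v * r v)" by (rule herm_cong) (auto simp: Q_ellipsoid)
    then show ?thesis using orth VQ_mult[OF that(1)] that(2) by auto
  qed
  have "Q_laplacian A P = (\<lambda>v. 0)"
  proof (cases "k < 2")
    case True then show ?thesis using Q_laplacian_low_degree[OF Ph] by blast
  next
    case False
    define r where "r = Q_laplacian A P"
    have r: "r \<in> hom_polys (k - 2)" using Q_laplacian_hom[OF Ph] by (simp add: r_def)
    \<comment> \<open>\<open>Q\<close> may be inserted once or twice, as it is \<open>1\<close> on the ellipsoid\<close>
    have 1: "herm A P r = 0" using low[OF r] False by simp
    have 2: "herm A P (Q_laplacian A r) = 0"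
    proof (cases "k - 2 < 2")
      case True then show ?thesis using Q_laplacian_low_degree[OF r] by simp
    next
      case False
      have s: "Q_laplacian A r \<in> hom_polys (k - 2 - 2)" by (rule Q_laplacian_hom[OF r])
      have "herm A P (Q_laplacian A r) = herm A P (\<lambda>v. Q v * Q_laplacian A r v)"
        by (rule herm_cong) (auto simp: Q_ellipsoid)
      also have "\<dots> = 0"
        using low[of "\<lambda>v. Q v * Q_laplacian A r v" "2 + (k - 2 - 2)"] hom_polys_mult[OF Q_hom s] False by simp
      finally show ?thesis .
    qed
    have "herm A r r = 0" using herm_Q_laplacian[OF Ph r] 1 2 by (simp add: r_def)
    then show ?thesis using hom_herm_zero[OF r] by (simp add: r_def)
  qed
  then show "P \<in> Har A k" by (rule HarI[OF Ph])
qed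

text \<open>
  Split off the orthogonal projection to the multiples of \<open>Q\<close>, divide it by \<open>Q\<close>, which is \<open>1\<close> on
  the ellipsoid, and repeat.
\<close>

lemma harmonic_decomposition_hom:
  "q \<in> hom_polys j \<Longrightarrow> \<exists>hs. (\<forall>i. hs i \<in> Har A i) \<and> (\<forall>v\<in>ellipsoid A. q v = (\<Sum>i\<le>j. hs i v))"
proof (induction j arbitrary: q rule: less_induct)
  case (less j)
  define g where "g = orth_proj A (VQ Q j) q"
  note pr = orth_proj_props[OF fun_subspace_VQ[of j] VQ_sub ellcont_hom[OF less.prems], folded g_def]
  define P where "P v = q v - g v" for v
  have gh: "g \<in> hom_polys j" by (rule subsetD[OF VQ_sub pr(1)])
  have P: "P \<in> Har A j"
    using pr(2) hom_polys_diff[OF less.prems gh] unfolding Har_eq_VQ_perp VQ_perp_def P_def by auto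
  have zero: "(\<lambda>v. 0) \<in> Har A i" for i using fun_subspace_Har fun_subspaceD(1) by blast
  from VQ_quotient[OF pr(1)] show ?case
  proof (elim disjE conjE bexE)
    assume "g = (\<lambda>v. 0)"
    then have "q = P" by (simp add: P_def fun_eq_iff)
    moreover have "(\<Sum>i\<le>j. (if i = j then P else (\<lambda>v. 0)) v) = P v" for v
      by (simp add: if_distribR cong: if_cong)
    ultimately show ?thesis using P zero by (intro exI[of _ "\<lambda>i. if i = j then P else (\<lambda>v. 0)"]) auto
  next
    fix r assume r: "2 \<le> j" "r \<in> hom_polys (j - 2)" "g = (\<lambda>v. Q v * r v)"
    obtain hs where hs: "\<And>i. hs i \<in> Har A i" "\<And>v. v \<in> ellipsoid A \<Longrightarrow> r v = (\<Sum>i\<le>j - 2. hs i v)"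
      using less.IH[OF _ r(2)] r(1) by auto
    define hs' where "hs' i = (if i = j then P else if i \<le> j - 2 then hs i else (\<lambda>v. 0))" for i
    have "q v = (\<Sum>i\<le>j. hs' i v)" if v: "v \<in> ellipsoid A" for v
    proof -
      have "(\<Sum>i\<le>j. hs' i v) = P v + (\<Sum>i<j. hs' i v)"
        by (simp add: lessThan_Suc_atMost[symmetric] hs'_def)
      also have "(\<Sum>i<j. hs' i v) = (\<Sum>i\<le>j-2. hs' i v)"
        by (rule sum.mono_neutral_right) (use r(1) in \<open>auto simp: hs'_def\<close>)
      also have "\<dots> = (\<Sum>i\<le>j-2. hs i v)" using r(1) by (intro sum.cong) (auto simp: hs'_def)
      also have "\<dots> = g v" using hs(2)[OF v] r(3) Q_ellipsoid[OF v] by simp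
      finally show ?thesis by (simp add: P_def)
    qed
    moreover have "hs' i \<in> Har A i" for i using P hs zero by (simp add: hs'_def)
    ultimately show ?thesis by blast
  qed
qed

lemma harmonic_decomposition:
  assumes "p \<in> polys"
  shows "\<exists>N hs. (\<forall>i. hs i \<in> Har A i) \<and> (\<forall>v\<in>ellipsoid A. p v = (\<Sum>i\<le>N. hs i v))"
proof -
  obtain d ps where ps: "\<And>k. ps k \<in> hom_polys k" and p: "p = (\<lambda>v. \<Sum>k\<le>d. ps k v)"
    using polys_homogeneous_split[OF assms] by blast
  have "\<forall>k. \<exists>hs. (\<forall>i. hs i \<in> Har A i) \<and> (\<forall>v\<in>ellipsoid A. ps k v = (\<Sum>i\<le>k. hs i v))"
    using harmonic_decomposition_hom[OF ps] by blast
  then obtain hs where hs: "\<And>k i. hs k i \<in> Har A i" "\<And>k v. v \<in> ellipsoid A \<Longrightarrow> ps k v = (\<Sum>i\<le>k. hs k i v)"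
    by metis
  have zero: "(\<lambda>v. 0) \<in> Har A i" for i using fun_subspace_Har fun_subspaceD(1) by blast
  define H where "H i = (\<lambda>v. \<Sum>k\<le>d. (if i \<le> k then hs k i else (\<lambda>v. 0)) v)" for i
  have "H i \<in> Har A i" for i unfolding H_def
    by (rule fun_subspace_sum[OF _ fun_subspace_Har]) (auto simp: hs zero)
  moreover have "p v = (\<Sum>i\<le>d. H i v)" if v: "v \<in> ellipsoid A" for v
  proof -
    have "p v = (\<Sum>k\<le>d. \<Sum>i\<le>k. hs k i v)" unfolding p by (simp add: hs(2)[OF v])
    also have "\<dots> = (\<Sum>k\<le>d. \<Sum>i\<le>d. (if i \<le> k then hs k i else (\<lambda>v. 0)) v)"
      by (intro sum.cong refl sum.mono_neutral_cong_left) auto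
    also have "\<dots> = (\<Sum>i\<le>d. H i v)" unfolding H_def by (rule sum.swap)
    finally show ?thesis .
  qed
  ultimately show ?thesis by blast
qed

section \<open>Fourier series\<close>

lemma fourier_Har: "f \<in> ellcont \<Longrightarrow> fourier A k f \<in> Har A k"
  unfolding fourier_def by (rule orth_proj_props(1)[OF fun_subspace_Har Har_sub])

lemma fourier_orth:
  "f \<in> ellcont \<Longrightarrow> h \<in> Har A k \<Longrightarrow> herm A (\<lambda>v. f v - fourier A k f v) h = 0"
  unfolding fourier_def by (rule orth_proj_props(2)[OF fun_subspace_Har Har_sub])

lemma fourier_eqI:
  "f \<in> ellcont \<Longrightarrow> p \<in> Har A k \<Longrightarrow> (\<And>h. h \<in> Har A k \<Longrightarrow> herm A (\<lambda>v. f v - p v) h = 0) \<Longrightarrow> fourier A k f = p"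
  unfolding fourier_def by (rule orth_proj_eqI[OF fun_subspace_Har Har_sub])

lemma fourier_ellcont: "f \<in> ellcont \<Longrightarrow> fourier A k f \<in> ellcont"
  by (rule Har_ellcont[OF fourier_Har])

definition fsum :: "cfun3 \<Rightarrow> nat \<Rightarrow> cfun3" where
  "fsum f d = (\<lambda>v. \<Sum>k\<le>d. fourier A k f v)"

lemma fsum_ellcont: "f \<in> ellcont \<Longrightarrow> fsum f d \<in> ellcont"
  unfolding fsum_def by (intro ellcont_sum fourier_ellcont)

lemma herm_Har_sum:
  assumes "\<And>i. hs i \<in> Har A i" "h \<in> Har A k"
  shows "herm A (\<lambda>v. \<Sum>i\<le>d. hs i v) h = (if k \<le> d then herm A (hs k) h else 0)"
proof -
  have "herm A (\<lambda>v. \<Sum>i\<le>d. hs i v) h = (\<Sum>i\<le>d. herm A (hs i) h)"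
    by (rule herm_sum_left) (auto intro: Har_ellcont assms)
  also have "\<dots> = (\<Sum>i\<le>d. if i = k then herm A (hs k) h else 0)"
    by (intro sum.cong) (auto intro: Har_orth assms)
  finally show ?thesis by simp
qed

lemma fsum_orth:
  assumes f: "f \<in> ellcont" and "h \<in> Har A k" "k \<le> d"
  shows "herm A (\<lambda>v. f v - fsum f d v) h = 0"
proof -
  have hC: "h \<in> ellcont" "fourier A k f \<in> ellcont" using assms Har_ellcont fourier_Har by auto
  have "herm A (fsum f d) h = herm A (fourier A k f) h"
    unfolding fsum_def using herm_Har_sum[of "\<lambda>i. fourier A i f" h k d] fourier_Har[OF f] assms by simp
  then show ?thesis using fourier_orth[OF f assms(2)]
    by (simp add: herm_diff_left f hC fsum_ellcont)
qed

text \<open>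
  The Fourier sum is at least as close as any sum of harmonic forms of degrees up to \<open>N\<close>, because
  it is the projection to a larger space.
\<close>

lemma best_approximation:
  assumes f: "f \<in> ellcont" and hs: "\<And>i. hs i \<in> Har A i" and "N \<le> d"
  shows "L2norm A (\<lambda>v. f v - fsum f d v) \<le> L2norm A (\<lambda>v. f v - (\<Sum>i\<le>N. hs i v))"
proof (rule power2_le_imp_le)
  define g where "g v = (\<Sum>i\<le>d. (if i \<le> N then (\<lambda>v. fourier A i f v - hs i v) else fourier A i f) v)" for v
  have gi: "(if i \<le> N then (\<lambda>v. fourier A i f v - hs i v) else fourier A i f) \<in> Har A i" for i
    using fun_subspace_diff[OF fun_subspace_Har fourier_Har[OF f] hs] fourier_Har[OF f] by simp
  have ge: "fsum f d v - (\<Sum>i\<le>N. hs i v) = g v" for v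
  proof -
    have "(\<Sum>i\<le>N. hs i v) = (\<Sum>i\<le>d. if i \<le> N then hs i v else 0)"
      using assms(3) by (intro sum.mono_neutral_cong_left) auto
    then have "fsum f d v - (\<Sum>i\<le>N. hs i v) = (\<Sum>i\<le>d. fourier A i f v - (if i \<le> N then hs i v else 0))"
      by (simp add: fsum_def sum_subtractf)
    also have "\<dots> = g v" unfolding g_def by (intro sum.cong) auto
    finally show ?thesis .
  qed
  have gC: "g \<in> ellcont" unfolding g_def by (rule ellcont_sum) (rule Har_ellcont[OF gi])
  have fC: "(\<lambda>v. f v - fsum f d v) \<in> ellcont" by (intro ellcont_diff f fsum_ellcont)
  have "herm A g (\<lambda>v. f v - fsum f d v) = 0"
  proof -
    have "herm A g (\<lambda>v. f v - fsum f d v) = (\<Sum>i\<le>d. herm A (if i \<le> N then (\<lambda>v. fourier A i f v - hs i v) else fourier A i f) (\<lambda>v. f v - fsum f d v))"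
      unfolding g_def by (rule herm_sum_left) (use Har_ellcont[OF gi] fC in blast)+
    also have "\<dots> = 0"
      using fsum_orth[OF f gi] herm_cnj by (intro sum.neutral) (metis (no_types, lifting) atMost_iff complex_cnj_zero)
    finally show ?thesis .
  qed
  then have o: "herm A (\<lambda>v. f v - fsum f d v) g = 0" by (simp add: herm_cnj[of _ g])
  have "(L2norm A (\<lambda>v. f v - (\<Sum>i\<le>N. hs i v)))\<^sup>2 = (L2norm A (\<lambda>v. (f v - fsum f d v) + g v))\<^sup>2"
    by (simp add: ge[symmetric])
  also have "\<dots> = (L2norm A (\<lambda>v. f v - fsum f d v))\<^sup>2 + (L2norm A g)\<^sup>2"
    by (rule pythagoras[OF fC gC o])
  finally show "(L2norm A (\<lambda>v. f v - fsum f d v))\<^sup>2 \<le> (L2norm A (\<lambda>v. f v - (\<Sum>i\<le>N. hs i v)))\<^sup>2"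
    by simp
qed (rule L2norm_nonneg)

text \<open>
  Connects the polynomials on \<open>real ^ 3\<close> in the theorem of Stone and Weierstrass with \<open>polys\<close>.
\<close>

lemma real_polynomial_function_extends:
  assumes "real_polynomial_function g"
  shows "\<exists>p\<in>polys. \<forall>u. p (emb u) = of_real (g u)"
  using assms
proof (induction rule: real_polynomial_function.induct)
  case (linear g)
  have "g u = (\<Sum>i\<in>UNIV. g (axis i 1) * u $ i)" for u :: "real^3"
  proof -
    have l: "linear g" using linear by (simp add: linear_conv_bounded_linear)
    have "u = (\<Sum>i\<in>UNIV. u $ i *\<^sub>R axis i 1)"
      by (simp add: Finite_Cartesian_Product.vec_eq_iff axis_def if_distrib[of "\<lambda>x. _ * x"] cong: if_cong)
    then have "g u = g (\<Sum>i\<in>UNIV. u $ i *\<^sub>R axis i 1)" by simp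
    also have "\<dots> = (\<Sum>i\<in>UNIV. u $ i * g (axis i 1))"
      by (simp add: linear_sum[OF l] linear_scale[OF l])
    finally show ?thesis by (simp add: mult.commute)
  qed
  then have g_sum: "complex_of_real (g u) = of_real (\<Sum>i\<in>UNIV. g (axis i 1) * u $ i)" for u
    by (rule arg_cong)
  have "\<forall>u. (\<Sum>i\<in>UNIV. of_real (g (axis i 1)) * emb u $ i) = complex_of_real (g u)"
  proof
    fix u
    show "(\<Sum>i\<in>UNIV. of_real (g (axis i 1)) * emb u $ i) = complex_of_real (g u)"
      by (subst g_sum) (simp only: of_real_sum of_real_mult emb_nth)
  qed
  then show ?case using polys_linear_form[of "\<lambda>i. of_real (g (axis i 1))"] by (rule bexI)
next
  case (const c) then show ?case by (intro bexI[OF _ polys_const[of "of_real c"]]) simp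
next
  case (add f g)
  then obtain p q where "p \<in> polys" "q \<in> polys" "\<forall>u. p (emb u) = of_real (f u)" "\<forall>u. q (emb u) = of_real (g u)" by blast
  then show ?case by (intro bexI[OF _ polys_add[of p q]]) auto
next
  case (mult f g)
  then obtain p q where "p \<in> polys" "q \<in> polys" "\<forall>u. p (emb u) = of_real (f u)" "\<forall>u. q (emb u) = of_real (g u)" by blast
  then show ?case by (intro bexI[OF _ polys_mult[of p q]]) auto
qed

lemma polys_dense:
  assumes f: "f \<in> ellcont" and "\<epsilon> > 0"
  shows "\<exists>p\<in>polys. \<forall>v\<in>ellipsoid A. cmod (f v - p v) < \<epsilon>"
proof -
  have "continuous_on (sphere 0 1) (\<lambda>u. f (ellipsoid_point u))" by (rule ellcont_ellipsoid_point[OF f])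
  then obtain g :: "real^3 \<Rightarrow> complex" where g: "polynomial_function g"
    "\<And>u. u \<in> sphere 0 1 \<Longrightarrow> norm (f (ellipsoid_point u) - g u) < \<epsilon>"
    using Stone_Weierstrass_polynomial_function[OF compact_sphere _ assms(2)] by metis
  have "real_polynomial_function (\<lambda>u. Re (g u))" "real_polynomial_function (\<lambda>u. Im (g u))"
    using g(1) bounded_linear_Re bounded_linear_Im unfolding polynomial_function_def o_def by blast+
  then obtain p q where p: "p \<in> polys" "\<And>u. p (emb u) = of_real (Re (g u))"
    and q: "q \<in> polys" "\<And>u. q (emb u) = of_real (Im (g u))"
    using real_polynomial_function_extends by meson
  define r where "r = (\<lambda>v. p (v v* A) + \<i> * q (v v* A))"
  have "r \<in> polys" unfolding r_def by (intro polys_add polys_cmult polys_subst p q)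
  moreover have "r (ellipsoid_point u) = g u" for u by (simp add: r_def p q complex_eq[symmetric])
  ultimately show ?thesis using g(2) by (intro bexI[of _ r]) (auto simp: ellipsoid_eq)
qed

text \<open>
  A uniformly close polynomial is, on the ellipsoid, a sum of harmonic forms, and the Fourier sums
  are better approximations.
\<close>

lemma fourier_converges:
  assumes f: "f \<in> ellcont"
  shows "(\<lambda>d. L2norm A (\<lambda>v. fsum f d v - f v)) \<longlonglongrightarrow> 0"
proof (rule LIMSEQ_I)
  fix e :: real assume e: "0 < e"
  define C where "C = sqrt (measure sphere_measure (sphere 0 1))"
  have C: "C \<ge> 0" by (simp add: C_def)
  define \<epsilon> where "\<epsilon> = e / (C + 1)"
  have \<epsilon>: "\<epsilon> > 0" "\<epsilon> * C < e" using e C by (auto simp: \<epsilon>_def field_simps)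
  obtain p where p: "p \<in> polys" "\<And>v. v \<in> ellipsoid A \<Longrightarrow> cmod (f v - p v) < \<epsilon>"
    using polys_dense[OF f \<epsilon>(1)] by blast
  obtain N hs where hs: "\<And>i. hs i \<in> Har A i" "\<And>v. v \<in> ellipsoid A \<Longrightarrow> p v = (\<Sum>i\<le>N. hs i v)"
    using harmonic_decomposition[OF p(1)] by blast
  have "L2norm A (\<lambda>v. fsum f d v - f v) < e" if "N \<le> d" for d
  proof -
    have "L2norm A (\<lambda>v. fsum f d v - f v) = L2norm A (\<lambda>v. f v - fsum f d v)" by (rule L2norm_minus_commute)
    also have "\<dots> \<le> L2norm A (\<lambda>v. f v - (\<Sum>i\<le>N. hs i v))"
      by (rule best_approximation[OF f hs(1) that])
    also have "\<dots> \<le> \<epsilon> * C" unfolding C_def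
    proof (rule L2norm_bound)
      show "(\<lambda>v. f v - (\<Sum>i\<le>N. hs i v)) \<in> ellcont"
        by (intro ellcont_diff f ellcont_sum Har_ellcont[OF hs(1)])
      show "cmod (f v - (\<Sum>i\<le>N. hs i v)) \<le> \<epsilon>" if "v \<in> ellipsoid A" for v
        using p(2)[OF that] hs(2)[OF that] by simp
    qed
    also have "\<dots> < e" by (rule \<epsilon>)
    finally show ?thesis .
  qed
  then show "\<exists>no. \<forall>n\<ge>no. norm (L2norm A (\<lambda>v. fsum f n v - f v) - 0) < e"
    using L2norm_nonneg by auto
qed

lemma bessel:
  assumes f: "f \<in> ellcont"
  shows "summable (\<lambda>k. (L2norm A (fourier A k f))\<^sup>2)"
proof (rule summableI_nonneg_bounded)
  have fi: "fourier A k f \<in> ellcont" for k by (rule fourier_ellcont[OF f])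
  have s: "(L2norm A (fsum f d))\<^sup>2 = (\<Sum>k\<le>d. (L2norm A (fourier A k f))\<^sup>2)" for d
  proof (induction d)
    case 0 then show ?case by (simp add: fsum_def)
  next
    case (Suc d)
    have "herm A (fsum f d) (fourier A (Suc d) f) = 0"
      unfolding fsum_def by (subst herm_Har_sum) (auto intro: fourier_Har f)
    then have "(L2norm A (\<lambda>v. fsum f d v + fourier A (Suc d) f v))\<^sup>2
       = (L2norm A (fsum f d))\<^sup>2 + (L2norm A (fourier A (Suc d) f))\<^sup>2"
      by (intro pythagoras fsum_ellcont fi f)
    then show ?case using Suc by (simp add: fsum_def)
  qed
  fix n
  have "(\<Sum>k<n. (L2norm A (fourier A k f))\<^sup>2) \<le> (\<Sum>k\<le>n. (L2norm A (fourier A k f))\<^sup>2)"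
    by (intro sum_mono2) auto
  also have "\<dots> = (L2norm A (fsum f n))\<^sup>2" by (simp add: s)
  also have "\<dots> \<le> (L2norm A f)\<^sup>2"
  proof -
    have "herm A (\<lambda>v. f v - fsum f n v) (fsum f n) = 0"
    proof -
      have "herm A (fsum f n) (\<lambda>v. f v - fsum f n v) = (\<Sum>k\<le>n. herm A (fourier A k f) (\<lambda>v. f v - fsum f n v))"
        unfolding fsum_def[of f n]
        by (rule herm_sum_left) (auto intro!: fi ellcont_diff f ellcont_sum)
      also have "\<dots> = 0"
        using fsum_orth[OF f fourier_Har[OF f]] herm_cnj by (intro sum.neutral) (metis (no_types, lifting) atMost_iff complex_cnj_zero)
      finally show ?thesis by (simp add: herm_cnj[of _ "fsum f n"])
    qed
    then have "(L2norm A (\<lambda>v. (f v - fsum f n v) + fsum f n v))\<^sup>2 = (L2norm A (\<lambda>v. f v - fsum f n v))\<^sup>2 + (L2norm A (fsum f n))\<^sup>2"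
      by (intro pythagoras ellcont_diff f fsum_ellcont)
    then show ?thesis by simp
  qed
  finally show "(\<Sum>k<n. (L2norm A (fourier A k f))\<^sup>2) \<le> (L2norm A f)\<^sup>2" .
qed simp

text \<open>
  The product with a harmonic form of degree \<open>k\<close> is continuous in the mean and annihilates all
  summands but \<open>hs k\<close>.
\<close>

lemma fourier_unique:
  assumes f: "f \<in> ellcont" and hs: "\<And>i. hs i \<in> Har A i"
    and lim: "(\<lambda>d. L2norm A (\<lambda>v. (\<Sum>i\<le>d. hs i v) - f v)) \<longlonglongrightarrow> 0"
  shows "fourier A k f = hs k"
proof (rule fourier_eqI[OF f hs])
  fix h assume h: "h \<in> Har A k"
  note C = Har_ellcont[OF h] Har_ellcont[OF hs] f
  have e: "herm A (\<lambda>v. f v - hs k v) h = - herm A (\<lambda>v. (\<Sum>i\<le>d. hs i v) - f v) h" if "k \<le> d" for d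
    using that herm_Har_sum[OF hs h, of d] by (simp add: herm_diff_left C ellcont_sum)
  have "(\<lambda>d. L2norm A (\<lambda>v. (\<Sum>i\<le>d. hs i v) - f v) * L2norm A h) \<longlonglongrightarrow> 0 * L2norm A h"
    by (intro tendsto_mult lim tendsto_const)
  then have "(\<lambda>d. L2norm A (\<lambda>v. (\<Sum>i\<le>d. hs i v) - f v) * L2norm A h) \<longlonglongrightarrow> 0" by simp
  moreover have "\<forall>\<^sub>F d in sequentially. cmod (herm A (\<lambda>v. f v - hs k v) h)
      \<le> L2norm A (\<lambda>v. (\<Sum>i\<le>d. hs i v) - f v) * L2norm A h"
    using eventually_ge_at_top[of k]
  proof eventually_elim
    case (elim d)
    have "(\<lambda>v. (\<Sum>i\<le>d. hs i v) - f v) \<in> ellcont" by (intro ellcont_diff ellcont_sum C)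
    from cauchy_schwarz[OF this C(1)] show ?case unfolding e[OF elim] by simp
  qed
  ultimately have "cmod (herm A (\<lambda>v. f v - hs k v) h) \<le> 0"
    by (intro tendsto_lowerbound[of _ 0 sequentially]) auto
  then show "herm A (\<lambda>v. f v - hs k v) h = 0" by simp
qed

lemma L2_limit_unique:
  assumes f: "f \<in> ellcont" and g: "g \<in> ellcont" and P: "\<And>d. P d \<in> ellcont"
    and "(\<lambda>d. L2norm A (\<lambda>v. P d v - f v)) \<longlonglongrightarrow> 0" "(\<lambda>d. L2norm A (\<lambda>v. P d v - g v)) \<longlonglongrightarrow> 0"
    and v: "v \<in> ellipsoid A"
  shows "f v = g v"
proof -
  have "(\<lambda>d. L2norm A (\<lambda>v. P d v - f v) + L2norm A (\<lambda>v. P d v - g v)) \<longlonglongrightarrow> 0 + 0"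
    by (intro tendsto_add assms)
  then have l: "(\<lambda>d. L2norm A (\<lambda>v. P d v - f v) + L2norm A (\<lambda>v. P d v - g v)) \<longlonglongrightarrow> 0" by simp
  have "L2norm A (\<lambda>v. f v - g v) \<le> L2norm A (\<lambda>v. P d v - f v) + L2norm A (\<lambda>v. P d v - g v)" for d
  proof -
    have "L2norm A (\<lambda>v. (f v - P d v) + (P d v - g v)) \<le> L2norm A (\<lambda>v. f v - P d v) + L2norm A (\<lambda>v. P d v - g v)"
      by (intro L2norm_triangle ellcont_diff assms)
    then show ?thesis by (simp add: L2norm_minus_commute[of f])
  qed
  then have "L2norm A (\<lambda>v. f v - g v) \<le> 0"
    by (intro tendsto_lowerbound[OF l]) auto
  then have "L2norm A (\<lambda>v. f v - g v) = 0" using L2norm_nonneg[of "\<lambda>v. f v - g v"] by simp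
  then show ?thesis using L2norm_zero_iff[OF ellcont_diff[OF f g]] v by auto
qed

end

section \<open>Holomorphic functions on the quadric\<close>

lemma polys_has_derivative:
  "p \<in> polys \<Longrightarrow> \<exists>D. (p has_derivative D) (at x) \<and> (\<forall>c v. D (c *s v) = c * D v)"
proof (induction rule: polys_induct)
  case (const c) then show ?case by (intro exI[of _ "\<lambda>v. 0"]) auto
next
  case (coord i) then show ?case
    by (intro exI[of _ "\<lambda>v. v $ i"]) (auto intro!: bounded_linear_imp_has_derivative bounded_linear_vec_nth)
next
  case (add p q)
  then obtain D E where "(p has_derivative D) (at x)" "(q has_derivative E) (at x)"
    "\<forall>c v. D (c *s v) = c * D v" "\<forall>c v. E (c *s v) = c * E v" by blast
  then show ?case
    by (intro exI[of _ "\<lambda>v. D v + E v"]) (auto intro!: derivative_eq_intros simp: distrib_left)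
next
  case (mult p q)
  then obtain D E where "(p has_derivative D) (at x)" "(q has_derivative E) (at x)"
    "\<forall>c v. D (c *s v) = c * D v" "\<forall>c v. E (c *s v) = c * E v" by blast
  then show ?case
    by (intro exI[of _ "\<lambda>v. p x * E v + D v * q x"]) (auto intro!: derivative_eq_intros simp: algebra_simps)
qed

lemma polys_holo: "p \<in> polys \<Longrightarrow> p \<in> holo_on_variety S"
proof -
  assume "p \<in> polys"
  then have "holomorphic3_on p UNIV" unfolding holomorphic3_on_def using polys_has_derivative by blast
  then show ?thesis unfolding holo_on_variety_def by blast
qed

text \<open>
  Local extensions to the ambient space make the chain rule available, although \<open>f\<close> matters only
  on \<open>S\<close>.
\<close>

lemma holo_on_variety_curve:
  assumes f: "f \<in> holo_on_variety S" and \<gamma>: "\<And>z. \<gamma> z \<in> S"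
    and d: "\<And>z i. ((\<lambda>t. \<gamma> t $ i) has_field_derivative \<gamma>' z $ i) (at z)"
  shows "(\<lambda>z. f (\<gamma> z)) holomorphic_on UNIV"
proof -
  have dv: "(\<gamma> has_derivative (\<lambda>h. h *s \<gamma>' z)) (at z)" for z
  proof -
    have "((\<lambda>t. \<gamma> t $ i) has_derivative (\<lambda>h. h * \<gamma>' z $ i)) (at z)" for i
      using d by (simp add: has_field_derivative_def mult_commute_abs)
    then have "((\<lambda>t. \<gamma> t $ i \<bullet> b) has_derivative (\<lambda>h. (h * \<gamma>' z $ i) \<bullet> b)) (at z)" for i b
      by (rule has_derivative_inner_left)
    then show ?thesis
      unfolding has_derivative_componentwise_within[of \<gamma>] by (auto simp: Basis_vec_def inner_axis)
  qed
  have "\<exists>f'. ((\<lambda>z. f (\<gamma> z)) has_field_derivative f') (at z)" for z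
  proof -
    obtain U g where U: "open U" "\<gamma> z \<in> U" "holomorphic3_on g U" "\<And>v. v \<in> S \<inter> U \<Longrightarrow> f v = g v"
      using f \<gamma>[of z] unfolding holo_on_variety_def by blast
    obtain D where D: "(g has_derivative D) (at (\<gamma> z))" "\<And>c v. D (c *s v) = c * D v"
      using U(2,3) unfolding holomorphic3_on_def by blast
    have "((\<lambda>t. g (\<gamma> t)) has_derivative (\<lambda>h. D (h *s \<gamma>' z))) (at z)"
      by (rule has_derivative_compose[OF dv D(1)])
    then have 1: "((\<lambda>t. g (\<gamma> t)) has_field_derivative D (\<gamma>' z)) (at z)"
      by (simp add: has_field_derivative_def D(2) mult_commute_abs)
    have cont: "continuous_on UNIV \<gamma>"
      by (intro continuous_at_imp_continuous_on ballI) (rule has_derivative_continuous[OF dv])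
    have o: "open (\<gamma> -` U)" using U(1) cont by (simp add: open_vimage)
    have "((\<lambda>t. f (\<gamma> t)) has_field_derivative D (\<gamma>' z)) (at z)"
      by (rule has_field_derivative_transform_within_open[OF 1 o]) (use U \<gamma> in auto)
    then show ?thesis by blast
  qed
  then show ?thesis unfolding holomorphic_on_def field_differentiable_def
    using has_field_derivative_at_within by blast
qed

context ellipsoid_form
begin

lemma holo_ellcont:
  assumes f: "f \<in> holo_on_variety (quadric Q)" shows "f \<in> ellcont"
  unfolding ellcont_def mem_Collect_eq continuous_on_def
proof
  fix p assume p: "p \<in> ellipsoid A"
  then have pq: "p \<in> quadric Q" using ellipsoid_subset_quadric by blast
  obtain U g where U: "open U" "p \<in> U" "holomorphic3_on g U" "\<And>v. v \<in> quadric Q \<inter> U \<Longrightarrow> f v = g v"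
    using f pq unfolding holo_on_variety_def by blast
  obtain D where "(g has_derivative D) (at p)" using U(2,3) unfolding holomorphic3_on_def by blast
  then have "isCont g p" using has_derivative_continuous by blast
  then have g: "(g \<longlongrightarrow> g p) (at p within ellipsoid A)"
    unfolding isCont_def using tendsto_within_subset by blast
  have "\<forall>\<^sub>F v in at p within ellipsoid A. g v = f v"
    unfolding eventually_at_topological
    by (rule exI[of _ U]) (use U ellipsoid_subset_quadric in auto)
  then have "(f \<longlongrightarrow> g p) (at p within ellipsoid A)" by (rule Lim_transform_eventually[OF g])
  then show "(f \<longlongrightarrow> f p) (at p within ellipsoid A)" using U(2,4) pq by simp
qed

text \<open>
  Write a point of the quadric, in the coordinates \<open>v v* A\<close>, as \<open>a + \<i> b\<close> with real \<open>a\<close>, \<open>b\<close>. Then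
  \<open>a \<bullet> b = 0\<close> and \<open>\<bar>a\<bar>\<^sup>2 = 1 + \<bar>b\<bar>\<^sup>2\<close>, so the point is \<open>cos z e\<^sub>1 + sin z e\<^sub>2\<close> for orthonormal
  real vectors and imaginary \<open>z\<close>. Along this curve \<open>f\<close> and \<open>g\<close> are entire functions of \<open>z\<close> that
  agree for real \<open>z\<close>.
\<close>

lemma holo_determined_by_ellipsoid:
  assumes f: "f \<in> holo_on_variety (quadric Q)" and g: "g \<in> holo_on_variety (quadric Q)"
    and eq: "\<And>v. v \<in> ellipsoid A \<Longrightarrow> f v = g v" and v: "v \<in> quadric Q"
  shows "f v = g v"
proof -
  define u where "u = v v* A"
  have u1: "(\<Sum>i\<in>UNIV. (u $ i)\<^sup>2) = 1" using v by (simp add: quadric_def Q_eq u_def)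
  define a b where "a = (\<chi> i. Re (u $ i))" and "b = (\<chi> i. Im (u $ i))"
  have uab: "u = emb a + \<i> *s emb b"
    by (simp add: Finite_Cartesian_Product.vec_eq_iff a_def b_def complex_eq)
  have dots: "x \<bullet> y = (\<Sum>i\<in>UNIV. x $ i * y $ i)" for x y :: "real^3"
    by (simp add: inner_vec_def)
  have "Re (\<Sum>i\<in>UNIV. (u $ i)\<^sup>2) = a \<bullet> a - b \<bullet> b" "Im (\<Sum>i\<in>UNIV. (u $ i)\<^sup>2) = 2 * (a \<bullet> b)"
    by (simp_all add: dots a_def b_def power2_eq_square sum_subtractf sum_distrib_left mult.commute)
  then have ab: "a \<bullet> a = 1 + b \<bullet> b" "a \<bullet> b = 0" using u1 by simp_all
  define s where "s = norm b"
  have na: "(norm a)\<^sup>2 = 1 + s\<^sup>2" using ab(1) by (simp add: s_def power2_norm_eq_inner)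
  have na0: "norm a > 0"
  proof (rule ccontr)
    assume "\<not> 0 < norm a"
    then have "(norm a)\<^sup>2 = 0" by simp
    then show False using na zero_le_power2[of s] by linarith
  qed
  show ?thesis
  proof (cases "s = 0")
    case True
    then have "u = emb a" by (simp add: uab s_def Finite_Cartesian_Product.vec_eq_iff)
    then have "v = ellipsoid_point a" by (metis ellipsoid_point_def u_def v_A_inv(1))
    moreover have "norm a = 1" using na True by (simp add: power2_eq_1_iff) (use na0 in linarith)
    ultimately show ?thesis by (intro eq) (auto simp: ellipsoid_eq)
  next
    case False
    then have s0: "s > 0" by (simp add: s_def)
    define e1 e2 where "e1 = a /\<^sub>R norm a" and "e2 = b /\<^sub>R s"
    have e: "e1 \<bullet> e1 = 1" "e2 \<bullet> e2 = 1" "e1 \<bullet> e2 = 0"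
      using na0 s0 by (simp_all add: e1_def e2_def s_def ab flip: power2_norm_eq_inner)
    define \<gamma> where "\<gamma> z = (cos z *s emb e1 + sin z *s emb e2) v* matrix_inv A" for z
    define \<gamma>' where "\<gamma>' z = ((- sin z) *s emb e1 + cos z *s emb e2) v* matrix_inv A" for z
    have emb_dot: "(\<Sum>i\<in>UNIV. emb x $ i * emb y $ i) = of_real (x \<bullet> y)" for x y
      by (simp add: dots)
    have square_expand: "(c * x + s * y)\<^sup>2 = c\<^sup>2 * (x * x) + s\<^sup>2 * (y * y) + 2 * c * s * (x * y)" for c s x y :: complex
      by (simp add: power2_eq_square algebra_simps)
    have Q\<gamma>: "\<gamma> z \<in> quadric Q" for z
    proof -
      have "Q (\<gamma> z) = (\<Sum>i\<in>UNIV. (cos z * emb e1 $ i + sin z * emb e2 $ i)\<^sup>2)"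
        by (simp add: Q_eq \<gamma>_def)
      also have "\<dots> = (\<Sum>i\<in>UNIV. (cos z)\<^sup>2 * (emb e1 $ i * emb e1 $ i) + (sin z)\<^sup>2 * (emb e2 $ i * emb e2 $ i)
          + 2 * cos z * sin z * (emb e1 $ i * emb e2 $ i))"
        by (simp only: square_expand)
      also have "\<dots> = (cos z)\<^sup>2 * (\<Sum>i\<in>UNIV. emb e1 $ i * emb e1 $ i) + (sin z)\<^sup>2 * (\<Sum>i\<in>UNIV. emb e2 $ i * emb e2 $ i)
          + 2 * cos z * sin z * (\<Sum>i\<in>UNIV. emb e1 $ i * emb e2 $ i)"
        by (simp only: sum.distrib sum_distrib_left)
      also have "\<dots> = 1" unfolding emb_dot e by simp
      finally show ?thesis by (simp add: quadric_def)
    qed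
    have d: "((\<lambda>t. \<gamma> t $ i) has_field_derivative \<gamma>' z $ i) (at z)" for z i
      unfolding \<gamma>_def \<gamma>'_def vector_matrix_mult_nth by (auto intro!: derivative_eq_intros sum.cong)
    have \<gamma>r: "\<gamma> (of_real x) \<in> ellipsoid A" for x
    proof -
      have "norm (cos x *\<^sub>R e1 + sin x *\<^sub>R e2) = 1"
        unfolding norm_eq_1 by (simp add: inner_add_left inner_add_right e inner_commute[of e2 e1] flip: power2_eq_square)
      moreover have "cos (complex_of_real x) *s emb e1 + sin (complex_of_real x) *s emb e2 = emb (cos x *\<^sub>R e1 + sin x *\<^sub>R e2)"
        by (simp add: Finite_Cartesian_Product.vec_eq_iff cos_of_real sin_of_real)
      ultimately show ?thesis by (auto simp: ellipsoid_eq \<gamma>_def ellipsoid_point_def)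
    qed
    \<comment> \<open>\<open>cos z\<close> and \<open>sin z\<close> are \<open>cosh (arsinh s)\<close> and \<open>\<i> sinh (arsinh s)\<close>, that is \<open>norm a\<close> and
      \<open>\<i> s\<close>\<close>
    define z where "z = \<i> * of_real (arsinh s)"
    have c: "cos z = of_real (norm a)"
    proof -
      have "cosh (arsinh s) = norm a"
        using na na0 by (simp add: cosh_arsinh_real add.commute real_sqrt_unique)
      moreover have "cos z = of_real (cosh (arsinh s))"
        by (simp add: z_def flip: cosh_conv_cos) (simp add: cosh_field_def exp_of_real flip: exp_minus of_real_minus)
      ultimately show ?thesis by simp
    qed
    have sn: "sin z = \<i> * of_real s"
    proof -
      have "sinh (complex_of_real (arsinh s)) = of_real (sinh (arsinh s))"
        by (simp only: sinh_field_def exp_of_real flip: of_real_minus) simp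
      then have "- \<i> * sin z = of_real s" by (simp add: z_def sinh_conv_sin)
      then have "\<i> * (- \<i> * sin z) = \<i> * of_real s" by (simp only:)
      then show ?thesis by (simp only: mult.assoc[symmetric]) simp
    qed
    have cancel: "complex_of_real x * (inverse (complex_of_real x) * y) = y" if "x > 0" for x y
      using that by simp
    have "cos z *s emb e1 + sin z *s emb e2 = u"
      by (simp add: c sn uab Finite_Cartesian_Product.vec_eq_iff e1_def e2_def mult.assoc cancel[OF na0] cancel[OF s0])
    then have \<gamma>z: "\<gamma> z = v" by (simp add: \<gamma>_def u_def)
    have "(\<lambda>z. f (\<gamma> z) - g (\<gamma> z)) z = 0"
      by (rule entire_zero_on_reals)
        (auto intro!: holomorphic_on_diff holo_on_variety_curve[OF f Q\<gamma> d] holo_on_variety_curve[OF g Q\<gamma> d] simp: eq \<gamma>r)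
    then show ?thesis by (simp add: \<gamma>z)
  qed
qed

lemma herm_uniform_limit:
  assumes F: "\<And>t. t \<in> T \<Longrightarrow> F t \<in> ellcont" and f: "f \<in> ellcont" and e: "e \<in> ellcont"
    and lim: "uniform_limit (ellipsoid A) F f net" and T: "\<forall>\<^sub>F t in net. t \<in> T"
  shows "((\<lambda>t. herm A (F t) e) \<longlongrightarrow> herm A f e) net"
proof (rule tendstoI)
  fix r :: real assume r: "0 < r"
  define C where "C = sqrt (measure sphere_measure (sphere 0 1)) * L2norm A e"
  have C: "C \<ge> 0" by (simp add: C_def L2norm_nonneg)
  define \<epsilon> where "\<epsilon> = r / (C + 1)"
  have \<epsilon>: "\<epsilon> > 0" "\<epsilon> * C < r" using r C by (auto simp: \<epsilon>_def field_simps)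
  have "\<forall>\<^sub>F t in net. \<forall>v\<in>ellipsoid A. dist (F t v) (f v) < \<epsilon>"
    using lim \<epsilon>(1) unfolding uniform_limit_iff by blast
  with T show "\<forall>\<^sub>F t in net. dist (herm A (F t) e) (herm A f e) < r"
  proof eventually_elim
    case (elim t)
    have D: "(\<lambda>v. F t v - f v) \<in> ellcont" by (intro ellcont_diff F f elim)
    have "dist (herm A (F t) e) (herm A f e) = cmod (herm A (\<lambda>v. F t v - f v) e)"
      by (simp add: dist_norm herm_diff_left F elim f e)
    also have "\<dots> \<le> L2norm A (\<lambda>v. F t v - f v) * L2norm A e" by (rule cauchy_schwarz[OF D e])
    also have "\<dots> \<le> (\<epsilon> * sqrt (measure sphere_measure (sphere 0 1))) * L2norm A e"
      using elim by (intro mult_right_mono L2norm_bound D L2norm_nonneg) (auto simp: dist_norm less_imp_le)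
    also have "\<dots> < r" using \<epsilon>(2) by (simp add: C_def mult.assoc)
    finally show ?case .
  qed
qed

lemma fourier_uniform_limit:
  assumes F: "\<And>t. t \<in> T \<Longrightarrow> F t \<in> ellcont" and f: "f \<in> ellcont"
    and lim: "uniform_limit (ellipsoid A) F f net" and T: "\<forall>\<^sub>F t in net. t \<in> T"
  shows "((\<lambda>t. fourier A k (F t) v) \<longlongrightarrow> fourier A k f v) net"
proof -
  obtain n e where e: "orthonormal_basis (Har A k) n e" using orthonormal_basis_exists[OF fun_subspace_Har Har_sub] by blast
  have eC: "e i \<in> ellcont" if "i < n" for i using e that Har_ellcont by (auto simp: orthonormal_basis_def)
  have fo: "fourier A k g = (\<lambda>v. \<Sum>i<n. herm A g (e i) * e i v)" if "g \<in> ellcont" for g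
    unfolding fourier_def by (rule orth_proj_orthonormal_basis[OF fun_subspace_Har Har_sub that e])
  have "((\<lambda>t. \<Sum>i<n. herm A (F t) (e i) * e i v) \<longlongrightarrow> (\<Sum>i<n. herm A f (e i) * e i v)) net"
    by (intro tendsto_sum tendsto_mult tendsto_const herm_uniform_limit[OF F f _ lim T]) (auto intro: eC)
  then show ?thesis unfolding fo[OF f]
    by (rule Lim_transform_eventually) (use T in \<open>eventually_elim, simp add: fo F\<close>)
qed

end

section \<open>Products of linear forms\<close>

definition lform :: "complex ^ 'n \<Rightarrow> complex ^ 'n \<Rightarrow> complex" where
  "lform a x = (\<Sum>i\<in>UNIV. a $ i * x $ i)"

lemma lform_add: "lform a (x + y) = lform a x + lform a y"
  by (simp add: lform_def distrib_left sum.distrib)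

lemma lform_scale: "lform a (c *s x) = c * lform a x"
  by (simp add: lform_def sum_distrib_left mult.left_commute)

lemma lform_scale_left: "lform (c *s a) x = c * lform a x"
  by (simp add: lform_def sum_distrib_left mult.assoc)

lemma lform_axis: "lform a (axis i 1) = a $ i"
proof -
  have "lform a (axis i 1) = (\<Sum>j\<in>UNIV. if j = i then a $ j else 0)"
    unfolding lform_def by (intro sum.cong) (auto simp: axis_def)
  then show ?thesis by simp
qed

lemma lform_zero: "lform 0 x = 0" by (simp add: lform_def)

lemma lform_nonzero: "a \<noteq> 0 \<Longrightarrow> \<exists>x. lform a x \<noteq> 0"
  using lform_axis by (metis Finite_Cartesian_Product.vec_eq_iff zero_index)

lemma lform_continuous: "continuous_on S (lform a)"
  unfolding lform_def by (intro continuous_intros)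

text \<open>
  A vector space over an infinite field is not a finite union of proper subspaces, applied to the
  kernel of \<open>a\<close>.
\<close>

lemma lforms_common_nonzero:
  assumes "\<And>b. b \<in> set bs \<Longrightarrow> \<exists>x. lform a x = 0 \<and> lform b x \<noteq> 0"
  shows "\<exists>x. lform a x = 0 \<and> (\<forall>b\<in>set bs. lform b x \<noteq> 0)"
  using assms
proof (induction bs)
  case Nil
  have "lform a 0 = 0" by (simp add: lform_def)
  then show ?case by (intro exI[of _ 0]) simp
next
  case (Cons b bs)
  obtain x where x: "lform a x = 0" "\<And>c. c \<in> set bs \<Longrightarrow> lform c x \<noteq> 0" using Cons by auto
  obtain y where y: "lform a y = 0" "lform b y \<noteq> 0" using Cons.prems by auto
  have "finite ((\<lambda>c. - lform c x / lform c y) ` set (b # bs))" by simp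
  \<comment> \<open>off finitely many parameters the point \<open>x + t *s y\<close> avoids all the hyperplanes\<close>
  then obtain t where t: "t \<notin> (\<lambda>c. - lform c x / lform c y) ` set (b # bs)"
    using ex_new_if_finite[OF infinite_UNIV_char_0[where 'a = complex]] by blast
  have "lform c (x + t *s y) \<noteq> 0" if c: "c \<in> set (b # bs)" for c
  proof
    assume z: "lform c (x + t *s y) = 0"
    then have z': "lform c x + t * lform c y = 0" by (simp add: lform_add lform_scale)
    show False
    proof (cases "lform c y = 0")
      case True
      then show False using z' x(2) y(2) c by auto
    next
      case False
      then have "t = - lform c x / lform c y" using z' by (simp add: field_simps eq_neg_iff_add_eq_0)
      then show False using t c by blast
    qed
  qed
  moreover have "lform a (x + t *s y) = 0" using x y by (simp add: lform_add lform_scale)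
  ultimately show ?case by blast
qed

lemma lforms_product_nonzero:
  assumes "0 \<notin> set bs" shows "\<exists>x. (\<Prod>b\<leftarrow>bs. lform b x) \<noteq> 0"
proof -
  have "\<exists>x. lform 0 x = 0 \<and> (\<forall>b\<in>set bs. lform b x \<noteq> 0)"
    by (rule lforms_common_nonzero) (use assms lform_nonzero lform_zero in metis)
  then obtain x where "\<forall>b\<in>set bs. lform b x \<noteq> 0" by blast
  then have "(\<Prod>b\<leftarrow>bs. lform b x) \<noteq> 0" by (induction bs) auto
  then show ?thesis by blast
qed

lemma lform_kernel_subset:
  assumes a: "a \<noteq> 0" and sub: "\<And>x. lform a x = 0 \<Longrightarrow> lform b x = 0"
  shows "\<exists>c. b = c *s a"
proof -
  obtain i where i: "a $ i \<noteq> 0" using a by (auto simp: Finite_Cartesian_Product.vec_eq_iff)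
  define c where "c = b $ i / a $ i"
  have "b $ j = c * a $ j" for j
  proof -
    have "lform a (a $ i *s axis j 1 + (- a $ j) *s axis i 1) = 0"
      unfolding lform_add lform_scale lform_axis by simp
    then have "lform b (a $ i *s axis j 1 + (- a $ j) *s axis i 1) = 0" by (rule sub)
    then have "a $ i * b $ j + (- a $ j) * b $ i = 0" unfolding lform_add lform_scale lform_axis .
    then have "a $ i * b $ j = b $ i * a $ j" by (simp add: mult.commute)
    then have "c * a $ j = (a $ i * b $ j) / a $ i" by (simp add: c_def)
    then show ?thesis using i by simp
  qed
  then show ?thesis by (intro exI[of _ c]) (simp add: Finite_Cartesian_Product.vec_eq_iff)
qed

text \<open>
  A linear form is prime: if no \<open>b\<close> is proportional to \<open>a\<close>, then the kernels of all of them cut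
  the kernel of \<open>a\<close> in proper subspaces, and \<open>lforms_common_nonzero\<close> applies.
\<close>

lemma lform_prime:
  assumes a: "a \<noteq> 0" and z: "\<And>x. lform a x = 0 \<Longrightarrow> (\<Prod>b\<leftarrow>bs. lform b x) = 0"
  shows "\<exists>b\<in>set bs. \<exists>c. b = c *s a"
proof (rule ccontr)
  assume no: "\<not> ?thesis"
  have "\<exists>x. lform a x = 0 \<and> (\<forall>b\<in>set bs. lform b x \<noteq> 0)"
    by (rule lforms_common_nonzero) (use no lform_kernel_subset[OF a] in metis)
  then obtain x where x: "lform a x = 0" "\<forall>b\<in>set bs. lform b x \<noteq> 0" by blast
  have "(\<Prod>b\<leftarrow>bs. lform b x) \<noteq> 0" using x(2) by (induction bs) auto
  then show False using z[OF x(1)] by simp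
qed

text \<open>
  Cancellation off the hyperplane is trivial, and continuity extends the equation to it.
  Continuity is also the only property of the cofactors that is available uniformly for
  polynomials in two and three variables.
\<close>

lemma lform_cancel:
  fixes f g :: "complex ^ 'n \<Rightarrow> complex"
  assumes a: "a \<noteq> 0" and f: "continuous_on UNIV f" and g: "continuous_on UNIV g"
    and eq: "\<And>x. lform a x * f x = lform a x * g x"
  shows "f = g"
proof
  fix x
  obtain w where w: "lform a w \<noteq> 0" using lform_nonzero[OF a] by blast
  show "f x = g x"
  proof (cases "lform a x = 0")
    case False then show ?thesis using eq by auto
  next
    case True
    have l: "continuous_on UNIV (\<lambda>t :: complex. x + t *s w)"
      by (simp add: vector_scalar_mult_def continuous_on_add continuous_on_vec_lambda continuous_on_mult_right)
    have "continuous_on UNIV (\<lambda>t. f (x + t *s w) - g (x + t *s w))"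
      by (intro continuous_on_diff continuous_on_compose2[OF f l] continuous_on_compose2[OF g l]) auto
    then have l1: "((\<lambda>t. f (x + t *s w) - g (x + t *s w)) \<longlongrightarrow> f (x + 0 *s w) - g (x + 0 *s w)) (at 0)"
      unfolding continuous_on_def by blast
    have "lform a (x + t *s w) \<noteq> 0" if "t \<noteq> 0" for t
      using that w True by (simp add: lform_add lform_scale)
    then have nz: "f (x + t *s w) = g (x + t *s w)" if "t \<noteq> 0" for t using eq that by (metis mult_left_cancel)
    have l2: "((\<lambda>t. f (x + t *s w) - g (x + t *s w)) \<longlongrightarrow> 0) (at 0)"
      by (rule tendsto_eventually) (auto simp: eventually_at_filter nz)
    have "f (x + 0 *s w) - g (x + 0 *s w) = 0" by (rule tendsto_unique[OF at_neq_bot l1 l2])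
    then show ?thesis by simp
  qed
qed

lemma lforms_product_continuous: "continuous_on S (\<lambda>x. \<Prod>a\<leftarrow>as. lform a x)"
  by (induction as) (auto intro!: continuous_intros lform_continuous)

text \<open>
  Induction with \<open>lform_prime\<close> and \<open>lform_cancel\<close>; the constant \<open>d\<close> is needed for the induction to
  pass to the cofactors.
\<close>

lemma lforms_unique_factorization:
  assumes "length as = length bs" "0 \<notin> set as" "0 \<notin> set bs" "d \<noteq> 0"
    and "\<And>x. (\<Prod>a\<leftarrow>as. lform a x) = d * (\<Prod>b\<leftarrow>bs. lform b x)"
  shows "\<exists>cs. mset cs = mset as \<and> list_all2 (\<lambda>c b. \<exists>r. r \<noteq> 0 \<and> b = r *s c) cs bs"
  using assms
proof (induction bs arbitrary: as d)
  case Nil then show ?case by simp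
next
  case (Cons b bs)
  have b0: "b \<noteq> 0" using Cons.prems by auto
  have "\<exists>a\<in>set as. \<exists>c. a = c *s b"
    by (rule lform_prime[OF b0]) (simp add: Cons.prems(5))
  then obtain a c where a: "a \<in> set as" "a = c *s b" by blast
  have "a \<noteq> 0" using a(1) Cons.prems(2) by metis
  then have c: "c \<noteq> 0" using a(2) by auto
  define as' where "as' = remove1 a as"
  have ms: "mset as = mset (a # as')" using a(1) by (simp add: as'_def)
  have pr: "(\<Prod>a\<leftarrow>as. lform a x) = lform a x * (\<Prod>a\<leftarrow>as'. lform a x)" for x
  proof -
    have "(\<Prod>a\<leftarrow>as. lform a x) = prod_mset (image_mset (\<lambda>a. lform a x) (mset as))"
      by (metis mset_map prod_mset_prod_list)
    also have "\<dots> = lform a x * (\<Prod>a\<leftarrow>as'. lform a x)"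
      unfolding ms by (simp flip: prod_mset_prod_list)
    finally show ?thesis .
  qed
  have "(\<lambda>x. \<Prod>a\<leftarrow>as'. lform a x) = (\<lambda>x. (d / c) * (\<Prod>b\<leftarrow>bs. lform b x))"
  proof (rule lform_cancel[OF b0])
    fix x
    have "c * (lform b x * (\<Prod>a\<leftarrow>as'. lform a x)) = d * (lform b x * (\<Prod>b\<leftarrow>bs. lform b x))"
      using Cons.prems(5)[of x] unfolding pr by (simp add: a(2) lform_scale_left mult.assoc)
    then show "lform b x * (\<Prod>a\<leftarrow>as'. lform a x) = lform b x * (d / c * (\<Prod>b\<leftarrow>bs. lform b x))"
      using c by (simp add: field_simps)
  qed (intro continuous_intros lforms_product_continuous)+
  moreover have "length as' = length bs" using Cons.prems(1) arg_cong[OF ms, of size] by simp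
  moreover have "0 \<notin> set as'" using Cons.prems(2) unfolding as'_def by (metis notin_set_remove1)
  ultimately obtain cs where cs: "mset cs = mset as'" "list_all2 (\<lambda>c b. \<exists>r. r \<noteq> 0 \<and> b = r *s c) cs bs"
    using Cons.IH[of as' "d / c"] Cons.prems c by (auto simp: fun_eq_iff)
  have "b = (1 / c) *s a" using c by (simp add: a(2) Finite_Cartesian_Product.vec_eq_iff)
  then show ?case using cs c ms by (intro exI[of _ "a # cs"]) (auto intro!: exI[of _ "1 / c"])
qed

section \<open>Multipoles as products\<close>

lemma hom_polys_1_iff: "p \<in> hom_polys 1 \<longleftrightarrow> (\<exists>a. p = lform a)"
proof
  assume p: "p \<in> hom_polys 1"
  have "cpartial i p = (\<lambda>v. cpartial i p 0)" for i
    using hom_polys_0 cpartial_hom[OF p, of i] by simp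
  then have "p v = (\<Sum>i\<in>UNIV. v $ i * cpartial i p 0)" for v
    using euler[OF p, of v] by (metis (no_types, lifting) mult_1 of_nat_1 sum.cong)
  then have "p = lform (\<chi> i. cpartial i p 0)" by (simp add: lform_def fun_eq_iff mult.commute)
  then show "\<exists>a. p = lform a" by blast
next
  assume "\<exists>a. p = lform a"
  then obtain a where p: "p = lform a" by blast
  have "lform a \<in> polys" using polys_linear_form[of "\<lambda>i. a $ i"] by (simp add: lform_def[abs_def])
  then show "p \<in> hom_polys 1" by (intro hom_polysI) (auto simp: p lform_scale)
qed

lemma form_tuples_lforms:
  "Ls \<in> form_tuples k \<longleftrightarrow> (\<exists>as. Ls = map lform as \<and> length as = k \<and> 0 \<notin> set as)"
proof
  assume L: "Ls \<in> form_tuples k"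
  then have "\<forall>L\<in>set Ls. \<exists>a. L = lform a \<and> a \<noteq> 0"
    using hom_polys_1_iff lform_zero unfolding form_tuples_def by fastforce
  then obtain g where g: "\<And>L. L \<in> set Ls \<Longrightarrow> L = lform (g L) \<and> g L \<noteq> 0" by metis
  have "Ls = map lform (map g Ls)" using g by (simp add: map_idI)
  moreover have "0 \<notin> set (map g Ls)" using g by auto
  ultimately show "\<exists>as. Ls = map lform as \<and> length as = k \<and> 0 \<notin> set as"
    using L by (intro exI[of _ "map g Ls"]) (simp add: form_tuples_def)
next
  assume "\<exists>as. Ls = map lform as \<and> length as = k \<and> 0 \<notin> set as"
  then obtain as where as: "Ls = map lform as" "length as = k" "0 \<notin> set as" by blast
  have "lform a \<in> hom_polys 1 - {\<lambda>v. 0}" if "a \<in> set as" for a :: "complex^3"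
    using hom_polys_1_iff lform_nonzero[of a] that as(3) by fastforce
  then show "Ls \<in> form_tuples k" using as by (auto simp: form_tuples_def)
qed

definition fprod :: "cfun3 list \<Rightarrow> cfun3" where
  "fprod Ls = (\<lambda>v. \<Prod>L\<leftarrow>Ls. L v)"

lemma fprod_lforms: "fprod (map lform as) = (\<lambda>v. \<Prod>a\<leftarrow>as. lform a v)"
  by (simp add: fprod_def o_def)

lemma fprod_nonzero: "Ls \<in> form_tuples k \<Longrightarrow> \<exists>v. fprod Ls v \<noteq> 0"
  unfolding form_tuples_lforms using fprod_lforms lforms_product_nonzero by metis

text \<open>
  Tuples are equivalent if and only if they have the same product. For the converse, unique
  factorization provides a permutation and factors \<open>c i\<close>; their product is \<open>1\<close> because the
  products of the tuples agree and are not zero.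
\<close>

lemma multipole_rel_iff:
  "(Ls, Ms) \<in> multipole_rel k \<longleftrightarrow> Ls \<in> form_tuples k \<and> Ms \<in> form_tuples k \<and> fprod Ls = fprod Ms"
proof
  assume "(Ls, Ms) \<in> multipole_rel k"
  then obtain \<sigma> c where LM: "Ls \<in> form_tuples k" "Ms \<in> form_tuples k" and \<sigma>: "\<sigma> permutes {..<k}"
    and c: "(\<Prod>i<k. c i) = 1" and e: "\<And>i. i < k \<Longrightarrow> Ms ! i = (\<lambda>v. c i * (Ls ! \<sigma> i) v)"
    unfolding multipole_rel_def by blast
  have len: "length Ls = k" "length Ms = k" using LM by (auto simp: form_tuples_def)
  have "fprod Ms v = fprod Ls v" for v
  proof -
    have "fprod Ms v = (\<Prod>i<k. (Ms ! i) v)"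
      by (simp add: fprod_def prod.list_conv_set_nth len atLeast0LessThan)
    also have "\<dots> = (\<Prod>i<k. c i) * (\<Prod>i<k. (Ls ! \<sigma> i) v)"
      using e by (simp add: prod.distrib)
    also have "(\<Prod>i<k. (Ls ! \<sigma> i) v) = (\<Prod>i<k. (Ls ! i) v)"
      using prod.permute[OF \<sigma>, of "\<lambda>i. (Ls ! i) v"] by (simp add: o_def)
    also have "\<dots> = fprod Ls v" by (simp add: fprod_def prod.list_conv_set_nth len atLeast0LessThan)
    finally show ?thesis using c by simp
  qed
  then show "Ls \<in> form_tuples k \<and> Ms \<in> form_tuples k \<and> fprod Ls = fprod Ms" using LM by auto
next
  assume *: "Ls \<in> form_tuples k \<and> Ms \<in> form_tuples k \<and> fprod Ls = fprod Ms"
  then obtain as bs where as: "Ls = map lform as" "length as = k" "0 \<notin> set as"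
    and bs: "Ms = map lform bs" "length bs = k" "0 \<notin> set bs" unfolding form_tuples_lforms by blast
  have pe: "(\<Prod>a\<leftarrow>as. lform a x) = 1 * (\<Prod>b\<leftarrow>bs. lform b x)" for x
    using * unfolding as bs fprod_lforms by (simp add: fun_eq_iff)
  obtain cs where cs: "mset cs = mset as" "list_all2 (\<lambda>c b. \<exists>r. r \<noteq> 0 \<and> b = r *s c) cs bs"
    using lforms_unique_factorization[OF _ as(3) bs(3) _ pe] as bs by auto
  obtain \<sigma> where \<sigma>: "\<sigma> permutes {..<length as}" "permute_list \<sigma> as = cs" using mset_eq_permutation[OF cs(1)] by blast
  have "\<forall>i<k. \<exists>r. r \<noteq> 0 \<and> bs ! i = r *s (cs ! i)"
    using cs(2) as(2) bs(2) by (auto simp: list_all2_conv_all_nth)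
  then obtain c where c: "\<And>i. i < k \<Longrightarrow> bs ! i = c i *s (cs ! i)" by metis
  have csn: "cs ! i = as ! \<sigma> i" if "i < k" for i
    using permute_list_nth[OF \<sigma>(1), of i] \<sigma>(2) that as(2) by simp
  have \<sigma>k: "\<sigma> i < k" if "i < k" for i using \<sigma>(1) that as(2) permutes_in_image by fastforce
  have e: "Ms ! i = (\<lambda>v. c i * (Ls ! \<sigma> i) v)" if "i < k" for i
    using that c[OF that] csn[OF that] \<sigma>k[OF that] as bs by (simp add: lform_scale_left fun_eq_iff)
  obtain v where v: "fprod Ls v \<noteq> 0" using fprod_nonzero * by blast
  have len: "length Ls = k" "length Ms = k" using as bs by auto
  have "fprod Ms v = (\<Prod>i<k. (Ms ! i) v)"
    by (simp add: fprod_def prod.list_conv_set_nth len atLeast0LessThan)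
  also have "\<dots> = (\<Prod>i<k. c i) * (\<Prod>i<k. (Ls ! \<sigma> i) v)"
    using e by (simp add: prod.distrib)
  also have "(\<Prod>i<k. (Ls ! \<sigma> i) v) = (\<Prod>i<k. (Ls ! i) v)"
    using prod.permute[OF \<sigma>(1)[unfolded as(2)], of "\<lambda>i. (Ls ! i) v"] by (simp add: o_def)
  also have "\<dots> = fprod Ls v" by (simp add: fprod_def prod.list_conv_set_nth len atLeast0LessThan)
  finally have "(\<Prod>i<k. c i) = 1" using v * by auto
  then show "(Ls, Ms) \<in> multipole_rel k"
    unfolding multipole_rel_def using * \<sigma>(1) as(2) e by auto
qed

definition form_class :: "nat \<Rightarrow> cfun3 list \<Rightarrow> multipole" where
  "form_class k Ls = Class_mp (multipole_rel k `` {Ls})"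

lemma multipoles_mp: "k \<noteq> 0 \<Longrightarrow> multipoles k = form_class k ` form_tuples k"
  unfolding multipoles_def form_class_def quotient_def by auto

lemma Theta_mp: "Ls \<in> form_tuples k \<Longrightarrow> Theta (form_class k Ls) = fprod Ls"
proof -
  assume L: "Ls \<in> form_tuples k"
  define X where "X = multipole_rel k `` {Ls}"
  have "Ls \<in> X" using L by (simp add: X_def multipole_rel_iff)
  have "(SOME Ls. Ls \<in> X) \<in> X" using \<open>Ls \<in> X\<close> by (rule someI)
  then have "(Ls, SOME Ls. Ls \<in> X) \<in> multipole_rel k" unfolding X_def by blast
  then have "fprod (SOME Ls. Ls \<in> X) = fprod Ls" unfolding multipole_rel_iff by metis
  then show ?thesis by (simp add: form_class_def X_def[symmetric]) (simp add: fprod_def)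
qed

text \<open>So multipoles may be identified with the products of linear forms that they represent.\<close>

lemma Theta_inj: "inj_on Theta (multipoles_bar k)"
proof (rule inj_onI)
  fix u w assume u: "u \<in> multipoles_bar k" and w: "w \<in> multipoles_bar k" and eq: "Theta u = Theta w"
  show "u = w"
  proof (cases "k = 0")
    case True
    then show ?thesis using u w eq by (auto simp: multipoles_bar_def multipoles_def fun_eq_iff)
  next
    case False
    have cases: "x = Zero_mp \<or> (\<exists>Ls\<in>form_tuples k. x = form_class k Ls)" if "x \<in> multipoles_bar k" for x
      using that multipoles_mp[OF False] by (auto simp: multipoles_bar_def)
    have nz: "Theta (form_class k Ls) \<noteq> (\<lambda>v. 0)" if "Ls \<in> form_tuples k" for Ls
      using fprod_nonzero[OF that] Theta_mp[OF that] by auto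
    have "form_class k Ls = form_class k Ms" if "Ls \<in> form_tuples k" "Ms \<in> form_tuples k" "fprod Ls = fprod Ms" for Ls Ms
      using that by (auto simp: form_class_def multipole_rel_iff)
    then show ?thesis using cases[OF u] cases[OF w] eq nz Theta_mp by (metis Theta.simps(1))
  qed
qed

lemma fprod_hom: "Ls \<in> form_tuples k \<Longrightarrow> fprod Ls \<in> hom_polys k"
proof (induction Ls arbitrary: k)
  case Nil
  then have "k = 0" by (simp add: form_tuples_def)
  then show ?case by (auto simp: fprod_def intro!: hom_polysI polys_const)
next
  case (Cons L Ls)
  then obtain j where k: "k = Suc j" "Ls \<in> form_tuples j" "L \<in> hom_polys 1" by (auto simp: form_tuples_def)
  then show ?case using hom_polys_mult[OF k(3) Cons.IH[OF k(2)]] by (simp add: fprod_def)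
qed

lemma Theta_hom:
  assumes "u \<in> multipoles_bar k" shows "Theta u \<in> hom_polys k"
proof (cases "k = 0")
  case True
  have "(\<lambda>v. c) \<in> hom_polys 0" for c by (rule hom_polysI) (auto intro: polys_const)
  then show ?thesis using assms True by (auto simp: multipoles_bar_def multipoles_def)
next
  case False
  then show ?thesis using assms fprod_hom Theta_mp
    by (auto simp: multipoles_bar_def multipoles_mp hom_polys_zero)
qed

section \<open>The null cone and its parametrization\<close>

text \<open>Restrict to the line through \<open>v\<close> and \<open>w\<close>: there \<open>b\<close> is entire and vanishes near \<open>w\<close>.\<close>

lemma polys_cancel_zero:
  assumes s: "s \<in> polys" and b: "b \<in> polys" and nz: "s w \<noteq> 0" and z: "\<And>v. s v * b v = 0"
  shows "b v = 0"
proof -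
  define \<gamma> where "\<gamma> = (\<lambda>z. v + z *s (w - v))"
  have hs: "(\<lambda>z. s (\<gamma> z)) holomorphic_on UNIV" and hb: "(\<lambda>z. b (\<gamma> z)) holomorphic_on UNIV"
    unfolding \<gamma>_def by (rule polys_line_holomorphic[OF s], rule polys_line_holomorphic[OF b])
  have c: "continuous_on UNIV (\<lambda>z. s (\<gamma> z))" using hs by (rule holomorphic_on_imp_continuous_on)
  have g1: "\<gamma> 1 = w" "\<gamma> 0 = v" by (simp_all add: \<gamma>_def)
  define U where "U = (\<lambda>z. s (\<gamma> z)) -` (- {0})"
  have o: "open U" unfolding U_def by (rule open_vimage[OF _ c]) auto
  have 1: "1 \<in> U" using nz g1 by (simp add: U_def)
  have "b (\<gamma> 0) = 0"
  proof (rule analytic_continuation_open[of U UNIV "\<lambda>z. b (\<gamma> z)" "\<lambda>z. 0"])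
    show "b (\<gamma> z) = 0" if "z \<in> U" for z using z[of "\<gamma> z"] that by (auto simp: U_def)
  qed (use o 1 hb in auto)
  then show ?thesis by (simp add: g1)
qed

text \<open>
  Division with remainder with respect to the last variable: \<open>a\<close> and \<open>b\<close> are the coefficients of
  the remainder, and do not depend on that variable.
\<close>

definition sum_squares_division :: "cfun3 \<Rightarrow> cfun3 \<Rightarrow> cfun3 \<Rightarrow> cfun3 \<Rightarrow> bool" where
  "sum_squares_division q r a b \<longleftrightarrow>
     (\<forall>u. q u = (\<Sum>i\<in>UNIV. (u $ i)\<^sup>2) * r u + a u + u $ 3 * b u) \<and>
     (\<forall>u w. u $ 1 = w $ 1 \<longrightarrow> u $ 2 = w $ 2 \<longrightarrow> a u = a w \<and> b u = b w) \<and>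
     r \<in> polys \<and> a \<in> polys \<and> b \<in> polys"

lemma sum_squares_divisionD:
  assumes "sum_squares_division q r a b"
  shows "r \<in> polys" "a \<in> polys" "b \<in> polys"
    "q u = (\<Sum>i\<in>UNIV. (u $ i)\<^sup>2) * r u + a u + u $ 3 * b u"
    "u $ 1 = w $ 1 \<Longrightarrow> u $ 2 = w $ 2 \<Longrightarrow> a u = a w \<and> b u = b w"
  using assms unfolding sum_squares_division_def by blast+

text \<open>
  In a product of two remainders the square of the last variable is replaced by the sum of squares
  minus the squares of the other two.
\<close>

lemma polys_divide_sum_squares:
  assumes "q \<in> polys"
  shows "\<exists>r a b. sum_squares_division q r a b"
  using assms
proof (induction rule: polys_induct)
  case (const c)
  then show ?case
    by (intro exI[of _ "\<lambda>u. 0"] exI[of _ "\<lambda>u. c"]) (auto simp: sum_squares_division_def intro: polys_const)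
next
  case (coord i)
  show ?case
  proof (cases "i = 3")
    case True
    then show ?thesis
      by (intro exI[of _ "\<lambda>u. 0"] exI[of _ "\<lambda>u. 1"]) (auto simp: sum_squares_division_def intro: polys_const)
  next
    case False
    then have "i = 1 \<or> i = 2" using exhaust_3[of i] by blast
    then show ?thesis
      by (intro exI[of _ "\<lambda>u. 0"] exI[of _ "\<lambda>u. u $ i"]) (auto simp: sum_squares_division_def intro: polys_const polys_coord)
  qed
next
  case (add p q)
  then obtain r a b r' a' b' where D: "sum_squares_division p r a b" "sum_squares_division q r' a' b'"
    by blast
  note P = sum_squares_divisionD(1-3)[OF D(1)] sum_squares_divisionD(1-3)[OF D(2)]
  note e = sum_squares_divisionD(4)[OF D(1)] sum_squares_divisionD(4)[OF D(2)]
  note i = sum_squares_divisionD(5)[OF D(1)] sum_squares_divisionD(5)[OF D(2)]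
  show ?case unfolding sum_squares_division_def
  proof (intro exI conjI allI impI)
    show "p u + q u = (\<Sum>i\<in>UNIV. (u $ i)\<^sup>2) * (r u + r' u) + (a u + a' u) + u $ 3 * (b u + b' u)" for u
      unfolding e by (simp add: algebra_simps)
    show "a u + a' u = a w + a' w" "b u + b' u = b w + b' w" if "u $ 1 = w $ 1" "u $ 2 = w $ 2" for u w
      using i(1)[OF that] i(2)[OF that] by auto
  qed (intro polys_add P)+
next
  case (mult p q)
  then obtain r a b r' a' b' where D: "sum_squares_division p r a b" "sum_squares_division q r' a' b'"
    by blast
  note P = sum_squares_divisionD(1-3)[OF D(1)] sum_squares_divisionD(1-3)[OF D(2)]
  note e = sum_squares_divisionD(4)[OF D(1)] sum_squares_divisionD(4)[OF D(2)]
  note i = sum_squares_divisionD(5)[OF D(1)] sum_squares_divisionD(5)[OF D(2)]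
  let ?S = "\<lambda>u. \<Sum>i\<in>UNIV. (u $ i)\<^sup>2 :: complex"
  have SP: "?S \<in> polys" by (intro polys_sum polys_power polys_coord) auto
  show ?case unfolding sum_squares_division_def
  proof (intro exI conjI allI impI)
    show "p u * q u = ?S u * (?S u * r u * r' u + r u * (a' u + u $ 3 * b' u) + r' u * (a u + u $ 3 * b u) + b u * b' u)
        + (a u * a' u - ((u $ 1)\<^sup>2 + (u $ 2)\<^sup>2) * (b u * b' u)) + u $ 3 * (a u * b' u + b u * a' u)" for u
    proof -
      have S: "(u $ 3)\<^sup>2 = ?S u - ((u $ 1)\<^sup>2 + (u $ 2)\<^sup>2)" by (simp add: sum_3)
      define s where "s = ?S u"
      have "p u * q u = s * (s * r u * r' u + r u * (a' u + u $ 3 * b' u) + r' u * (a u + u $ 3 * b u))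
          + a u * a' u + (u $ 3)\<^sup>2 * (b u * b' u) + u $ 3 * (a u * b' u + b u * a' u)"
        unfolding e s_def[symmetric] by (simp add: algebra_simps power2_eq_square)
      then show ?thesis unfolding S s_def[symmetric] by (simp add: algebra_simps)
    qed
    show "a u * a' u - ((u $ 1)\<^sup>2 + (u $ 2)\<^sup>2) * (b u * b' u) = a w * a' w - ((w $ 1)\<^sup>2 + (w $ 2)\<^sup>2) * (b w * b' w)"
      "a u * b' u + b u * a' u = a w * b' w + b w * a' w" if "u $ 1 = w $ 1" "u $ 2 = w $ 2" for u w
      using i(1)[OF that] i(2)[OF that] that by auto
  qed (intro polys_add polys_diff polys_mult polys_power polys_coord SP P)+
qed

text \<open>
  Over a point \<open>(u\<^sub>1, u\<^sub>2)\<close> the null cone has the two points with last coordinate \<open>\<plusminus> w\<close>,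
  \<open>w\<^sup>2 = - u\<^sub>1\<^sup>2 - u\<^sub>2\<^sup>2\<close>; a remainder \<open>a + u\<^sub>3 b\<close> that vanishes at both is zero wherever \<open>w \<noteq> 0\<close>.
  This is the case of the Nullstellensatz that the theorem needs.
\<close>

lemma null_cone_divisible:
  assumes q: "q \<in> polys" and z: "\<And>u. (\<Sum>i\<in>UNIV. (u $ i)\<^sup>2) = 0 \<Longrightarrow> q u = 0"
  shows "\<exists>r\<in>polys. \<forall>u. q u = (\<Sum>i\<in>UNIV. (u $ i)\<^sup>2) * r u"
proof -
  obtain r a b where D: "sum_squares_division q r a b" using polys_divide_sum_squares[OF q] by blast
  note P = sum_squares_divisionD(1-3)[OF D] and e = sum_squares_divisionD(4)[OF D] and i = sum_squares_divisionD(5)[OF D]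
  have on_cone: "a u = 0 \<and> csqrt (- ((u $ 1)\<^sup>2 + (u $ 2)\<^sup>2)) * b u = 0" for u
  proof -
    define w where "w = csqrt (- ((u $ 1)\<^sup>2 + (u $ 2)\<^sup>2))"
    have w2: "w\<^sup>2 = - ((u $ 1)\<^sup>2 + (u $ 2)\<^sup>2)" by (simp add: w_def)
    define U where "U c = (\<chi> i. if i = 3 then c else u $ i)" for c
    have U: "U c $ 1 = u $ 1" "U c $ 2 = u $ 2" "U c $ 3 = c" for c by (simp_all add: U_def)
    have "a u + c * b u = 0" if "c\<^sup>2 = w\<^sup>2" for c
    proof -
      have s: "(\<Sum>i\<in>UNIV. (U c $ i)\<^sup>2) = 0" using that w2 by (simp add: sum_3 U)
      show ?thesis using z[OF s] e[of "U c"] i[OF U(1,2), of c] s by (simp add: U)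
    qed
    from this[of w] this[of "- w"] have "a u + w * b u = 0" "a u - w * b u = 0" by simp_all
    moreover have "2 * a u = (a u + w * b u) + (a u - w * b u)" "2 * (w * b u) = (a u + w * b u) - (a u - w * b u)"
      by simp_all
    ultimately have "2 * a u = 0" "2 * (w * b u) = 0" by (simp_all only:) simp_all
    then show ?thesis by (simp add: w_def)
  qed
  have "b u = 0" for u
  proof (rule polys_cancel_zero[OF _ P(3), of "\<lambda>u. (u $ 1)\<^sup>2 + (u $ 2)\<^sup>2" "axis 1 1"])
    show "(\<lambda>u. (u $ 1)\<^sup>2 + (u $ 2)\<^sup>2) \<in> polys" by (intro polys_add polys_power polys_coord)
    show "(axis 1 1 $ 1)\<^sup>2 + (axis 1 1 $ 2)\<^sup>2 \<noteq> (0 :: complex)" by (simp add: axis_def)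
    show "((v $ 1)\<^sup>2 + (v $ 2)\<^sup>2) * b v = 0" for v
    proof -
      have "csqrt (- ((v $ 1)\<^sup>2 + (v $ 2)\<^sup>2)) = 0 \<or> b v = 0" using on_cone[of v] by simp
      then have "(v $ 1)\<^sup>2 + (v $ 2)\<^sup>2 = 0 \<or> b v = 0" by (simp only: csqrt_eq_0 neg_equal_0_iff_equal)
      then show ?thesis by auto
    qed
  qed
  then show ?thesis using e on_cone P(1) by (intro bexI[of _ r]) auto
qed

text \<open>The classical rational parametrization of the null cone of the sum of three squares.\<close>

definition null_vec :: "complex \<Rightarrow> complex \<Rightarrow> complex ^ 3" where
  "null_vec s t = (\<chi> i. if i = 1 then s\<^sup>2 - t\<^sup>2 else if i = 2 then \<i> * (s\<^sup>2 + t\<^sup>2) else 2 * s * t)"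

lemma null_vec_nth: "null_vec s t $ 1 = s\<^sup>2 - t\<^sup>2" "null_vec s t $ 2 = \<i> * (s\<^sup>2 + t\<^sup>2)" "null_vec s t $ 3 = 2 * s * t"
  by (simp_all add: null_vec_def)

lemma null_vec_null: "(\<Sum>i\<in>UNIV. (null_vec s t $ i)\<^sup>2) = 0"
  by (simp add: sum_3 null_vec_nth power_mult_distrib) (simp add: power2_eq_square algebra_simps)

lemma vec3_eqI: "u $ 1 = w $ 1 \<Longrightarrow> u $ 2 = w $ 2 \<Longrightarrow> u $ 3 = w $ 3 \<Longrightarrow> u = (w :: complex^3)"
  by (simp add: Finite_Cartesian_Product.vec_eq_iff forall_3)

lemma null_vec_surj:
  assumes "(\<Sum>i\<in>UNIV. (u $ i)\<^sup>2) = 0" shows "\<exists>s t. u = null_vec s t"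
proof -
  define s where "s = csqrt ((u $ 1 - \<i> * u $ 2) / 2)"
  define t where "t = csqrt (- (u $ 1 + \<i> * u $ 2) / 2)"
  have s2: "s\<^sup>2 = (u $ 1 - \<i> * u $ 2) / 2" and t2: "t\<^sup>2 = - (u $ 1 + \<i> * u $ 2) / 2"
    by (simp_all add: s_def t_def)
  have e1: "s\<^sup>2 - t\<^sup>2 = u $ 1" unfolding s2 t2 by (simp add: field_simps)
  have e2: "\<i> * (s\<^sup>2 + t\<^sup>2) = u $ 2" unfolding s2 t2 by (simp add: field_simps)
  have "(2 * s * t)\<^sup>2 = (2 * s\<^sup>2) * (2 * t\<^sup>2)" by (simp add: power2_eq_square)
  also have "\<dots> = (u $ 1 - \<i> * u $ 2) * (- (u $ 1 + \<i> * u $ 2))"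
  proof -
    have "2 * s\<^sup>2 = u $ 1 - \<i> * u $ 2" "2 * t\<^sup>2 = - (u $ 1 + \<i> * u $ 2)" by (simp_all add: s2 t2)
    then show ?thesis by (simp only:)
  qed
  also have "\<dots> = - ((u $ 1)\<^sup>2 + (u $ 2)\<^sup>2)"
    by (simp add: power2_eq_square algebra_simps)
  also have "\<dots> = (u $ 3)\<^sup>2" using assms unfolding sum_3 by (rule minus_unique)
  finally have "2 * s * t = u $ 3 \<or> 2 * s * t = - u $ 3" by (simp add: power2_eq_iff)
  then show ?thesis
  proof
    assume "2 * s * t = u $ 3"
    then have "u = null_vec s t" using e1 e2 by (intro vec3_eqI) (simp_all add: null_vec_nth)
    then show ?thesis by blast
  next
    assume "2 * s * t = - u $ 3"
    then have "u = null_vec s (- t)" using e1 e2 by (intro vec3_eqI) (simp_all add: null_vec_nth)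
    then show ?thesis by blast
  qed
qed

lemma lform_2: "lform (x :: complex^2) y = x $ 1 * y $ 1 + x $ 2 * y $ 2"
  by (simp add: lform_def sum_2)

lemma vec2_eqI: "u $ 1 = w $ 1 \<Longrightarrow> u $ 2 = w $ 2 \<Longrightarrow> u = (w :: complex^2)"
  by (simp add: Finite_Cartesian_Product.vec_eq_iff forall_2)

definition vec2 :: "complex \<Rightarrow> complex \<Rightarrow> complex^2" where
  "vec2 a b = (\<chi> i. if i = 1 then a else b)"

lemma vec2_nth [simp]: "vec2 a b $ 1 = a" "vec2 a b $ 2 = b"
  by (simp_all add: vec2_def)

lemma vec2_eta: "vec2 (y $ 1) (y $ 2) = y" by (rule vec2_eqI) simp_all

lemma vec2_zero_iff: "vec2 a b = 0 \<longleftrightarrow> a = 0 \<and> b = 0"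
  by (auto simp: Finite_Cartesian_Product.vec_eq_iff forall_2)

lemma normalize2: "x \<noteq> 0 \<Longrightarrow> \<exists>x' r. norm x' = 1 \<and> r \<noteq> 0 \<and> (x :: complex^2) = r *s x'"
  by (intro exI[of _ "x /\<^sub>R norm x"] exI[of _ "of_real (norm x)"])
     (auto simp: Finite_Cartesian_Product.vec_eq_iff scaleR_conv_of_real[where 'a = complex])

context ellipsoid_form
begin

section \<open>The cone over the conic\<close>

text \<open>
  The composite with the coordinate change, a parametrization of the cone \<open>Q = 0\<close>; it is
  quadratic, and injective up to sign.
\<close>

definition psi :: "complex ^ 2 \<Rightarrow> complex ^ 3" where
  "psi y = null_vec (y $ 1) (y $ 2) v* matrix_inv A"

lemma psi_A [simp]: "psi y v* A = null_vec (y $ 1) (y $ 2)" by (simp add: psi_def)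

lemma Q_psi: "Q (psi y) = 0" by (simp add: Q_eq null_vec_null)

lemma psi_surj:
  assumes "Q v = 0" shows "\<exists>y. v = psi y"
proof -
  obtain s t where "v v* A = null_vec s t" using null_vec_surj assms unfolding Q_eq by blast
  then have "v = psi (vec2 s t)" by (metis psi_def v_A_inv(1) vec2_nth)
  then show ?thesis by blast
qed

lemma psi_scale: "psi (c *s y) = c\<^sup>2 *s psi y"
proof -
  have "null_vec (c * s) (c * t) = c\<^sup>2 *s null_vec s t" for s t
    by (rule vec3_eqI) (simp_all add: null_vec_nth power_mult_distrib algebra_simps power2_eq_square)
  then show ?thesis by (simp add: psi_def vector_matrix_scale)
qed

lemma psi_continuous: "continuous_on S psi"
proof -
  have "continuous_on S (\<lambda>y. null_vec (y $ 1) (y $ 2))" unfolding null_vec_def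
  proof (rule continuous_on_vec_lambda)
    fix i
    show "continuous_on S (\<lambda>y. if i = 1 then (y $ 1)\<^sup>2 - (y $ 2)\<^sup>2
        else if i = 2 then \<i> * ((y $ 1)\<^sup>2 + (y $ 2)\<^sup>2) else 2 * y $ 1 * y $ 2)"
      by (cases "i = 1"; cases "i = 2") (auto intro!: continuous_intros)
  qed
  then show ?thesis unfolding psi_def by (rule continuous_on_compose2[OF vm_continuous[of UNIV]]) auto
qed

lemma hom_psi_scale: "p \<in> hom_polys k \<Longrightarrow> p (psi (c *s y)) = c ^ (2 * k) * p (psi y)"
  by (simp add: psi_scale hom_polys_scale power_mult)

lemma polys_psi_continuous: "p \<in> polys \<Longrightarrow> continuous_on S (\<lambda>y. p (psi y))"
  by (rule continuous_on_compose2[OF polys_continuous[of p UNIV] psi_continuous]) auto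

lemma VQ_psi: "p \<in> VQ Q k \<Longrightarrow> p (psi y) = 0"
  by (auto simp: VQ_def Q_psi)

text \<open>
  Forms vanishing on the conic are the multiples of \<open>Q\<close>; this identifies the quotient of
  \<open>hom_polys k\<close> by \<open>VQ Q k\<close> with a space of binary forms.
\<close>

lemma VQ_iff_psi:
  assumes p: "p \<in> hom_polys k"
  shows "p \<in> VQ Q k \<longleftrightarrow> (\<forall>y. p (psi y) = 0)"
proof
  assume "p \<in> VQ Q k" then show "\<forall>y. p (psi y) = 0" by (auto simp: VQ_def Q_psi)
next
  assume z: "\<forall>y. p (psi y) = 0"
  define q where "q u = p (u v* matrix_inv A)" for u
  have "q \<in> polys" unfolding q_def by (rule polys_subst[OF hom_polys_polys[OF p]])
  moreover have "q u = 0" if "(\<Sum>i\<in>UNIV. (u $ i)\<^sup>2) = 0" for u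
  proof -
    have "Q (u v* matrix_inv A) = 0" using that by (simp add: Q_eq)
    then show ?thesis using psi_surj z unfolding q_def by metis
  qed
  ultimately obtain r where r: "r \<in> polys" "\<And>u. q u = (\<Sum>i\<in>UNIV. (u $ i)\<^sup>2) * r u"
    using null_cone_divisible by meson
  have "p v = Q v * r (v v* A)" for v
    using r(2)[of "v v* A"] by (simp add: q_def Q_eq)
  then have "p = (\<lambda>v. Q v * r (v v* A))" by blast
  then show "p \<in> VQ Q k" using p polys_subst[OF r(1), of A] by (auto simp: VQ_def)
qed

section \<open>Linear forms as pairs of points on the conic\<close>

text \<open>
  The linear form on \<open>\<complex>\<^sup>3\<close> that vanishes at the points of the conic where the linear forms in two
  variables with coefficient vectors \<open>x\<close> and \<open>y\<close> do: the chord through these points. The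
  coefficients come from expressing the monomials \<open>s\<^sup>2\<close>, \<open>s t\<close> and \<open>t\<^sup>2\<close> through the coordinates
  of \<open>null_vec s t\<close>.
\<close>

definition chord_form :: "complex ^ 2 \<Rightarrow> complex ^ 2 \<Rightarrow> cfun3" where
  "chord_form x y v = x $ 1 * y $ 1 * (1/2 * ((v v* A) $ 1 - \<i> * (v v* A) $ 2))
     + (x $ 1 * y $ 2 + x $ 2 * y $ 1) * (1/2 * (v v* A) $ 3)
     - x $ 2 * y $ 2 * (1/2 * ((v v* A) $ 1 + \<i> * (v v* A) $ 2))"

lemma chord_form_psi: "chord_form x y (psi z) = lform x z * lform y z"
proof -
  have 1: "1/2 * (null_vec s t $ 1 - \<i> * null_vec s t $ 2) = s\<^sup>2" for s t by (simp add: null_vec_nth algebra_simps)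
  have 2: "1/2 * (null_vec s t $ 1 + \<i> * null_vec s t $ 2) = - t\<^sup>2" for s t by (simp add: null_vec_nth algebra_simps)
  show ?thesis unfolding chord_form_def psi_A 1 2 lform_2 by (simp add: null_vec_nth algebra_simps power2_eq_square)
qed

lemma chord_form_commute: "chord_form x y = chord_form y x" by (simp add: chord_form_def fun_eq_iff algebra_simps)

lemma chord_form_scale_left: "chord_form (c *s x) y v = c * chord_form x y v" by (simp add: chord_form_def algebra_simps)
lemma chord_form_scale_right: "chord_form x (c *s y) v = c * chord_form x y v" by (simp add: chord_form_def algebra_simps)

lemma chord_form_hom: "chord_form x y \<in> hom_polys 1"
proof (rule hom_polysI)
  show "chord_form x y \<in> polys" unfolding chord_form_def
    by (intro polys_add polys_diff polys_cmult polys_subst[OF polys_coord])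
  show "chord_form x y (t *s v) = t ^ 1 * chord_form x y v" for t v
    by (simp add: chord_form_def vector_matrix_scale algebra_simps)
qed

lemma lforms_product_nonzero2:
  assumes "x \<noteq> 0" "y \<noteq> 0" shows "\<exists>z. lform x z * lform y z \<noteq> 0"
  using lforms_product_nonzero[of "[x, y]"] assms by auto

lemma chord_form_nonzero:
  assumes "x \<noteq> 0" "y \<noteq> 0" shows "chord_form x y \<noteq> (\<lambda>v. 0)"
  using lforms_product_nonzero2[OF assms] chord_form_psi[of x y] by metis

lemma quadratic_factor:
  fixes p q r :: complex
  assumes "p \<noteq> 0 \<or> q \<noteq> 0 \<or> r \<noteq> 0"
  shows "\<exists>(x :: complex^2) (y :: complex^2). x \<noteq> 0 \<and> y \<noteq> 0 \<and> x $ 1 * y $ 1 = p \<and> x $ 2 * y $ 2 = q \<and>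
     x $ 1 * y $ 2 + x $ 2 * y $ 1 = r"
proof (cases "p = 0")
  case True
  then show ?thesis using assms
    by (intro exI[of _ "vec2 0 1"] exI[of _ "vec2 r q"]) (auto simp: vec2_zero_iff)
next
  case False
  define D where "D = csqrt (r\<^sup>2 - 4 * p * q)"
  have D2: "D\<^sup>2 = r\<^sup>2 - 4 * p * q" by (simp add: D_def)
  define z w where "z = (- r + D) / (2 * p)" and "w = (- r - D) / (2 * p)"
  have s: "p * z + p * w = - r" using False by (simp add: z_def w_def field_simps)
  have "4 * p * (p * z * w) = (2 * p * z) * (2 * p * w)" by simp
  also have "\<dots> = (- r + D) * (- r - D)" using False by (simp add: z_def w_def)
  also have "\<dots> = r\<^sup>2 - D\<^sup>2" by (simp add: algebra_simps power2_eq_square)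
  also have "\<dots> = 4 * p * q" by (simp add: D2)
  finally have m: "p * z * w = q" using False by simp
  have "p * (- w) + (- p * z) * 1 = - (p * z + p * w)" by simp
  also have "\<dots> = r" unfolding s by simp
  finally have "p * (- w) + (- p * z) * 1 = r" .
  then show ?thesis using False m
    by (intro exI[of _ "vec2 p (- p * z)"] exI[of _ "vec2 1 (- w)"]) (auto simp: vec2_zero_iff)
qed

text \<open>A linear form pulls back to a binary quadratic form, and binary quadratic forms split.\<close>

lemma chord_form_surj:
  assumes L: "L \<in> hom_polys 1" "L \<noteq> (\<lambda>v. 0)"
  shows "\<exists>x y. x \<noteq> 0 \<and> y \<noteq> 0 \<and> L = chord_form x y"
proof -
  have "(\<lambda>u. L (u v* matrix_inv A)) \<in> hom_polys 1" by (rule hom_polys_subst[OF L(1)])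
  then obtain a where a: "\<And>u. L (u v* matrix_inv A) = lform a u" using hom_polys_1_iff by metis
  have La: "L v = a $ 1 * (v v* A) $ 1 + a $ 2 * (v v* A) $ 2 + a $ 3 * (v v* A) $ 3" for v
    using a[of "v v* A"] by (simp add: lform_def sum_3)
  define p q r where "p = a $ 1 + \<i> * a $ 2" and "q = \<i> * a $ 2 - a $ 1" and "r = 2 * a $ 3"
  have "p \<noteq> 0 \<or> q \<noteq> 0 \<or> r \<noteq> 0"
  proof (rule ccontr)
    assume "\<not> ?thesis"
    then have z: "p = 0" "q = 0" "r = 0" by auto
    have "p - q = 2 * a $ 1" "p + q = 2 * (\<i> * a $ 2)" by (simp_all add: p_def q_def)
    then have "a $ 1 = 0" "a $ 2 = 0" "a $ 3 = 0" using z by (auto simp: r_def)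
    then show False using L(2) La by auto
  qed
  then obtain x y :: "complex^2" where xy: "x \<noteq> 0" "y \<noteq> 0" "x $ 1 * y $ 1 = p" "x $ 2 * y $ 2 = q"
     "x $ 1 * y $ 2 + x $ 2 * y $ 1 = r" using quadratic_factor by blast
  have "L = chord_form x y"
    by (rule ext) (simp add: La chord_form_def xy, simp add: p_def q_def r_def field_simps)
  then show ?thesis using xy by blast
qed

text \<open>
  Consecutive entries of the list are paired, so the reorderings of a list run through all
  pairings of its entries.
\<close>

fun pairprod :: "(complex ^ 2) list \<Rightarrow> cfun3" where
  "pairprod (x # y # xs) = (\<lambda>v. chord_form x y v * pairprod xs v)"
| "pairprod xs = (\<lambda>v. 1)"

lemma pairprod_psi:
  "even (length xs) \<Longrightarrow> pairprod xs (psi z) = (\<Prod>x\<leftarrow>xs. lform x z)"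
  by (induction xs rule: pairprod.induct) (auto simp: chord_form_psi)

text \<open>
  The scalar \<open>c\<close> is absorbed by one of the linear forms. For \<open>k = 0\<close> there is none, and constant
  multipoles take over.
\<close>

lemma multipole_of_points:
  assumes "length xs = 2 * k" "0 \<notin> set xs"
  shows "\<exists>u\<in>multipoles_bar k. Theta u = (\<lambda>v. c * pairprod xs v)"
proof (cases "c = 0")
  case True then show ?thesis by (intro bexI[of _ Zero_mp]) (auto simp: multipoles_bar_def)
next
  case c: False
  have forms: "\<exists>Ls\<in>form_tuples (length xs div 2). fprod Ls = pairprod xs" if "even (length xs)" "0 \<notin> set xs" for xs
    using that
  proof (induction xs rule: pairprod.induct)
    case (1 x y xs)
    then obtain Ls where Ls: "Ls \<in> form_tuples (length xs div 2)" "fprod Ls = pairprod xs" by auto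
    have "chord_form x y # Ls \<in> form_tuples (length (x # y # xs) div 2)"
      using Ls(1) chord_form_hom chord_form_nonzero[of x y] 1(3) by (auto simp: form_tuples_def)
    moreover have "fprod (chord_form x y # Ls) = pairprod (x # y # xs)" using Ls(2) by (auto simp: fprod_def fun_eq_iff)
    ultimately show ?case by blast
  qed (auto simp: form_tuples_def fprod_def)
  show ?thesis
  proof (cases "k = 0")
    case True
    then show ?thesis using assms c
      by (intro bexI[of _ "Const_mp c"]) (auto simp: multipoles_bar_def multipoles_def)
  next
    case False
    obtain Ls where Ls: "Ls \<in> form_tuples k" "fprod Ls = pairprod xs"
      using forms[OF _ assms(2)] assms(1) by auto
    then obtain L Ls' where L: "Ls = L # Ls'" using False by (cases Ls) (auto simp: form_tuples_def)
    have Lp: "L \<in> hom_polys 1" "L \<noteq> (\<lambda>v. 0)" using Ls(1) L by (auto simp: form_tuples_def)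
    have "(\<lambda>v. c * L v) \<in> hom_polys 1" using Lp(1) by (rule hom_polys_cmult)
    moreover have "(\<lambda>v. c * L v) \<noteq> (\<lambda>v. 0)" using c Lp(2) by (auto simp: fun_eq_iff)
    ultimately have T: "(\<lambda>v. c * L v) # Ls' \<in> form_tuples k" using Ls(1) L by (auto simp: form_tuples_def)
    have "fprod ((\<lambda>v. c * L v) # Ls') = (\<lambda>v. c * pairprod xs v)"
      using Ls(2) L by (auto simp: fprod_def fun_eq_iff)
    then show ?thesis using T Theta_mp[OF T] multipoles_mp[OF False]
      by (intro bexI[of _ "form_class k ((\<lambda>v. c * L v) # Ls')"]) (auto simp: multipoles_bar_def)
  qed
qed

text \<open>
  Unit vectors make the entries range over a compact set, which matters for the continuity of the
  fibres.
\<close>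

lemma points_of_multipole:
  assumes "u \<in> multipoles_bar k"
  shows "\<exists>c xs. length xs = 2 * k \<and> (\<forall>x\<in>set xs. norm x = 1) \<and> Theta u = (\<lambda>v. c * pairprod xs v)"
proof -
  have forms: "\<exists>c xs. length xs = 2 * length Ls \<and> (\<forall>x\<in>set xs. norm x = 1) \<and> fprod Ls = (\<lambda>v. c * pairprod xs v)"
    if "set Ls \<subseteq> hom_polys 1 - {\<lambda>v. 0}" for Ls
    using that
  proof (induction Ls)
    case Nil then show ?case by (intro exI[of _ 1] exI[of _ "[]"]) (auto simp: fprod_def)
  next
    case (Cons L Ls)
    then obtain c xs where cx: "length xs = 2 * length Ls" "\<forall>x\<in>set xs. norm x = 1" "fprod Ls = (\<lambda>v. c * pairprod xs v)"
      by auto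
    obtain x y where xy: "x \<noteq> 0" "y \<noteq> 0" "L = chord_form x y" using chord_form_surj[of L] Cons.prems by auto
    obtain x' r y' s where n: "norm x' = 1" "x = r *s x'" "norm y' = 1" "y = s *s y'"
      using normalize2[OF xy(1)] normalize2[OF xy(2)] by blast
    have "fprod (L # Ls) = (\<lambda>v. (r * s * c) * pairprod (x' # y' # xs) v)"
      using cx(3) by (auto simp: fprod_def fun_eq_iff xy(3) n chord_form_scale_left chord_form_scale_right)
    then show ?case using cx n by (intro exI[of _ "r * s * c"] exI[of _ "x' # y' # xs"]) auto
  qed
  consider "u = Zero_mp" | "k = 0" "\<exists>c. u = Const_mp c" | "k \<noteq> 0" "\<exists>Ls\<in>form_tuples k. u = form_class k Ls"
    using assms multipoles_mp[of k] by (auto simp: multipoles_bar_def multipoles_def split: if_splits)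
  then show ?thesis
  proof cases
    case 1
    then show ?thesis by (intro exI[of _ 0] exI[of _ "replicate (2 * k) (axis 1 1)"]) auto
  next
    case 2
    then show ?thesis by (auto intro!: exI[of _ "[]"])
  next
    case 3
    then obtain Ls where Ls: "Ls \<in> form_tuples k" "u = form_class k Ls" by blast
    then show ?thesis using forms[of Ls] Theta_mp[OF Ls(1)] by (auto simp: form_tuples_def)
  qed
qed

lemma fun_subspace_VQ_perp: "fun_subspace (VQ_perp A Q k)" and VQ_perp_sub: "VQ_perp A Q k \<subseteq> hom_polys k"
  using fun_subspace_Har Har_sub unfolding Har_eq_VQ_perp by auto

text \<open>Projecting to the complement is subtracting the projection to \<open>VQ Q k\<close>.\<close>

lemma Phi_eq:
  assumes u: "u \<in> multipoles_bar k"
  shows "Phi A Q k u = (\<lambda>v. Theta u v - orth_proj A (VQ Q k) (Theta u) v)"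
proof -
  have T: "Theta u \<in> hom_polys k" "Theta u \<in> ellcont" using Theta_hom[OF u] ellcont_hom by auto
  note pr = orth_proj_props[OF fun_subspace_VQ[of k] VQ_sub T(2)]
  show ?thesis unfolding Phi_def
  proof (rule orth_proj_eqI[OF fun_subspace_VQ_perp VQ_perp_sub T(2)])
    show "(\<lambda>v. Theta u v - orth_proj A (VQ Q k) (Theta u) v) \<in> VQ_perp A Q k"
      using pr hom_polys_diff[OF T(1) subsetD[OF VQ_sub pr(1)]] by (auto simp: VQ_perp_def)
    fix h assume h: "h \<in> VQ_perp A Q k"
    have "herm A h (orth_proj A (VQ Q k) (Theta u)) = 0" using h pr(1) by (auto simp: VQ_perp_def)
    then have "herm A (orth_proj A (VQ Q k) (Theta u)) h = 0" by (simp add: herm_cnj[of _ h])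
    then show "herm A (\<lambda>v. Theta u v - (Theta u v - orth_proj A (VQ Q k) (Theta u) v)) h = 0" by simp
  qed
qed

lemma Phi_VQ_perp: "u \<in> multipoles_bar k \<Longrightarrow> Phi A Q k u \<in> VQ_perp A Q k"
  unfolding Phi_def by (intro orth_proj_props(1)[OF fun_subspace_VQ_perp VQ_perp_sub] ellcont_hom[OF Theta_hom])

lemma Phi_psi: "u \<in> multipoles_bar k \<Longrightarrow> Phi A Q k u (psi y) = Theta u (psi y)"
  using VQ_psi[OF orth_proj_props(1)[OF fun_subspace_VQ[of k] VQ_sub ellcont_hom[OF Theta_hom[of u k]]], of y]
  by (simp add: Phi_eq)

lemma VQ_perp_psi_inj:
  assumes P: "P \<in> VQ_perp A Q k" "P' \<in> VQ_perp A Q k" and eq: "\<And>y. P (psi y) = P' (psi y)"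
  shows "P = P'"
proof -
  have h: "(\<lambda>v. P v - P' v) \<in> VQ_perp A Q k" by (rule fun_subspace_diff[OF fun_subspace_VQ_perp P])
  then have hh: "(\<lambda>v. P v - P' v) \<in> hom_polys k" using VQ_perp_sub by blast
  have "(\<lambda>v. P v - P' v) \<in> VQ Q k" using VQ_iff_psi[OF hh] eq by simp
  then have "herm A (\<lambda>v. P v - P' v) (\<lambda>v. P v - P' v) = 0" using h by (auto simp: VQ_perp_def)
  then have "(\<lambda>v. P v - P' v) = (\<lambda>v. 0)" by (rule hom_herm_zero[OF hh])
  then show ?thesis by (simp add: fun_eq_iff)
qed

text \<open>
  The equation of fibres, freed of all analysis: \<open>Phi\<close> changes \<open>Theta u\<close> by a multiple of \<open>Q\<close>,
  which is invisible on the cone.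
\<close>

lemma Phi_eq_iff:
  assumes "u \<in> multipoles_bar k" "P \<in> VQ_perp A Q k"
  shows "Phi A Q k u = P \<longleftrightarrow> (\<forall>y. Theta u (psi y) = P (psi y))"
  using VQ_perp_psi_inj[OF Phi_VQ_perp[OF assms(1)] assms(2)] Phi_psi[OF assms(1)] by metis

end

section \<open>Factorization of binary forms\<close>

text \<open>
  A homogeneous continuous function on \<open>\<complex>\<^sup>2\<close> is determined by its restriction to the line
  \<open>y $ 2 = 1\<close>. If that is a polynomial, then continuity at the point at infinity bounds its
  degree.
\<close>

lemma binary_form_expansion:
  assumes G: "continuous_on UNIV G" and hom: "\<And>c y. G (c *s y) = c ^ n * G (y :: complex^2)"
    and g: "\<And>s. G (vec2 s 1) = poly g s"
  shows "degree g \<le> n" "G y = (\<Sum>j\<le>n. coeff g j * (y $ 1) ^ j * (y $ 2) ^ (n - j))"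
proof -
  have scale: "t *s vec2 (s / t) 1 = vec2 s t" if "t \<noteq> 0" for s t
    using that by (intro vec2_eqI) auto
  show deg: "degree g \<le> n"
  proof (rule ccontr)
    assume "\<not> degree g \<le> n"
    then have m: "n < degree g" by simp
    \<comment> \<open>as \<open>t\<close> tends to \<open>0\<close>, this would make the leading coefficient of \<open>g\<close> vanish\<close>
    have eq: "t ^ (degree g - n) * G (vec2 1 t) = poly (reflect_poly g) t" if t: "t \<noteq> 0" for t
    proof -
      have "G (vec2 1 t) = t ^ n * poly g (inverse t)"
        using hom[of t "vec2 (1 / t) 1"] g[of "1 / t"] scale[OF t, of 1] by (simp add: inverse_eq_divide)
      then show ?thesis using m poly_reflect_poly_nz[OF t, of g]
        by (simp flip: power_add mult.assoc)
    qed
    have v: "((\<lambda>t. vec2 1 t) \<longlongrightarrow> vec2 1 0) (at 0)"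
      by (rule vec_tendstoI) (auto simp: vec2_def intro!: tendsto_eq_intros)
    have "((\<lambda>t. G (vec2 1 t)) \<longlongrightarrow> G (vec2 1 0)) (at 0)"
      using G continuous_on_tendsto_compose[OF G v] by simp
    then have "((\<lambda>t. t ^ (degree g - n) * G (vec2 1 t)) \<longlongrightarrow> 0 ^ (degree g - n) * G (vec2 1 0)) (at 0)"
      by (intro tendsto_intros)
    moreover have "(0 :: complex) ^ (degree g - n) = 0" using m by (simp add: zero_power)
    ultimately have l1: "((\<lambda>t. t ^ (degree g - n) * G (vec2 1 t)) \<longlongrightarrow> 0) (at 0)" by (simp only: mult_zero_left)
    have "((\<lambda>t. poly (reflect_poly g) t) \<longlongrightarrow> poly (reflect_poly g) 0) (at 0)"
      by (intro tendsto_intros)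
    then have l2: "((\<lambda>t. t ^ (degree g - n) * G (vec2 1 t)) \<longlongrightarrow> poly (reflect_poly g) 0) (at 0)"
      by (rule Lim_transform_eventually) (auto simp: eventually_at_filter eq)
    have "poly (reflect_poly g) 0 = 0" by (rule tendsto_unique[OF at_neq_bot l2 l1])
    then have "g = 0" by simp
    then show False using m by simp
  qed
  let ?R = "\<lambda>y :: complex^2. \<Sum>j\<le>n. coeff g j * (y $ 1) ^ j * (y $ 2) ^ (n - j)"
  have "G = ?R"
  proof (rule lform_cancel[of "vec2 0 1"])
    fix y :: "complex^2"
    show "lform (vec2 0 1) y * G y = lform (vec2 0 1) y * ?R y"
    proof (cases "y $ 2 = 0")
      case True then show ?thesis by (simp add: lform_2)
    next
      case False
      have "G y = (y $ 2) ^ n * poly g (y $ 1 / y $ 2)"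
        using hom[of "y $ 2" "vec2 (y $ 1 / y $ 2) 1"] scale[OF False, of "y $ 1"] by (simp add: vec2_eta g)
      also have "poly g (y $ 1 / y $ 2) = (\<Sum>j\<le>n. coeff g j * (y $ 1 / y $ 2) ^ j)"
        unfolding poly_altdef using deg
        by (intro sum.mono_neutral_left) (auto simp: coeff_eq_0)
      also have "(y $ 2) ^ n * \<dots> = ?R y"
        unfolding sum_distrib_left
      proof (rule sum.cong)
        fix j assume "j \<in> {..n}"
        then have "(y $ 2) ^ n = (y $ 2) ^ (n - j) * (y $ 2) ^ j" by (simp flip: power_add)
        then show "(y $ 2) ^ n * (coeff g j * (y $ 1 / y $ 2) ^ j) = coeff g j * (y $ 1) ^ j * (y $ 2) ^ (n - j)"
          using False by (simp add: power_divide)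
      qed simp
      finally show ?thesis by simp
    qed
  qed (auto simp: vec2_zero_iff intro!: continuous_intros G)
  then show "G y = ?R y" by (rule fun_cong)
qed

lemma lforms_normalize:
  assumes "0 \<notin> set xs"
  shows "\<exists>c ys. c \<noteq> 0 \<and> length ys = length xs \<and> (\<forall>y\<in>set ys. norm y = 1) \<and>
     (\<forall>z. (\<Prod>x\<leftarrow>xs. lform x z) = c * (\<Prod>y\<leftarrow>ys. lform (y :: complex^2) z))"
  using assms
proof (induction xs)
  case Nil then show ?case by (intro exI[of _ 1] exI[of _ "[]"]) auto
next
  case (Cons x xs)
  then obtain c ys where cy: "c \<noteq> 0" "length ys = length xs" "\<forall>y\<in>set ys. norm y = 1"
     "\<forall>z. (\<Prod>x\<leftarrow>xs. lform x z) = c * (\<Prod>y\<leftarrow>ys. lform y z)" by auto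
  have "x \<noteq> 0" using Cons.prems by auto
  then obtain x' r where x: "norm x' = 1" "r \<noteq> 0" "x = r *s x'"
    using normalize2 by blast
  show ?case using cy x
    by (intro exI[of _ "r * c"] exI[of _ "x' # ys"]) (auto simp: lform_scale_left)
qed

text \<open>
  The fundamental theorem of algebra gives the finite zeros; the defect \<open>n - degree g\<close> is the
  multiplicity of the zero at infinity.
\<close>

lemma binary_form_factorization:
  assumes G: "continuous_on UNIV G" and hom: "\<And>c y. G (c *s y) = c ^ n * G (y :: complex^2)"
    and g: "\<And>s. G (vec2 s 1) = poly g s"
  shows "\<exists>c xs. length xs = n \<and> (\<forall>x\<in>set xs. norm x = 1) \<and> (\<forall>y. G y = c * (\<Prod>x\<leftarrow>xs. lform x y))"
proof (cases "g = 0")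
  case True
  then have "G y = 0" for y using binary_form_expansion(2)[OF assms, of y] by simp
  then show ?thesis by (intro exI[of _ 0] exI[of _ "replicate n (axis 1 1)"]) auto
next
  case False
  obtain M where M: "size M = degree g" "g = Polynomial.smult (lead_coeff g) (\<Prod>x\<in>#M. [:-x, 1:])"
    using alg_closed_imp_factorization[OF False] by blast
  obtain rs where rs: "mset rs = M" using ex_mset by blast
  have lrs: "length rs = degree g" using M(1) rs by auto
  note deg = binary_form_expansion(1)[OF assms]
  \<comment> \<open>the form with coefficient vector \<open>vec2 0 1\<close> vanishes at the point at infinity\<close>
  define xs where "xs = map (\<lambda>r. vec2 1 (- r)) rs @ replicate (n - degree g) (vec2 0 1)"
  have len: "length xs = n" using deg by (simp add: xs_def lrs)
  have x0: "0 \<notin> set xs" using vec2_zero_iff by (auto simp: xs_def)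
  have pg: "poly g s = lead_coeff g * (\<Prod>r\<leftarrow>rs. s - r)" for s
  proof -
    have "poly g s = lead_coeff g * poly (\<Prod>x\<in>#M. [:-x, 1:]) s"
      using M(2) by (metis poly_smult)
    also have "poly (\<Prod>x\<in>#M. [:-x, 1:]) s = (\<Prod>r\<leftarrow>rs. s - r)"
      unfolding rs[symmetric] by (induction rs) (auto simp: algebra_simps)
    finally show ?thesis .
  qed
  have "G = (\<lambda>y. lead_coeff g * (\<Prod>x\<leftarrow>xs. lform x y))"
  proof (rule lform_cancel[of "vec2 0 1"])
    fix y :: "complex^2"
    show "lform (vec2 0 1) y * G y = lform (vec2 0 1) y * (lead_coeff g * (\<Prod>x\<leftarrow>xs. lform x y))"
    proof (cases "y $ 2 = 0")
      case True then show ?thesis by (simp add: lform_2)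
    next
      case y2: False
      have "y $ 2 *s vec2 (y $ 1 / y $ 2) 1 = y" using y2 by (intro vec2_eqI) auto
      then have "G y = (y $ 2) ^ n * poly g (y $ 1 / y $ 2)"
        using hom[of "y $ 2" "vec2 (y $ 1 / y $ 2) 1"] by (simp add: g)
      also have "\<dots> = lead_coeff g * ((y $ 2) ^ (n - degree g) * ((y $ 2) ^ length rs * (\<Prod>r\<leftarrow>rs. y $ 1 / y $ 2 - r)))"
        using deg by (simp add: pg lrs mult.left_commute mult.assoc[symmetric] flip: power_add)
      also have "(y $ 2) ^ length rs * (\<Prod>r\<leftarrow>rs. y $ 1 / y $ 2 - r) = (\<Prod>r\<leftarrow>rs. lform (vec2 1 (- r)) y)"
        using y2 by (induction rs) (auto simp: lform_2 field_simps)
      also have "lead_coeff g * ((y $ 2) ^ (n - degree g) * (\<Prod>r\<leftarrow>rs. lform (vec2 1 (- r)) y))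
         = lead_coeff g * (\<Prod>x\<leftarrow>xs. lform x y)"
        by (simp add: xs_def o_def prod_list_replicate lform_2)
      finally show ?thesis by simp
    qed
  qed (auto simp: vec2_zero_iff intro!: continuous_intros G lforms_product_continuous)
  moreover obtain c ys where "length ys = length xs" "\<forall>y\<in>set ys. norm y = 1"
     "\<forall>z. (\<Prod>x\<leftarrow>xs. lform x z) = c * (\<Prod>y\<leftarrow>ys. lform y z)"
    using lforms_normalize[OF x0] by blast
  ultimately show ?thesis using len
    by (intro exI[of _ "lead_coeff g * c"] exI[of _ ys]) auto
qed

text \<open>Sequential compactness of a finite power of \<open>K\<close>.\<close>

lemma compact_lists_subsequence:
  fixes f :: "nat \<Rightarrow> nat \<Rightarrow> 'a :: metric_space"
  assumes "compact K" "\<And>n i. i < m \<Longrightarrow> f n i \<in> K"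
  shows "\<exists>r. strict_mono (r :: nat \<Rightarrow> nat) \<and> (\<forall>i<m. \<exists>l\<in>K. (\<lambda>n. f (r n) i) \<longlonglongrightarrow> l)"
  using assms(2)
proof (induction m)
  case 0 then show ?case by (intro exI[of _ id]) (auto simp: strict_mono_def)
next
  case (Suc m)
  then obtain r where r: "strict_mono (r :: nat \<Rightarrow> nat)" "\<And>i. i < m \<Longrightarrow> \<exists>l\<in>K. (\<lambda>n. f (r n) i) \<longlonglongrightarrow> l" by force
  have sc: "seq_compact K" using assms(1) by (simp add: compact_eq_seq_compact_metric)
  have mK: "\<forall>n. f (r n) m \<in> K" using Suc.prems by simp
  obtain l s where s: "l \<in> K" "strict_mono (s :: nat \<Rightarrow> nat)" "((\<lambda>n. f (r n) m) \<circ> s) \<longlonglongrightarrow> l"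
    by (rule seq_compactE[OF sc mK])
  have "\<exists>l\<in>K. (\<lambda>n. f ((r \<circ> s) n) i) \<longlonglongrightarrow> l" if "i < Suc m" for i
  proof (cases "i = m")
    case True then show ?thesis using s by (auto simp: o_def)
  next
    case False
    then have "i < m" using \<open>i < Suc m\<close> by simp
    then obtain l' where l': "l' \<in> K" "(\<lambda>n. f (r n) i) \<longlonglongrightarrow> l'" using r(2) by blast
    then show ?thesis using LIMSEQ_subseq_LIMSEQ[OF l'(2) s(2)] by (auto simp: o_def)
  qed
  then show ?case using strict_mono_o[OF r(1) s(2)] by blast
qed

lemma lforms_product_mset:
  "mset xs = mset ys \<Longrightarrow> (\<Prod>x\<leftarrow>xs. lform x z) = (\<Prod>y\<leftarrow>ys. lform y z)"
  by (metis mset_map prod_mset_prod_list)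

context ellipsoid_form
begin

lemma psi_poly:
  "p \<in> polys \<Longrightarrow> \<exists>g :: complex poly. \<forall>s. p (psi (vec2 s 1)) = poly g s"
proof (induction rule: polys_induct)
  case (const c) then show ?case by (intro exI[of _ "[:c:]"]) simp
next
  case (coord i)
  define M where "M = matrix_inv A"
  have "psi (vec2 s 1) $ i = poly [: - M $ 1 $ i + \<i> * M $ 2 $ i, 2 * M $ 3 $ i, M $ 1 $ i + \<i> * M $ 2 $ i :] s" for s
    by (simp add: psi_def vector_matrix_mult_nth sum_3 null_vec_nth M_def[symmetric] power2_eq_square algebra_simps)
  then show ?case by blast
next
  case (add p q)
  then obtain g h where "\<forall>s. p (psi (vec2 s 1)) = poly g s" "\<forall>s. q (psi (vec2 s 1)) = poly h s" by blast
  then show ?case by (intro exI[of _ "g + h"]) simp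
next
  case (mult p q)
  then obtain g h where "\<forall>s. p (psi (vec2 s 1)) = poly g s" "\<forall>s. q (psi (vec2 s 1)) = poly h s" by blast
  then show ?case by (intro exI[of _ "g * h"]) simp
qed

lemma hom_psi_factorization:
  assumes P: "P \<in> hom_polys k"
  shows "\<exists>c xs. length xs = 2 * k \<and> (\<forall>x\<in>set xs. norm x = 1) \<and> (\<forall>y. P (psi y) = c * (\<Prod>x\<leftarrow>xs. lform x y))"
proof -
  have pp: "P \<in> polys" using P hom_polys_polys by blast
  obtain g where g: "\<And>s. P (psi (vec2 s 1)) = poly g s" using psi_poly[OF pp] by blast
  show ?thesis
    by (rule binary_form_factorization[of "\<lambda>y. P (psi y)", OF polys_psi_continuous[OF pp] hom_psi_scale[OF P] g])
qed

section \<open>Fibres of the multipole map\<close>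

definition fibre :: "nat \<Rightarrow> cfun3 \<Rightarrow> multipole set" where
  "fibre k P = {u \<in> multipoles_bar k. Phi A Q k u = P}"

lemma norm1_nonzero: "\<forall>x\<in>set xs. norm x = (1 :: real) \<Longrightarrow> 0 \<notin> set xs"
  by auto

lemma fibre_of_points:
  assumes P: "P \<in> VQ_perp A Q k" and xs: "length xs = 2 * k" "\<forall>x\<in>set xs. norm x = 1"
    and eq: "\<And>y. P (psi y) = c * (\<Prod>x\<leftarrow>xs. lform x y)"
  shows "\<exists>u\<in>fibre k P. Theta u = (\<lambda>v. c * pairprod xs v)"
proof -
  obtain u where u: "u \<in> multipoles_bar k" "Theta u = (\<lambda>v. c * pairprod xs v)"
    using multipole_of_points[OF xs(1) norm1_nonzero[OF xs(2)]] by blast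
  then have "Phi A Q k u = P" using Phi_eq_iff[OF u(1) P] eq xs(1) by (simp add: pairprod_psi)
  then show ?thesis using u by (auto simp: fibre_def)
qed

lemma points_of_fibre:
  assumes P: "P \<in> VQ_perp A Q k" and u: "u \<in> fibre k P"
  shows "\<exists>c xs. length xs = 2 * k \<and> (\<forall>x\<in>set xs. norm x = 1) \<and> Theta u = (\<lambda>v. c * pairprod xs v) \<and>
     (\<forall>y. P (psi y) = c * (\<Prod>x\<leftarrow>xs. lform x y))"
proof -
  have um: "u \<in> multipoles_bar k" "Phi A Q k u = P" using u by (auto simp: fibre_def)
  obtain c xs where cx: "length xs = 2 * k" "\<forall>x\<in>set xs. norm x = 1" "Theta u = (\<lambda>v. c * pairprod xs v)"
    using points_of_multipole[OF um(1)] by blast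
  then show ?thesis using um Phi_eq_iff[OF um(1) P] by (intro exI[of _ c] exI[of _ xs]) (auto simp: pairprod_psi)
qed

lemma fibre_nonempty:
  assumes P: "P \<in> VQ_perp A Q k" shows "fibre k P \<noteq> {}"
proof -
  have "P \<in> hom_polys k" using P VQ_perp_sub by blast
  then show ?thesis using hom_psi_factorization[of P k] fibre_of_points[OF P] by blast
qed

lemma list_all2_scale:
  assumes "list_all2 (\<lambda>c b. \<exists>r. r \<noteq> 0 \<and> b = r *s c) cs bs" "even (length cs)"
  shows "\<exists>R. R \<noteq> 0 \<and> (\<forall>v. pairprod bs v = R * pairprod cs v) \<and>
    (\<forall>z. (\<Prod>b\<leftarrow>bs. lform b z) = R * (\<Prod>c\<leftarrow>cs. lform c z))"
  using assms
proof (induction cs arbitrary: bs rule: pairprod.induct)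
  case (1 x y xs)
  then obtain r s bs' where b: "bs = (r *s x) # (s *s y) # bs'" "r \<noteq> 0" "s \<noteq> 0"
    "list_all2 (\<lambda>c b. \<exists>r. r \<noteq> 0 \<and> b = r *s c) xs bs'"
    by (auto simp: list_all2_Cons1)
  then obtain R where R: "R \<noteq> 0" "\<forall>v. pairprod bs' v = R * pairprod xs v"
    "\<forall>z. (\<Prod>b\<leftarrow>bs'. lform b z) = R * (\<Prod>c\<leftarrow>xs. lform c z)" using "1.IH"[of bs'] "1.prems" by auto
  show ?case using b R
    by (intro exI[of _ "r * s * R"]) (auto simp: chord_form_scale_left chord_form_scale_right lform_scale_left)
next
  case "2_1" then show ?case by (intro exI[of _ 1]) auto
qed auto

text \<open>
  By unique factorization on \<open>\<complex>\<^sup>2\<close> the multipoles over \<open>P\<close> correspond to the reorderings of one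
  fixed list of factors, with the same constant \<open>c\<close>.
\<close>

lemma fibre_Theta_image:
  assumes P: "P \<in> VQ_perp A Q k" and xs: "length xs = 2 * k" "\<forall>x\<in>set xs. norm x = 1"
    and eq: "\<And>y. P (psi y) = c * (\<Prod>x\<leftarrow>xs. lform x y)" and c: "c \<noteq> 0"
  shows "Theta ` fibre k P = (\<lambda>ys v. c * pairprod ys v) ` {ys. mset ys = mset xs}"
proof (intro equalityI subsetI)
  fix p assume "p \<in> Theta ` fibre k P"
  then obtain u where u: "u \<in> fibre k P" "p = Theta u" by blast
  obtain c' xs' where x': "length xs' = 2 * k" "\<forall>x\<in>set xs'. norm x = 1" "Theta u = (\<lambda>v. c' * pairprod xs' v)"
     "\<And>y. P (psi y) = c' * (\<Prod>x\<leftarrow>xs'. lform x y)" using points_of_fibre[OF P u(1)] by blast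
  obtain y where y: "(\<Prod>x\<leftarrow>xs. lform x y) \<noteq> 0" using lforms_product_nonzero[OF norm1_nonzero[OF xs(2)]] by blast
  have "c' \<noteq> 0" using eq[of y] x'(4)[of y] y c by auto
  then have "(\<Prod>x\<leftarrow>xs. lform x z) = c' / c * (\<Prod>x\<leftarrow>xs'. lform x z)" for z
    using eq[of z] x'(4)[of z] c by (simp add: field_simps)
  then obtain cs where cs: "mset cs = mset xs" "list_all2 (\<lambda>c b. \<exists>r. r \<noteq> 0 \<and> b = r *s c) cs xs'"
    using lforms_unique_factorization[OF _ norm1_nonzero[OF xs(2)] norm1_nonzero[OF x'(2)], of "c' / c"] xs x'(1) c \<open>c' \<noteq> 0\<close>
    by auto
  have lcs: "length cs = 2 * k" using arg_cong[OF cs(1), of size] xs(1) by simp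
  obtain R where R: "R \<noteq> 0" "\<And>v. pairprod xs' v = R * pairprod cs v"
    "\<And>z. (\<Prod>b\<leftarrow>xs'. lform b z) = R * (\<Prod>c\<leftarrow>cs. lform c z)" using list_all2_scale[OF cs(2)] lcs by auto
  have "c * (\<Prod>x\<leftarrow>xs. lform x y) = c' * (\<Prod>x\<leftarrow>xs'. lform x y)" by (simp only: eq[symmetric] x'(4)[symmetric])
  also have "\<dots> = c' * R * (\<Prod>x\<leftarrow>xs. lform x y)"
    by (simp only: R(3) lforms_product_mset[OF cs(1)] mult.assoc)
  finally have "c * (\<Prod>x\<leftarrow>xs. lform x y) = c' * R * (\<Prod>x\<leftarrow>xs. lform x y)" .
  then have "c = c' * R" using mult_right_cancel[OF y] by blast
  then have "p = (\<lambda>v. c * pairprod cs v)" using u(2) x'(3) R(2) by (simp add: fun_eq_iff)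
  then show "p \<in> (\<lambda>ys v. c * pairprod ys v) ` {ys. mset ys = mset xs}" using cs(1) by blast
next
  fix p assume "p \<in> (\<lambda>ys v. c * pairprod ys v) ` {ys. mset ys = mset xs}"
  then obtain ys where ys: "mset ys = mset xs" "p = (\<lambda>v. c * pairprod ys v)" by blast
  have "length ys = 2 * k" using arg_cong[OF ys(1), of size] xs(1) by simp
  moreover have "set ys = set xs" using arg_cong[OF ys(1), of set_mset] by simp
  ultimately obtain u where "u \<in> fibre k P" "Theta u = (\<lambda>v. c * pairprod ys v)"
    using fibre_of_points[OF P, of ys c] eq lforms_product_mset[OF ys(1)] xs(2) by auto
  then show "p \<in> Theta ` fibre k P" using ys(2) by (metis imageI)
qed

lemma fibre_zero:
  assumes P: "P \<in> VQ_perp A Q k" and z: "\<And>y. P (psi y) = 0"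
  shows "fibre k P = {Zero_mp}"
proof -
  have "u = Zero_mp" if u: "u \<in> fibre k P" for u
  proof -
    obtain c xs where x: "length xs = 2 * k" "\<forall>x\<in>set xs. norm x = 1" "Theta u = (\<lambda>v. c * pairprod xs v)"
      "\<And>y. P (psi y) = c * (\<Prod>x\<leftarrow>xs. lform x y)" using points_of_fibre[OF P u] by blast
    obtain y where "(\<Prod>x\<leftarrow>xs. lform x y) \<noteq> 0" using lforms_product_nonzero[OF norm1_nonzero[OF x(2)]] by blast
    then have "c = 0" using x(4)[of y] z[of y] by simp
    then have "Theta u = Theta Zero_mp" using x(3) by simp
    then show ?thesis using Theta_inj[of k] u by (auto simp: inj_on_def fibre_def multipoles_bar_def)
  qed
  then show ?thesis using fibre_nonempty[OF P] by blast
qed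

definition pairings :: "(complex^2) multiset \<Rightarrow> cfun3 set" where
  "pairings M = pairprod ` {ys. mset ys = M}"

lemma pairprod_extract:
  assumes "a \<in> set ys" "even (length ys)"
  shows "\<exists>b zs. mset ys = {#a, b#} + mset zs \<and> pairprod ys = (\<lambda>v. chord_form a b v * pairprod zs v)"
  using assms
proof (induction ys rule: pairprod.induct)
  case (1 x y xs)
  show ?case
  proof (cases "a = x \<or> a = y")
    case True
    then show ?thesis
    proof
      assume "a = x" then show ?thesis by (intro exI[of _ y] exI[of _ xs]) auto
    next
      assume "a = y" then show ?thesis by (intro exI[of _ x] exI[of _ xs]) (auto simp: chord_form_commute[of x y])
    qed
  next
    case False
    then obtain b zs where "mset xs = {#a, b#} + mset zs" "pairprod xs = (\<lambda>v. chord_form a b v * pairprod zs v)"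
      using 1 by auto
    then show ?thesis by (intro exI[of _ b] exI[of _ "x # y # zs"]) (auto simp: fun_eq_iff)
  qed
qed auto

text \<open>Choosing the partner \<open>b\<close> of \<open>a\<close> is the recursion behind \<open>(2 k - 1)!!\<close>.\<close>

lemma pairings_step:
  assumes "odd (size M)"
  shows "pairings (add_mset a M) = (\<Union>b\<in>set_mset M. (\<lambda>p v. chord_form a b v * p v) ` pairings (M - {#b#}))"
proof (intro equalityI subsetI)
  fix p assume "p \<in> pairings (add_mset a M)"
  then obtain ys where ys: "mset ys = add_mset a M" "p = pairprod ys" by (auto simp: pairings_def)
  have "a \<in> set ys" using arg_cong[OF ys(1), of set_mset] by auto
  moreover have "even (length ys)" using arg_cong[OF ys(1), of size] assms by simp
  ultimately obtain b zs where b: "mset ys = {#a, b#} + mset zs" "pairprod ys = (\<lambda>v. chord_form a b v * pairprod zs v)"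
    using pairprod_extract by blast
  have "M = add_mset b (mset zs)" using b(1) ys(1) by simp
  then show "p \<in> (\<Union>b\<in>set_mset M. (\<lambda>p v. chord_form a b v * p v) ` pairings (M - {#b#}))"
    using b(2) ys(2) by (auto simp: pairings_def intro!: image_eqI[where x = "pairprod zs"])
next
  fix p assume "p \<in> (\<Union>b\<in>set_mset M. (\<lambda>p v. chord_form a b v * p v) ` pairings (M - {#b#}))"
  then obtain b zs where b: "b \<in># M" "mset zs = M - {#b#}" "p = (\<lambda>v. chord_form a b v * pairprod zs v)"
    by (auto simp: pairings_def)
  then have "mset (a # b # zs) = add_mset a M" "p = pairprod (a # b # zs)" by auto
  then show "p \<in> pairings (add_mset a M)" unfolding pairings_def by blast
qed

text \<open>The number \<open>(2 k - 1)!!\<close> of pairings of \<open>2 * k\<close> objects.\<close>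

definition odd_dfact :: "nat \<Rightarrow> nat" where
  "odd_dfact k = (\<Prod>i=1..k. 2 * i - 1)"

lemma odd_dfact_simps: "odd_dfact 0 = 1" "odd_dfact (Suc k) = (2 * k + 1) * odd_dfact k"
  by (simp_all add: odd_dfact_def)

lemma card_pairings_le: "size M = 2 * k \<Longrightarrow> finite (pairings M) \<and> card (pairings M) \<le> odd_dfact k"
proof (induction k arbitrary: M)
  case 0
  then show ?case by (simp add: pairings_def odd_dfact_simps)
next
  case (Suc k)
  then obtain a M' where M: "M = add_mset a M'" by (metis size_eq_Suc_imp_eq_union mult_Suc_right add_2_eq_Suc)
  have sz: "size M' = 2 * k + 1" using Suc.prems M by simp
  have IH: "finite (pairings (M' - {#b#})) \<and> card (pairings (M' - {#b#})) \<le> odd_dfact k" if "b \<in># M'" for b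
    using Suc.IH[of "M' - {#b#}"] sz that by (simp add: size_Diff_singleton)
  let ?F = "\<lambda>b. (\<lambda>p v. chord_form a b v * p v) ` pairings (M' - {#b#})"
  have st: "pairings M = (\<Union>b\<in>set_mset M'. ?F b)" unfolding M using sz by (intro pairings_step) simp
  have "card (pairings M) \<le> (\<Sum>b\<in>set_mset M'. card (?F b))" unfolding st by (rule card_UN_le) simp
  also have "\<dots> \<le> (\<Sum>b\<in>set_mset M'. odd_dfact k)"
    by (intro sum_mono order_trans[OF card_image_le]) (use IH in auto)
  also have "\<dots> \<le> (2 * k + 1) * odd_dfact k"
    using sz by (simp) (metis add.commute mult_le_mono1 plus_1_eq_Suc size_multiset_overloaded_eq set_mset_mset size_mset card_length ex_mset mult_Suc)
  finally show ?case using IH by (auto simp: st odd_dfact_simps)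
qed

end

section \<open>Fibres over forms with distinct roots\<close>

text \<open>
  A multiset of representatives of distinct points of the projective line. Stated by submultisets
  of size two, it also excludes repetitions.
\<close>

definition nonprop :: "(complex^2) multiset \<Rightarrow> bool" where
  "nonprop M \<longleftrightarrow> 0 \<notin># M \<and> (\<forall>a b. {#a, b#} \<subseteq># M \<longrightarrow> (\<forall>c. a \<noteq> c *s b))"

lemma nonprop_mono: "nonprop M \<Longrightarrow> N \<subseteq># M \<Longrightarrow> nonprop N"
proof -
  assume M: "nonprop M" and N: "N \<subseteq># M"
  have "0 \<notin># N" using M mset_subset_eqD[OF N] by (auto simp: nonprop_def)
  moreover have "a \<noteq> c *s b" if "{#a, b#} \<subseteq># N" for a b c
    using M subset_mset.order_trans[OF that N] unfolding nonprop_def by blast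
  ultimately show ?thesis unfolding nonprop_def by blast
qed

lemma nonpropD:
  assumes "nonprop (add_mset a M)" "b \<in># M" shows "a \<noteq> c *s b" "b \<noteq> c *s a"
proof -
  have "{#a, b#} \<subseteq># add_mset a M" using assms(2) by simp
  moreover have "{#b, a#} = {#a, b#}" by simp
  ultimately show "a \<noteq> c *s b" "b \<noteq> c *s a" using assms(1) unfolding nonprop_def by metis+
qed

lemma lform_product_prop:
  assumes b: "b \<noteq> 0" and eq: "\<And>z. lform x z * lform y z = c * (lform a z * lform (b :: complex^2) z)"
  shows "\<exists>r. x = r *s b \<or> y = r *s b"
proof -
  have "\<exists>d\<in>set [x, y]. \<exists>r. d = r *s b"
    by (rule lform_prime[OF b]) (simp add: eq)
  then show ?thesis by auto
qed

context ellipsoid_form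
begin

lemma chord_form_lform: "\<exists>\<alpha>. chord_form x y = lform \<alpha>" using chord_form_hom hom_polys_1_iff by blast

lemma chord_form_continuous: "continuous_on S (chord_form x y)"
  using polys_continuous[OF hom_polys_polys[OF chord_form_hom]] .

lemma pairprod_continuous: "continuous_on S (pairprod xs)"
  by (induction xs rule: pairprod.induct) (auto intro!: continuous_intros chord_form_continuous)

lemma chord_form_cancel:
  assumes "x \<noteq> 0" "y \<noteq> 0" "\<And>v. chord_form x y v * pairprod zs v = chord_form x y v * pairprod zs' v"
  shows "pairprod zs = pairprod zs'"
proof -
  obtain \<alpha> where \<alpha>: "chord_form x y = lform \<alpha>" using chord_form_lform by blast
  have "\<alpha> \<noteq> 0" using chord_form_nonzero[OF assms(1,2)] \<alpha> lform_zero by fastforce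
  then show ?thesis using assms(3) unfolding \<alpha> by (intro lform_cancel pairprod_continuous)
qed

lemma pairprod_lforms:
  "\<exists>\<beta>s. pairprod xs = (\<lambda>v. \<Prod>\<beta>\<leftarrow>\<beta>s. lform \<beta> v) \<and> (\<forall>\<beta>\<in>set \<beta>s. \<exists>x\<in>set xs. \<exists>y\<in>set xs. chord_form x y = lform \<beta>)"
proof (induction xs rule: pairprod.induct)
  case (1 x y xs)
  then obtain \<beta>s where \<beta>s: "pairprod xs = (\<lambda>v. \<Prod>\<beta>\<leftarrow>\<beta>s. lform \<beta> v)"
    "\<forall>\<beta>\<in>set \<beta>s. \<exists>x\<in>set xs. \<exists>y\<in>set xs. chord_form x y = lform \<beta>" by blast
  obtain \<beta> where "chord_form x y = lform \<beta>" using chord_form_lform by blast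
  then show ?case using \<beta>s by (intro exI[of _ "\<beta> # \<beta>s"]) auto
qed (rule exI[of _ "[]"], simp)+

text \<open>
  By \<open>lform_prime\<close>. The first factor is kept apart, because \<open>card_pairings_eq\<close> excludes it for a
  different reason than the others.
\<close>

lemma chord_form_divides_pairprod:
  assumes ab: "a \<noteq> 0" "b \<noteq> 0" and z: "\<And>v. chord_form a b v = 0 \<Longrightarrow> pairprod (u # w # xs) v = 0"
  shows "(\<exists>c. \<forall>v. chord_form u w v = c * chord_form a b v) \<or> (\<exists>x\<in>set xs. \<exists>y\<in>set xs. \<exists>c. \<forall>v. chord_form x y v = c * chord_form a b v)"
proof -
  obtain \<alpha> where \<alpha>: "chord_form a b = lform \<alpha>" using chord_form_lform by blast
  have \<alpha>0: "\<alpha> \<noteq> 0" using chord_form_nonzero[OF ab] \<alpha> lform_zero by fastforce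
  obtain \<beta>0 where \<beta>0: "chord_form u w = lform \<beta>0" using chord_form_lform by blast
  obtain \<beta>s where \<beta>s: "pairprod xs = (\<lambda>v. \<Prod>\<beta>\<leftarrow>\<beta>s. lform \<beta> v)"
      "\<And>\<beta>. \<beta> \<in> set \<beta>s \<Longrightarrow> \<exists>x\<in>set xs. \<exists>y\<in>set xs. chord_form x y = lform \<beta>" using pairprod_lforms by blast
  have "\<exists>\<beta>\<in>set (\<beta>0 # \<beta>s). \<exists>c. \<beta> = c *s \<alpha>"
  proof (rule lform_prime[OF \<alpha>0])
    fix v assume "lform \<alpha> v = 0"
    then have "pairprod (u # w # xs) v = 0" using z unfolding \<alpha> by blast
    then show "(\<Prod>\<beta>\<leftarrow>\<beta>0 # \<beta>s. lform \<beta> v) = 0" using \<beta>s(1) \<beta>0 by simp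
  qed
  then obtain \<beta> c where bc: "\<beta> \<in> set (\<beta>0 # \<beta>s)" "\<beta> = c *s \<alpha>" by blast
  have e: "chord_form x y v = c * chord_form a b v" if "chord_form x y = lform \<beta>" for x y v
    unfolding that \<alpha> bc(2) by (rule lform_scale_left)
  from bc(1) consider "\<beta> = \<beta>0" | "\<beta> \<in> set \<beta>s" by auto
  then show ?thesis
  proof cases
    case 1 then show ?thesis using e[of u w] \<beta>0 by blast
  next
    case 2 then show ?thesis using e \<beta>s(2)[of \<beta>] by blast
  qed
qed

text \<open>
  The union in \<open>pairings_step\<close> is disjoint: if partners \<open>b\<close> and \<open>b\<^sub>1\<close> of \<open>a\<close> gave the same
  product, then the chord through \<open>a\<close> and \<open>b\<^sub>1\<close> would be among the chords of the first pairing,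
  where \<open>a\<close> is on the chord to \<open>b\<close> only.
\<close>

lemma card_pairings_eq: "size M = 2 * k \<Longrightarrow> nonprop M \<Longrightarrow> card (pairings M) = odd_dfact k"
proof (induction k arbitrary: M)
  case 0
  then show ?case by (simp add: pairings_def odd_dfact_simps)
next
  case (Suc k)
  then obtain a M' where M: "M = add_mset a M'" by (metis size_eq_Suc_imp_eq_union mult_Suc_right add_2_eq_Suc)
  have sz: "size M' = 2 * k + 1" using Suc.prems M by simp
  have np: "nonprop (add_mset a M')" using Suc.prems M by simp
  have np': "nonprop M'" using nonprop_mono[OF np] by simp
  have nz: "a \<noteq> 0" "\<And>b. b \<in># M' \<Longrightarrow> b \<noteq> 0" using np by (auto simp: nonprop_def)
  have IH: "finite (pairings (M' - {#b#}))" "card (pairings (M' - {#b#})) = odd_dfact k" if "b \<in># M'" for b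
    using Suc.IH[of "M' - {#b#}"] card_pairings_le[of "M' - {#b#}" k] nonprop_mono[OF np', of "M' - {#b#}"] sz that
    by (simp_all add: size_Diff_singleton)
  let ?F = "\<lambda>b. (\<lambda>p v. chord_form a b v * p v) ` pairings (M' - {#b#})"
  have st: "pairings M = (\<Union>b\<in>set_mset M'. ?F b)" unfolding M using sz by (intro pairings_step) simp
  have inj: "inj_on (\<lambda>p v. chord_form a b v * p v) (pairings (M' - {#b#}))" if b: "b \<in># M'" for b
  proof (rule inj_onI)
    fix p q assume pq: "p \<in> pairings (M' - {#b#})" "q \<in> pairings (M' - {#b#})"
      and eq: "(\<lambda>v. chord_form a b v * p v) = (\<lambda>v. chord_form a b v * q v)"
    then obtain zs zs' where "p = pairprod zs" "q = pairprod zs'" by (auto simp: pairings_def)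
    then show "p = q" using chord_form_cancel[OF nz(1) nz(2)[OF b], of zs zs'] fun_cong[OF eq] by simp
  qed
  have distinct: "b = b'" if b: "b \<in># M'" "b' \<in># M'" and common: "p \<in> ?F b" "p \<in> ?F b'" for b b' p
  proof (rule ccontr)
    assume neq: "b \<noteq> b'"
    obtain zs where zs: "mset zs = M' - {#b#}" "p = (\<lambda>v. chord_form a b v * pairprod zs v)"
      using common(1) by (auto simp: pairings_def)
    obtain zs' where zs': "p = (\<lambda>v. chord_form a b' v * pairprod zs' v)" using common(2) by (auto simp: pairings_def)
    have "b' \<in># M' - {#b#}" using b neq by (metis insert_DiffM insert_noteq_member)
    then have bb': "add_mset b {#b'#} \<subseteq># M'"
      using b by (simp add: insert_subset_eq_iff)
    have npb: "b \<noteq> c *s b'" "b' \<noteq> c *s b" for c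
      using nonpropD[OF nonprop_mono[OF np' bb']] by auto
    have vanish: "pairprod (a # b # zs) v = 0" if "chord_form a b' v = 0" for v
      using zs(2) zs' that by (auto dest: fun_cong[of _ _ v])
    have "(\<exists>c. \<forall>v. chord_form a b v = c * chord_form a b' v) \<or> (\<exists>x\<in>set zs. \<exists>y\<in>set zs. \<exists>c. \<forall>v. chord_form x y v = c * chord_form a b' v)"
      by (rule chord_form_divides_pairprod[OF nz(1) nz(2)[OF b(2)]]) (rule vanish)
    then show False
    proof (elim disjE exE bexE)
      fix c assume c: "\<forall>v. chord_form a b v = c * chord_form a b' v"
      have "lform a z * lform b z = c * (lform a z * lform b' z)" for z
        using c chord_form_psi by metis
      from lform_product_prop[OF nz(2)[OF b(2)] this] show False
        using nonpropD[OF np b(2)] npb by blast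
    next
      fix x y c assume xy: "x \<in> set zs" "y \<in> set zs" and c: "\<forall>v. chord_form x y v = c * chord_form a b' v"
      have "lform x z * lform y z = c * (lform b' z * lform a z)" for z
        using c chord_form_psi by (metis mult.commute)
      from lform_product_prop[OF nz(1) this] have "\<exists>r. x = r *s a \<or> y = r *s a" .
      moreover have "x \<in># M'" "y \<in># M'" using xy zs(1) by (metis in_diffD set_mset_mset)+
      ultimately show False using nonpropD(2)[OF np] by blast
    qed
  qed
  have "card (pairings M) = (\<Sum>b\<in>set_mset M'. card (?F b))" unfolding st
  proof (rule card_UN_disjoint)
    show "\<forall>b\<in>set_mset M'. finite (?F b)" using IH by blast
    show "\<forall>b\<in>set_mset M'. \<forall>b'\<in>set_mset M'. b \<noteq> b' \<longrightarrow> ?F b \<inter> ?F b' = {}"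
    proof (intro ballI impI)
      fix b b' assume bb: "b \<in># M'" "b' \<in># M'" "b \<noteq> b'"
      show "?F b \<inter> ?F b' = {}"
      proof (rule ccontr)
        assume "?F b \<inter> ?F b' \<noteq> {}"
        then obtain p where "p \<in> ?F b" "p \<in> ?F b'" by (meson disjoint_iff)
        then show False using distinct[OF bb(1,2)] bb(3) by blast
      qed
    qed
  qed simp
  also have "\<dots> = (\<Sum>b\<in>set_mset M'. odd_dfact k)"
    using card_image[OF inj] IH by (intro sum.cong) auto
  also have "\<dots> = card (set_mset M') * odd_dfact k" by simp
  also have "card (set_mset M') = size M'"
  proof -
    have "count M' b = 1" if "b \<in># M'" for b
    proof (rule ccontr)
      assume "count M' b \<noteq> 1"
      then have "2 \<le> count M' b" using that by (metis One_nat_def Suc_1 count_greater_zero_iff le_less_linear less_2_cases not_gr_zero)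
      then have "{#b, b#} \<subseteq># M'" by (simp add: subseteq_mset_def)
      then show False using np' unfolding nonprop_def by (metis vector_smult_lid)
    qed
    then show ?thesis by (simp add: size_multiset_overloaded_eq)
  qed
  finally show ?case using sz by (simp add: odd_dfact_simps)
qed

lemma Theta_inj_fibre: "inj_on Theta (fibre k P)"
  by (rule inj_on_subset[OF Theta_inj[of k]]) (auto simp: fibre_def)

lemma card_fibre_pairings:
  assumes P: "P \<in> VQ_perp A Q k" and xs: "length xs = 2 * k" "\<forall>x\<in>set xs. norm x = 1"
    and eq: "\<And>y. P (psi y) = c * (\<Prod>x\<leftarrow>xs. lform x y)" and c: "c \<noteq> 0"
  shows "finite (fibre k P) \<and> card (fibre k P) = card (pairings (mset xs))"
proof -
  have im: "Theta ` fibre k P = (\<lambda>p v. c * p v) ` pairings (mset xs)"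
    unfolding fibre_Theta_image[OF P xs eq c] pairings_def by (simp add: image_image)
  have i2: "inj_on (\<lambda>p v. c * p v) (pairings (mset xs))"
    using c by (auto intro!: inj_onI simp: fun_eq_iff)
  have f: "finite (pairings (mset xs))" using card_pairings_le[of "mset xs" k] xs(1) by simp
  have "finite (Theta ` fibre k P)" unfolding im using f by simp
  then have "finite (fibre k P)" using finite_image_iff[OF Theta_inj_fibre] by blast
  moreover have "card (fibre k P) = card (Theta ` fibre k P)" using card_image[OF Theta_inj_fibre] by metis
  ultimately show ?thesis unfolding im using card_image[OF i2] by simp
qed

lemma card_fibre_le:
  assumes P: "P \<in> VQ_perp A Q k"
  shows "finite (fibre k P)" "card (fibre k P) \<le> odd_dfact k"
proof -
  have "P \<in> hom_polys k" using P VQ_perp_sub by blast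
  then obtain c xs where cx: "length xs = 2 * k" "\<forall>x\<in>set xs. norm x = 1" "\<And>y. P (psi y) = c * (\<Prod>x\<leftarrow>xs. lform x y)"
    using hom_psi_factorization by blast
  have "finite (fibre k P) \<and> card (fibre k P) \<le> odd_dfact k"
  proof (cases "c = 0")
    case True
    then have "fibre k P = {Zero_mp}" using fibre_zero[OF P] cx(3) by simp
    moreover have "1 \<le> odd_dfact k" by (induction k) (auto simp: odd_dfact_simps)
    ultimately show ?thesis by simp
  next
    case False
    then show ?thesis using card_fibre_pairings[OF P cx False] card_pairings_le[of "mset xs" k] cx(1) by simp
  qed
  then show "finite (fibre k P)" "card (fibre k P) \<le> odd_dfact k" by auto
qed

lemma card_fibre_generic:
  assumes "P \<in> VQ_perp A Q k" "length xs = 2 * k" "\<forall>x\<in>set xs. norm x = 1"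
    "\<And>y. P (psi y) = c * (\<Prod>x\<leftarrow>xs. lform x y)" "c \<noteq> 0" "nonprop (mset xs)"
  shows "card (fibre k P) = odd_dfact k"
  using card_fibre_pairings[OF assms(1-5)] card_pairings_eq[of "mset xs" k] assms(2,6) by simp

section \<open>Continuity of the fibres\<close>

lemma pairprod_nth:
  "length xs = 2 * k \<Longrightarrow> pairprod xs v = (\<Prod>i<k. chord_form (xs ! (2 * i)) (xs ! (2 * i + 1)) v)"
proof (induction xs arbitrary: k rule: pairprod.induct)
  case (1 x y xs)
  then obtain j where k: "k = Suc j" "length xs = 2 * j" by (cases k) auto
  show ?case using "1.IH"[OF k(2)] unfolding k(1) prod.lessThan_Suc_shift by simp
next
  case ("2_2" w)
  then have "1 = 2 * k" by simp
  then have False by presburger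
  then show ?case ..
qed auto

lemma chord_form_tendsto:
  assumes "(x \<longlongrightarrow> x0) F" "(y \<longlongrightarrow> y0) F"
  shows "((\<lambda>n. chord_form (x n) (y n) v) \<longlongrightarrow> chord_form x0 y0 v) F"
  unfolding chord_form_def by (intro tendsto_intros assms)

lemma lform_tendsto:
  assumes "(x \<longlongrightarrow> x0) F" shows "((\<lambda>n. lform (x n) z) \<longlongrightarrow> lform x0 z) F"
  unfolding lform_def by (intro tendsto_intros assms)

definition list_conv :: "nat \<Rightarrow> (nat \<Rightarrow> (complex^2) list) \<Rightarrow> (complex^2) list \<Rightarrow> bool" where
  "list_conv m xs ys \<longleftrightarrow> length ys = m \<and> (\<forall>y\<in>set ys. norm y = 1) \<and> (\<forall>n. length (xs n) = m \<and> (\<forall>x\<in>set (xs n). norm x = 1))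
     \<and> (\<forall>i<m. (\<lambda>n. xs n ! i) \<longlonglongrightarrow> ys ! i)"

lemma pairprod_tendsto:
  assumes "list_conv (2 * k) xs ys" shows "(\<lambda>n. pairprod (xs n) v) \<longlonglongrightarrow> pairprod ys v"
proof -
  have l: "length ys = 2 * k" "length (xs n) = 2 * k" for n using assms by (auto simp: list_conv_def)
  show ?thesis unfolding pairprod_nth[OF l(1)] pairprod_nth[OF l(2)]
    using assms by (intro tendsto_prod chord_form_tendsto) (auto simp: list_conv_def)
qed

lemma lforms_tendsto:
  assumes "list_conv m xs ys" shows "(\<lambda>n. \<Prod>x\<leftarrow>xs n. lform x z) \<longlonglongrightarrow> (\<Prod>y\<leftarrow>ys. lform y z)"
proof -
  have e: "(\<Prod>x\<leftarrow>us. lform x z) = (\<Prod>i<m. lform (us ! i) z)" if "length us = m" for us :: "(complex^2) list"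
    using that by (simp add: prod.list_conv_set_nth atLeast0LessThan)
  have l: "length ys = m" "length (xs n) = m" for n using assms by (auto simp: list_conv_def)
  show ?thesis unfolding e[OF l(1)] e[OF l(2)]
    using assms by (intro tendsto_prod lform_tendsto) (auto simp: list_conv_def)
qed

lemma list_conv_subsequence:
  assumes "\<And>n. length (xs n) = m" "\<And>n. \<forall>x\<in>set (xs n). norm x = 1"
  shows "\<exists>r ys. strict_mono (r :: nat \<Rightarrow> nat) \<and> list_conv m (\<lambda>n. xs (r n)) ys"
proof -
  have "xs n ! i \<in> sphere 0 1" if "i < m" for n i
  proof -
    have "xs n ! i \<in> set (xs n)" using assms(1) that by simp
    then show ?thesis using assms(2) by simp
  qed
  then obtain r where r: "strict_mono (r :: nat \<Rightarrow> nat)" "\<forall>i<m. \<exists>l\<in>sphere 0 1. (\<lambda>n. xs (r n) ! i) \<longlonglongrightarrow> l"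
    using compact_lists_subsequence[OF compact_sphere, of m "\<lambda>n i. xs n ! i" 0 1] by blast
  then obtain l where l: "\<And>i. i < m \<Longrightarrow> l i \<in> sphere 0 1" "\<And>i. i < m \<Longrightarrow> (\<lambda>n. xs (r n) ! i) \<longlonglongrightarrow> l i" by metis
  have "list_conv m (\<lambda>n. xs (r n)) (map l [0..<m])"
    using l assms by (auto simp: list_conv_def)
  then show ?thesis using r(1) by blast
qed

lemma ellipsoid_norm: "v \<in> ellipsoid A \<Longrightarrow> norm ((v v* A) $ i) \<le> 1"
  using Finite_Cartesian_Product.norm_nth_le[of "v v* A" i] by (simp add: ellipsoid_def)

lemma pairprod_bound:
  assumes "\<forall>x\<in>set xs. norm x = 1" "v \<in> ellipsoid A"
  shows "cmod (pairprod xs v) \<le> 3 ^ length xs"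
proof -
  have L: "cmod (chord_form x y v) \<le> 3" if "norm x = 1" "norm y = 1" for x y
  proof -
    have c: "cmod (x $ i) \<le> 1" "cmod (y $ i) \<le> 1" for i
      using that by (metis Finite_Cartesian_Product.norm_nth_le)+
    have xy: "cmod (x $ i * y $ j) \<le> 1" for i j using c mult_le_one[of "cmod (x $ i)" "cmod (y $ j)"] by (simp add: norm_mult)
    let ?u = "v v* A"
    have u: "cmod (?u $ i) \<le> 1" for i using ellipsoid_norm[OF assms(2)] .
    have a: "cmod (1/2 * (?u $ 1 - \<i> * ?u $ 2)) \<le> 1" "cmod (1/2 * (?u $ 1 + \<i> * ?u $ 2)) \<le> 1"
      using norm_triangle_ineq4[of "?u $ 1" "\<i> * ?u $ 2"] norm_triangle_ineq[of "?u $ 1" "\<i> * ?u $ 2"] u[of 1] u[of 2]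
      by (simp_all add: norm_mult)
    have b: "cmod (1/2 * ?u $ 3) \<le> 1/2" using u[of 3] by (simp add: norm_mult)
    have "cmod (chord_form x y v) \<le> cmod (x $ 1 * y $ 1 * (1/2 * (?u $ 1 - \<i> * ?u $ 2)))
       + cmod ((x $ 1 * y $ 2 + x $ 2 * y $ 1) * (1/2 * ?u $ 3)) + cmod (x $ 2 * y $ 2 * (1/2 * (?u $ 1 + \<i> * ?u $ 2)))"
      unfolding chord_form_def by (rule order_trans[OF norm_triangle_ineq4]) (intro add_right_mono norm_triangle_ineq)
    also have "\<dots> \<le> 1 * 1 + 2 * (1/2) + 1 * 1"
      unfolding norm_mult[of "_ * _"] norm_mult[of "_ + _"]
    proof (intro add_mono mult_mono xy a b)
      show "cmod (x $ 1 * y $ 2 + x $ 2 * y $ 1) \<le> 2"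
        using norm_triangle_ineq[of "x $ 1 * y $ 2" "x $ 2 * y $ 1"] xy[of 1 2] xy[of 2 1] by linarith
    qed auto
    finally show ?thesis by simp
  qed
  show ?thesis using assms(1)
  proof (induction xs rule: pairprod.induct)
    case (1 x y xs)
    then have "cmod (chord_form x y v) * cmod (pairprod xs v) \<le> 9 * 3 ^ length xs"
      using L[of x y] by (intro mult_mono) auto
    then show ?case by (simp add: norm_mult)
  qed auto
qed

lemma rho_eq: "rho A u w = L2norm A (\<lambda>v. Theta u v - Theta w v)"
  by (simp add: rho_def)

text \<open>
  Products of convergent chord forms converge pointwise and are uniformly bounded on the
  ellipsoid, hence converge in the mean.
\<close>

lemma rho_tendsto:
  assumes xs: "list_conv (2 * k) xs ys" and c: "c \<longlonglongrightarrow> c0"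
    and w: "\<And>n. Theta (w n) = (\<lambda>v. c n * pairprod (xs n) v)" and w0: "Theta w0 = (\<lambda>v. c0 * pairprod ys v)"
  shows "(\<lambda>n. rho A (w n) w0) \<longlonglongrightarrow> 0"
proof -
  define d where "d n = (\<lambda>v. Theta (w n) v - Theta w0 v)" for n
  have dC: "d n \<in> ellcont" for n unfolding d_def w w0
    by (auto simp: ellcont_def intro!: continuous_intros pairprod_continuous)
  obtain B where B: "\<And>n. cmod (c n) \<le> B" using convergent_imp_Bseq[of c] c unfolding Bseq_def convergent_def by blast
  have B0: "cmod c0 \<le> B" by (rule LIMSEQ_le_const2[OF tendsto_norm[OF c]]) (use B in auto)
  define K where "K = 2 * (B * 3 ^ (2 * k))"
  have bd: "cmod (d n v) \<le> K" if v: "v \<in> ellipsoid A" for n v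
  proof -
    have l: "length ys = 2 * k" "length (xs n) = 2 * k" "\<forall>x\<in>set ys. norm x = 1" "\<forall>x\<in>set (xs n). norm x = 1"
      using xs by (auto simp: list_conv_def)
    have BB: "0 \<le> B" using B[of 0] norm_ge_zero order_trans by blast
    have "cmod (c n * pairprod (xs n) v) \<le> B * 3 ^ (2 * k)" "cmod (c0 * pairprod ys v) \<le> B * 3 ^ (2 * k)"
      using pairprod_bound[OF l(3) v] pairprod_bound[OF l(4) v] B B0 BB l(1,2)
      unfolding norm_mult by (auto intro!: mult_mono)
    then show ?thesis unfolding d_def w w0 K_def
      using norm_triangle_ineq4[of "c n * pairprod (xs n) v" "c0 * pairprod ys v"] by linarith
  qed
  have lim: "(\<lambda>n. d n v) \<longlonglongrightarrow> 0" for v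
  proof -
    have "(\<lambda>n. d n v) \<longlonglongrightarrow> c0 * pairprod ys v - c0 * pairprod ys v"
      unfolding d_def w w0 by (intro tendsto_intros c pairprod_tendsto[OF xs])
    then show ?thesis by simp
  qed
  have "(\<lambda>n. LINT u|sphere_measure. (cmod (d n (ellipsoid_point u)))\<^sup>2) \<longlonglongrightarrow> (LINT u|sphere_measure. (0 :: real))"
  proof (rule integral_dominated_convergence[where w = "\<lambda>_. K\<^sup>2"])
    show "(\<lambda>u. (cmod (d n (ellipsoid_point u)))\<^sup>2) \<in> borel_measurable sphere_measure" for n
      by (intro sphere_measurable continuous_intros ellcont_ellipsoid_point dC)
    show "integrable sphere_measure (\<lambda>_. K\<^sup>2)" by (rule sphere_integrable) auto
    show "AE u in sphere_measure. (\<lambda>n. (cmod (d n (ellipsoid_point u)))\<^sup>2) \<longlonglongrightarrow> 0"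
      using tendsto_power[OF tendsto_norm[OF lim], where n = 2] by simp
    show "AE u in sphere_measure. norm ((cmod (d n (ellipsoid_point u)))\<^sup>2) \<le> K\<^sup>2" for n
      using bd by (intro AE_I2) (auto simp: space_sphere_measure ellipsoid_eq intro!: power_mono)
  qed simp
  then have "(\<lambda>n. (LINT u|sphere_measure. (cmod (d n (ellipsoid_point u)))\<^sup>2)) \<longlonglongrightarrow> 0" by simp
  then have "(\<lambda>n. sqrt (LINT u|sphere_measure. (cmod (d n (ellipsoid_point u)))\<^sup>2)) \<longlonglongrightarrow> sqrt 0"
    by (rule tendsto_real_sqrt)
  then show ?thesis unfolding rho_eq d_def[symmetric] L2norm_def herm_self[OF dC] by simp
qed

text \<open>
  The factors subconverge by compactness. The constants follow since the limit factors have a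
  point \<open>y0\<close> where none of them vanishes.
\<close>

lemma factorizations_subconverge:
  assumes P: "\<And>v. (\<lambda>n. P n v) \<longlonglongrightarrow> P0 v"
    and xs: "\<And>n. length (xs n) = 2 * k" "\<And>n. \<forall>x\<in>set (xs n). norm x = 1"
    and eq: "\<And>n y. P n (psi y) = c n * (\<Prod>x\<leftarrow>xs n. lform x y)"
  shows "\<exists>r ys c0. strict_mono (r :: nat \<Rightarrow> nat) \<and> list_conv (2 * k) (\<lambda>n. xs (r n)) ys \<and> (\<lambda>n. c (r n)) \<longlonglongrightarrow> c0 \<and>
     (\<forall>y. P0 (psi y) = c0 * (\<Prod>x\<leftarrow>ys. lform x y))"
proof -
  obtain r ys where r: "strict_mono (r :: nat \<Rightarrow> nat)" "list_conv (2 * k) (\<lambda>n. xs (r n)) ys"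
    using list_conv_subsequence[of xs "2 * k", OF xs] by blast
  have "0 \<notin> set ys" using r(2) norm1_nonzero unfolding list_conv_def by blast
  then obtain y0 where y0: "(\<Prod>x\<leftarrow>ys. lform x y0) \<noteq> 0" using lforms_product_nonzero by blast
  define q where "q n y = (\<Prod>x\<leftarrow>xs (r n). lform x y)" for n y
  have q: "(\<lambda>n. q n y) \<longlonglongrightarrow> (\<Prod>x\<leftarrow>ys. lform x y)" for y unfolding q_def by (rule lforms_tendsto[OF r(2)])
  have Pr: "(\<lambda>n. P (r n) v) \<longlonglongrightarrow> P0 v" for v using LIMSEQ_subseq_LIMSEQ[OF P r(1)] by (simp add: o_def)
  define c0 where "c0 = P0 (psi y0) / (\<Prod>x\<leftarrow>ys. lform x y0)"
  have "(\<lambda>n. P (r n) (psi y0) / q n y0) \<longlonglongrightarrow> c0" unfolding c0_def by (intro tendsto_divide Pr q y0)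
  moreover have "\<forall>\<^sub>F n in sequentially. P (r n) (psi y0) / q n y0 = c (r n)"
    using tendsto_imp_eventually_ne[OF q y0] by eventually_elim (simp add: eq q_def)
  ultimately have c: "(\<lambda>n. c (r n)) \<longlonglongrightarrow> c0" by (rule Lim_transform_eventually)
  have "P0 (psi y) = c0 * (\<Prod>x\<leftarrow>ys. lform x y)" for y
  proof (rule LIMSEQ_unique[OF Pr])
    show "(\<lambda>n. P (r n) (psi y)) \<longlonglongrightarrow> c0 * (\<Prod>x\<leftarrow>ys. lform x y)"
      unfolding eq q_def[symmetric] by (intro tendsto_mult c q)
  qed
  then show ?thesis using r c by blast
qed

lemma fibre_upper_seq:
  assumes P: "\<And>n. P n \<in> VQ_perp A Q k" and P0: "P0 \<in> VQ_perp A Q k" and lim: "\<And>v. (\<lambda>n. P n v) \<longlonglongrightarrow> P0 v"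
    and u: "\<And>n. u n \<in> fibre k (P n)"
  shows "\<exists>r w. strict_mono (r :: nat \<Rightarrow> nat) \<and> w \<in> fibre k P0 \<and> (\<lambda>n. rho A (u (r n)) w) \<longlonglongrightarrow> 0"
proof -
  obtain c xs where cx: "\<And>n. length (xs n) = 2 * k" "\<And>n. \<forall>x\<in>set (xs n). norm x = 1"
    "\<And>n. Theta (u n) = (\<lambda>v. c n * pairprod (xs n) v)" "\<And>n y. P n (psi y) = c n * (\<Prod>x\<leftarrow>xs n. lform x y)"
    using points_of_fibre[OF P u] by metis
  obtain r ys c0 where r: "strict_mono (r :: nat \<Rightarrow> nat)" "list_conv (2 * k) (\<lambda>n. xs (r n)) ys" "(\<lambda>n. c (r n)) \<longlonglongrightarrow> c0"
     "\<And>y. P0 (psi y) = c0 * (\<Prod>x\<leftarrow>ys. lform x y)" using factorizations_subconverge[OF lim cx(1,2,4)] by blast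
  obtain w where w: "w \<in> fibre k P0" "Theta w = (\<lambda>v. c0 * pairprod ys v)"
    using fibre_of_points[OF P0, of ys c0] r(2,4) unfolding list_conv_def by blast
  have "(\<lambda>n. rho A (u (r n)) w) \<longlonglongrightarrow> 0" by (rule rho_tendsto[OF r(2,3) _ w(2)]) (simp add: cx(3))
  then show ?thesis using r(1) w(1) by blast
qed

text \<open>
  Every multipole over the limit is approached: its pairing of the limit factors, transferred by
  position to the factors of \<open>P n\<close>, gives multipoles over \<open>P n\<close>.
\<close>

lemma fibre_lower_seq:
  assumes P: "\<And>n. P n \<in> VQ_perp A Q k" and P0: "P0 \<in> VQ_perp A Q k" and lim: "\<And>v. (\<lambda>n. P n v) \<longlonglongrightarrow> P0 v"
    and u: "u \<in> fibre k P0"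
  shows "\<exists>r w. strict_mono (r :: nat \<Rightarrow> nat) \<and> (\<forall>n. w n \<in> fibre k (P (r n))) \<and> (\<lambda>n. rho A (w n) u) \<longlonglongrightarrow> 0"
proof -
  have "\<forall>n. \<exists>c xs. length xs = 2 * k \<and> (\<forall>x\<in>set xs. norm x = 1) \<and> (\<forall>y. P n (psi y) = c * (\<Prod>x\<leftarrow>xs. lform x y))"
    using hom_psi_factorization P VQ_perp_sub by blast
  then obtain c xs where cx: "\<And>n. length (xs n) = 2 * k" "\<And>n. \<forall>x\<in>set (xs n). norm x = 1"
    "\<And>n y. P n (psi y) = c n * (\<Prod>x\<leftarrow>xs n. lform x y)" by metis
  obtain r ys c0 where r: "strict_mono (r :: nat \<Rightarrow> nat)" "list_conv (2 * k) (\<lambda>n. xs (r n)) ys" "(\<lambda>n. c (r n)) \<longlonglongrightarrow> c0"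
     "\<And>y. P0 (psi y) = c0 * (\<Prod>x\<leftarrow>ys. lform x y)" using factorizations_subconverge[OF lim cx] by blast
  obtain c1 zs where z: "length zs = 2 * k" "\<forall>x\<in>set zs. norm x = 1" "Theta u = (\<lambda>v. c1 * pairprod zs v)"
     "\<And>y. P0 (psi y) = c1 * (\<Prod>x\<leftarrow>zs. lform x y)" using points_of_fibre[OF P0 u] by blast
  have ys: "length ys = 2 * k" "\<forall>x\<in>set ys. norm x = 1" using r(2) by (auto simp: list_conv_def)
  \<comment> \<open>the pairing that defines \<open>u\<close> as a reordering of the limit factors\<close>
  obtain \<sigma> where \<sigma>: "\<sigma> permutes {..<2 * k}" "Theta u = (\<lambda>v. c0 * pairprod (permute_list \<sigma> ys) v)"
  proof (cases "c0 = 0")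
    case True
    obtain y where "(\<Prod>x\<leftarrow>zs. lform x y) \<noteq> 0" using lforms_product_nonzero[OF norm1_nonzero[OF z(2)]] by blast
    then have "c1 = 0" using z(4)[of y] r(4)[of y] True by auto
    then show ?thesis using True z(3) by (intro that[of id]) (auto simp: permutes_id)
  next
    case False
    have "u \<in> fibre k P0" by (rule u)
    then have "Theta u \<in> (\<lambda>ys v. c0 * pairprod ys v) ` {zs. mset zs = mset ys}"
      using fibre_Theta_image[OF P0 ys r(4) False] by blast
    then obtain cs where cs: "mset cs = mset ys" "Theta u = (\<lambda>v. c0 * pairprod cs v)" by blast
    obtain \<sigma> where "\<sigma> permutes {..<length ys}" "permute_list \<sigma> ys = cs" using mset_eq_permutation[OF cs(1)] by blast
    then show ?thesis using cs(2) ys(1) by (intro that[of \<sigma>]) auto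
  qed
  define xs' where "xs' n = permute_list \<sigma> (xs (r n))" for n
  have ms: "mset (xs' n) = mset (xs (r n))" for n using \<sigma>(1) cx(1) by (simp add: xs'_def)
  have lc: "list_conv (2 * k) xs' (permute_list \<sigma> ys)"
  proof -
    have 1: "(\<lambda>n. xs' n ! i) \<longlonglongrightarrow> permute_list \<sigma> ys ! i" if i: "i < 2 * k" for i
    proof -
      have "\<sigma> i < 2 * k" using permutes_in_image[OF \<sigma>(1), of i] i by simp
      then have "(\<lambda>n. xs (r n) ! \<sigma> i) \<longlonglongrightarrow> ys ! \<sigma> i" using r(2) by (simp add: list_conv_def)
      moreover have "permute_list \<sigma> us ! i = us ! \<sigma> i" if "length us = 2 * k" for us :: "(complex^2) list"
        using \<sigma>(1) i that by (intro permute_list_nth) auto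
      ultimately show ?thesis unfolding xs'_def by (simp only: cx(1) ys(1))
    qed
    have 2: "set (xs' n) = set (xs (r n))" for n using arg_cong[OF ms, of set_mset] by simp
    have 3: "set (permute_list \<sigma> ys) = set ys" using \<sigma>(1) ys(1) by simp
    have 4: "length (xs' n) = 2 * k" for n by (simp add: xs'_def cx(1))
    show ?thesis unfolding list_conv_def using 1 2 3 4 cx(2) ys by simp
  qed
  have "\<exists>w\<in>fibre k (P (r n)). Theta w = (\<lambda>v. c (r n) * pairprod (xs' n) v)" for n
  proof (rule fibre_of_points[OF P])
    show "length (xs' n) = 2 * k" "\<forall>x\<in>set (xs' n). norm x = 1" using lc by (auto simp: list_conv_def)
    show "P (r n) (psi y) = c (r n) * (\<Prod>x\<leftarrow>xs' n. lform x y)" for y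
      using cx(3) lforms_product_mset[OF ms] by metis
  qed
  then obtain w where w: "\<And>n. w n \<in> fibre k (P (r n))" "\<And>n. Theta (w n) = (\<lambda>v. c (r n) * pairprod (xs' n) v)" by metis
  have "(\<lambda>n. rho A (w n) u) \<longlonglongrightarrow> 0" by (rule rho_tendsto[OF lc r(3) w(2) \<sigma>(2)])
  then show ?thesis using r(1) w(1) by blast
qed

end

section \<open>Continuous selections of finite-valued maps\<close>

text \<open>
  An approximate selection: it follows, up to \<open>\<delta>\<close>, a sequence of values \<open>a j\<close> at equidistant nodes
  whose jumps are below \<open>\<delta>\<close>.
\<close>

definition chain :: "(real \<Rightarrow> 'a set) \<Rightarrow> ('a \<Rightarrow> 'a \<Rightarrow> real) \<Rightarrow> 'a \<Rightarrow> real \<Rightarrow> (real \<Rightarrow> 'a) \<Rightarrow> bool" where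
  "chain R d x0 \<delta> g \<longleftrightarrow> g 0 = x0 \<and> (\<forall>t\<in>{0..1}. g t \<in> R t) \<and>
     (\<exists>n a. 0 < n \<and> 1 / real n \<le> \<delta> \<and> (\<forall>j\<le>n. a j \<in> R (real j / real n)) \<and> (\<forall>j<n. d (a j) (a (Suc j)) < \<delta>) \<and>
        (\<forall>t\<in>{0..1}. d (g t) (a (nat \<lfloor>t * real n\<rfloor>)) < \<delta>))"

text \<open>Finite-valued maps on the unit interval, continuous for the Hausdorff distance.\<close>

locale finite_multifunction = Metric_space M d for M :: "'a set" and d +
  fixes R :: "real \<Rightarrow> 'a set"
  assumes fin: "t \<in> {0..1} \<Longrightarrow> finite (R t)" and sub: "t \<in> {0..1} \<Longrightarrow> R t \<subseteq> M"
    and upper: "t \<in> {0..1} \<Longrightarrow> 0 < e \<Longrightarrow> \<forall>\<^sub>F s in at t within {0..1}. \<forall>x\<in>R s. \<exists>y\<in>R t. d x y < e"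
    and lower: "t \<in> {0..1} \<Longrightarrow> 0 < e \<Longrightarrow> y \<in> R t \<Longrightarrow> \<forall>\<^sub>F s in at t within {0..1}. \<exists>x\<in>R s. d x y < e"
begin

lemma R_in_M: "t \<in> {0..1} \<Longrightarrow> x \<in> R t \<Longrightarrow> x \<in> M" using sub by blast

lemma hausdorff_continuous:
  assumes t: "t \<in> {0..1}" and e: "0 < e"
  shows "\<exists>\<eta>>0. \<forall>s\<in>{0..1}. \<bar>s - t\<bar> < \<eta> \<longrightarrow> (\<forall>x\<in>R s. \<exists>y\<in>R t. d x y < e) \<and> (\<forall>y\<in>R t. \<exists>x\<in>R s. d x y < e)"
proof -
  have "\<forall>\<^sub>F s in at t within {0..1}. \<forall>y\<in>R t. \<exists>x\<in>R s. d x y < e"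
    by (rule eventually_ball_finite[OF fin[OF t]]) (use lower[OF t e] in blast)
  with upper[OF t e] have "\<forall>\<^sub>F s in at t within {0..1}. (\<forall>x\<in>R s. \<exists>y\<in>R t. d x y < e) \<and> (\<forall>y\<in>R t. \<exists>x\<in>R s. d x y < e)"
    by (rule eventually_conj)
  then obtain \<eta> where \<eta>: "\<eta> > 0" "\<And>s. s \<in> {0..1} \<Longrightarrow> s \<noteq> t \<Longrightarrow> dist s t < \<eta> \<Longrightarrow>
      (\<forall>x\<in>R s. \<exists>y\<in>R t. d x y < e) \<and> (\<forall>y\<in>R t. \<exists>x\<in>R s. d x y < e)"
    unfolding eventually_at by blast
  have dxx: "d x x < e" if "x \<in> R t" for x using R_in_M[OF t that] e by simp
  have "(\<forall>x\<in>R s. \<exists>y\<in>R t. d x y < e) \<and> (\<forall>y\<in>R t. \<exists>x\<in>R s. d x y < e)" if "s \<in> {0..1}" "\<bar>s - t\<bar> < \<eta>" for s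
  proof (cases "s = t")
    case True then show ?thesis using dxx by blast
  next
    case False then show ?thesis using \<eta>(2)[of s] that by (simp add: dist_real_def)
  qed
  then show ?thesis using \<eta>(1) by blast
qed

text \<open>Compactness of the interval makes the upper estimate uniform, at both ends of a short step.\<close>

lemma uniform_step:
  assumes e: "0 < e"
  shows "\<exists>\<eta>>0. \<forall>s\<in>{0..1}. \<forall>t\<in>{0..1}. \<bar>s - t\<bar> < \<eta> \<longrightarrow> (\<forall>x\<in>R s. \<exists>y\<in>R t. d x y < e)"
proof -
  have e2: "0 < e / 2" using e by simp
  obtain \<eta> where \<eta>: "\<And>t. t \<in> {0..1} \<Longrightarrow> \<eta> t > 0"
    "\<And>t s. t \<in> {0..1} \<Longrightarrow> s \<in> {0..1} \<Longrightarrow> \<bar>s - t\<bar> < \<eta> t \<Longrightarrow> (\<forall>x\<in>R s. \<exists>y\<in>R t. d x y < e / 2) \<and> (\<forall>y\<in>R t. \<exists>x\<in>R s. d x y < e / 2)"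
    using hausdorff_continuous[OF _ e2] by metis
  have "{0..1} \<subseteq> (\<Union>t\<in>{0..1}. ball t (\<eta> t))" using \<eta>(1) by (auto intro: bexI)
  then obtain h where h: "h > 0" "\<And>s. s \<in> {0..1} \<Longrightarrow> \<exists>G\<in>(\<lambda>t. ball t (\<eta> t)) ` {0..1}. ball s h \<subseteq> G"
    using Heine_Borel_lemma[OF compact_Icc, of 0 "1 :: real" "(\<lambda>t. ball t (\<eta> t)) ` {0..1}"] by (metis (no_types, lifting) imageE open_ball)
  have "\<exists>y\<in>R t. d x y < e" if s: "s \<in> {0..1}" and t: "t \<in> {0..1}" and st: "\<bar>s - t\<bar> < h" and x: "x \<in> R s" for s t x
  proof -
    obtain c where c: "c \<in> {0..1}" "ball s h \<subseteq> ball c (\<eta> c)" using h(2)[OF s] by blast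
    have "s \<in> ball s h" "t \<in> ball s h" using h(1) st by (auto simp: dist_real_def)
    then have "s \<in> ball c (\<eta> c)" "t \<in> ball c (\<eta> c)" using c(2) by blast+
    then have sc: "\<bar>s - c\<bar> < \<eta> c" "\<bar>t - c\<bar> < \<eta> c" by (simp_all add: dist_real_def abs_minus_commute)
    obtain y where y: "y \<in> R c" "d x y < e / 2" using \<eta>(2)[OF c(1) s sc(1)] x by blast
    obtain z where z: "z \<in> R t" "d z y < e / 2" using \<eta>(2)[OF c(1) t sc(2)] y(1) by blast
    have "d x z \<le> d x y + d y z" by (rule triangle) (use R_in_M x y z s t c in blast)+
    then show ?thesis using y z commute[of y z] by (intro bexI[of _ z]) auto
  qed
  then show ?thesis using h(1) by blast
qed

lemma chain_exists:
  assumes \<delta>: "0 < \<delta>" and x0: "x0 \<in> R 0"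
  shows "\<exists>g. chain R d x0 \<delta> g"
proof -
  obtain \<eta> where \<eta>: "\<eta> > 0" "\<And>s t x. s \<in> {0..1} \<Longrightarrow> t \<in> {0..1} \<Longrightarrow> \<bar>s - t\<bar> < \<eta> \<Longrightarrow> x \<in> R s \<Longrightarrow> \<exists>y\<in>R t. d x y < \<delta>"
    using uniform_step[OF \<delta>] by blast
  obtain n :: nat where n: "n > 0" "1 / real n < min \<eta> \<delta>"
    using real_arch_inverse[of "min \<eta> \<delta>"] \<delta> \<eta>(1) by (auto simp: inverse_eq_divide)
  have inI: "real j / real n \<in> {0..1}" if "j \<le> n" for j using that n(1) by auto
  have step: "\<bar>real j / real n - real (Suc j) / real n\<bar> < \<eta>" for j
  proof -
    have "real j / real n - real (Suc j) / real n = - (1 / real n)" by (simp add: diff_divide_distrib[symmetric])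
    then show ?thesis using n by simp
  qed
  have "\<exists>a. a 0 = x0 \<and> (\<forall>j. (j \<le> n \<longrightarrow> a j \<in> R (real j / real n)) \<and> (j < n \<longrightarrow> d (a j) (a (Suc j)) < \<delta>))"
  proof -
    have "\<exists>a. \<forall>j. (j \<le> n \<longrightarrow> a j \<in> R (real j / real n)) \<and> (j = 0 \<longrightarrow> a j = x0) \<and> (j < n \<longrightarrow> d (a j) (a (Suc j)) < \<delta>)"
    proof (rule dependent_nat_choice[where P = "\<lambda>j x. (j \<le> n \<longrightarrow> x \<in> R (real j / real n)) \<and> (j = 0 \<longrightarrow> x = x0)"
          and Q = "\<lambda>j x y. j < n \<longrightarrow> d x y < \<delta>", simplified conj_assoc])
      show "\<exists>x. (0 \<le> n \<longrightarrow> x \<in> R (real 0 / real n)) \<and> (0 = (0 :: nat) \<longrightarrow> x = x0)" using x0 by auto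
      fix x j assume x: "(j \<le> n \<longrightarrow> x \<in> R (real j / real n)) \<and> (j = 0 \<longrightarrow> x = x0)"
      show "\<exists>y. (Suc j \<le> n \<longrightarrow> y \<in> R (real (Suc j) / real n)) \<and> (Suc j = 0 \<longrightarrow> y = x0) \<and> (j < n \<longrightarrow> d x y < \<delta>)"
      proof (cases "j < n")
        case True
        then show ?thesis using \<eta>(2)[OF inI[of j] inI[of "Suc j"] step] x by auto
      qed auto
    qed
    then show ?thesis by blast
  qed
  then obtain a where a: "a 0 = x0" "\<And>j. j \<le> n \<Longrightarrow> a j \<in> R (real j / real n)" "\<And>j. j < n \<Longrightarrow> d (a j) (a (Suc j)) < \<delta>" by blast
  define J where "J t = nat \<lfloor>t * real n\<rfloor>" for t
  have J: "J t \<le> n" "\<bar>real (J t) / real n - t\<bar> < \<eta>" if t: "t \<in> {0..1}" for t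
  proof -
    have 0: "0 \<le> t * real n" "t * real n \<le> real n" using t n(1) by (auto simp: mult_left_le_one_le)
    show "J t \<le> n" unfolding J_def using 0 by (simp add: nat_le_iff floor_le_iff)
    have "real (J t) \<le> t * real n" "t * real n < real (J t) + 1" unfolding J_def using 0 by (simp_all add: floor_correct)
    then have "\<bar>real (J t) - t * real n\<bar> < 1 + 1 / 2 \<and> t * real n - real (J t) < 1 \<and> real (J t) - t * real n \<le> 0" by linarith
    moreover have "real (J t) / real n - t = (real (J t) - t * real n) / real n" using n(1) by (simp add: field_simps)
    ultimately have "\<bar>real (J t) / real n - t\<bar> < 1 / real n" using n(1) by (simp add: abs_divide divide_strict_right_mono)
    then show "\<bar>real (J t) / real n - t\<bar> < \<eta>" using n(2) by linarith
  qed
  have "\<exists>y. t \<in> {0..1} \<longrightarrow> y \<in> R t \<and> d y (a (J t)) < \<delta> \<and> (t = 0 \<longrightarrow> y = x0)" for t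
  proof (cases "t = 0")
    case True
    have "d x0 (a (J 0)) < \<delta>" using a(1) \<delta> R_in_M[of 0 x0] x0 by (simp add: J_def)
    then show ?thesis using True x0 by auto
  next
    case False
    show ?thesis
    proof (cases "t \<in> {0..1}")
      case t: True
      obtain y where "y \<in> R t" "d (a (J t)) y < \<delta>"
        using \<eta>(2)[OF inI[OF J(1)[OF t]] t J(2)[OF t] a(2)[OF J(1)[OF t]]] by blast
      then show ?thesis using False commute by auto
    qed auto
  qed
  then obtain g where g: "\<And>t. t \<in> {0..1} \<Longrightarrow> g t \<in> R t \<and> d (g t) (a (J t)) < \<delta> \<and> (t = 0 \<longrightarrow> g t = x0)" by metis
  have "chain R d x0 \<delta> g" unfolding chain_def
  proof (intro conjI ballI exI[of _ n] exI[of _ a])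
    show "g 0 = x0" using g[of 0] by simp
  qed (use g a n in \<open>auto simp: J_def\<close>)
  then show ?thesis by blast
qed

text \<open>
  The values at a single parameter are finitely many, hence separated. No lower bound is uniform
  in \<open>t\<close>, since values may collide.
\<close>

lemma separation:
  assumes "t \<in> {0..1}" shows "\<exists>\<sigma>>0. \<forall>y\<in>R t. \<forall>z\<in>R t. y \<noteq> z \<longrightarrow> \<sigma> \<le> d y z"
proof -
  define D where "D = (\<lambda>p. d (fst p) (snd p)) ` {p \<in> R t \<times> R t. fst p \<noteq> snd p}"
  have f: "finite (insert 1 D)" unfolding D_def using fin[OF assms] by auto
  have "x > 0" if "x \<in> insert 1 D" for x
    using that R_in_M[OF assms] mdist_pos_less unfolding D_def by auto
  then have "Min (insert 1 D) > 0" using f by simp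
  moreover have "Min (insert 1 D) \<le> d y z" if "y \<in> R t" "z \<in> R t" "y \<noteq> z" for y z
    by (rule Min_le[OF f]) (use that in \<open>auto simp: D_def intro!: image_eqI[of _ _ "(y, z)"]\<close>)
  ultimately show ?thesis by blast
qed

text \<open>
  Near \<open>t\<close> all values lie close to one of the finitely many values at \<open>t\<close>, and these are
  separated; a chain with jumps that are small compared to the separation cannot pass from one of
  these clusters to another. The bound \<open>\<eta>\<close> is the same for all fine chains.
\<close>

lemma chain_equicontinuous:
  assumes t: "t \<in> {0..1}" and \<epsilon>: "0 < \<epsilon>"
  shows "\<exists>\<eta>>0. \<exists>\<delta>>0. \<forall>g \<delta>'. \<delta>' \<le> \<delta> \<longrightarrow> chain R d x0 \<delta>' g \<longrightarrow> (\<forall>s\<in>{0..1}. \<bar>s - t\<bar> < \<eta> \<longrightarrow> d (g s) (g t) < \<epsilon>)"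
proof -
  obtain \<sigma> where \<sigma>: "\<sigma> > 0" "\<And>y z. y \<in> R t \<Longrightarrow> z \<in> R t \<Longrightarrow> y \<noteq> z \<Longrightarrow> \<sigma> \<le> d y z" using separation[OF t] by blast
  define e where "e = min \<epsilon> (\<sigma> / 4)"
  have e: "e > 0" "e \<le> \<epsilon>" "4 * e \<le> \<sigma>" using \<epsilon> \<sigma>(1) by (auto simp: e_def)
  obtain h where h: "h > 0" "\<And>s x. s \<in> {0..1} \<Longrightarrow> \<bar>s - t\<bar> < h \<Longrightarrow> x \<in> R s \<Longrightarrow> \<exists>y\<in>R t. d x y < e"
    using hausdorff_continuous[OF t e(1)] by blast
  define \<delta> where "\<delta> = min e (h / 2)"
  have \<delta>: "\<delta> > 0" "\<delta> \<le> e" "\<delta> \<le> h / 2" using e h by (auto simp: \<delta>_def)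
  \<comment> \<open>a value within \<open>e\<close> of a point that is \<open>e\<close>-close to \<open>y\<close> is itself \<open>e\<close>-close to \<open>y\<close>, because
    values near \<open>t\<close> cannot lie between the clusters\<close>
  have jump: "d p y < e" if y: "y \<in> R t" and s: "s \<in> {0..1}" "\<bar>s - t\<bar> < h" and p: "p \<in> R s" and q: "q \<in> M" "d q y < e" "d p q < e" for y s p q
  proof -
    obtain y' where y': "y' \<in> R t" "d p y' < e" using h(2)[OF s p] by blast
    have m: "y \<in> M" "y' \<in> M" "p \<in> M" using R_in_M t y y' s p by blast+
    have "d y y' \<le> d y q + d q y'" "d q y' \<le> d q p + d p y'" using triangle m q(1) by blast+
    then have "d y y' < 3 * e" using q y'(2) commute[of y q] commute[of q p] by linarith
    then have "y = y'" using \<sigma>(2)[OF y y'(1)] e by force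
    then show ?thesis using y'(2) by simp
  qed
  have "d (g s) (g t) < \<epsilon>" if ch: "chain R d x0 \<delta>' g" and \<delta>': "\<delta>' \<le> \<delta>" and s: "s \<in> {0..1}" "\<bar>s - t\<bar> < h / 2" for g \<delta>' s
  proof -
    obtain n a where n: "0 < n" "1 / real n \<le> \<delta>'" and a: "\<And>j. j \<le> n \<Longrightarrow> a j \<in> R (real j / real n)"
      "\<And>j. j < n \<Longrightarrow> d (a j) (a (Suc j)) < \<delta>'" and ga: "\<And>t. t \<in> {0..1} \<Longrightarrow> d (g t) (a (nat \<lfloor>t * real n\<rfloor>)) < \<delta>'"
      using ch unfolding chain_def by blast
    have gR: "g t \<in> R t" if "t \<in> {0..1}" for t using ch that unfolding chain_def by blast
    define J where "J t = nat \<lfloor>t * real n\<rfloor>" for t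
    have inI: "real j / real n \<in> {0..1}" if "j \<le> n" for j using that n(1) by auto
    have J: "J t \<le> n" "real (J t) / real n \<le> t" "t - 1 / real n < real (J t) / real n" if t: "t \<in> {0..1}" for t
    proof -
      have 0: "0 \<le> t * real n" "t * real n \<le> real n" using t n(1) by (auto simp: mult_left_le_one_le)
      show "J t \<le> n" unfolding J_def using 0 by (simp add: nat_le_iff floor_le_iff)
      have 1: "real (J t) \<le> t * real n" "t * real n < real (J t) + 1" unfolding J_def using 0 by (simp_all add: floor_correct)
      then show "real (J t) / real n \<le> t" using n(1) by (simp add: divide_le_eq)
      have "t = t * real n / real n" using n(1) by simp
      also have "\<dots> < (real (J t) + 1) / real n" using 1(2) n(1) by (intro divide_strict_right_mono) auto
      finally show "t - 1 / real n < real (J t) / real n" by (simp add: add_divide_distrib)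
    qed
    define l u where "l = min (J s) (J t)" and "u = max (J s) (J t)"
    have lu: "l \<le> u" "u \<le> n" using J(1)[OF s(1)] J(1)[OF t] by (auto simp: l_def u_def)
    have window: "\<bar>real i / real n - t\<bar> < h" if "l \<le> i" "i \<le> u" for i
    proof -
      have "real l / real n \<le> real i / real n" "real i / real n \<le> real u / real n"
        using that n(1) by (auto intro!: divide_right_mono)
      moreover have "min s t - 1 / real n < real l / real n" using J(3)[OF s(1)] J(3)[OF t] by (auto simp: l_def min_def)
      moreover have "real u / real n \<le> max s t" using J(2)[OF s(1)] J(2)[OF t] by (auto simp: u_def max_def)
      ultimately show ?thesis using s(2) n(2) \<delta>' \<delta>(3) by linarith
    qed
    have aR: "a i \<in> R (real i / real n)" "a i \<in> M" if "i \<le> u" for i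
      using a(1)[of i] R_in_M[OF inI[of i]] that lu(2) by auto
    obtain y where y: "y \<in> R t" "d (a l) y < e"
      using h(2)[OF inI window[of l] aR(1)[of l]] lu by auto
    have near: "d (a i) y < e" if "l \<le> i" "i \<le> u" for i
      using that
    proof (induction i rule: dec_induct)
      case base then show ?case using y by simp
    next
      case (step i)
      have "d (a (Suc i)) (a i) < e" using a(2)[of i] step lu \<delta>' \<delta>(2) commute[of "a i"] by simp
      then show ?case using step lu
        by (intro jump[OF y(1) inI window[of "Suc i"] aR(1)[of "Suc i"] aR(2)[of i]]) auto
    qed
    have nJ: "d (a (J s)) y < e" "d (a (J t)) y < e" by (auto intro!: near simp: l_def u_def)
    have aM: "a (J s) \<in> M" "a (J t) \<in> M" by (auto intro!: aR simp: u_def)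
    have gs: "d (g s) y < e"
      using ga[OF s(1)] \<delta>' \<delta>(2) s h(1) by (intro jump[OF y(1) s(1) _ gR[OF s(1)] aM(1) nJ(1)]) (auto simp: J_def)
    have gt: "d (g t) y < e"
      using ga[OF t] \<delta>' \<delta>(2) h(1) by (intro jump[OF y(1) t _ gR[OF t] aM(2) nJ(2)]) (auto simp: J_def)
    have "g t = y" using \<sigma>(2)[OF gR[OF t] y(1)] gt e by force
    then show ?thesis using gs e(2) by simp
  qed
  then show ?thesis using h(1) \<delta>(1) by (intro exI[of _ "h / 2"] conjI exI[of _ \<delta>]) auto
qed

text \<open>
  The equicontinuity estimates of fine chains are closed conditions on a point of the product of
  the finite sets \<open>R t\<close>, which is compact. Any finitely many of them are satisfied by a
  sufficiently fine chain, so some point satisfies all of them.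
\<close>

theorem continuous_selection:
  assumes x0: "x0 \<in> R 0"
  shows "\<exists>g. g 0 = x0 \<and> (\<forall>t\<in>{0..1}. g t \<in> R t) \<and> (\<forall>t\<in>{0..1}. ((\<lambda>s. d (g s) (g t)) \<longlongrightarrow> 0) (at t within {0..1}))"
proof -
  define I where "I = {0..1 :: real}"
  obtain \<eta> where \<eta>: "\<And>t \<epsilon>. t \<in> I \<Longrightarrow> 0 < \<epsilon> \<Longrightarrow> \<eta> t \<epsilon> > 0" and eq: "\<And>t \<epsilon>. t \<in> I \<Longrightarrow> 0 < \<epsilon> \<Longrightarrow>
      \<exists>\<delta>>0. \<forall>g \<delta>'. \<delta>' \<le> \<delta> \<longrightarrow> chain R d x0 \<delta>' g \<longrightarrow> (\<forall>s\<in>I. \<bar>s - t\<bar> < \<eta> t \<epsilon> \<longrightarrow> d (g s) (g t) < \<epsilon>)"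
    using chain_equicontinuous[of _ _ x0] unfolding I_def by metis
  define X where "X = product_topology (\<lambda>t. discrete_topology (R t)) I"
  have top: "topspace X = PiE I R" by (simp add: X_def)
  have comp: "compact_space X" unfolding X_def
    using fin by (intro iffD2[OF compact_space_product_topology] disjI2) (auto simp: I_def compact_space_discrete_topology)
  have proj: "continuous_map X (discrete_topology (R t)) (\<lambda>g. g t)" if "t \<in> I" for t
    unfolding X_def by (rule continuous_map_product_projection[OF that])
  have cl1: "closedin X {g \<in> topspace X. g t \<in> S}" if "t \<in> I" "S \<subseteq> R t" for t S
    using closedin_continuous_map_preimage[OF proj[OF that(1)], of S] that(2) by simp
  have cl2: "closedin X {g \<in> topspace X. Z (g s) (g t)}" if "s \<in> I" "t \<in> I" for s t Z
  proof -
    have "{g \<in> topspace X. Z (g s) (g t)} = (\<Union>p\<in>R s. {g \<in> topspace X. g s \<in> {p}} \<inter> {g \<in> topspace X. g t \<in> {q \<in> R t. Z p q}})"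
      using that by (auto simp: top PiE_iff)
    moreover have "closedin X \<dots>"
    proof (rule closedin_Union)
      show "finite ((\<lambda>p. {g \<in> topspace X. g s \<in> {p}} \<inter> {g \<in> topspace X. g t \<in> {q \<in> R t. Z p q}}) ` R s)"
        using fin[of s] that by (simp add: I_def)
      fix C assume "C \<in> (\<lambda>p. {g \<in> topspace X. g s \<in> {p}} \<inter> {g \<in> topspace X. g t \<in> {q \<in> R t. Z p q}}) ` R s"
      then obtain p where p: "p \<in> R s" "C = {g \<in> topspace X. g s \<in> {p}} \<inter> {g \<in> topspace X. g t \<in> {q \<in> R t. Z p q}}" by blast
      show "closedin X C" unfolding p(2) using p(1) that by (intro closedin_Int cl1) auto
    qed
    ultimately show ?thesis by simp
  qed
  \<comment> \<open>all the closed conditions that a continuous selection through \<open>x0\<close> has to satisfy\<close>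
  define U where "U = insert {g \<in> topspace X. g 0 \<in> {x0}}
     {{g \<in> topspace X. d (g s) (g t) < \<epsilon>} | s t \<epsilon>. s \<in> I \<and> t \<in> I \<and> 0 < \<epsilon> \<and> \<bar>s - t\<bar> < \<eta> t \<epsilon>}"
  have closed: "closedin X C" if C: "C \<in> U" for C
  proof -
    have "closedin X {g \<in> topspace X. g 0 \<in> {x0}}" using x0 by (intro cl1) (auto simp: I_def)
    then show ?thesis using C cl2 unfolding U_def by auto
  qed
  have good: "\<exists>\<delta>>0. \<forall>g \<delta>'. \<delta>' \<le> \<delta> \<longrightarrow> chain R d x0 \<delta>' g \<longrightarrow> restrict g I \<in> C" if C: "C \<in> U" for C
  proof -
    have rt: "restrict g I \<in> topspace X" if "chain R d x0 \<delta>' g" for g \<delta>'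
      using that by (auto simp: top chain_def I_def)
    from C consider "C = {g \<in> topspace X. g 0 \<in> {x0}}"
      | s t \<epsilon> where "C = {g \<in> topspace X. d (g s) (g t) < \<epsilon>}" "s \<in> I" "t \<in> I" "0 < \<epsilon>" "\<bar>s - t\<bar> < \<eta> t \<epsilon>"
      unfolding U_def by blast
    then show ?thesis
    proof cases
      case 1
      then show ?thesis using rt by (intro exI[of _ 1]) (auto simp: chain_def I_def)
    next
      case 2
      obtain \<delta> where \<delta>: "\<delta> > 0" "\<And>g \<delta>'. \<delta>' \<le> \<delta> \<Longrightarrow> chain R d x0 \<delta>' g \<Longrightarrow> (\<forall>s\<in>I. \<bar>s - t\<bar> < \<eta> t \<epsilon> \<longrightarrow> d (g s) (g t) < \<epsilon>)"
        using eq[OF 2(3,4)] by blast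
      show ?thesis
      proof (intro exI conjI allI impI)
        show "\<delta> > 0" by (rule \<delta>)
        fix g \<delta>' assume g: "\<delta>' \<le> \<delta>" "chain R d x0 \<delta>' g"
        then show "restrict g I \<in> C" using \<delta>(2)[OF g] 2 rt[OF g(2)] by simp
      qed
    qed
  qed
  have fip: "\<Inter>F \<noteq> {}" if F: "finite F" "F \<subseteq> U" for F
  proof -
    have "\<forall>C\<in>F. \<exists>\<delta>>0. \<forall>g \<delta>'. \<delta>' \<le> \<delta> \<longrightarrow> chain R d x0 \<delta>' g \<longrightarrow> restrict g I \<in> C" using good F(2) by blast
    then obtain D where D: "\<And>C. C \<in> F \<Longrightarrow> D C > 0"
      "\<And>C g \<delta>'. C \<in> F \<Longrightarrow> \<delta>' \<le> D C \<Longrightarrow> chain R d x0 \<delta>' g \<Longrightarrow> restrict g I \<in> C" by metis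
    define \<delta> where "\<delta> = Min (insert 1 (D ` F))"
    have \<delta>: "\<delta> > 0" "\<And>C. C \<in> F \<Longrightarrow> \<delta> \<le> D C" using F(1) D(1) by (auto simp: \<delta>_def)
    obtain g where g: "chain R d x0 \<delta> g" using chain_exists[OF \<delta>(1) x0] by blast
    then have "restrict g I \<in> \<Inter>F" using D(2)[OF _ \<delta>(2) g] by blast
    then show ?thesis by blast
  qed
  have "\<Inter>U \<noteq> {}" using comp[unfolded compact_space_fip] closed fip by blast
  then obtain g where g: "g \<in> \<Inter>U" by blast
  have g0: "g \<in> topspace X" "g 0 = x0" using g unfolding U_def by auto
  have gc: "d (g s) (g t) < \<epsilon>" if "s \<in> I" "t \<in> I" "0 < \<epsilon>" "\<bar>s - t\<bar> < \<eta> t \<epsilon>" for s t \<epsilon>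
    using g that unfolding U_def by blast
  have "((\<lambda>s. d (g s) (g t)) \<longlongrightarrow> 0) (at t within {0..1})" if t: "t \<in> I" for t
  proof (rule tendstoI)
    fix \<epsilon> :: real assume \<epsilon>: "0 < \<epsilon>"
    show "\<forall>\<^sub>F s in at t within {0..1}. dist (d (g s) (g t)) 0 < \<epsilon>"
      unfolding eventually_at using \<eta>[OF t \<epsilon>] gc[OF _ t \<epsilon>] by (intro exI[of _ "\<eta> t \<epsilon>"]) (auto simp: dist_real_def I_def)
  qed
  then show ?thesis using g0 by (intro exI[of _ g]) (auto simp: top PiE_iff I_def)
qed

text \<open>
  If the number of values is constant, then near \<open>t\<close> each value at \<open>t\<close> is continued by exactly one
  value, so the set where two selections agree is open. It is closed by continuity.
\<close>

theorem selection_unique: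
  assumes card: "\<And>t. t \<in> {0..1} \<Longrightarrow> card (R t) = N"
    and g: "\<And>t. t \<in> {0..1} \<Longrightarrow> g t \<in> R t" "\<And>t. t \<in> {0..1} \<Longrightarrow> ((\<lambda>s. d (g s) (g t)) \<longlongrightarrow> 0) (at t within {0..1})"
    and h: "\<And>t. t \<in> {0..1} \<Longrightarrow> h t \<in> R t" "\<And>t. t \<in> {0..1} \<Longrightarrow> ((\<lambda>s. d (h s) (h t)) \<longlongrightarrow> 0) (at t within {0..1})"
    and eq: "g 0 = h 0" and t: "t \<in> {0..1}"
  shows "g t = h t"
proof -
  define S where "S = {t \<in> {0..1}. g t = h t}"
  have close: "\<forall>\<^sub>F s in at t within {0..1}. d (g s) (g t) < e \<and> d (h s) (h t) < e" if "t \<in> {0..1}" "e > 0" for t e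
    using order_tendstoD(2)[OF g(2)[OF that(1)] that(2)] order_tendstoD(2)[OF h(2)[OF that(1)] that(2)]
    by (rule eventually_conj)
  have open_S: "\<forall>\<^sub>F s in at t within {0..1}. s \<in> {0..1} \<longrightarrow> g s = h s" if t: "t \<in> S" for t
  proof -
    have t1: "t \<in> {0..1}" and gh: "g t = h t" using t by (auto simp: S_def)
    obtain \<sigma> where \<sigma>: "\<sigma> > 0" "\<And>y z. y \<in> R t \<Longrightarrow> z \<in> R t \<Longrightarrow> y \<noteq> z \<Longrightarrow> \<sigma> \<le> d y z" using separation[OF t1] by blast
    have s4: "\<sigma> / 4 > 0" using \<sigma>(1) by simp
    have "\<forall>\<^sub>F s in at t within {0..1}. \<forall>y\<in>R t. \<exists>x\<in>R s. d x y < \<sigma> / 4"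
      by (rule eventually_ball_finite[OF fin[OF t1]]) (use lower[OF t1 s4] in blast)
    with close[OF t1 s4] show ?thesis
    proof eventually_elim
      case (elim s)
      show ?case
      proof
        assume s: "s \<in> {0..1}"
        obtain X where X: "\<And>y. y \<in> R t \<Longrightarrow> X y \<in> R s" "\<And>y. y \<in> R t \<Longrightarrow> d (X y) y < \<sigma> / 4" using elim(2) by metis
        \<comment> \<open>the values at \<open>t\<close> continue to different values at \<open>s\<close>, and by counting to all of them\<close>
        have inj: "inj_on X (R t)"
        proof (rule inj_onI, rule ccontr)
          fix y z assume yz: "y \<in> R t" "z \<in> R t" "X y = X z" "y \<noteq> z"
          have "d y z \<le> d y (X y) + d (X y) z" by (rule triangle) (use R_in_M t1 s yz X in blast)+
          then have "d y z < \<sigma>" using X(2)[OF yz(1)] X(2)[OF yz(2)] yz(3) commute[of y] \<sigma>(1) by simp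
          then show False using \<sigma>(2)[OF yz(1,2,4)] by simp
        qed
        have im: "X ` R t = R s"
          using X(1) card_image[OF inj] card[OF t1] card[OF s] fin[OF s] by (intro card_subset_eq) auto
        have key: "f = X z" if f: "f \<in> R s" and z: "z \<in> R t" and fz: "d f z < \<sigma> / 4" for f z
        proof -
          obtain y where y: "y \<in> R t" "f = X y" using im f by blast
          have "d y z \<le> d y f + d f z" by (rule triangle) (use R_in_M t1 s y f z in blast)+
          then have "d y z < \<sigma>" using X(2)[OF y(1)] y(2) fz commute[of y] \<sigma>(1) by simp
          then have "y = z" using \<sigma>(2)[OF y(1) z] by force
          then show ?thesis using y(2) by simp
        qed
        show "g s = h s"
          using key[OF g(1)[OF s] g(1)[OF t1]] key[OF h(1)[OF s] h(1)[OF t1]] elim(1) gh by simp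
      qed
    qed
  qed
  have open_C: "\<forall>\<^sub>F s in at t within {0..1}. s \<in> {0..1} \<longrightarrow> g s \<noteq> h s" if t: "t \<in> {0..1} - S" for t
  proof -
    have t1: "t \<in> {0..1}" and gh: "g t \<noteq> h t" using t by (auto simp: S_def)
    have pos: "d (g t) (h t) / 2 > 0" using mdist_pos_less[OF gh R_in_M[OF t1 g(1)[OF t1]] R_in_M[OF t1 h(1)[OF t1]]] by simp
    from close[OF t1 pos] show ?thesis
    proof eventually_elim
      case (elim s)
      show ?case
      proof (intro impI notI)
        assume s: "s \<in> {0..1}" and e: "g s = h s"
        have "d (g t) (h t) \<le> d (g t) (g s) + d (g s) (h t)"
          by (rule triangle) (use R_in_M t1 s g(1) h(1) in blast)+
        then show False using elim e commute[of "g t"] by simp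
      qed
    qed
  qed
  have oi: "openin (top_of_set {0..1}) T" if T: "T \<subseteq> {0..1}" and ev: "\<And>t. t \<in> T \<Longrightarrow> \<forall>\<^sub>F s in at t within {0..1}. s \<in> {0..1} \<longrightarrow> s \<in> T" for T :: "real set"
    unfolding openin_contains_ball
  proof (intro conjI ballI T)
    fix t assume t: "t \<in> T"
    obtain e where e: "e > 0" "\<And>s. s \<in> {0..1} \<Longrightarrow> s \<noteq> t \<Longrightarrow> dist s t < e \<Longrightarrow> s \<in> T"
      using ev[OF t] unfolding eventually_at by blast
    show "\<exists>e>0. ball t e \<inter> {0..1} \<subseteq> T"
    proof (intro exI conjI subsetI)
      fix s assume s: "s \<in> ball t e \<inter> {0..1}"
      then show "s \<in> T" using e(2)[of s] t by (cases "s = t") (auto simp: dist_commute)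
    qed (rule e)
  qed
  have 1: "openin (top_of_set {0..1}) S"
    by (rule oi) (use open_S in \<open>auto simp: S_def elim!: eventually_mono\<close>)
  have 2: "openin (top_of_set {0..1}) ({0..1} - S)"
    by (rule oi) (use open_C in \<open>auto simp: S_def elim!: eventually_mono\<close>)
  have "S \<subseteq> {0..1}" by (auto simp: S_def)
  then have "closedin (top_of_set {0..1}) S" using 2 by (simp add: closedin_def)
  then have "S = {} \<or> S = {0..1}" using connected_Icc[of 0 "1 :: real"] 1 unfolding connected_clopen by blast
  moreover have "0 \<in> S" using eq by (simp add: S_def)
  ultimately have "t \<in> S" using t by blast
  then show ?thesis by (simp only: S_def mem_Collect_eq)
qed

end

text \<open>Reduces the two continuity conditions on a finite-valued map to sequences.\<close>

lemma eventually_within_sequences: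
  fixes t :: real
  assumes "\<And>s. (\<And>n. s n \<in> S) \<Longrightarrow> s \<longlonglongrightarrow> t \<Longrightarrow> \<exists>n. Z (s n)"
  shows "eventually Z (at t within S)"
proof (rule ccontr)
  assume "\<not> ?thesis"
  then have "\<forall>n. \<exists>x\<in>S. dist x t < inverse (real (Suc n)) \<and> \<not> Z x"
    unfolding eventually_at by (metis inverse_positive_iff_positive of_nat_0_less_iff zero_less_Suc)
  then obtain s where s: "\<And>n. s n \<in> S" "\<And>n. dist (s n) t < inverse (real (Suc n))" "\<And>n. \<not> Z (s n)" by metis
  have "(\<lambda>n. dist (s n) t) \<longlonglongrightarrow> 0"
    by (rule Lim_null_comparison[OF always_eventually LIMSEQ_inverse_real_of_nat]) (use s(2) in \<open>auto intro: less_imp_le\<close>)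
  then have "s \<longlonglongrightarrow> t" using tendsto_dist_iff by blast
  then show False using assms s by blast
qed

context ellipsoid_form
begin

section \<open>The fibres along a path\<close>

lemma Metric_space_multipoles: "Metric_space (multipoles_bar k) (rho A)"
proof
  fix u w :: multipole
  show "0 \<le> rho A u w" by (simp add: rho_def L2norm_nonneg)
  show "rho A u w = rho A w u" unfolding rho_def by (rule L2norm_minus_commute)
next
  fix u w assume u: "u \<in> multipoles_bar k" and w: "w \<in> multipoles_bar k"
  have h: "(\<lambda>v. Theta u v - Theta w v) \<in> hom_polys k" by (intro hom_polys_diff Theta_hom u w)
  show "(rho A u w = 0) = (u = w)"
  proof
    assume "rho A u w = 0"
    then have "(\<lambda>v. Theta u v - Theta w v) = (\<lambda>v. 0)"
      using L2norm_zero_iff[OF ellcont_hom[OF h]] hom_zero_on_ellipsoid[OF h] by (simp add: rho_def)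
    then have "Theta u = Theta w" by (simp add: fun_eq_iff)
    then show "u = w" using Theta_inj[of k] u w by (simp add: inj_on_def)
  next
    assume "u = w" then show "rho A u w = 0" by (simp add: rho_def L2norm_def)
  qed
next
  fix u v w assume m: "u \<in> multipoles_bar k" "v \<in> multipoles_bar k" "w \<in> multipoles_bar k"
  have c: "(\<lambda>x. Theta u x - Theta v x) \<in> ellcont" "(\<lambda>x. Theta v x - Theta w x) \<in> ellcont"
    using m ellcont_diff ellcont_hom[OF Theta_hom] by blast+
  show "rho A u w \<le> rho A u v + rho A v w"
    using L2norm_triangle[OF c] by (simp add: rho_def)
qed

lemma fibre_multifunction:
  assumes P: "\<And>t. t \<in> {0..1} \<Longrightarrow> P t \<in> VQ_perp A Q k"
    and cont: "\<And>v. continuous_on {0..1} (\<lambda>t. P t v)"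
  shows "finite_multifunction (multipoles_bar k) (rho A) (\<lambda>t. fibre k (P t))"
proof -
  interpret Metric_space "multipoles_bar k" "rho A" by (rule Metric_space_multipoles)
  have seq: "(\<lambda>n. P (s n) v) \<longlonglongrightarrow> P t v" if "\<And>n. s n \<in> {0..1}" "s \<longlonglongrightarrow> t" "t \<in> {0..1}" for s t v
    using cont[of v] that unfolding continuous_on_sequentially by (auto simp: o_def)
  show ?thesis
  proof
    fix t :: real assume t: "t \<in> {0..1}"
    show "finite (fibre k (P t))" by (rule card_fibre_le[OF P[OF t]])
    show "fibre k (P t) \<subseteq> multipoles_bar k" by (auto simp: fibre_def)
    fix e :: real assume e: "0 < e"
    show "\<forall>\<^sub>F s in at t within {0..1}. \<forall>x\<in>fibre k (P s). \<exists>y\<in>fibre k (P t). rho A x y < e"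
    proof (rule eventually_within_sequences, rule ccontr)
      fix s assume s: "\<And>n. s n \<in> {0..1 :: real}" "s \<longlonglongrightarrow> t"
        and no: "\<nexists>n. \<forall>x\<in>fibre k (P (s n)). \<exists>y\<in>fibre k (P t). rho A x y < e"
      then obtain u where u: "\<And>n. u n \<in> fibre k (P (s n))" "\<And>n y. y \<in> fibre k (P t) \<Longrightarrow> \<not> rho A (u n) y < e" by metis
      obtain r w where "w \<in> fibre k (P t)" "(\<lambda>n. rho A (u (r n)) w) \<longlonglongrightarrow> 0"
        using fibre_upper_seq[OF P[OF s(1)] P[OF t] seq[OF s t] u(1)] by blast
      then have "\<forall>\<^sub>F n in sequentially. rho A (u (r n)) w < e" using order_tendstoD(2) e by blast
      then show False using u(2)[OF \<open>w \<in> fibre k (P t)\<close>] by (auto simp: eventually_sequentially)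
    qed
    fix y assume y: "y \<in> fibre k (P t)"
    show "\<forall>\<^sub>F s in at t within {0..1}. \<exists>x\<in>fibre k (P s). rho A x y < e"
    proof (rule eventually_within_sequences)
      fix s assume s: "\<And>n. s n \<in> {0..1 :: real}" "s \<longlonglongrightarrow> t"
      obtain r w where w: "\<And>n. w n \<in> fibre k (P (s (r n)))" "(\<lambda>n. rho A (w n) y) \<longlonglongrightarrow> 0"
        using fibre_lower_seq[OF P[OF s(1)] P[OF t] seq[OF s t] y] by blast
      then have "\<forall>\<^sub>F n in sequentially. rho A (w n) y < e" using order_tendstoD(2) e by blast
      then obtain n where "rho A (w n) y < e" by (auto simp: eventually_sequentially)
      then show "\<exists>n. \<exists>x\<in>fibre k (P (s n)). rho A x y < e" using w(1) by blast
    qed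
  qed
qed

text \<open>The pull-back of \<open>P\<close> has \<open>2 * k\<close> different zeros on the projective line.\<close>

definition roots_distinct :: "nat \<Rightarrow> cfun3 \<Rightarrow> bool" where
  "roots_distinct k P \<longleftrightarrow> (\<exists>c xs. c \<noteq> 0 \<and> length xs = 2 * k \<and> (\<forall>x\<in>set xs. norm x = 1) \<and>
      (\<forall>y. P (psi y) = c * (\<Prod>x\<leftarrow>xs. lform x y)) \<and> nonprop (mset xs))"

lemma card_fibre_roots_distinct: "P \<in> VQ_perp A Q k \<Longrightarrow> roots_distinct k P \<Longrightarrow> card (fibre k P) = odd_dfact k"
  unfolding roots_distinct_def using card_fibre_generic by blast

section \<open>Intersection points with the conic\<close>

text \<open>The zero of the linear form with coefficient vector \<open>x\<close>.\<close>

definition perp :: "complex^2 \<Rightarrow> complex^2" where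
  "perp x = vec2 (- x $ 2) (x $ 1)"

lemma lform_perp: "lform x (perp y) = - (x $ 1 * y $ 2) + x $ 2 * y $ 1"
  by (simp add: lform_2 perp_def algebra_simps)

lemma perp_nonzero: "x \<noteq> 0 \<Longrightarrow> perp x \<noteq> 0"
  by (auto simp: perp_def vec2_zero_iff Finite_Cartesian_Product.vec_eq_iff forall_2)

lemma lform_zero_prop:
  assumes "lform x y = 0" "x \<noteq> 0" shows "\<exists>c. y = c *s perp x"
proof -
  have e: "x $ 1 * y $ 1 = - (x $ 2 * y $ 2)" using assms(1) by (simp add: lform_2 eq_neg_iff_add_eq_0)
  show ?thesis
  proof (cases "x $ 1 = 0")
    case True
    then have "x $ 2 \<noteq> 0" using assms(2) by (auto simp: Finite_Cartesian_Product.vec_eq_iff forall_2)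
    then show ?thesis using True e
      by (intro exI[of _ "- y $ 1 / x $ 2"] vec2_eqI) (auto simp: perp_def)
  next
    case False
    then have "y $ 1 = y $ 2 / x $ 1 * (- x $ 2)" using e by (simp add: field_simps)
    then show ?thesis using False
      by (intro exI[of _ "y $ 2 / x $ 1"] vec2_eqI) (simp_all add: perp_def)
  qed
qed

lemma lform_perp_zero_prop:
  assumes "lform x (perp y) = 0" "y \<noteq> 0" shows "\<exists>c. x = c *s y"
proof -
  have e: "x $ 1 * y $ 2 = x $ 2 * y $ 1" using assms(1) by (simp add: lform_perp)
  show ?thesis
  proof (cases "y $ 1 = 0")
    case True
    then have "y $ 2 \<noteq> 0" using assms(2) by (auto simp: Finite_Cartesian_Product.vec_eq_iff forall_2)
    then show ?thesis using True e
      by (intro exI[of _ "x $ 2 / y $ 2"] vec2_eqI) auto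
  next
    case False
    then have "x $ 2 = x $ 1 / y $ 1 * y $ 2" using e by (simp add: field_simps)
    then show ?thesis using False
      by (intro exI[of _ "x $ 1 / y $ 1"] vec2_eqI) simp_all
  qed
qed

lemma null_vec_prop:
  assumes "null_vec s t = c *s null_vec s' t'" "c \<noteq> 0" shows "s * t' = t * s'"
proof -
  have 1: "s\<^sup>2 - t\<^sup>2 = c * (s'\<^sup>2 - t'\<^sup>2)" "\<i> * (s\<^sup>2 + t\<^sup>2) = c * (\<i> * (s'\<^sup>2 + t'\<^sup>2))" "2 * s * t = c * (2 * s' * t')"
    using assms(1) null_vec_nth[of s t] null_vec_nth[of s' t'] by (metis vector_smult_component)+
  have 2: "s\<^sup>2 + t\<^sup>2 = c * (s'\<^sup>2 + t'\<^sup>2)" using 1(2) by (simp add: mult.left_commute)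
  have "2 * s\<^sup>2 = (s\<^sup>2 - t\<^sup>2) + (s\<^sup>2 + t\<^sup>2)" by simp
  also have "\<dots> = 2 * (c * s'\<^sup>2)" unfolding 1(1) 2 by (simp add: algebra_simps)
  finally have s: "s\<^sup>2 = c * s'\<^sup>2" by simp
  then have t: "t\<^sup>2 = c * t'\<^sup>2" using 2 by (simp add: algebra_simps)
  have st: "s * t = c * (s' * t')" using 1(3) by simp
  have "(s * t' - t * s')\<^sup>2 = s\<^sup>2 * t'\<^sup>2 + t\<^sup>2 * s'\<^sup>2 - 2 * (s * t) * (s' * t')"
    by (simp add: power2_eq_square algebra_simps)
  also have "\<dots> = 0" unfolding s t st by (simp add: power2_eq_square algebra_simps)
  finally show ?thesis by simp
qed

lemma psi_nonzero: "y \<noteq> 0 \<Longrightarrow> psi y \<noteq> 0"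
proof
  assume y: "y \<noteq> 0" and "psi y = 0"
  then have "psi y v* A = 0" by (simp only: Finite_Cartesian_Product.vec_eq_iff vector_matrix_mult_nth) simp
  then have c: "null_vec (y $ 1) (y $ 2) = 0" by simp
  have "null_vec (y $ 1) (y $ 2) $ i = 0" for i by (simp add: c)
  then have "(y $ 1)\<^sup>2 - (y $ 2)\<^sup>2 = 0" "2 * y $ 1 * y $ 2 = 0" using null_vec_nth by metis+
  then have "y $ 1 = 0" "y $ 2 = 0" by auto
  then show False using y by (simp add: Finite_Cartesian_Product.vec_eq_iff forall_2)
qed

text \<open>The parametrization \<open>psi\<close> induces an injective map from the projective line to the conic.\<close>

lemma cpoint_psi_eq:
  assumes y: "y \<noteq> 0" "z \<noteq> 0"
  shows "cpoint (psi y) = cpoint (psi z) \<longleftrightarrow> (\<exists>c. y = c *s z)"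
proof
  assume "cpoint (psi y) = cpoint (psi z)"
  moreover have "psi y \<in> cpoint (psi y)" unfolding cpoint_def by (intro CollectI exI[of _ 1]) auto
  ultimately obtain c where c: "c \<noteq> 0" "psi y = c *s psi z" unfolding cpoint_def by blast
  then have "psi y v* A = c *s (psi z v* A)" by (simp only: vector_matrix_scale)
  then have "null_vec (y $ 1) (y $ 2) = c *s null_vec (z $ 1) (z $ 2)" by simp
  then have "y $ 1 * z $ 2 = y $ 2 * z $ 1" by (rule null_vec_prop[OF _ c(1)])
  then have "lform y (perp z) = 0" by (simp add: lform_perp)
  then show "\<exists>c. y = c *s z" by (rule lform_perp_zero_prop[OF _ y(2)])
next
  assume "\<exists>c. y = c *s z"
  then obtain c where c: "y = c *s z" by blast
  then have c0: "c \<noteq> 0" using y(1) by auto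
  have p: "psi y = c\<^sup>2 *s psi z" unfolding c by (rule psi_scale)
  show "cpoint (psi y) = cpoint (psi z)" unfolding cpoint_def p
  proof (intro equalityI subsetI)
    fix x assume "x \<in> {d *s (c\<^sup>2 *s psi z) |d. d \<noteq> 0}"
    then obtain d where "d \<noteq> 0" "x = (d * c\<^sup>2) *s psi z" by auto
    then show "x \<in> {d *s psi z |d. d \<noteq> 0}" using c0 by (intro CollectI exI[of _ "d * c\<^sup>2"]) auto
  next
    fix x assume "x \<in> {d *s psi z |d. d \<noteq> 0}"
    then obtain d where "d \<noteq> 0" "x = d *s psi z" by auto
    then show "x \<in> {d *s (c\<^sup>2 *s psi z) |d. d \<noteq> 0}" using c0 by (intro CollectI exI[of _ "d / c\<^sup>2"]) auto
  qed
qed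

lemma intersection_points_eq:
  assumes x0: "0 \<notin> set xs" and eq: "\<And>y. P (psi y) = c * (\<Prod>x\<leftarrow>xs. lform x y)" and c: "c \<noteq> 0"
  shows "intersection_points Q P = (\<lambda>x. cpoint (psi (perp x))) ` set xs"
proof (intro equalityI subsetI)
  fix X assume "X \<in> intersection_points Q P"
  then obtain v where v: "v \<noteq> 0" "P v = 0" "Q v = 0" "X = cpoint v" by (auto simp: intersection_points_def)
  obtain y where y: "v = psi y" using psi_surj[OF v(3)] by blast
  have y0: "y \<noteq> 0"
  proof
    assume "y = 0"
    then have "v = psi (0 *s y)" using y by simp
    then show False using v(1) unfolding psi_scale by simp
  qed
  have "(\<Prod>x\<leftarrow>xs. lform x y) = 0" using eq[of y] v(2) y c by simp
  then obtain x where x: "x \<in> set xs" "lform x y = 0" by (auto simp: prod_list_zero_iff)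
  have xn: "x \<noteq> 0" using x(1) x0 by auto
  have "\<exists>d. y = d *s perp x" by (rule lform_zero_prop[OF x(2) xn])
  then have "cpoint (psi y) = cpoint (psi (perp x))" using cpoint_psi_eq[OF y0 perp_nonzero[OF xn]] by blast
  then show "X \<in> (\<lambda>x. cpoint (psi (perp x))) ` set xs" using x(1) v(4) y by blast
next
  fix X assume "X \<in> (\<lambda>x. cpoint (psi (perp x))) ` set xs"
  then obtain x where x: "x \<in> set xs" "X = cpoint (psi (perp x))" by blast
  have xn: "x \<noteq> 0" using x(1) x0 by auto
  have "lform x (perp x) = 0" by (simp add: lform_perp)
  then have "(\<Prod>x'\<leftarrow>xs. lform x' (perp x)) = 0" using x(1) by (force simp: prod_list_zero_iff)
  then have "P (psi (perp x)) = 0" using eq by simp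
  then show "X \<in> intersection_points Q P" unfolding intersection_points_def x(2)
    using psi_nonzero[OF perp_nonzero[OF xn]] Q_psi by blast
qed

lemma cpoint_perp_inj:
  assumes "x \<noteq> 0" "y \<noteq> 0" "cpoint (psi (perp x)) = cpoint (psi (perp y))"
  shows "\<exists>c. x = c *s y"
proof -
  obtain c where c: "perp x = c *s perp y" using assms cpoint_psi_eq perp_nonzero by blast
  have "x = c *s y"
  proof (rule vec2_eqI)
    show "x $ 1 = (c *s y) $ 1" using arg_cong[OF c, of "\<lambda>z. z $ 2"] by (simp add: perp_def)
    show "x $ 2 = (c *s y) $ 2" using arg_cong[OF c, of "\<lambda>z. z $ 1"] by (simp add: perp_def)
  qed
  then show ?thesis by blast
qed

lemma nonprop_distinct:
  assumes "nonprop (mset xs)" shows "distinct xs"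
  using assms
proof (induction xs)
  case (Cons x xs)
  have "x \<notin> set xs" using nonpropD(1)[of x "mset xs" x 1] Cons.prems by auto
  moreover have "nonprop (mset xs)" by (rule nonprop_mono[OF Cons.prems]) simp
  ultimately show ?case using Cons.IH by simp
qed simp

text \<open>
  Translates between linear factors and points of the conic, so that the partition of an
  intersection can be read off from the factors.
\<close>

lemma nonprop_iff_card:
  assumes x0: "0 \<notin> set xs"
  shows "nonprop (mset xs) \<longleftrightarrow> card ((\<lambda>x. cpoint (psi (perp x))) ` set xs) = length xs"
proof
  assume np: "nonprop (mset xs)"
  have "inj_on (\<lambda>x. cpoint (psi (perp x))) (set xs)"
  proof (rule inj_onI, rule ccontr)
    fix x y assume xy: "x \<in> set xs" "y \<in> set xs" "cpoint (psi (perp x)) = cpoint (psi (perp y))" "x \<noteq> y"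
    then obtain c where "x = c *s y" using cpoint_perp_inj x0 by metis
    moreover have "{#x, y#} \<subseteq># mset xs" using xy
      by (metis add_mset_eq_single insert_DiffM insert_noteq_member insert_subset_eq_iff set_mset_mset single_subset_iff)
    ultimately show False using np unfolding nonprop_def by blast
  qed
  then show "card ((\<lambda>x. cpoint (psi (perp x))) ` set xs) = length xs"
    using card_image nonprop_distinct[OF np] distinct_card by metis
next
  assume c: "card ((\<lambda>x. cpoint (psi (perp x))) ` set xs) = length xs"
  have "card ((\<lambda>x. cpoint (psi (perp x))) ` set xs) \<le> card (set xs)" by (rule card_image_le) simp
  then have cs: "card (set xs) = length xs" using c card_length[of xs] by simp
  then have d: "distinct xs" by (rule card_distinct)
  have inj: "inj_on (\<lambda>x. cpoint (psi (perp x))) (set xs)" using c cs by (intro eq_card_imp_inj_on) auto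
  show "nonprop (mset xs)" unfolding nonprop_def
  proof (intro conjI allI impI notI)
    assume "0 \<in># mset xs" then show False using x0 by simp
  next
    fix a b e assume ab: "{#a, b#} \<subseteq># mset xs" and e: "a = e *s b"
    have m: "a \<in> set xs" "b \<in> set xs" using mset_subset_eqD[OF ab] by auto
    then have n: "a \<noteq> 0" "b \<noteq> 0" using x0 by auto
    have "perp a = e *s perp b" unfolding e by (rule vec2_eqI) (simp_all add: perp_def)
    then have "cpoint (psi (perp a)) = cpoint (psi (perp b))" using cpoint_psi_eq[OF perp_nonzero[OF n(1)] perp_nonzero[OF n(2)]] by blast
    then have "a = b" using inj m by (auto simp: inj_on_def)
    then have "2 \<le> count (mset xs) a" using mset_subset_eq_count[OF ab, of a] by simp
    then show False using d m(1) by (simp add: distinct_count_atmost_1)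
  qed
qed

text \<open>
  Along the parametrization, the derivative at a zero of one factor is a non-zero constant times
  the remaining factors, and these do not vanish there.
\<close>

lemma simple_root_derivative:
  assumes P: "P \<in> hom_polys k" and eq: "\<And>y. P (psi y) = c * (\<Prod>x\<leftarrow>xs. lform x y)" and c: "c \<noteq> 0"
    and np: "nonprop (mset xs)" and x: "x \<in> set xs" and w: "\<not> (\<exists>r. w = r *s perp x)"
  shows "\<exists>D. ((\<lambda>z. P (psi (perp x + z *s w))) has_field_derivative D) (at 0) \<and> D \<noteq> 0"
proof -
  obtain ys where ys: "mset xs = add_mset x (mset ys)" using x by (metis ex_mset insert_DiffM set_mset_mset)
  have xn: "x \<noteq> 0" using np x by (auto simp: nonprop_def)
  have eq': "P (psi y) = c * (lform x y * (\<Prod>x\<leftarrow>ys. lform x y))" for y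
    using eq[of y] lforms_product_mset[of xs "x # ys" y] ys by simp
  have lw: "lform x w \<noteq> 0" using lform_zero_prop xn w by blast
  have l0: "lform x (perp x) = 0" by (simp add: lform_perp)
  have nz: "(\<Prod>y\<leftarrow>ys. lform y (perp x)) \<noteq> 0"
  proof
    assume "(\<Prod>y\<leftarrow>ys. lform y (perp x)) = 0"
    then obtain y where y: "y \<in> set ys" "lform y (perp x) = 0" by (auto simp: prod_list_zero_iff)
    then obtain r where "y = r *s x" using lform_perp_zero_prop xn by blast
    then show False using nonpropD(2)[of x "mset ys" y r] np ys y(1) by simp
  qed
  define q where "q z = (\<Prod>y\<leftarrow>ys. lform y (perp x + z *s w))" for z
  have qd: "\<exists>q'. ((\<lambda>z. \<Prod>y\<leftarrow>ys. lform y (perp x + z *s w)) has_field_derivative q') (at 0)" for ys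
  proof (induction ys)
    case (Cons y ys)
    then obtain q' where q': "((\<lambda>z. \<Prod>y\<leftarrow>ys. lform y (perp x + z *s w)) has_field_derivative q') (at 0)" by blast
    have "((\<lambda>z. lform y (perp x + z *s w)) has_field_derivative lform y w) (at 0)"
      unfolding lform_add lform_scale by (auto intro!: derivative_eq_intros)
    from DERIV_mult[OF this q'] show ?case by auto
  qed (auto intro!: exI[of _ 0])
  obtain q' where q': "(q has_field_derivative q') (at 0)" using qd[of ys] unfolding q_def by blast
  have e: "P (psi (perp x + z *s w)) = c * lform x w * (z * q z)" for z
    unfolding eq' lform_add lform_scale l0 by (simp add: q_def lform_add lform_scale)
  have "((\<lambda>z. z * q z) has_field_derivative q 0) (at 0)"
    using DERIV_mult[OF DERIV_ident q'] by simp
  then have "((\<lambda>z. c * lform x w * (z * q z)) has_field_derivative c * lform x w * q 0) (at 0)"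
    by (rule DERIV_cmult)
  moreover have "c * lform x w * q 0 \<noteq> 0" using c lw nz by (simp add: q_def)
  ultimately show ?thesis unfolding e by blast
qed

end

section \<open>Intersection multiplicities\<close>

lemma plane_combination:
  fixes a b g :: "complex^3"
  assumes n: "n \<noteq> 0" "lform a n = 0" "lform b n = 0" "lform g n = 0"
    and ind: "\<And>\<alpha> \<beta>. \<alpha> *s a + \<beta> *s b = 0 \<Longrightarrow> \<alpha> = 0 \<and> \<beta> = 0"
  shows "\<exists>\<alpha> \<beta>. g = \<alpha> *s a + \<beta> *s b"
proof -
  \<comment> \<open>the matrix with rows \<open>a\<close>, \<open>b\<close>, \<open>g\<close> annihilates \<open>n\<close>, so its rows are dependent\<close>
  define B :: "complex^3^3" where "B = (\<chi> i. if i = 1 then a else if i = 2 then b else g)"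
  have rows: "Finite_Cartesian_Product.row 1 B = a" "Finite_Cartesian_Product.row 2 B = b" "Finite_Cartesian_Product.row 3 B = g"
    by (simp_all add: B_def Finite_Cartesian_Product.row_def)
  have Bn: "B *v n = 0"
  proof -
    have "(B *v n) $ i = 0" for i
      using n(2-4) exhaust_3[of i] by (auto simp: B_def matrix_vector_mult_def lform_def)
    then show ?thesis by (simp add: Finite_Cartesian_Product.vec_eq_iff)
  qed
  have "\<not> (\<exists>C. B ** C = mat 1)"
  proof
    assume "\<exists>C. B ** C = mat 1"
    then obtain C where "C ** B = mat 1" using matrix_left_right_inverse by blast
    then have "n = C *v (B *v n)" by (simp add: matrix_vector_mul_assoc)
    then show False using n(1) unfolding Bn by (simp add: matrix_vector_mult_0_right)
  qed
  then obtain c :: "3 \<Rightarrow> complex" and i where c: "(\<Sum>i\<in>UNIV. c i *s Finite_Cartesian_Product.row i B) = 0" "c i \<noteq> 0"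
    unfolding matrix_right_invertible_independent_rows by blast
  have s: "c 1 *s a + c 2 *s b + c 3 *s g = 0" using c(1) by (simp add: sum_3 rows)
  have c3: "c 3 \<noteq> 0"
  proof
    assume z: "c 3 = 0"
    then have "c 1 = 0 \<and> c 2 = 0" using ind s by simp
    then show False using c(2) z exhaust_3[of i] by auto
  qed
  have "g = (- c 1 / c 3) *s a + (- c 2 / c 3) *s b"
  proof -
    have "g $ j = ((- c 1 / c 3) *s a + (- c 2 / c 3) *s b) $ j" for j
    proof -
      have "c 1 * a $ j + c 2 * b $ j + c 3 * g $ j = 0" using arg_cong[OF s, of "\<lambda>v. v $ j"] by simp
      then have "c 3 * g $ j = - (c 1 * a $ j + c 2 * b $ j)" by (rule minus_unique[symmetric])
      then have "g $ j = - (c 1 * a $ j + c 2 * b $ j) / c 3" using c3 by (simp add: nonzero_eq_divide_eq mult.commute)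
      then show ?thesis by (simp add: add_divide_distrib diff_divide_distrib)
    qed
    then show ?thesis by (simp add: Finite_Cartesian_Product.vec_eq_iff)
  qed
  then show ?thesis by blast
qed

lemma zorder_simple:
  assumes "f holomorphic_on ball 0 r" "0 < r" "f 0 = 0" "(f has_field_derivative D) (at 0)" "D \<noteq> 0"
  shows "zorder f 0 = 1"
proof (rule zorder_zero_eqI')
  show "f analytic_on {0}" using assms(1,2) analytic_on_open[of "ball 0 r" f]
    by (meson analytic_on_subset centre_in_ball empty_subsetI insert_subset open_ball)
  show "(deriv ^^ nat 1) f 0 \<noteq> 0" using DERIV_imp_deriv[OF assms(4)] assms(5) by simp
  show "(deriv ^^ i) f 0 = 0" if "i < nat 1" for i using that assms(3) by simp
qed simp

context ellipsoid_form
begin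

definition grad :: "cfun3 \<Rightarrow> complex^3 \<Rightarrow> complex^3" where
  "grad P v = (\<chi> i. cpartial i P v)"

lemma chain_grad:
  assumes "P \<in> polys" "\<And>i. ((\<lambda>t. \<gamma> t $ i) has_field_derivative \<gamma>' $ i) (at z)"
  shows "((\<lambda>t. P (\<gamma> t)) has_field_derivative lform \<gamma>' (grad P (\<gamma> z))) (at z)"
  using polys_chain[OF assms] by (simp add: grad_def lform_def mult.commute)

lemma grad_hom: "P \<in> hom_polys k \<Longrightarrow> grad P (c *s v) = c ^ (k - 1) *s grad P v"
  by (simp add: grad_def Finite_Cartesian_Product.vec_eq_iff hom_polys_scale[OF cpartial_hom])

lemma euler_grad: "P \<in> hom_polys k \<Longrightarrow> lform v (grad P v) = of_nat k * P v"
  using euler[of P k v] by (simp add: lform_def grad_def)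

lemma lform_add_left: "lform (x + y) z = lform x z + lform y (z :: complex^'n)"
  by (simp add: lform_def distrib_right sum.distrib)

text \<open>The cone is smooth off the origin.\<close>

lemma grad_Q_nonzero:
  assumes "p \<noteq> 0" shows "grad Q p \<noteq> 0"
proof
  assume g: "grad Q p = 0"
  have "p v* A \<noteq> 0"
  proof
    assume "p v* A = 0"
    then have "p = 0 v* matrix_inv A" by (metis v_A_inv(1))
    also have "0 v* matrix_inv A = 0" by (simp only: Finite_Cartesian_Product.vec_eq_iff vector_matrix_mult_nth) simp
    finally show False using assms by simp
  qed
  then obtain l where l: "(p v* A) $ l \<noteq> 0" by (auto simp: Finite_Cartesian_Product.vec_eq_iff)
  define d where "d = axis l 1 v* matrix_inv A"
  have "((\<lambda>t. Q (p + t *s d)) has_field_derivative lform d (grad Q (p + 0 *s d))) (at 0)"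
    by (rule chain_grad[OF Q_polys]) (auto intro!: derivative_eq_intros)
  then have 1: "((\<lambda>t. Q (p + t *s d)) has_field_derivative 0) (at 0)" using g by (simp add: lform_def)
  have "((p + t *s d) v* A) = p v* A + t *s axis l 1" for t
  proof -
    have "((p + t *s d) v* A) = p v* A + t *s (d v* A)"
      by (simp add: Finite_Cartesian_Product.vec_eq_iff vector_matrix_mult_nth distrib_left sum.distrib sum_distrib_left mult.left_commute)
    then show ?thesis by (simp add: d_def)
  qed
  then have Qe: "Q (p + t *s d) = (\<Sum>i\<in>UNIV. ((p v* A) $ i + t * axis l 1 $ i)\<^sup>2)" for t by (simp add: Q_eq)
  have "((\<lambda>t. Q (p + t *s d)) has_field_derivative (\<Sum>i\<in>UNIV. 2 * ((p v* A) $ i) * axis l 1 $ i)) (at 0)"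
    unfolding Qe by (auto intro!: derivative_eq_intros sum.cong)
  moreover have "(\<Sum>i\<in>UNIV. 2 * ((p v* A) $ i) * axis l 1 $ i) = (\<Sum>i\<in>UNIV. if i = l then 2 * (p v* A) $ i else 0)"
    by (intro sum.cong) (auto simp: axis_def)
  ultimately have "((\<lambda>t. Q (p + t *s d)) has_field_derivative 2 * (p v* A) $ l) (at 0)" by simp
  then have "2 * (p v* A) $ l = 0" using DERIV_unique[OF _ 1] by blast
  then show False using l by simp
qed

text \<open>
  The curves in the definition of \<open>intersection_mult\<close>, which refers to a number that must be the
  same for all of them.
\<close>

definition admissible :: "(complex^3) set \<Rightarrow> (complex \<Rightarrow> complex^3) \<Rightarrow> real \<Rightarrow> bool" where
  "admissible X \<gamma> r \<longleftrightarrow> 0 < r \<and> (\<forall>i. (\<lambda>z. \<gamma> z $ i) holomorphic_on ball 0 r) \<and> \<gamma> 0 \<in> X \<and>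
     (\<forall>z\<in>ball 0 r. Q (\<gamma> z) = 0) \<and> (\<forall>c. (\<chi> i. deriv (\<lambda>z. \<gamma> z $ i) 0) \<noteq> c *s \<gamma> 0)"

lemma intersection_mult_admissible:
  "intersection_mult Q P X = (THE m. \<exists>\<gamma> r. admissible X \<gamma> r \<and> int m = zorder (\<lambda>z. P (\<gamma> z)) 0)"
  unfolding intersection_mult_def admissible_def by (simp add: conj_assoc)

lemma admissible_velocity:
  assumes "admissible X \<gamma> r"
  shows "((\<lambda>z. \<gamma> z $ i) has_field_derivative (\<chi> i. deriv (\<lambda>z. \<gamma> z $ i) 0) $ i) (at 0)"
  using assms holomorphic_derivI[of "\<lambda>z. \<gamma> z $ i" "ball 0 r" 0] unfolding admissible_def by simp

text \<open>
  The velocity of any admissible curve is tangent to the cone, so it is a combination of the point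
  itself and of the velocity along \<open>psi\<close>. By Euler's relation the former does not contribute to
  the derivative of \<open>P\<close>; the latter contributes a non-zero multiple of the derivative in
  \<open>simple_root_derivative\<close>.
\<close>

lemma intersection_mult_simple:
  assumes P: "P \<in> hom_polys k" and eq: "\<And>y. P (psi y) = c * (\<Prod>x\<leftarrow>xs. lform x y)" and c: "c \<noteq> 0"
    and np: "nonprop (mset xs)" and x: "x \<in> set xs"
  shows "intersection_mult Q P (cpoint (psi (perp x))) = 1"
proof -
  define p0 where "p0 = psi (perp x)"
  have pp: "P \<in> polys" using P hom_polys_polys by blast
  have xn: "x \<noteq> 0" using np x by (auto simp: nonprop_def)
  have p0n: "p0 \<noteq> 0" unfolding p0_def by (intro psi_nonzero perp_nonzero xn)
  have Pp0: "P p0 = 0"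
  proof -
    have "(\<Prod>x'\<leftarrow>xs. lform x' (perp x)) = 0" using x lform_perp[of x x] by (force simp: prod_list_zero_iff)
    then show ?thesis using eq by (simp add: p0_def)
  qed
  obtain w where w: "lform x w \<noteq> 0" using lform_nonzero[OF xn] by blast
  have w': "\<not> (\<exists>r. w = r *s perp x)" using w by (auto simp: lform_scale lform_perp)
  define \<gamma>0 where "\<gamma>0 z = psi (perp x + z *s w)" for z
  obtain D where D: "((\<lambda>z. P (\<gamma>0 z)) has_field_derivative D) (at 0)" "D \<noteq> 0"
    using simple_root_derivative[OF P eq c np x w'] unfolding \<gamma>0_def by blast
  have \<gamma>0h: "(\<lambda>z. \<gamma>0 z $ i) holomorphic_on S" for i S
  proof -
    have "(\<lambda>z. null_vec ((perp x + z *s w) $ 1) ((perp x + z *s w) $ 2) $ j) holomorphic_on S" for j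
      unfolding null_vec_def by (cases "j = 1"; cases "j = 2") (auto intro!: holomorphic_intros)
    then show ?thesis unfolding \<gamma>0_def psi_def vector_matrix_mult_nth by (intro holomorphic_intros)
  qed
  define \<tau> where "\<tau> = (\<chi> i. deriv (\<lambda>z. \<gamma>0 z $ i) 0)"
  have \<gamma>0d: "((\<lambda>z. \<gamma>0 z $ i) has_field_derivative \<tau> $ i) (at 0)" for i
    unfolding \<tau>_def using holomorphic_derivI[OF \<gamma>0h open_ball, of 0 0 1 i] by simp
  have \<gamma>00: "\<gamma>0 0 = p0" by (simp add: \<gamma>0_def p0_def)
  have D\<tau>: "D = lform \<tau> (grad P p0)"
    using DERIV_unique[OF D(1) chain_grad[OF pp \<gamma>0d]] \<gamma>00 by simp
  have euler0: "lform p0 (grad P p0) = 0" using euler_grad[OF P, of p0] Pp0 by simp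
  have \<tau>_ind: "\<alpha> = 0 \<and> \<beta> = 0" if e: "\<alpha> *s p0 + \<beta> *s \<tau> = 0" for \<alpha> \<beta>
  proof -
    have "\<beta> * D = lform (\<alpha> *s p0 + \<beta> *s \<tau>) (grad P p0)"
      by (simp add: lform_add_left lform_scale_left euler0 D\<tau>)
    also have "\<dots> = 0" by (simp add: e lform_zero)
    finally have "\<beta> = 0" using D(2) by simp
    then have "\<alpha> *s p0 = 0" using e by simp
    then show ?thesis using p0n \<open>\<beta> = 0\<close> by simp
  qed
  have adm0: "admissible (cpoint p0) \<gamma>0 1"
    unfolding admissible_def
  proof (intro conjI allI ballI notI)
    show "\<gamma>0 0 \<in> cpoint p0" unfolding \<gamma>00 cpoint_def by (intro CollectI exI[of _ 1]) auto
    show "Q (\<gamma>0 z) = 0" for z by (simp add: \<gamma>0_def Q_psi)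
    fix e assume "(\<chi> i. deriv (\<lambda>z. \<gamma>0 z $ i) 0) = e *s \<gamma>0 0"
    then have "e *s p0 + (- 1) *s \<tau> = 0" unfolding \<tau>_def[symmetric] \<gamma>00 by simp
    then show False using \<tau>_ind by fastforce
  qed (auto intro: \<gamma>0h)
  have order: "zorder (\<lambda>z. P (\<gamma> z)) 0 = 1" if adm: "admissible (cpoint p0) \<gamma> r" for \<gamma> r
  proof -
    define g where "g = (\<chi> i. deriv (\<lambda>z. \<gamma> z $ i) 0)"
    have r: "0 < r" and hol: "\<And>i. (\<lambda>z. \<gamma> z $ i) holomorphic_on ball 0 r" and Qz: "\<And>z. z \<in> ball 0 r \<Longrightarrow> Q (\<gamma> z) = 0"
      and ng: "\<And>c. g \<noteq> c *s \<gamma> 0" using adm unfolding admissible_def g_def by blast+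
    obtain e where e: "e \<noteq> 0" "\<gamma> 0 = e *s p0" using adm unfolding admissible_def cpoint_def by blast
    have gd: "((\<lambda>z. \<gamma> z $ i) has_field_derivative g $ i) (at 0)" for i
      unfolding g_def by (rule admissible_velocity[OF adm])
    have Qd: "lform g' (grad Q p) = 0" if "((\<lambda>z. Q (\<gamma> z)) has_field_derivative lform g' (grad Q p)) (at 0)"
      "\<And>z. z \<in> ball 0 r \<Longrightarrow> Q (\<gamma> z) = 0" "0 < r" for g' p \<gamma> r
    proof -
      have "((\<lambda>z. 0) has_field_derivative lform g' (grad Q p)) (at 0)"
        by (rule has_field_derivative_transform_within_open[OF that(1), of "ball 0 r"]) (use that in auto)
      then show ?thesis using DERIV_unique[OF _ DERIV_const] by blast
    qed
    \<comment> \<open>all three vectors are orthogonal to the gradient of \<open>Q\<close> at \<open>p0\<close>, the first two by tangency\<close>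
    have n1: "lform \<tau> (grad Q p0) = 0"
      using Qd[of \<gamma>0 \<tau> p0 1] chain_grad[OF Q_polys \<gamma>0d] \<gamma>00 by (simp add: \<gamma>0_def Q_psi)
    have "lform g (grad Q (\<gamma> 0)) = 0" using Qd[OF chain_grad[OF Q_polys gd] Qz r] by simp
    then have n2: "lform g (grad Q p0) = 0" unfolding e(2) grad_hom[OF Q_hom] using e(1) by (simp add: lform_scale)
    have n3: "lform p0 (grad Q p0) = 0" using euler_grad[OF Q_hom, of p0] Q_psi by (simp add: p0_def)
    obtain \<alpha> \<beta> where ab: "g = \<alpha> *s p0 + \<beta> *s \<tau>"
      using plane_combination[OF grad_Q_nonzero[OF p0n] n3 n1 n2 \<tau>_ind] by blast
    have \<beta>: "\<beta> \<noteq> 0"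
    proof
      assume "\<beta> = 0"
      then have "g = (\<alpha> / e) *s \<gamma> 0" using ab e by simp
      then show False using ng by blast
    qed
    have "((\<lambda>z. P (\<gamma> z)) has_field_derivative lform g (grad P (\<gamma> 0))) (at 0)" by (rule chain_grad[OF pp gd])
    moreover have "lform g (grad P (\<gamma> 0)) = e ^ (k - 1) * (\<beta> * D)"
      unfolding e(2) grad_hom[OF P] lform_scale ab lform_add_left lform_scale_left euler0 D\<tau> by simp
    moreover have "(\<lambda>z. P (\<gamma> z)) holomorphic_on ball 0 r"
    proof -
      have "((\<lambda>z. P (\<gamma> z)) has_field_derivative lform (\<chi> i. deriv (\<lambda>z. \<gamma> z $ i) z) (grad P (\<gamma> z))) (at z)" if "z \<in> ball 0 r" for z
        by (rule chain_grad[OF pp]) (use holomorphic_derivI[OF hol open_ball that] in simp)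
      then show ?thesis unfolding holomorphic_on_def field_differentiable_def
        using has_field_derivative_at_within by blast
    qed
    moreover have "P (\<gamma> 0) = 0" unfolding e(2) hom_polys_scale[OF P] Pp0 by simp
    moreover have "e ^ (k - 1) * (\<beta> * D) \<noteq> 0" using e(1) \<beta> D(2) by simp
    ultimately show ?thesis using zorder_simple[of "\<lambda>z. P (\<gamma> z)" r "e ^ (k - 1) * (\<beta> * D)"] r by simp
  qed
  show ?thesis unfolding intersection_mult_admissible p0_def[symmetric]
  proof (rule the_equality)
    show "\<exists>\<gamma> r. admissible (cpoint p0) \<gamma> r \<and> int 1 = zorder (\<lambda>z. P (\<gamma> z)) 0"
      using adm0 order[OF adm0] by (intro exI[of _ \<gamma>0] exI[of _ 1]) auto
    show "m = 1" if "\<exists>\<gamma> r. admissible (cpoint p0) \<gamma> r \<and> int m = zorder (\<lambda>z. P (\<gamma> z)) 0" for m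
      using that order by auto
  qed
qed

text \<open>
  By counting: the partition has as many parts as there are intersection points, so having \<open>2 * k\<close>
  parts means that the \<open>2 * k\<close> factors give different points. Multiplicities are only ever
  evaluated at simple points.
\<close>

lemma pure_stratum_iff:
  assumes P: "P \<in> VQ_perp A Q k"
  shows "P \<in> pure_stratum A Q k (replicate_mset (2 * k) 1) \<longleftrightarrow> roots_distinct k P"
proof
  have Ph: "P \<in> hom_polys k" using P VQ_perp_sub by blast
  assume "roots_distinct k P"
  then obtain c xs where cx: "c \<noteq> 0" "length xs = 2 * k" "\<forall>x\<in>set xs. norm x = 1"
    "\<And>y. P (psi y) = c * (\<Prod>x\<leftarrow>xs. lform x y)" "nonprop (mset xs)" unfolding roots_distinct_def by blast
  have x0: "0 \<notin> set xs" by (rule norm1_nonzero[OF cx(3)])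
  note ip = intersection_points_eq[OF x0 cx(4,1)]
  have card: "card (intersection_points Q P) = 2 * k" unfolding ip using nonprop_iff_card[OF x0] cx(2,5) by simp
  have "mult_partition Q P = image_mset (\<lambda>X. 1) (mset_set (intersection_points Q P))"
    unfolding mult_partition_def
  proof (rule image_mset_cong)
    fix X assume "X \<in># mset_set (intersection_points Q P)"
    then have "X \<in> intersection_points Q P" by (metis elem_mset_set empty_iff infinite_set_mset_mset_set)
    then obtain x where "x \<in> set xs" "X = cpoint (psi (perp x))" unfolding ip by blast
    then show "intersection_mult Q P X = 1" using intersection_mult_simple[OF Ph cx(4,1,5)] by blast
  qed
  also have "\<dots> = replicate_mset (2 * k) 1" using card by (simp add: image_mset_const_eq)
  finally have "mult_partition Q P = replicate_mset (2 * k) 1" .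
  moreover have "P \<noteq> (\<lambda>v. 0)"
  proof
    assume z: "P = (\<lambda>v. 0)"
    obtain y where "(\<Prod>x\<leftarrow>xs. lform x y) \<noteq> 0" using lforms_product_nonzero[OF x0] by blast
    then show False using cx(4)[of y] cx(1) z by simp
  qed
  ultimately show "P \<in> pure_stratum A Q k (replicate_mset (2 * k) 1)" using P by (simp add: pure_stratum_def)
next
  have Ph: "P \<in> hom_polys k" using P VQ_perp_sub by blast
  assume "P \<in> pure_stratum A Q k (replicate_mset (2 * k) 1)"
  then have P0: "P \<noteq> (\<lambda>v. 0)" and parts: "mult_partition Q P = replicate_mset (2 * k) 1" by (auto simp: pure_stratum_def)
  obtain c xs where cx: "length xs = 2 * k" "\<forall>x\<in>set xs. norm x = 1" "\<And>y. P (psi y) = c * (\<Prod>x\<leftarrow>xs. lform x y)"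
    using hom_psi_factorization[OF Ph] by blast
  have c: "c \<noteq> 0"
  proof
    assume "c = 0"
    then have "P (psi y) = (\<lambda>v. 0) (psi y)" for y using cx(3) by simp
    then have "P = (\<lambda>v. 0)" by (rule VQ_perp_psi_inj[OF P fun_subspaceD(1)[OF fun_subspace_VQ_perp]])
    then show False using P0 by blast
  qed
  have x0: "0 \<notin> set xs" by (rule norm1_nonzero[OF cx(2)])
  note ip = intersection_points_eq[OF x0 cx(3) c]
  have "size (mult_partition Q P) = card (intersection_points Q P)" by (simp add: mult_partition_def)
  then have "card (intersection_points Q P) = 2 * k" using parts by simp
  then have "nonprop (mset xs)" using nonprop_iff_card[OF x0] cx(1) unfolding ip by simp
  then show "roots_distinct k P" unfolding roots_distinct_def using c cx by blast
qed

end

section \<open>The discriminant of a binary form\<close>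

text \<open>For the binary form \<open>G\<close> of degree \<open>n\<close> with \<open>G (s, 1) = g s\<close>, this is \<open>\<partial>G / \<partial>s\<close> at \<open>(s, 1)\<close>.\<close>

definition form_ds :: "complex poly \<Rightarrow> complex poly" where
  "form_ds g = pderiv g"

text \<open>Likewise \<open>\<partial>G / \<partial>t\<close> at \<open>(s, 1)\<close>, by Euler's relation \<open>s \<partial>G / \<partial>s + t \<partial>G / \<partial>t = n G\<close>.\<close>

definition form_dt :: "nat \<Rightarrow> complex poly \<Rightarrow> complex poly" where
  "form_dt n g = Polynomial.smult (of_nat n) g - [:0, 1:] * pderiv g"

text \<open>
  The Sylvester matrix of the two partial derivatives as forms of degree \<open>n - 1\<close>, so that a common
  zero at infinity counts as well. Its columns are the coefficients of the multiples by \<open>s ^ j\<close>;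
  the sign makes a kernel vector a relation \<open>u * form_ds g = v * form_dt n g\<close>.
\<close>

definition sylvester :: "nat \<Rightarrow> complex poly \<Rightarrow> complex Matrix.mat" where
  "sylvester n g = Matrix.mat (2 * (n - 1)) (2 * (n - 1)) (\<lambda>(i, j).
     if j < n - 1 then coeff (monom 1 j * form_ds g) i
     else - coeff (monom 1 (j - (n - 1)) * form_dt n g) i)"

definition disc :: "nat \<Rightarrow> complex poly \<Rightarrow> complex" where
  "disc n g = Determinant.det (sylvester n g)"

lemma coeff_form_dt: "coeff (form_dt n g) i = (of_nat n - of_nat i) * coeff g i"
  by (cases i) (simp_all add: form_dt_def coeff_pderiv algebra_simps)

lemma form_degrees:
  assumes "degree g \<le> n" "0 < n"
  shows "degree (form_ds g) \<le> n - 1" "degree (form_dt n g) \<le> n - 1"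
proof -
  show "degree (form_ds g) \<le> n - 1" using assms by (simp add: form_ds_def degree_pderiv)
  show "degree (form_dt n g) \<le> n - 1"
  proof (rule degree_le, intro allI impI)
    fix i assume "n - 1 < i"
    then show "coeff (form_dt n g) i = 0"
      using assms by (cases "i = n") (auto simp: coeff_form_dt coeff_eq_0)
  qed
qed

lemma poly_of_coeffs: "coeff (\<Sum>j<m. monom (c j) j) i = (if i < m then (c i :: complex) else 0)"
  by (simp add: coeff_sum if_distrib cong: if_cong)

text \<open>A kernel vector lists the coefficients of \<open>u\<close> followed by those of \<open>v\<close>.\<close>

lemma disc_zero_iff:
  assumes deg: "degree g \<le> n" and n: "2 \<le> n"
  shows "disc n g = 0 \<longleftrightarrow> (\<exists>u v. (u \<noteq> 0 \<or> v \<noteq> 0) \<and> degree u < n - 1 \<and> degree v < n - 1 \<and>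
     u * form_ds g = v * form_dt n g)"
proof -
  define m where "m = n - 1"
  have m: "0 < m" using n by (simp add: m_def)
  define M where "M = sylvester n g"
  have m': "n - 1 = m" by (simp add: m_def)
  have S: "sylvester n g = Matrix.mat (2 * m) (2 * m) (\<lambda>(i, j).
     if j < m then coeff (monom 1 j * form_ds g) i
     else - coeff (monom 1 (j - m) * form_dt n g) i)"
    unfolding sylvester_def m' ..
  have MN: "M \<in> carrier_mat (2 * m) (2 * m)" by (simp add: M_def sylvester_def m_def)
  define U where "U w = (\<Sum>j<m. monom (vec_index w j) j)" for w :: "complex Matrix.vec"
  define V where "V w = (\<Sum>j<m. monom (vec_index w (m + j)) j)" for w :: "complex Matrix.vec"
  have entry: "vec_index (M *\<^sub>v w) i = coeff (U w * form_ds g - V w * form_dt n g) i"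
    if w: "w \<in> carrier_vec (2 * m)" and i: "i < 2 * m" for w i
  proof -
    have "vec_index (M *\<^sub>v w) i = (\<Sum>j<2 * m. M $$ (i, j) * vec_index w j)"
      using i w MN by (simp add: scalar_prod_def atLeast0LessThan)
    also have "\<dots> = (\<Sum>j<m. M $$ (i, j) * vec_index w j) + (\<Sum>j<m. M $$ (i, m + j) * vec_index w (m + j))"
    proof -
      have "{..<2 * m} = {..<m} \<union> {m..<m + m}" by auto
      moreover have "(\<Sum>j\<in>{m..<m + m}. M $$ (i, j) * vec_index w j) = (\<Sum>j<m. M $$ (i, m + j) * vec_index w (m + j))"
        using sum.shift_bounds_nat_ivl[of "\<lambda>j. M $$ (i, j) * vec_index w j" 0 m m] by (simp add: atLeast0LessThan add.commute)
      ultimately show ?thesis by (simp add: sum.union_disjoint[of "{..<m}" "{m..<m + m}"] disjoint_iff)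
    qed
    also have "(\<Sum>j<m. M $$ (i, j) * vec_index w j) = coeff (U w * form_ds g) i"
    proof -
      have "M $$ (i, j) * vec_index w j = coeff (monom (vec_index w j) j * form_ds g) i" if "j < m" for j
      proof -
        have "M $$ (i, j) = coeff (monom 1 j * form_ds g) i" using i that by (simp add: M_def S)
        moreover have "monom (vec_index w j) j * form_ds g = Polynomial.smult (vec_index w j) (monom 1 j * form_ds g)"
          by (simp add: smult_monom mult_smult_left[symmetric])
        ultimately show ?thesis by simp
      qed
      then show ?thesis by (simp add: U_def sum_distrib_right coeff_sum)
    qed
    also have "(\<Sum>j<m. M $$ (i, m + j) * vec_index w (m + j)) = - coeff (V w * form_dt n g) i"
    proof -
      have "M $$ (i, m + j) * vec_index w (m + j) = - coeff (monom (vec_index w (m + j)) j * form_dt n g) i" if "j < m" for j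
      proof -
        have "M $$ (i, m + j) = - coeff (monom 1 j * form_dt n g) i" using i that by (simp add: M_def S)
        moreover have "monom (vec_index w (m + j)) j * form_dt n g = Polynomial.smult (vec_index w (m + j)) (monom 1 j * form_dt n g)"
          by (simp add: smult_monom mult_smult_left[symmetric])
        ultimately show ?thesis by simp
      qed
      then show ?thesis by (simp add: V_def sum_distrib_right coeff_sum sum_negf)
    qed
    finally show ?thesis by simp
  qed
  have degU: "degree (U w) < m" "degree (V w) < m" for w
    unfolding U_def V_def by (rule degree_lessI; use m in \<open>auto simp: poly_of_coeffs\<close>)+
  have fd: "degree (form_ds g) \<le> m" "degree (form_dt n g) \<le> m"
    using form_degrees[OF deg] n by (auto simp: m_def)
  have ker: "M *\<^sub>v w = 0\<^sub>v (2 * m) \<longleftrightarrow> U w * form_ds g = V w * form_dt n g" if w: "w \<in> carrier_vec (2 * m)" for w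
  proof
    assume z: "M *\<^sub>v w = 0\<^sub>v (2 * m)"
    have "coeff (U w * form_ds g - V w * form_dt n g) i = 0" for i
    proof (cases "i < 2 * m")
      case True
      have "vec_index (M *\<^sub>v w) i = 0" unfolding z using True by simp
      then show ?thesis using entry[OF w True] by simp
    next
      case False
      have "degree (U w * form_ds g) < 2 * m" "degree (V w * form_dt n g) < 2 * m"
        using degree_mult_le[of "U w" "form_ds g"] degree_mult_le[of "V w" "form_dt n g"] degU[of w] fd by linarith+
      then show ?thesis using False by (simp add: coeff_eq_0)
    qed
    then have "U w * form_ds g - V w * form_dt n g = 0" by (intro poly_eqI) simp
    then show "U w * form_ds g = V w * form_dt n g" by simp
  next
    assume "U w * form_ds g = V w * form_dt n g"
    then show "M *\<^sub>v w = 0\<^sub>v (2 * m)" using entry[OF w] MN by (intro eq_vecI) auto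
  qed
  have "disc n g = 0 \<longleftrightarrow> (\<exists>w. w \<in> carrier_vec (2 * m) \<and> w \<noteq> 0\<^sub>v (2 * m) \<and> M *\<^sub>v w = 0\<^sub>v (2 * m))"
    unfolding disc_def M_def[symmetric] by (rule det_0_iff_vec_prod_zero[OF MN])
  also have "\<dots> \<longleftrightarrow> (\<exists>u v. (u \<noteq> 0 \<or> v \<noteq> 0) \<and> degree u < m \<and> degree v < m \<and> u * form_ds g = v * form_dt n g)"
  proof
    assume "\<exists>w. w \<in> carrier_vec (2 * m) \<and> w \<noteq> 0\<^sub>v (2 * m) \<and> M *\<^sub>v w = 0\<^sub>v (2 * m)"
    then obtain w where w: "w \<in> carrier_vec (2 * m)" "w \<noteq> 0\<^sub>v (2 * m)" "M *\<^sub>v w = 0\<^sub>v (2 * m)" by blast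
    obtain i where i: "i < 2 * m" "vec_index w i \<noteq> 0"
    proof (rule ccontr)
      assume "\<not> thesis"
      then have "\<And>i. i < 2 * m \<Longrightarrow> vec_index w i = 0" using that by blast
      then have "w = 0\<^sub>v (2 * m)" using w(1) by (intro eq_vecI) auto
      then show False using w(2) by blast
    qed
    have "U w \<noteq> 0 \<or> V w \<noteq> 0"
    proof (cases "i < m")
      case True
      then have "coeff (U w) i \<noteq> 0" using i(2) by (simp add: U_def poly_of_coeffs)
      then show ?thesis by auto
    next
      case False
      then have "coeff (V w) (i - m) \<noteq> 0" using i by (simp add: V_def poly_of_coeffs)
      then show ?thesis by auto
    qed
    then show "\<exists>u v. (u \<noteq> 0 \<or> v \<noteq> 0) \<and> degree u < m \<and> degree v < m \<and> u * form_ds g = v * form_dt n g"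
      using degU[of w] ker[OF w(1)] w(3) by blast
  next
    assume "\<exists>u v. (u \<noteq> 0 \<or> v \<noteq> 0) \<and> degree u < m \<and> degree v < m \<and> u * form_ds g = v * form_dt n g"
    then obtain u v where uv: "u \<noteq> 0 \<or> v \<noteq> 0" "degree u < m" "degree v < m" "u * form_ds g = v * form_dt n g" by blast
    define w where "w = Matrix.vec (2 * m) (\<lambda>i. if i < m then coeff u i else coeff v (i - m))"
    have w: "w \<in> carrier_vec (2 * m)" by (simp add: w_def)
    have Uw: "U w = u" using uv(2) by (intro poly_eqI) (auto simp: U_def poly_of_coeffs w_def coeff_eq_0)
    have Vw: "V w = v" using uv(3) by (intro poly_eqI) (auto simp: V_def poly_of_coeffs w_def coeff_eq_0)
    have "w \<noteq> 0\<^sub>v (2 * m)"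
    proof
      assume "w = 0\<^sub>v (2 * m)"
      then have "U w = 0" "V w = 0" by (auto simp: U_def V_def)
      then show False using uv(1) Uw Vw by simp
    qed
    then show "\<exists>w. w \<in> carrier_vec (2 * m) \<and> w \<noteq> 0\<^sub>v (2 * m) \<and> M *\<^sub>v w = 0\<^sub>v (2 * m)"
      using w ker[OF w] Uw Vw uv(4) by auto
  qed
  finally show ?thesis by (simp add: m_def)
qed

text \<open>The dehomogenized linear form with coefficient vector \<open>x\<close>.\<close>

definition lin_poly :: "complex^2 \<Rightarrow> complex poly" where
  "lin_poly x = [:x $ 2, x $ 1:]"

lemma poly_lin_poly: "poly (lin_poly x) s = lform x (vec2 s 1)"
  by (simp add: lin_poly_def lform_2 mult.commute)

lemma poly_lforms: "poly (\<Prod>x\<leftarrow>xs. lin_poly x) s = (\<Prod>x\<leftarrow>xs. lform x (vec2 s 1))"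
  by (induction xs) (auto simp: poly_lin_poly)

lemma degree_lin_polys: "degree (\<Prod>x\<leftarrow>xs. lin_poly x) \<le> length xs"
proof (induction xs)
  case (Cons x xs)
  have "degree (lin_poly x * (\<Prod>x\<leftarrow>xs. lin_poly x)) \<le> degree (lin_poly x) + degree (\<Prod>x\<leftarrow>xs. lin_poly x)"
    by (rule degree_mult_le)
  also have "\<dots> \<le> 1 + length xs" using Cons by (intro add_mono) (auto simp: lin_poly_def)
  finally show ?case by simp
qed simp

text \<open>
  This identity and the next two are the product rule for \<open>g = l * l * h\<close>, showing that both
  partial derivatives are divisible by \<open>l\<close>. They are stated in a general ring so that they are
  proved by mere expansion.
\<close>

lemma double_root_dt:
  fixes l h h' X c e N :: "'a :: comm_ring_1"
  assumes "l = e + X * c"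
  shows "(N + 2) * (l * l * h) - X * (l * l * h' + 2 * l * c * h) = l * (2 * e * h + l * (N * h - X * h'))"
  unfolding assms by (simp add: algebra_simps)

lemma double_root_pderiv:
  fixes l h h' c :: "'a :: comm_ring_1"
  shows "l * l * h' + h * (l * c + l * c) = l * l * h' + 2 * l * c * h"
  by (simp add: algebra_simps)

lemma double_root_ds:
  fixes l h h' c :: "'a :: comm_ring_1"
  shows "l * l * h' + 2 * l * c * h = l * (2 * c * h + l * h')"
  by (simp add: algebra_simps)

text \<open>
  Both partial derivatives have the factor \<open>lin_poly a\<close>, and exchanging their cofactors gives a
  relation of too small a degree.
\<close>

lemma disc_of_square:
  assumes g: "g = lin_poly a * lin_poly a * h" and h: "degree h \<le> n - 2" and n: "2 \<le> n" and dg: "degree g \<le> n"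
  shows "disc n g = 0"
proof -
  have lt: "n - 2 < n - 1" using n by simp
  define l where "l = lin_poly a"
  define w1 where "w1 = 2 * [:a $ 1:] * h + l * pderiv h"
  define w2 where "w2 = 2 * [:a $ 2:] * h + l * form_dt (n - 2) h"
  have pl: "pderiv l = [:a $ 1:]" by (simp add: l_def lin_poly_def pderiv_pCons)
  have lX: "l = [:a $ 2:] + [:0, 1:] * [:a $ 1:]" by (simp add: l_def lin_poly_def)
  have pg: "pderiv g = l * l * pderiv h + 2 * l * [:a $ 1:] * h"
    unfolding g l_def[symmetric] pderiv_mult pl by (rule double_root_pderiv)
  have fs: "form_ds g = l * w1"
    unfolding form_ds_def pg w1_def by (rule double_root_ds)
  have sm: "Polynomial.smult c p = [:c:] * p" for c and p :: "complex poly" by simp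
  have Nn: "[:of_nat n :: complex:] = [:of_nat (n - 2):] + 2"
  proof -
    have "(of_nat n :: complex) = of_nat (n - 2) + 2" using n by (simp add: of_nat_diff)
    then show ?thesis by (simp add: numeral_poly)
  qed
  have ft: "form_dt n g = l * w2"
    unfolding form_dt_def w2_def sm pg Nn
    unfolding g l_def[symmetric]
    using double_root_dt[OF lX, of "[:of_nat (n - 2):]" h "pderiv h"] by simp
  have d2: "degree (2 * [:b:] * h) \<le> n - 2" for b :: complex
  proof -
    have "2 * [:b:] * h = Polynomial.smult (2 * b) h" by (simp add: numeral_poly mult.commute)
    then show ?thesis using h degree_smult_le[of "2 * b" h] by simp
  qed
  have dl: "degree (l * p) \<le> n - 2" if "p = 0 \<or> (0 < n - 2 \<and> degree p \<le> n - 2 - 1)" for p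
  proof (cases "p = 0")
    case False
    then show ?thesis using that degree_mult_le[of l p] by (auto simp: l_def lin_poly_def split: if_splits)
  qed simp
  have "degree (l * pderiv h) \<le> n - 2"
  proof (rule dl)
    show "pderiv h = 0 \<or> (0 < n - 2 \<and> degree (pderiv h) \<le> n - 2 - 1)"
      using h by (cases "degree h = 0") (auto simp: degree_pderiv pderiv_eq_0_iff)
  qed
  then have dw1: "degree w1 < n - 1" unfolding w1_def
    by (rule degree_add_less[OF le_less_trans[OF d2 lt] le_less_trans[OF _ lt]])
  have "degree (l * form_dt (n - 2) h) \<le> n - 2"
  proof (rule dl)
    show "form_dt (n - 2) h = 0 \<or> (0 < n - 2 \<and> degree (form_dt (n - 2) h) \<le> n - 2 - 1)"
    proof (cases "n - 2 = 0")
      case True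
      then have "coeff (form_dt (n - 2) h) i = 0" for i using h by (cases i) (auto simp: coeff_form_dt coeff_eq_0)
      then show ?thesis by (simp add: poly_eq_iff)
    next
      case False then show ?thesis using form_degrees(2)[OF h] by simp
    qed
  qed
  then have dw2: "degree w2 < n - 1" unfolding w2_def
    by (rule degree_add_less[OF le_less_trans[OF d2 lt] le_less_trans[OF _ lt]])
  show ?thesis unfolding disc_zero_iff[OF dg n]
  proof (cases "w1 = 0 \<and> w2 = 0")
    case True
    then show "\<exists>u v. (u \<noteq> 0 \<or> v \<noteq> 0) \<and> degree u < n - 1 \<and> degree v < n - 1 \<and> u * form_ds g = v * form_dt n g"
      using n by (intro exI[of _ 1] exI[of _ 0]) (simp add: fs)
  next
    case False
    then show "\<exists>u v. (u \<noteq> 0 \<or> v \<noteq> 0) \<and> degree u < n - 1 \<and> degree v < n - 1 \<and> u * form_ds g = v * form_dt n g"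
      using dw1 dw2 by (intro exI[of _ w2] exI[of _ w1]) (auto simp: fs ft)
  qed
qed

lemma lin_polys_mset: "mset xs = mset ys \<Longrightarrow> (\<Prod>x\<leftarrow>xs. lin_poly x) = (\<Prod>y\<leftarrow>ys. lin_poly y)"
  by (metis mset_map prod_mset_prod_list)

lemma top_coeff_lin_polys: "coeff (\<Prod>x\<leftarrow>xs. lin_poly x) (length xs) = (\<Prod>x\<leftarrow>xs. x $ 1)"
proof (induction xs)
  case (Cons x xs)
  have "coeff (\<Prod>x\<leftarrow>xs. lin_poly x) (Suc (length xs)) = 0"
    using degree_lin_polys[of xs] by (intro coeff_eq_0) simp
  then show ?case using Cons by (simp add: lin_poly_def)
qed simp

text \<open>
  Every entry is a constant multiple of a coefficient of \<open>g\<close>, so the discriminant depends on these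
  coefficients polynomially.
\<close>

lemma sylvester_entry:
  assumes "i < 2 * (n - 1)" "j < 2 * (n - 1)"
  shows "sylvester n g $$ (i, j) =
    (if j < n - 1 then if i < j then 0 else of_nat (Suc (i - j))
     else if i < j - (n - 1) then 0 else of_nat (i - (j - (n - 1))) - of_nat n) *
    coeff g (if j < n - 1 then Suc (i - j) else i - (j - (n - 1)))"
  using assms
  by (simp add: sylvester_def coeff_monom_mult form_ds_def coeff_pderiv coeff_form_dt del: of_nat_Suc)
    (simp add: algebra_simps)

lemma disc_expansion:
  "disc n g = (\<Sum>p | p permutes {0..<2 * (n - 1)}. signof p * (\<Prod>i = 0..<2 * (n - 1). sylvester n g $$ (i, p i)))"
  unfolding disc_def by (rule det_def') (simp add: sylvester_def)

lemma disc_tendsto: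
  assumes "\<And>i. ((\<lambda>t. coeff (g t) i) \<longlongrightarrow> coeff g0 i) F"
  shows "((\<lambda>t. disc n (g t)) \<longlongrightarrow> disc n g0) F"
proof -
  have "((\<lambda>t. sylvester n (g t) $$ (i, j)) \<longlongrightarrow> sylvester n g0 $$ (i, j)) F"
    if "i < 2 * (n - 1)" "j < 2 * (n - 1)" for i j
    unfolding sylvester_entry[OF that] by (intro tendsto_mult tendsto_const assms)
  then show ?thesis unfolding disc_expansion
    by (intro tendsto_sum tendsto_mult tendsto_const tendsto_prod) (auto dest: permutes_in_image)
qed

lemma disc_holomorphic:
  assumes "\<And>i. (\<lambda>t. coeff (g t) i) holomorphic_on S"
  shows "(\<lambda>t. disc n (g t)) holomorphic_on S"
proof -
  have "(\<lambda>t. sylvester n (g t) $$ (i, j)) holomorphic_on S"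
    if "i < 2 * (n - 1)" "j < 2 * (n - 1)" for i j
    unfolding sylvester_entry[OF that] by (intro holomorphic_on_mult holomorphic_on_const assms)
  then show ?thesis unfolding disc_expansion
    by (intro holomorphic_on_sum holomorphic_on_mult holomorphic_on_const holomorphic_on_prod) (auto dest: permutes_in_image)
qed

context ellipsoid_form
begin

text \<open>
  Without repeated factors the partial derivatives have no common zero, not even at infinity; the
  latter means that one of them has a non-zero coefficient of degree \<open>n - 1\<close>. So they are coprime,
  and the one with this coefficient divides a cofactor of smaller degree.
\<close>

lemma disc_nonzero:
  assumes c: "c \<noteq> 0" and len: "length xs = n" and np: "nonprop (mset xs)" and n: "2 \<le> n"
    and g: "g = Polynomial.smult c (\<Prod>x\<leftarrow>xs. lin_poly x)"
  shows "disc n g \<noteq> 0"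
proof
  assume d0: "disc n g = 0"
  have dg: "degree g \<le> n" using degree_lin_polys[of xs] len c by (simp add: g)
  obtain u v where uv: "u \<noteq> 0 \<or> v \<noteq> 0" "degree u < n - 1" "degree v < n - 1" "u * form_ds g = v * form_dt n g"
    using d0 unfolding disc_zero_iff[OF dg n] by blast
  have pick: "\<exists>ys. mset xs = add_mset x (mset ys) \<and> Suc (length ys) = n \<and> (\<forall>y\<in>set ys. \<forall>r. y \<noteq> r *s x)"
    if x: "x \<in> set xs" for x
  proof -
    obtain ys where ys: "mset xs = add_mset x (mset ys)" using x by (metis ex_mset insert_DiffM set_mset_mset)
    have "Suc (length ys) = n" using arg_cong[OF ys, of size] len by simp
    moreover have "y \<noteq> r *s x" if "y \<in> set ys" for y r using nonpropD(2)[of x "mset ys" y r] np ys that by simp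
    ultimately show ?thesis using ys by blast
  qed
  have xs0: "x \<noteq> 0" if "x \<in> set xs" for x using np that by (auto simp: nonprop_def)
  \<comment> \<open>no common zero at infinity\<close>
  have top: "coeff (form_ds g) (n - 1) \<noteq> 0 \<or> coeff (form_dt n g) (n - 1) \<noteq> 0"
  proof (rule ccontr)
    assume "\<not> ?thesis"
    then have z: "coeff g n = 0" "coeff g (n - 1) = 0"
      using n by (auto simp: form_ds_def coeff_pderiv coeff_form_dt of_nat_diff)
    have "(\<Prod>x\<leftarrow>xs. x $ 1) = 0" using z(1) c top_coeff_lin_polys[of xs] len by (simp add: g)
    then obtain x where x: "x \<in> set xs" "x $ 1 = 0" by (auto simp: prod_list_zero_iff)
    obtain ys where ys: "mset xs = mset (x # ys)" "Suc (length ys) = n" "\<forall>y\<in>set ys. \<forall>r. y \<noteq> r *s x"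
      using pick[OF x(1)] by auto
    have x2: "x $ 2 \<noteq> 0" using xs0[OF x(1)] x(2) by (auto simp: Finite_Cartesian_Product.vec_eq_iff forall_2)
    have "(\<Prod>x\<leftarrow>xs. lin_poly x) = Polynomial.smult (x $ 2) (\<Prod>y\<leftarrow>ys. lin_poly y)"
      using lin_polys_mset[OF ys(1)] x(2) by (simp add: lin_poly_def)
    then have "coeff g (n - 1) = c * (x $ 2 * (\<Prod>y\<leftarrow>ys. y $ 1))"
      using top_coeff_lin_polys[of ys] ys(2) by (auto simp: g)
    then have "(\<Prod>y\<leftarrow>ys. y $ 1) = 0" using z(2) c x2 by simp
    then obtain y where y: "y \<in> set ys" "y $ 1 = 0" by (auto simp: prod_list_zero_iff)
    have "y = (y $ 2 / x $ 2) *s x" using x2 x(2) y(2) by (intro vec2_eqI) auto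
    then show False using ys(3) y(1) by blast
  qed
  have nroot: "\<not> (poly (form_ds g) s = 0 \<and> poly (form_dt n g) s = 0)" for s
  proof
    assume z: "poly (form_ds g) s = 0 \<and> poly (form_dt n g) s = 0"
    define w where "w = vec2 s 1"
    have w0: "w \<noteq> 0" by (simp add: w_def vec2_zero_iff)
    have "of_nat n * poly g s = 0" "poly (pderiv g) s = 0" using z by (auto simp: form_ds_def form_dt_def)
    then have g0: "poly g s = 0" and g1: "poly (pderiv g) s = 0" using n by auto
    have "(\<Prod>x\<leftarrow>xs. lform x w) = 0" using g0 c by (simp add: g poly_lforms w_def)
    then obtain x where x: "x \<in> set xs" "lform x w = 0" by (auto simp: prod_list_zero_iff)
    obtain ys where ys: "mset xs = mset (x # ys)" "Suc (length ys) = n" "\<forall>y\<in>set ys. \<forall>r. y \<noteq> r *s x"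
      using pick[OF x(1)] by auto
    have ge: "g = Polynomial.smult c (lin_poly x * (\<Prod>y\<leftarrow>ys. lin_poly y))"
      using lin_polys_mset[OF ys(1)] by (simp add: g)
    have "poly (pderiv g) s = c * (x $ 1 * (\<Prod>y\<leftarrow>ys. lform y w))"
    proof -
      have "poly (pderiv g) s = c * (poly (lin_poly x) s * poly (pderiv (\<Prod>y\<leftarrow>ys. lin_poly y)) s + poly (pderiv (lin_poly x)) s * poly (\<Prod>y\<leftarrow>ys. lin_poly y) s)"
        unfolding ge by (simp add: pderiv_smult pderiv_mult)
      moreover have "pderiv (lin_poly x) = [:x $ 1:]" by (simp add: lin_poly_def pderiv_pCons)
      ultimately show ?thesis using x(2) by (simp add: poly_lin_poly poly_lforms w_def)
    qed
    moreover have "x $ 1 \<noteq> 0"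
    proof
      assume "x $ 1 = 0"
      then have "x $ 2 = 0" using x(2) by (simp add: lform_2 w_def)
      then show False using xs0[OF x(1)] \<open>x $ 1 = 0\<close> by (auto simp: Finite_Cartesian_Product.vec_eq_iff forall_2)
    qed
    ultimately have "(\<Prod>y\<leftarrow>ys. lform y w) = 0" using g1 c by simp
    then obtain y where y: "y \<in> set ys" "lform y w = 0" by (auto simp: prod_list_zero_iff)
    obtain d where d: "w = d *s perp x" using lform_zero_prop[OF x(2) xs0[OF x(1)]] by blast
    have "d \<noteq> 0" using d w0 by auto
    then have "lform y (perp x) = 0" using y(2) unfolding d lform_scale by simp
    then show False using lform_perp_zero_prop[OF _ xs0[OF x(1)]] ys(3) y(1) by blast
  qed
  have cop: "coprime (form_ds g) (form_dt n g)"
  proof (rule coprimeI)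
    fix q assume q: "q dvd form_ds g" "q dvd form_dt n g"
    have "\<not> (\<exists>s. poly q s = 0)" using nroot q by (auto elim!: dvdE)
    then have "degree q = 0" using alg_closed_imp_poly_has_root[of q] by blast
    moreover have "q \<noteq> 0" using \<open>\<not> (\<exists>s. poly q s = 0)\<close> by auto
    ultimately show "is_unit q" by (simp add: is_unit_iff_degree)
  qed
  from top show False
  proof
    assume t: "coeff (form_ds g) (n - 1) \<noteq> 0"
    then have deg: "n - 1 \<le> degree (form_ds g)" "form_ds g \<noteq> 0" by (auto intro: le_degree)
    have "form_ds g dvd v * form_dt n g" using uv(4) by (metis dvd_triv_right)
    then have "form_ds g dvd v" using cop by (simp add: coprime_dvd_mult_left_iff)
    then have "v = 0" using dvd_imp_degree_le[of "form_ds g" v] deg(1) uv(3) by auto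
    then show False using uv(1,4) deg(2) by simp
  next
    assume t: "coeff (form_dt n g) (n - 1) \<noteq> 0"
    then have deg: "n - 1 \<le> degree (form_dt n g)" "form_dt n g \<noteq> 0" by (auto intro: le_degree)
    have "form_dt n g dvd u * form_ds g" using uv(4) by (metis dvd_triv_right)
    then have "form_dt n g dvd u" using cop by (metis coprime_commute coprime_dvd_mult_left_iff)
    then have "u = 0" using dvd_imp_degree_le[of "form_dt n g" u] deg(1) uv(2) by auto
    then show False using uv(1,4) deg(2) by simp
  qed
qed

section \<open>The discriminant as a countable union of hypersurfaces\<close>

text \<open>The pull-back of a polynomial to the cone, as a polynomial on the affine line \<open>(s, 1)\<close>.\<close>

definition dehom :: "cfun3 \<Rightarrow> complex poly" where
  "dehom p = (SOME g. \<forall>s. p (psi (vec2 s 1)) = poly g s)"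

lemma poly_dehom: "p \<in> polys \<Longrightarrow> p (psi (vec2 s 1)) = poly (dehom p) s"
  unfolding dehom_def using someI_ex[OF psi_poly] by blast

lemma dehom_eqI: "p \<in> polys \<Longrightarrow> (\<And>s. p (psi (vec2 s 1)) = poly g s) \<Longrightarrow> dehom p = g"
  using poly_dehom by (metis poly_eq_poly_eq_iff ext)

lemma disc_roots:
  assumes P: "P \<in> hom_polys k" and k: "0 < k"
  shows "disc (2 * k) (dehom P) = 0 \<longleftrightarrow> \<not> roots_distinct k P"
proof
  have pp: "P \<in> polys" using P hom_polys_polys by blast
  have n: "2 \<le> 2 * k" using k by simp
  {
    assume d: "disc (2 * k) (dehom P) = 0"
    show "\<not> roots_distinct k P"
    proof
      assume "roots_distinct k P"
      then obtain c xs where cx: "c \<noteq> 0" "length xs = 2 * k" "\<forall>x\<in>set xs. norm x = 1"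
        "\<And>y. P (psi y) = c * (\<Prod>x\<leftarrow>xs. lform x y)" "nonprop (mset xs)" unfolding roots_distinct_def by blast
      have "dehom P = Polynomial.smult c (\<Prod>x\<leftarrow>xs. lin_poly x)"
        by (rule dehom_eqI[OF pp]) (simp add: cx(4) poly_lforms)
      then show False using disc_nonzero[OF cx(1,2,5) n] d by blast
    qed
  next
    assume nr: "\<not> roots_distinct k P"
    obtain c xs where cx: "length xs = 2 * k" "\<forall>x\<in>set xs. norm x = 1" "\<And>y. P (psi y) = c * (\<Prod>x\<leftarrow>xs. lform x y)"
      using hom_psi_factorization[OF P] by blast
    have gP: "dehom P = Polynomial.smult c (\<Prod>x\<leftarrow>xs. lin_poly x)"
      by (rule dehom_eqI[OF pp]) (simp add: cx(3) poly_lforms)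
    have dg: "degree (dehom P) \<le> 2 * k" unfolding gP using degree_lin_polys[of xs] cx(1) degree_smult_le order_trans by metis
    show "disc (2 * k) (dehom P) = 0"
    proof (cases "c = 0")
      case True
      then show ?thesis using disc_of_square[of "dehom P" 0 0 "2 * k"] n dg gP by simp
    next
      case False
      then have "\<not> nonprop (mset xs)" using nr cx unfolding roots_distinct_def by blast
      then obtain a b e where ab: "{#a, b#} \<subseteq># mset xs" "a = e *s b"
        using norm1_nonzero[OF cx(2)] by (auto simp: nonprop_def)
      obtain ys where ys: "mset xs = mset (a # b # ys)"
      proof -
        obtain N where "mset xs = {#a, b#} + N" using ab(1) by (metis mset_subset_eq_exists_conv)
        moreover obtain ys where "mset ys = N" using ex_mset by blast
        ultimately show ?thesis using that[of ys] by simp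
      qed
      have lys: "length ys = 2 * k - 2" using arg_cong[OF ys, of size] cx(1) by simp
      have "lin_poly a = Polynomial.smult e (lin_poly b)" by (simp add: ab(2) lin_poly_def)
      then have "dehom P = lin_poly b * lin_poly b * Polynomial.smult (c * e) (\<Prod>y\<leftarrow>ys. lin_poly y)"
        unfolding gP lin_polys_mset[OF ys] by (simp add: mult.assoc)
      moreover have "degree (Polynomial.smult (c * e) (\<Prod>y\<leftarrow>ys. lin_poly y)) \<le> 2 * k - 2"
        using degree_lin_polys[of ys] lys degree_smult_le order_trans by metis
      ultimately show ?thesis using disc_of_square n dg by blast
    qed
  }
qed

text \<open>
  The coefficients of the pulled-back Fourier component are finite linear combinations of
  Hermitian products with fixed functions; continuity and holomorphy of the discriminant in \<open>f\<close>
  come from here.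
\<close>

lemma fourier_dehom_coeff:
  "\<exists>(N :: nat) e. (\<forall>i<N. e i \<in> ellcont) \<and>
    (\<forall>f\<in>ellcont. fourier A k f = (\<lambda>v. \<Sum>i<N. herm A f (e i) * e i v)) \<and>
    (\<forall>f\<in>ellcont. \<forall>j. coeff (dehom (fourier A k f)) j = (\<Sum>i<N. herm A f (e i) * coeff (dehom (e i)) j))"
proof -
  obtain N e where e: "orthonormal_basis (Har A k) N e" using orthonormal_basis_exists[OF fun_subspace_Har Har_sub] by blast
  have eH: "e i \<in> Har A k" if "i < N" for i using e that by (auto simp: orthonormal_basis_def)
  have ep: "e i \<in> polys" if "i < N" for i using eH[OF that] HarD(1) hom_polys_polys by blast
  have fo: "fourier A k f = (\<lambda>v. \<Sum>i<N. herm A f (e i) * e i v)" if "f \<in> ellcont" for f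
    unfolding fourier_def by (rule orth_proj_orthonormal_basis[OF fun_subspace_Har Har_sub that e])
  have "dehom (fourier A k f) = (\<Sum>i<N. Polynomial.smult (herm A f (e i)) (dehom (e i)))" if f: "f \<in> ellcont" for f
  proof (rule dehom_eqI)
    show "fourier A k f \<in> polys" using HarD(1)[OF fourier_Har[OF f]] hom_polys_polys by blast
    show "fourier A k f (psi (vec2 s 1)) = poly (\<Sum>i<N. Polynomial.smult (herm A f (e i)) (dehom (e i))) s" for s
      unfolding fo[OF f] by (simp add: poly_sum poly_dehom[OF ep])
  qed
  then have "\<forall>f\<in>ellcont. \<forall>j. coeff (dehom (fourier A k f)) j = (\<Sum>i<N. herm A f (e i) * coeff (dehom (e i)) j)"
    by (simp add: coeff_sum)
  moreover have "\<forall>i<N. e i \<in> ellcont" using Har_ellcont[OF eH] by simp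
  ultimately show ?thesis using fo by (intro exI[of _ N] exI[of _ e]) simp
qed

text \<open>
  For \<open>k = 0\<close> there is no binary form to speak of, but the origin still belongs to the
  discriminant.
\<close>

definition disc_functional :: "nat \<Rightarrow> cfun3 \<Rightarrow> complex" where
  "disc_functional k f = (if k = 0 then fourier A 0 f 0 else disc (2 * k) (dehom (fourier A k f)))"

lemma nonprop_empty: "nonprop {#}" by (simp add: nonprop_def)

lemma roots_distinct_0:
  assumes P: "P \<in> hom_polys 0" shows "roots_distinct 0 P \<longleftrightarrow> P 0 \<noteq> 0"
proof -
  have c: "P v = P 0" for v using hom_polys_0[OF P] by metis
  show ?thesis
  proof
    assume "roots_distinct 0 P"
    then obtain d where "d \<noteq> 0" "\<And>y. P (psi y) = d" unfolding roots_distinct_def by auto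
    then show "P 0 \<noteq> 0" using c by metis
  next
    assume "P 0 \<noteq> 0"
    then show "roots_distinct 0 P" unfolding roots_distinct_def using nonprop_empty c
      by (intro exI[of _ "P 0"] exI[of _ "[]"]) auto
  qed
qed

lemma disc_functional_zero_iff:
  assumes f: "f \<in> ellcont"
  shows "disc_functional k f = 0 \<longleftrightarrow> fourier A k f \<in> discriminant A Q k"
proof -
  have P: "fourier A k f \<in> VQ_perp A Q k" using fourier_Har[OF f] Har_eq_VQ_perp by blast
  then have Ph: "fourier A k f \<in> hom_polys k" using VQ_perp_sub by blast
  have "disc_functional k f = 0 \<longleftrightarrow> \<not> roots_distinct k (fourier A k f)"
  proof (cases "k = 0")
    case True
    then show ?thesis using roots_distinct_0 Ph by (simp add: disc_functional_def)
  next
    case False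
    then show ?thesis using disc_roots[OF Ph] by (simp add: disc_functional_def)
  qed
  then show ?thesis using pure_stratum_iff[OF P] P by (auto simp: discriminant_def)
qed

lemma entire_disc_functional: "entire_functional (quadric Q) (disc_functional k)"
  unfolding entire_functional_def
proof (intro conjI ballI allI impI)
  obtain N :: nat and e where E: "\<forall>i<N. e i \<in> ellcont"
    "\<forall>f\<in>ellcont. fourier A k f = (\<lambda>v. \<Sum>i<N. herm A f (e i) * e i v)"
    "\<forall>f\<in>ellcont. \<forall>j. coeff (dehom (fourier A k f)) j = (\<Sum>i<N. herm A f (e i) * coeff (dehom (e i)) j)"
    using fourier_dehom_coeff[of k] by (elim exE conjE) (rule that; assumption)
  have e: "e i \<in> ellcont" if "i < N" for i using E(1) that by blast
  have fo: "fourier A k f v = (\<Sum>i<N. herm A f (e i) * e i v)" if "f \<in> ellcont" for f v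
    using bspec[OF E(2) that] by (rule fun_cong)
  have co: "coeff (dehom (fourier A k f)) j = (\<Sum>i<N. herm A f (e i) * coeff (dehom (e i)) j)" if "f \<in> ellcont" for f j
    using E(3) that by blast
  {
    fix f h assume f: "f \<in> holo_on_variety (quadric Q)"
      and h: "(\<forall>n. h n \<in> holo_on_variety (quadric Q)) \<and>
        (\<forall>K. compact K \<and> K \<subseteq> quadric Q \<longrightarrow> uniform_limit K h f sequentially)"
    have fC: "f \<in> ellcont" and hC: "\<And>n. h n \<in> ellcont" using f h holo_ellcont by auto
    have ul: "uniform_limit (ellipsoid A) h f sequentially" using h compact_ellipsoid ellipsoid_subset_quadric by blast
    have hl: "(\<lambda>n. herm A (h n) (e i)) \<longlonglongrightarrow> herm A f (e i)" if "i < N" for i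
      by (rule herm_uniform_limit[OF hC fC e[OF that] ul, of UNIV]) auto
    show "(\<lambda>n. disc_functional k (h n)) \<longlonglongrightarrow> disc_functional k f"
    proof (cases "k = 0")
      case True
      have "(\<lambda>n. fourier A k (h n) 0) \<longlonglongrightarrow> fourier A k f 0" unfolding fo[OF fC] fo[OF hC]
        by (intro tendsto_sum tendsto_mult tendsto_const hl) auto
      then show ?thesis using True by (simp add: disc_functional_def)
    next
      case False
      have "(\<lambda>n. disc (2 * k) (dehom (fourier A k (h n)))) \<longlonglongrightarrow> disc (2 * k) (dehom (fourier A k f))"
        by (rule disc_tendsto) (unfold co[OF fC] co[OF hC], intro tendsto_sum tendsto_mult tendsto_const hl, auto)
      then show ?thesis using False by (simp add: disc_functional_def)
    qed
  next
    fix f g assume "f \<in> holo_on_variety (quadric Q)" "g \<in> holo_on_variety (quadric Q)"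
    then have C: "f \<in> ellcont" "g \<in> ellcont" using holo_ellcont by auto
    have zC: "(\<lambda>v. f v + z * g v) \<in> ellcont" for z by (intro ellcont_add ellcont_cmult C)
    have hl: "(\<lambda>z. herm A (\<lambda>v. f v + z * g v) (e i)) holomorphic_on UNIV" if "i < N" for i
    proof -
      have "herm A (\<lambda>v. f v + z * g v) (e i) = herm A f (e i) + z * herm A g (e i)" for z
        using e[OF that] C by (simp add: herm_add_left herm_cmult_left ellcont_cmult)
      then show ?thesis by (simp add: holomorphic_intros)
    qed
    show "(\<lambda>z. disc_functional k (\<lambda>v. f v + z * g v)) holomorphic_on UNIV"
    proof (cases "k = 0")
      case True
      have "(\<lambda>z. fourier A k (\<lambda>v. f v + z * g v) 0) holomorphic_on UNIV" unfolding fo[OF zC]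
        by (intro holomorphic_on_sum holomorphic_on_mult holomorphic_on_const hl) auto
      then show ?thesis using True by (simp add: disc_functional_def)
    next
      case False
      have "(\<lambda>z. disc (2 * k) (dehom (fourier A k (\<lambda>v. f v + z * g v)))) holomorphic_on UNIV"
        by (rule disc_holomorphic) (unfold co[OF zC], intro holomorphic_on_sum holomorphic_on_mult holomorphic_on_const hl, auto)
      then show ?thesis using False by (simp add: disc_functional_def)
    qed
  }
qed

text \<open>
  Take any \<open>2 * k\<close> different points of the projective line as the factors. This shows that the
  hypersurfaces are proper.
\<close>

lemma generic_harmonic_exists: "\<exists>P\<in>Har A k. P \<notin> discriminant A Q k"
proof -
  \<comment> \<open>unit vectors representing the points \<open>(1 : i)\<close> of the projective line\<close>
  define x where "x i = vec2 1 (of_nat i) /\<^sub>R norm (vec2 1 (of_nat i))" for i :: nat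
  have v0: "vec2 1 (of_nat i) \<noteq> 0" for i by (simp add: vec2_zero_iff)
  have xn: "norm (x i) = 1" for i using v0 by (simp add: x_def)
  then have x0: "x i \<noteq> 0" for i by (metis norm_zero zero_neq_one)
  define xs where "xs = map x [0..<2 * k]"
  have len: "length xs = 2 * k" by (simp add: xs_def)
  have n1: "\<forall>x\<in>set xs. norm x = 1" by (auto simp: xs_def xn)
  have xij: "i = j" if "x i = c *s x j" for i j c
  proof -
    define p q where "p = complex_of_real (inverse (norm (vec2 1 (of_nat i))))" and "q = complex_of_real (inverse (norm (vec2 1 (of_nat j))))"
    have pq: "p \<noteq> 0" using v0 by (simp add: p_def)
    have xp: "x i $ 1 = p" "x i $ 2 = p * of_nat i" "x j $ 1 = q" "x j $ 2 = q * of_nat j"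
      by (simp_all add: x_def p_def q_def scaleR_conv_of_real[where 'a = complex])
    have "p = c * q" "p * of_nat i = c * (q * of_nat j)"
      using arg_cong[OF that, of "\<lambda>v. v $ 1"] arg_cong[OF that, of "\<lambda>v. v $ 2"] by (simp_all add: xp)
    then have "p * of_nat i = p * of_nat j" by simp
    then show ?thesis using pq by simp
  qed
  have "inj_on (\<lambda>i. cpoint (psi (perp (x i)))) {..<2 * k}"
    using cpoint_perp_inj[OF x0 x0] xij by (intro inj_onI) blast
  then have "card ((\<lambda>i. cpoint (psi (perp (x i)))) ` {..<2 * k}) = 2 * k" by (simp add: card_image)
  moreover have "(\<lambda>x. cpoint (psi (perp x))) ` set xs = (\<lambda>i. cpoint (psi (perp (x i)))) ` {..<2 * k}"
    by (auto simp: xs_def image_image)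
  ultimately have np: "nonprop (mset xs)" using nonprop_iff_card[OF norm1_nonzero[OF n1]] len by simp
  obtain u where u: "u \<in> multipoles_bar k" "Theta u = (\<lambda>v. 1 * pairprod xs v)"
    using multipole_of_points[OF len norm1_nonzero[OF n1], of 1] by blast
  define P where "P = Phi A Q k u"
  have P: "P \<in> VQ_perp A Q k" unfolding P_def by (rule Phi_VQ_perp[OF u(1)])
  have "P (psi y) = 1 * (\<Prod>x\<leftarrow>xs. lform x y)" for y
    unfolding P_def Phi_psi[OF u(1)] u(2) using len by (simp add: pairprod_psi)
  then have "roots_distinct k P" unfolding roots_distinct_def using len n1 np
    by (intro exI[of _ 1] exI[of _ xs]) auto
  then have "P \<notin> discriminant A Q k" using pure_stratum_iff[OF P] by (simp add: discriminant_def)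
  then show ?thesis using P Har_eq_VQ_perp by blast
qed

text \<open>
  Each hypersurface is not empty as it contains \<open>0\<close>, and is proper because a generic harmonic form
  is its own Fourier component.
\<close>

lemma discriminant_codim_one: "complex_codim_one (quadric Q) (discriminant_fun A Q)"
  unfolding complex_codim_one_def
proof (intro exI conjI allI)
  let ?H = "\<lambda>k. {f \<in> holo_on_variety (quadric Q). disc_functional k f = 0}"
  show "discriminant_fun A Q = (\<Union>k. ?H k)"
    using disc_functional_zero_iff holo_ellcont by (auto simp: discriminant_fun_def)
  fix k
  have "(\<lambda>v. 0) \<in> ?H k"
  proof -
    have h: "(\<lambda>v. 0) \<in> holo_on_variety (quadric Q)" by (intro polys_holo polys_const)
    have "fourier A k (\<lambda>v. 0) = (\<lambda>v. 0)"
      by (rule fourier_eqI) (auto intro: ellcont_const fun_subspaceD(1)[OF fun_subspace_Har])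
    moreover have "(\<lambda>v. 0) \<in> discriminant A Q k"
      using fun_subspaceD(1)[OF fun_subspace_VQ_perp] by (simp add: discriminant_def pure_stratum_def)
    ultimately show ?thesis using h disc_functional_zero_iff[OF ellcont_const[of 0], of k] by simp
  qed
  moreover obtain P where P: "P \<in> Har A k" "P \<notin> discriminant A Q k" using generic_harmonic_exists by blast
  have "P \<in> holo_on_variety (quadric Q)" using P(1) HarD(1) hom_polys_polys polys_holo by blast
  moreover have "fourier A k P = P"
    by (rule fourier_eqI) (auto intro: Har_ellcont P)
  then have "P \<notin> ?H k" using P disc_functional_zero_iff[OF Har_ellcont[OF P(1)], of k] by simp
  ultimately show "analytic_hypersurface (quadric Q) (?H k)"
    unfolding analytic_hypersurface_def using entire_disc_functional by blast
qed

section \<open>Angles and norms of multipoles\<close>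

lemma angle_range:
  assumes "p \<in> ellcont" "r \<in> ellcont"
  shows "- 1 \<le> Re (herm A p r) / (L2norm A p * L2norm A r)" "Re (herm A p r) / (L2norm A p * L2norm A r) \<le> 1"
proof -
  have "\<bar>Re (herm A p r)\<bar> \<le> L2norm A p * L2norm A r"
    by (rule order_trans[OF abs_Re_le_cmod cauchy_schwarz[OF assms]])
  moreover have "0 \<le> L2norm A p * L2norm A r" by (intro mult_nonneg_nonneg L2norm_nonneg)
  ultimately have "\<bar>Re (herm A p r) / (L2norm A p * L2norm A r)\<bar> \<le> 1"
    by (simp only: abs_divide abs_of_nonneg) (auto simp: divide_le_eq_1 less_le)
  then show "- 1 \<le> Re (herm A p r) / (L2norm A p * L2norm A r)" "Re (herm A p r) / (L2norm A p * L2norm A r) \<le> 1"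
    by linarith+
qed

lemma angle_nonneg: "p \<in> ellcont \<Longrightarrow> r \<in> ellcont \<Longrightarrow> 0 \<le> angle A p r"
  unfolding angle_def by (rule arccos_lbound[OF angle_range])

text \<open>
  Let \<open>r\<close> be the projection of \<open>p = Theta u\<close> to \<open>VQ Q k\<close>. If \<open>r \<noteq> 0\<close>, then
  \<open>cos (angle A p r) = \<parallel>r\<parallel> / \<parallel>p\<parallel>\<close>, so \<open>\<parallel>p\<parallel> sin (angle A p r) = \<parallel>p - r\<parallel>\<close> is the norm of
  \<open>Phi A Q k u\<close>, and the minimal angle is at most this one. If \<open>r = 0\<close>, then \<open>Phi\<close> preserves the
  norm.
\<close>

lemma sin_theta_rho_le:
  assumes u: "u \<in> multipoles_bar k"
  shows "(sin (theta A Q k))\<^sup>2 * (rho A u Zero_mp)\<^sup>2 \<le> (L2norm A (Phi A Q k u))\<^sup>2"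
proof -
  define p where "p = Theta u"
  define r where "r = orth_proj A (VQ Q k) p"
  have pC: "p \<in> ellcont" unfolding p_def by (rule ellcont_hom[OF Theta_hom[OF u]])
  have rV: "r \<in> VQ Q k" unfolding r_def by (rule orth_proj_props(1)[OF fun_subspace_VQ VQ_sub pC])
  then have rC: "r \<in> ellcont" using VQ_sub ellcont_hom by blast
  have Phi: "Phi A Q k u = (\<lambda>v. p v - r v)" unfolding Phi_eq[OF u] r_def p_def ..
  have rho: "rho A u Zero_mp = L2norm A p" by (simp add: rho_def p_def)
  have "herm A (\<lambda>v. p v - r v) r = 0"
    using orth_proj_props(2)[OF fun_subspace_VQ VQ_sub pC rV] unfolding r_def .
  then have pr: "herm A p r = of_real ((L2norm A r)\<^sup>2)"
    using herm_diff_left[OF pC rC rC] herm_self_L2norm[OF rC] by simp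
  then have rp: "herm A r p = of_real ((L2norm A r)\<^sup>2)" using herm_cnj[of r p] by simp
  have pyth: "(L2norm A (\<lambda>v. p v - r v))\<^sup>2 = (L2norm A p)\<^sup>2 - (L2norm A r)\<^sup>2"
  proof -
    have d: "(\<lambda>v. p v - r v) \<in> ellcont" by (rule ellcont_diff[OF pC rC])
    have "herm A (\<lambda>v. p v - r v) (\<lambda>v. p v - r v) = herm A p p - herm A p r - (herm A r p - herm A r r)"
      by (simp only: herm_diff_left[OF pC rC d] herm_diff_right[OF pC rC pC] herm_diff_right[OF pC rC rC])
    then show ?thesis using L2norm_sq[OF d] L2norm_sq[OF pC] L2norm_sq[OF rC] by (simp add: pr rp)
  qed
  have s1: "(sin (theta A Q k))\<^sup>2 \<le> 1" by (simp add: abs_square_le_1)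
  show ?thesis
  proof (cases "L2norm A r = 0")
    case True
    then show ?thesis unfolding Phi rho pyth using mult_right_mono[OF s1, of "(L2norm A p)\<^sup>2"] by simp
  next
    case False
    then have r0: "0 < L2norm A r" using L2norm_nonneg[of r] by linarith
    have rp2: "(L2norm A r)\<^sup>2 \<le> (L2norm A p)\<^sup>2"
      using pyth zero_le_power2[of "L2norm A (\<lambda>v. p v - r v)"] by linarith
    then have rle: "L2norm A r \<le> L2norm A p" using power2_le_imp_le[OF _ L2norm_nonneg] by blast
    have p0: "0 < L2norm A p" using r0 rle by linarith
    have rn: "r \<noteq> (\<lambda>v. 0)"
    proof
      assume "r = (\<lambda>v. 0)"
      then have "L2norm A r = 0" by (simp add: L2norm_def)
      then show False using r0 by simp
    qed
    have "u \<noteq> Zero_mp"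
    proof
      assume "u = Zero_mp"
      then have "L2norm A p = 0" by (simp add: p_def L2norm_def)
      then show False using p0 by simp
    qed
    then have pF: "p \<in> Fact k" using u by (simp add: Fact_def p_def multipoles_bar_def)
    define S where "S = {angle A p r | p r. p \<in> Fact k \<and> r \<in> VQ Q k - {\<lambda>v. 0}}"
    have th: "theta A Q k = Inf S" using rV rn by (auto simp: theta_def S_def)
    have aS: "angle A p r \<in> S" using pF rV rn by (auto simp: S_def)
    have S0: "0 \<le> a" if aS: "a \<in> S" for a
    proof -
      obtain p' r' where a: "a = angle A p' r'" "p' \<in> Fact k" "r' \<in> VQ Q k" using aS by (auto simp: S_def)
      have "p' \<in> ellcont" using a(2) Theta_hom ellcont_hom by (auto simp: Fact_def multipoles_bar_def)
      moreover have "r' \<in> ellcont" using a(3) VQ_sub ellcont_hom by blast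
      ultimately show ?thesis unfolding a(1) by (rule angle_nonneg)
    qed
    have t0: "0 \<le> theta A Q k" unfolding th by (rule cInf_greatest) (use aS S0 in auto)
    have tle: "theta A Q k \<le> angle A p r" unfolding th
      by (rule cInf_lower[OF aS]) (rule bdd_belowI[of S 0], rule S0)
    define y where "y = L2norm A r / L2norm A p"
    have y: "0 \<le> y" "y \<le> 1" using r0 p0 rle by (auto simp: y_def)
    have ang: "angle A p r = arccos y"
      using r0 by (simp add: angle_def pr y_def power2_eq_square)
    have "arccos y \<le> pi / 2" using y by (intro arccos_le_pi2) auto
    then have "sin (theta A Q k) \<le> sin (arccos y)" using t0 tle ang by (intro sin_monotone_2pi_le) auto
    moreover have "0 \<le> sin (theta A Q k)"
      using t0 tle ang \<open>arccos y \<le> pi / 2\<close> by (intro sin_ge_zero) auto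
    ultimately have "(sin (theta A Q k))\<^sup>2 \<le> (sin (arccos y))\<^sup>2" by (rule power_mono)
    also have "(sin (arccos y))\<^sup>2 = 1 - y\<^sup>2" using y by (simp add: sin_arccos_abs abs_square_le_1)
    finally have "(sin (theta A Q k))\<^sup>2 * (L2norm A p)\<^sup>2 \<le> (1 - y\<^sup>2) * (L2norm A p)\<^sup>2"
      by (rule mult_right_mono) simp
    also have "\<dots> = (L2norm A p)\<^sup>2 - (L2norm A r)\<^sup>2" using p0 by (simp add: y_def field_simps)
    finally show ?thesis unfolding Phi rho pyth .
  qed
qed

section \<open>Lifting deformations\<close>

lemma fourier_cong:
  assumes f: "f \<in> ellcont" and g: "g \<in> ellcont" and eq: "\<And>v. v \<in> ellipsoid A \<Longrightarrow> f v = g v"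
  shows "fourier A k f = fourier A k g"
proof (rule fourier_eqI[OF f fourier_Har[OF g]])
  fix h assume h: "h \<in> Har A k"
  have "herm A (\<lambda>v. f v - fourier A k g v) h = herm A (\<lambda>v. g v - fourier A k g v) h"
    by (rule herm_cong) (simp_all add: eq)
  then show "herm A (\<lambda>v. f v - fourier A k g v) h = 0" using fourier_orth[OF g h] by simp
qed

lemma fourier_VQ_perp: "f \<in> holo_on_variety (quadric Q) \<Longrightarrow> fourier A k f \<in> VQ_perp A Q k"
  using fourier_Har[OF holo_ellcont] Har_eq_VQ_perp by blast

text \<open>
  Uniform convergence on the ellipsoid, a compact part of the quadric, suffices for the
  convergence of Fourier components.
\<close>

lemma fourier_path_continuous:
  assumes F: "continuous_family (quadric Q) F"
  shows "continuous_on {0..1} (\<lambda>t. fourier A k (F t) v)"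
  unfolding continuous_on_def
proof
  fix t :: real assume t: "t \<in> {0..1}"
  have C: "F s \<in> ellcont" if "s \<in> {0..1}" for s
    using F that holo_ellcont unfolding continuous_family_def by blast
  have ul: "uniform_limit (ellipsoid A) F (F t) (at t within {0..1})"
    using F t compact_ellipsoid ellipsoid_subset_quadric unfolding continuous_family_def by blast
  have ev: "\<forall>\<^sub>F s in at t within {0..1}. s \<in> {0..1}" by (simp add: eventually_at_filter)
  show "((\<lambda>t. fourier A k (F t) v) \<longlongrightarrow> fourier A k (F t) v) (at t within {0..1})"
    by (rule fourier_uniform_limit[OF _ C[OF t] ul ev]) (rule C)
qed

lemma representing_iff: "representing A Q f w \<longleftrightarrow> (\<forall>k. w k \<in> fibre k (fourier A k f))"
  by (auto simp: representing_def fibre_def)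

lemma representing_multifunction:
  assumes F: "continuous_family (quadric Q) F"
  shows "finite_multifunction (multipoles_bar k) (rho A) (\<lambda>t. fibre k (fourier A k (F t)))"
proof (rule fibre_multifunction[OF _ fourier_path_continuous[OF F]])
  fix t :: real assume "t \<in> {0..1}"
  then show "fourier A k (F t) \<in> VQ_perp A Q k"
    using F fourier_VQ_perp unfolding continuous_family_def by blast
qed

text \<open>
  The degrees do not interact, so continuous selections are chosen independently for each \<open>k\<close>.
\<close>

lemma multipole_lift_exists:
  assumes F: "continuous_family (quadric Q) F" and u: "representing A Q (F 0) u"
  shows "\<exists>W. multipole_lift A Q F W \<and> W 0 = u"
proof -
  have "\<exists>g. g 0 = u k \<and> (\<forall>t\<in>{0..1}. g t \<in> fibre k (fourier A k (F t))) \<and>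
      (\<forall>t\<in>{0..1}. ((\<lambda>s. rho A (g s) (g t)) \<longlongrightarrow> 0) (at t within {0..1}))" for k
    by (rule finite_multifunction.continuous_selection[OF representing_multifunction[OF F]])
      (use u in \<open>simp add: representing_iff\<close>)
  then obtain g where g: "\<And>k. g k 0 = u k" "\<And>k t. t \<in> {0..1} \<Longrightarrow> g k t \<in> fibre k (fourier A k (F t))"
    "\<And>k t. t \<in> {0..1} \<Longrightarrow> ((\<lambda>s. rho A (g k s) (g k t)) \<longlongrightarrow> 0) (at t within {0..1})" by metis
  have "multipole_lift A Q F (\<lambda>t k. g k t)"
    unfolding multipole_lift_def representing_iff using g(2,3) by blast
  then show ?thesis using g(1) by (intro exI[of _ "\<lambda>t k. g k t"]) (simp add: fun_eq_iff)
qed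

text \<open>Off the discriminant all fibres of a given degree have \<open>(2 k - 1)!!\<close> elements.\<close>

lemma multipole_lift_unique:
  assumes F: "continuous_family (quadric Q) F" and gen: "\<And>t. t \<in> {0..1} \<Longrightarrow> F t \<notin> discriminant_fun A Q"
    and W: "multipole_lift A Q F W" "multipole_lift A Q F W'" and eq: "W 0 = W' 0" and t: "t \<in> {0..1}"
  shows "W t = W' t"
proof
  fix k
  have card: "card (fibre k (fourier A k (F s))) = odd_dfact k" if s: "s \<in> {0..1}" for s
  proof -
    have h: "F s \<in> holo_on_variety (quadric Q)" using F s unfolding continuous_family_def by blast
    have P: "fourier A k (F s) \<in> VQ_perp A Q k" by (rule fourier_VQ_perp[OF h])
    have "fourier A k (F s) \<notin> discriminant A Q k" using gen[OF s] h unfolding discriminant_fun_def by blast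
    then have "roots_distinct k (fourier A k (F s))"
      using P pure_stratum_iff[OF P] unfolding discriminant_def by blast
    then show ?thesis by (rule card_fibre_roots_distinct[OF P])
  qed
  show "W t k = W' t k"
    by (rule finite_multifunction.selection_unique[OF representing_multifunction[OF F] card, where g = "\<lambda>t. W t k" and h = "\<lambda>t. W' t k"])
      (use W eq t in \<open>auto simp: multipole_lift_def representing_iff\<close>)
qed

end

theorem theorem21:
  fixes Q :: "complex ^ 3 \<Rightarrow> complex" and A :: "complex ^ 3 ^ 3"
    and f :: "complex ^ 3 \<Rightarrow> complex"
  assumes quadratic_form: "Q \<in> hom_polys 2"
    and irreducible: "irreducible_poly_fun Q"
    and A_invertible: "invertible A"
    and A_reduces: "\<And>v. Q v = (\<Sum>i\<in>UNIV. ((v v* A) $ i)\<^sup>2)"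
    and f_holo: "f \<in> holo_on_variety (quadric Q)"
  shows "\<exists>w :: nat \<Rightarrow> multipole.
    (\<forall>k. w k \<in> multipoles_bar k) \<and>
    \<comment> \<open>(1)\<close>
    ((\<forall>d. partial_sum A Q w d \<in> Q_harmonic A) \<and>
     (\<forall>k. Phi A Q k (w k) \<in> Har A k) \<and>
     (\<forall>j k. j \<noteq> k \<longrightarrow> herm A (Phi A Q j (w j)) (Phi A Q k (w k)) = 0) \<and>
     (\<forall>k. Phi A Q k (w k) = fourier A k f) \<and>
     (\<forall>w'. (\<forall>k. w' k \<in> multipoles_bar k) \<and> L2_converges A (partial_sum A Q w') f \<longrightarrow>
        (\<forall>k. Phi A Q k (w' k) = Phi A Q k (w k)))) \<and>
    \<comment> \<open>(2)\<close>
    (L2_converges A (partial_sum A Q w) f \<and>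
     (\<forall>g \<in> holo_on_variety (quadric Q). L2_converges A (partial_sum A Q w) g \<longrightarrow>
        (\<forall>v \<in> quadric Q. g v = f v))) \<and>
    \<comment> \<open>(3)\<close>
    (\<forall>k. finite {u \<in> multipoles_bar k. Phi A Q k u = fourier A k f} \<and>
       card {u \<in> multipoles_bar k. Phi A Q k u = fourier A k f} \<le> (\<Prod>i=1..k. 2 * i - 1)) \<and>
    \<comment> \<open>(4)\<close>
    summable (\<lambda>k. (sin (theta A Q k))\<^sup>2 * (rho A (w k) Zero_mp)\<^sup>2) \<and>
    \<comment> \<open>(5)\<close>
    ((\<forall>F. tame_family A Q F \<and> (\<forall>v \<in> quadric Q. F 0 v = f v) \<longrightarrow>
        (\<exists>W. multipole_lift A Q F W \<and> W 0 = w)) \<and>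
     complex_codim_one (quadric Q) (discriminant_fun A Q) \<and>
     (\<forall>F. continuous_family (quadric Q) F \<and> (\<forall>v \<in> quadric Q. F 0 v = f v) \<and>
        (\<forall>t\<in>{0..1}. F t \<notin> discriminant_fun A Q) \<longrightarrow>
        (\<forall>u. representing A Q f u \<longrightarrow>
           (\<exists>W. multipole_lift A Q F W \<and> W 0 = u) \<and>
           (\<forall>W W'. multipole_lift A Q F W \<and> W 0 = u \<and> multipole_lift A Q F W' \<and> W' 0 = u \<longrightarrow>
              (\<forall>t\<in>{0..1}. W t = W' t)))))"
proof -
  interpret ellipsoid_form A Q
    using A_invertible A_reduces by unfold_locales auto
  have fC: "f \<in> ellcont" by (rule holo_ellcont[OF f_holo])
  have fH: "fourier A k f \<in> Har A k" for k by (rule fourier_Har[OF fC])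
  have P: "fourier A k f \<in> VQ_perp A Q k" for k by (rule fourier_VQ_perp[OF f_holo])
  have "\<forall>k. \<exists>u. u \<in> fibre k (fourier A k f)" using fibre_nonempty[OF P] by blast
  then obtain w where "\<forall>k. w k \<in> fibre k (fourier A k f)" by metis
  then have w: "w k \<in> multipoles_bar k" and Phiw: "Phi A Q k (w k) = fourier A k f" for k
    by (auto simp: fibre_def)
  have ps: "partial_sum A Q w d = fsum f d" for d by (simp add: partial_sum_def fsum_def Phiw)
  have psC: "partial_sum A Q w d \<in> ellcont" for d unfolding ps by (rule fsum_ellcont[OF fC])
  have conv: "L2_converges A (partial_sum A Q w) f"
    unfolding L2_converges_def ps by (rule fourier_converges[OF fC])
  \<comment> \<open>\<open>F 0\<close> and \<open>f\<close> may differ off the quadric, but Fourier components depend on the ellipsoid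
    only\<close>
  have F0: "representing A Q (F 0) u \<longleftrightarrow> representing A Q f u"
    if F: "continuous_family (quadric Q) F" and eq: "\<forall>v\<in>quadric Q. F 0 v = f v" for F u
  proof -
    have "F 0 \<in> holo_on_variety (quadric Q)" using F unfolding continuous_family_def by simp
    then have "fourier A k (F 0) = fourier A k f" for k
      by (intro fourier_cong holo_ellcont f_holo) (use eq ellipsoid_subset_quadric in auto)
    then show ?thesis unfolding representing_def by simp
  qed
  have rw: "representing A Q f w" by (simp add: representing_def w Phiw)
  show ?thesis
  proof (intro exI[of _ w] conjI allI impI ballI)
    fix d
    have pp: "fourier A k f \<in> polys" for k using HarD(1)[OF fH] hom_polys_polys by blast
    show "partial_sum A Q w d \<in> Q_harmonic A"
      unfolding ps fsum_def Q_harmonic_def mem_Collect_eq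
      by (intro conjI polys_sum pp) (simp_all add: Q_laplacian_sum pp HarD(2)[OF fH])
  next
    fix w' k
    assume w': "(\<forall>k. w' k \<in> multipoles_bar k) \<and> L2_converges A (partial_sum A Q w') f"
    have "fourier A k f = Phi A Q k (w' k)"
    proof (rule fourier_unique[OF fC])
      show "Phi A Q i (w' i) \<in> Har A i" for i using w' Phi_VQ_perp Har_eq_VQ_perp by blast
      show "(\<lambda>d. L2norm A (\<lambda>v. (\<Sum>i\<le>d. Phi A Q i (w' i) v) - f v)) \<longlonglongrightarrow> 0"
        using w' by (simp add: L2_converges_def partial_sum_def)
    qed
    then show "Phi A Q k (w' k) = Phi A Q k (w k)" by (simp add: Phiw)
  next
    fix g v assume g: "g \<in> holo_on_variety (quadric Q)" "L2_converges A (partial_sum A Q w) g" and v: "v \<in> quadric Q"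
    have "g x = f x" if "x \<in> ellipsoid A" for x
      by (rule L2_limit_unique[OF holo_ellcont[OF g(1)] fC psC _ _ that])
        (use g(2) conv in \<open>simp_all add: L2_converges_def\<close>)
    then show "g v = f v" by (rule holo_determined_by_ellipsoid[OF g(1) f_holo _ v])
  next
    show "summable (\<lambda>k. (sin (theta A Q k))\<^sup>2 * (rho A (w k) Zero_mp)\<^sup>2)"
    proof (rule summable_comparison_test'[OF bessel[OF fC]])
      fix k
      show "norm ((sin (theta A Q k))\<^sup>2 * (rho A (w k) Zero_mp)\<^sup>2) \<le> (L2norm A (fourier A k f))\<^sup>2"
        using sin_theta_rho_le[OF w] by (simp add: Phiw)
    qed
  next
    fix F assume "tame_family A Q F \<and> (\<forall>v\<in>quadric Q. F 0 v = f v)"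
    then have F: "continuous_family (quadric Q) F" and eq: "\<forall>v\<in>quadric Q. F 0 v = f v"
      by (auto simp: tame_family_def)
    show "\<exists>W. multipole_lift A Q F W \<and> W 0 = w"
      by (rule multipole_lift_exists[OF F]) (simp add: F0[OF F eq] rw)
  next
    fix F u
    assume "continuous_family (quadric Q) F \<and> (\<forall>v\<in>quadric Q. F 0 v = f v) \<and> (\<forall>t\<in>{0..1}. F t \<notin> discriminant_fun A Q)"
    then have F: "continuous_family (quadric Q) F" and eq: "\<forall>v\<in>quadric Q. F 0 v = f v" by auto
    assume "representing A Q f u"
    then show "\<exists>W. multipole_lift A Q F W \<and> W 0 = u"
      by (intro multipole_lift_exists[OF F]) (simp add: F0[OF F eq])
  next
    fix F u W W' t
    assume F: "continuous_family (quadric Q) F \<and> (\<forall>v\<in>quadric Q. F 0 v = f v) \<and> (\<forall>t\<in>{0..1}. F t \<notin> discriminant_fun A Q)"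
      and W: "multipole_lift A Q F W \<and> W 0 = u \<and> multipole_lift A Q F W' \<and> W' 0 = u" and t: "t \<in> {0..1 :: real}"
    show "W t = W' t" by (rule multipole_lift_unique[OF _ _ _ _ _ t]) (use F W in auto)
  qed (use conv w Phiw fH Har_orth[OF fH fH] discriminant_codim_one card_fibre_le[OF P] in \<open>simp_all add: fibre_def odd_dfact_def\<close>)
qed

end
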